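(* Let $T>0$ and let $\overline{B},\overline{E}\in L^\infty(\mathbb{T}^3\times[0,T];\mathbb{R}^3)$ be piecewise constant vector fields solving the Faraday--Maxwell system $$\partial_t \overline{B}+\nabla\times\overline{E}=0,\qquad \nabla\cdot\overline{B}=0$$ in the sense of distributions, with $\int_{\mathbb{T}^3}\overline{B}(x,t)\,dx=0$ for a.e. $t$. Let $3/2<p<\infty$ and let $p'$ be the Hölder-dual exponent, $1/p+1/p'=1$. Then there exist piecewise constant vector fields $B,E\in L^1(\mathbb{T}^3\times[0,T];\mathbb{R}^3)$ solving $\partial_tB+\nabla\times E=0$, $\nabla\cdot B=0$ in the sense of distributions, with $$B\in L^\infty(0,T;L^{p,\infty}(\mathbb{T}^3)),\qquad E\in L^\infty(0,T;L^{p',\infty}(\mathbb{T}^3)),$$ such that $B\cdot E=0$ for a.e. $(x,t)\in\mathbb{T}^3\times[0,T]$ and $$\mathcal{H}(B)(t)=\mathcal{H}(\overline{B})(t)\quad\text{for a.e. }t\in[0,T].$$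
   Context: $\mathbb{T}^3$ is the flat three-dimensional torus. A vector field $v:\mathbb{T}^3\times(0,T)\to\mathbb{R}^3$ is piecewise constant if there is a countable family of pairwise disjoint open subsets $Q_i$ of $\mathbb{T}^3\times(0,T)$ whose union has full (4-dimensional Lebesgue) measure and such that $v|_{Q_i}$ is constant for each $i$. $L^{p,\infty}$ denotes the weak $L^p$ (Marcinkiewicz) space. Distributional solutions are understood on $\mathbb{T}^3\times(0,T)$. For a divergence-free, zero-mean field $B\in L^{3/2}(\mathbb{T}^3;\mathbb{R}^3)$, its magnetic helicity is $\mathcal{H}(B)=\int_{\mathbb{T}^3}A\cdot B\,dx$, where $A=\mathrm{curl}^{-1}B$ is the (zero-mean) vector potential with $\mathrm{curl}\,A=B$, $\mathrm{div}\,A=0$. For time-dependent $B$, $\mathcal{H}(B)(t)$ is the helicity of $B(\cdot,t)$; stating $\mathcal{H}(B)(t)$ includes that $B(\cdot,t)$ has zero mean. *)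

theory Defs
  imports "HOL-Analysis.Analysis"
begin

text \<open>
  The torus is R^3 / Z^3.  A function on the torus is a \<open>\<int>\<^sup>3\<close>-periodic function on R^3, and a
  function on (torus) x (0,T) is a function of (x,t) that is periodic in x; only its values at
  times 0 < t < T matter.  Integration over the torus is integration over the unit cube (whose
  boundary is a null set).
\<close>

definition torus :: "(real^3) measure" where
  "torus = lebesgue_on (cbox 0 1)"

definition torus_time :: "real \<Rightarrow> ((real^3) \<times> real) measure" where
  "torus_time T = lebesgue_on (cbox 0 1 \<times> {0<..<T})"

definition lattice :: "(real^3) set" where
  "lattice = {k. \<forall>i. k $ i \<in> \<int>}"

definition periodic :: "(real^3 \<Rightarrow> 'b) \<Rightarrow> bool" where
  "periodic f \<longleftrightarrow> (\<forall>x. \<forall>k\<in>lattice. f (x + k) = f x)"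

definition torus_time_field :: "real \<Rightarrow> ((real^3) \<times> real \<Rightarrow> 'b) \<Rightarrow> bool" where
  "torus_time_field T v \<longleftrightarrow> (\<forall>t\<in>{0<..<T}. periodic (\<lambda>x. v (x, t)))"

text \<open>Open subsets of (torus) x (0,T), as open sets of R^3 x (0,T) invariant under the lattice.\<close>

definition torus_time_open :: "real \<Rightarrow> ((real^3) \<times> real) set \<Rightarrow> bool" where
  "torus_time_open T Q \<longleftrightarrow>
     open Q \<and> Q \<subseteq> UNIV \<times> {0<..<T} \<and> (\<forall>x t. \<forall>k\<in>lattice. (x, t) \<in> Q \<longrightarrow> (x + k, t) \<in> Q)"

definition piecewise_constant :: "real \<Rightarrow> ((real^3) \<times> real \<Rightarrow> 'b) \<Rightarrow> bool" where
  "piecewise_constant T v \<longleftrightarrow>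
     torus_time_field T v \<and>
     (\<exists>\<Q>. countable \<Q> \<and> (\<forall>Q\<in>\<Q>. torus_time_open T Q) \<and> disjoint \<Q> \<and>
          negligible (UNIV \<times> {0<..<T} - \<Union>\<Q>) \<and>
          (\<forall>Q\<in>\<Q>. v constant_on Q))"

primrec C_k :: "nat \<Rightarrow> ('a::euclidean_space \<Rightarrow> 'b::real_normed_vector) \<Rightarrow> bool" where
  "C_k 0 f \<longleftrightarrow> continuous_on UNIV f"
| "C_k (Suc k) f \<longleftrightarrow>
     (\<forall>x. f differentiable (at x)) \<and> (\<forall>i\<in>Basis. C_k k (\<lambda>x. frechet_derivative f (at x) i))"

definition C_infinity :: "('a::euclidean_space \<Rightarrow> 'b::real_normed_vector) \<Rightarrow> bool" where
  "C_infinity f \<longleftrightarrow> (\<forall>k. C_k k f)"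

definition torus_test :: "(real^3 \<Rightarrow> 'b::real_normed_vector) \<Rightarrow> bool" where
  "torus_test \<phi> \<longleftrightarrow> C_infinity \<phi> \<and> periodic \<phi>"

text \<open>Smooth functions with compact support in (torus) x (0,T), extended by zero to all times.\<close>

definition torus_time_test :: "real \<Rightarrow> ((real^3) \<times> real \<Rightarrow> 'b::real_normed_vector) \<Rightarrow> bool" where
  "torus_time_test T \<phi> \<longleftrightarrow>
     C_infinity \<phi> \<and> (\<forall>t. periodic (\<lambda>x. \<phi> (x, t))) \<and>
     (\<exists>a b. 0 < a \<and> b < T \<and> (\<forall>x t. t \<notin> {a..b} \<longrightarrow> \<phi> (x, t) = 0))"

definition partial :: "3 \<Rightarrow> (real^3 \<Rightarrow> 'b::real_normed_vector) \<Rightarrow> real^3 \<Rightarrow> 'b" where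
  "partial i f x = frechet_derivative f (at x) (axis i 1)"

definition grad :: "(real^3 \<Rightarrow> real) \<Rightarrow> real^3 \<Rightarrow> real^3" where
  "grad f x = (\<chi> i. partial i f x)"

definition curl :: "(real^3 \<Rightarrow> real^3) \<Rightarrow> real^3 \<Rightarrow> real^3" where
  "curl F x = vector
     [partial 2 F x $ 3 - partial 3 F x $ 2,
      partial 3 F x $ 1 - partial 1 F x $ 3,
      partial 1 F x $ 2 - partial 2 F x $ 1]"

text \<open>
  Distributional equations.  Integrating by parts against a test field, curl moves onto the test
  field with a plus sign, whereas div and the time derivative change sign.
\<close>

definition weak_curl_eq :: "(real^3 \<Rightarrow> real^3) \<Rightarrow> (real^3 \<Rightarrow> real^3) \<Rightarrow> bool" where
  "weak_curl_eq A B \<longleftrightarrow>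
     (\<forall>\<phi>::real^3 \<Rightarrow> real^3. torus_test \<phi> \<longrightarrow>
        (\<integral>x. A x \<bullet> curl \<phi> x \<partial>torus) = (\<integral>x. B x \<bullet> \<phi> x \<partial>torus))"

definition weak_div_free :: "(real^3 \<Rightarrow> real^3) \<Rightarrow> bool" where
  "weak_div_free B \<longleftrightarrow>
     (\<forall>\<psi>::real^3 \<Rightarrow> real. torus_test \<psi> \<longrightarrow> (\<integral>x. B x \<bullet> grad \<psi> x \<partial>torus) = 0)"

definition faraday_maxwell ::
  "real \<Rightarrow> ((real^3) \<times> real \<Rightarrow> real^3) \<Rightarrow> ((real^3) \<times> real \<Rightarrow> real^3) \<Rightarrow> bool" where
  "faraday_maxwell T B E \<longleftrightarrow>
     (\<forall>\<phi>::(real^3) \<times> real \<Rightarrow> real^3. torus_time_test T \<phi> \<longrightarrow>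
        - (\<integral>(x, t). B (x, t) \<bullet> vector_derivative (\<lambda>s. \<phi> (x, s)) (at t) \<partial>torus_time T)
        + (\<integral>(x, t). E (x, t) \<bullet> curl (\<lambda>y. \<phi> (y, t)) x \<partial>torus_time T) = 0) \<and>
     (\<forall>\<psi>::(real^3) \<times> real \<Rightarrow> real. torus_time_test T \<psi> \<longrightarrow>
        - (\<integral>(x, t). B (x, t) \<bullet> grad (\<lambda>y. \<psi> (y, t)) x \<partial>torus_time T) = 0)"

definition L_infinity :: "real \<Rightarrow> ((real^3) \<times> real \<Rightarrow> real^3) \<Rightarrow> bool" where
  "L_infinity T v \<longleftrightarrow>
     v \<in> borel_measurable (torus_time T) \<and> (\<exists>C. AE z in torus_time T. norm (v z) \<le> C)"

text \<open>The weak \<open>L\<^sup>p\<close> quasi-norm, the supremum over s > 0 of s |{|f| > s}|^(1/p).\<close>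

definition weak_Lp_norm :: "real \<Rightarrow> (real^3 \<Rightarrow> real^3) \<Rightarrow> ennreal" where
  "weak_Lp_norm p f =
     (SUP s\<in>{0<..}. ennreal (s * measure torus {x\<in>space torus. s < norm (f x)} powr (1 / p)))"

definition Linfty_weak_Lp :: "real \<Rightarrow> real \<Rightarrow> ((real^3) \<times> real \<Rightarrow> real^3) \<Rightarrow> bool" where
  "Linfty_weak_Lp T p v \<longleftrightarrow>
     v \<in> borel_measurable (torus_time T) \<and>
     (\<exists>C. AE t in lebesgue_on {0<..<T}.
        (\<lambda>x. v (x, t)) \<in> borel_measurable torus \<and>
        weak_Lp_norm p (\<lambda>x. v (x, t)) \<le> ennreal C)"

definition zero_mean :: "(real^3 \<Rightarrow> real^3) \<Rightarrow> bool" where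
  "zero_mean B \<longleftrightarrow> integrable torus B \<and> (\<integral>x. B x \<partial>torus) = 0"

text \<open>
  The fields whose helicity is defined: periodic, in \<open>L\<^sup>3\<^sup>/\<^sup>2\<close>, divergence-free and of zero mean.
\<close>

definition helicity_field :: "(real^3 \<Rightarrow> real^3) \<Rightarrow> bool" where
  "helicity_field B \<longleftrightarrow>
     periodic B \<and> B \<in> borel_measurable torus \<and>
     integrable torus (\<lambda>x. norm (B x) powr (3 / 2)) \<and>
     weak_div_free B \<and> zero_mean B"

definition vector_potential :: "(real^3 \<Rightarrow> real^3) \<Rightarrow> (real^3 \<Rightarrow> real^3) \<Rightarrow> bool" where
  "vector_potential B A \<longleftrightarrow> periodic A \<and> zero_mean A \<and> weak_curl_eq A B \<and> weak_div_free A"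

text \<open>
  The vector potential is unique almost everywhere: the difference of two is a curl-free and
  divergence-free, hence constant, field of zero mean.  For a \<open>helicity_field\<close> it exists and lies
  in \<open>L\<^sup>3\<close>, so the choice of a representative does not affect the helicity integral.
\<close>

definition inverse_curl :: "(real^3 \<Rightarrow> real^3) \<Rightarrow> real^3 \<Rightarrow> real^3" where
  "inverse_curl B = (SOME A. vector_potential B A)"

definition helicity :: "(real^3 \<Rightarrow> real^3) \<Rightarrow> real" where
  "helicity B = (\<integral>x. inverse_curl B x \<bullet> B x \<partial>torus)"

end

theory Submission
 imports Defs
begin

text \<open>The new fields depend on \<open>t\<close> and on one space variable \<open>x\<close> only. With the potential \<open>A = (0, Y, Q)(x, t)\<close> put
  \<open>B = curl A = (0, - Qx, Yx)\<close> and \<open>E = - At = (0, - Yt, - Qt)\<close>. The system then holds for every choice of \<open>Y, Q\<close>,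
  the condition \<open>B \<bullet> E = 0\<close> reads \<open>Qx Yt = Yx Qt\<close>, and the helicity is \<open>2 \<integral> Q Yx dx\<close>. One loop of length scale \<open>l\<close> is driven
  by a clock \<open>et\<close>: the cells of a Cantor set with ratio \<open>th = 2 powr (- p')\<close> become active one after another,
  and the fields are of size \<open>(2 th) powr (- n)\<close> and \<open>2 ^ n\<close> on sets of measure \<open>th ^ n\<close>, which gives the two weak bounds.
  Its helicity is a multiple of \<open>l\<^sup>2 et(t)\<close>.
  The derivative \<open>- 2 \<integral> B0 \<bullet> E0 dx\<close> of the given helicity is bounded and, as the fields are piecewise constant, continuous
  at almost every time. Hence the given helicity is a series of piecewise affine functions whose \<open>k\<close>-th term is \<open>O(4 powr (- k))\<close>,
  and this term is the helicity of a loop of length scale \<open>2 powr (- k) / 8\<close>; the loop \<open>k = 0\<close> has the opposite orientation,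
  so that all clocks can be taken nonnegative.\<close>

text \<open>For regular fields \<open>B \<bullet> E = 0\<close> freezes the helicity, whose time
  derivative is \<open>- 2 \<integral> B \<bullet> E\<close>. The way out is concentration: the size
  of \<open>B\<close>, the size of \<open>E\<close> and the measure of an active cell multiply to a
  quantity of order one at every level, so a flux of fixed strength is handed down through all
  scales and ends on a null set, invisible to a condition that holds almost everywhere. The weak
  bound on \<open>E\<close> alone fixes \<open>th\<close>; duality of the exponents then gives the
  bound on \<open>B\<close>, and \<open>3 / 2 < p\<close>, that is \<open>p' < 3\<close>, makes the
  helicity of \<open>B\<close> meaningful. The clock has base \<open>4\<close> because an active
  cell of level \<open>n\<close> holds the share \<open>2 powr (- n)\<close> of the rise of
  \<open>Y\<close>: \<open>Q\<close> must move there \<open>2 ^ n\<close> times as fast, while its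
  oscillation has to shrink like \<open>2 powr (- n)\<close> for the series to converge, so a stroke
  takes a time of order \<open>4 powr (- n)\<close>. A stroke doubles the speed of \<open>Q\<close>
  on the active subcell and stops it on the other. \<open>Y\<close> is a Cantor staircase along the
  active cells, flat in their gaps, where \<open>Q\<close> varies in \<open>x\<close>; it is rebuilt
  only where \<open>Q\<close> is at rest.\<close>

abbreviation "bmeas == borel_measurable borel"
abbreviation "bmeas2 f == (%z. f (fst z) (snd z)) : borel_measurable (borel \<Otimes>\<^sub>M borel)"
abbreviation "sint == set_integrable lborel"
abbreviation "contU == continuous_on UNIV"
abbreviation "fder f z == frechet_derivative f (at z)"
lemmas meas_cont = borel_measurable_continuous_onI
lemmas lint_def = set_lebesgue_integral_def
lemmas bint_cong = Bochner_Integration.integral_cong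
lemmas bint_diff = Bochner_Integration.integral_diff
lemmas bint_add = Bochner_Integration.integral_add
lemmas bint_sum = Bochner_Integration.integral_sum
lemmas real_vector_deriv = has_real_derivative_iff_has_vector_derivative

section \<open>Lipschitz functions of one variable\<close>

lemma negligible_iff_AE_lborel:
 assumes "S : sets borel" shows "negligible S \<longleftrightarrow> (AE x in lborel. x ~: S)"
proof
 assume "negligible S"
 hence "AE x in lebesgue. x ~: S" by (simp add: negligible_iff_null_sets AE_not_in)
 thus "AE x in lborel. x ~: S" by (simp add: AE_completion_iff)
next
 assume "AE x in lborel. x ~: S"
 hence "AE x in lebesgue. x ~: S" by (rule AE_completion)
 thus "negligible S" using assms by (simp add: negligible_iff_null_sets AE_iff_null_sets)
qed

lemma negligible_imp_AE_lborel:
 assumes "negligible S" shows "AE x in lborel. x ~: S"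
proof -
 from assms have "AE x in lebesgue. x ~: S" by (simp add: negligible_iff_null_sets AE_not_in)
 thus "AE x in lborel. x ~: S" by (simp add: AE_completion_iff)
qed

lemma countable_imp_AE_lborel:
 fixes S :: "'a::euclidean_space set"
 assumes "countable S" shows "AE x in lborel. x ~: S"
 by (rule negligible_imp_AE_lborel) (simp add: assms negligible_iff_null_sets countable_imp_null_set_lborel null_sets_completionI)

lemma lipschitz_imp_continuous_on:
 "(L::real)-lipschitz_on S f ==> continuous_on S f" by (rule lipschitz_on_continuous_on)

text \<open>Difference quotients are bounded by \<open>L\<close>, so dominated convergence applies
  to them, while a primitive \<open>F\<close> of \<open>f\<close> turns each integrated quotient
  into two quotients at the ends. The Lipschitz bound reaches up to \<open>b + 1\<close> because the
  quotients step to the right by at most \<open>1\<close>.\<close>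

lemma lipschitz_FTC:
 fixes f f' :: "real => real"
 assumes ab: "a <= b" and lip: "L-lipschitz_on {a..b+1} f" and der: "AE x in lborel. x : {a<..<b} --> (f has_real_derivative f' x) (at x)"
  and meas: "f' : bmeas" shows "sint {a..b} f'" and "(LBINT x:{a..b}. f' x) = f b - f a"
proof -
 have contf: "continuous_on {a..b+1} f" using lip by (rule lipschitz_on_continuous_on)
 obtain F where F: "!!x. x : {a..b+1} ==> (F has_vector_derivative f x) (at x within {a..b+1})" using antiderivative_continuous[OF contf] by blast
 define h where "h n = 1 / real (Suc n)" for n
 have h0: "h n > 0" "h n <= 1" for n by (auto simp: h_def)
 have h_lim: "h \<longlonglongrightarrow> 0" unfolding h_def using LIMSEQ_inverse_real_of_nat by (simp add: inverse_eq_divide)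
 define d where "d n x = indicator {a..b} x *\<^sub>R ((f (x + h n) - f x) / h n)" for n x
 have cont_shift: "continuous_on {a..b} (%x. (f (x + h n) - f x) / h n)" for n using h0[of n] by (intro continuous_intros continuous_on_compose2[OF contf]) auto
 have d_meas: "d n : borel_measurable lborel" for n unfolding d_def using borel_measurable_continuous_on_indicator[OF _ cont_shift] by simp
 have d_bound: "norm (d n x) <= indicator {a..b} x * L" for n x
 proof (cases "x : {a..b}")
  case True
  hence "dist (f (x + h n)) (f x) <= L * dist (x + h n) x" using h0[of n] by (intro lipschitz_onD[OF lip]) auto
  thus ?thesis using True h0[of n] by (simp add: d_def dist_real_def field_simps)
 qed (simp add: d_def)
 have intL: "integrable lborel (%x. indicator {a..b} x * L)" by (intro integrable_mult_left integrable_real_indicator) (auto simp: emeasure_lborel_Icc_eq)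
 have d_lim: "AE x in lborel. (%n. d n x) \<longlonglongrightarrow> indicator {a..b} x *\<^sub>R f' x"
 proof -
  have "AE x in lborel. x ~: {a, b}" by (intro countable_imp_AE_lborel) auto
  with der show ?thesis
  proof eventually_elim
   case (elim x)
   show ?case
   proof (cases "x : {a..b}")
    case True
    with elim have "(f has_real_derivative f' x) (at x)" by auto
    hence "(%h. (f (x + h) - f x) / h) \<midarrow>0\<rightarrow> f' x" by (simp add: DERIV_def)
    moreover have "filterlim h (at 0) sequentially" using h_lim h0(1) by (auto simp: filterlim_at eventually_sequentially intro!: exI[of _ 0]
       order.strict_implies_not_eq[symmetric])
    ultimately have "(%n. (f (x + h n) - f x) / h n) \<longlonglongrightarrow> f' x" by (rule filterlim_compose)
    thus ?thesis using True by (simp add: d_def)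
   qed (simp add: d_def)
  qed
 qed
 have f'_meas: "(%x. indicator {a..b} x *\<^sub>R f' x) : borel_measurable lborel" using meas by measurable
 note dc = integrable_dominated_convergence[OF f'_meas d_meas intL d_lim] and dcl = integral_dominated_convergence[OF f'_meas d_meas intL d_lim]
 show "sint {a..b} f'" unfolding set_integrable_def using dc d_bound by (auto simp: AE_I2)
 have lim1: "(%n. integral\<^sup>L lborel (d n)) \<longlonglongrightarrow> (LBINT x:{a..b}. f' x)" unfolding lint_def using dcl d_bound by (auto simp: AE_I2)
 have eq: "integral\<^sup>L lborel (d n) = (F (b + h n) - F b) / h n - (F (a + h n) - F a) / h n" for n
 proof -
  have "((%x. (F (x + h n) - F x) / h n) has_vector_derivative (f (x + h n) - f x) / h n) (at x within {a..b})" if "a <= x" "x <= b" for x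
  proof -
   have 1: "(F has_vector_derivative f x) (at x within {a..b})" using F[of x] that by (intro has_vector_derivative_within_subset[OF F]) auto
   have 2: "((F \<circ> (%x. x + h n)) has_vector_derivative 1 *\<^sub>R f (x + h n)) (at x within {a..b})"
   proof (rule vector_diff_chain_within)
    show "((%x. x + h n) has_vector_derivative 1) (at x within {a..b})" by (auto intro!: derivative_eq_intros simp: has_vector_derivative_def)
    show "(F has_vector_derivative f (x + h n)) (at (x + h n) within (%x. x + h n) ` {a..b})"
     using that h0[of n] by (intro has_vector_derivative_within_subset[OF F]) auto
   qed
   from has_vector_derivative_divide[OF has_vector_derivative_diff[OF 2 1]] show ?thesis by (simp add: o_def)
  qed
  from integral_FTC_Icc[OF ab this cont_shift] show ?thesis unfolding d_def by (simp add: diff_divide_distrib)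
 qed
 have lim_at: "(%n. (F (y + h n) - F y) / h n) \<longlonglongrightarrow> f y" if "y : {a..b}" for y
 proof -
  have "(F has_real_derivative f y) (at y within {a..b+1})" using F[of y] that by (simp add: real_vector_deriv)
  hence "((%z. (F z - F y) / (z - y)) \<longlongrightarrow> f y) (at y within {a..b+1})" by (simp add: has_field_derivative_iff)
  moreover have "filterlim (%n. y + h n) (at y within {a..b+1}) sequentially"
  proof -
   have "(%n. y + h n) \<longlonglongrightarrow> y" using tendsto_add[OF tendsto_const h_lim] by fastforce
   moreover have "y + h n : {a..b+1}" "y + h n ~= y" for n using that h0[of n] by auto
   ultimately show ?thesis by (auto simp: filterlim_at)
  qed
  ultimately have "(%n. (F (y + h n) - F y) / (y + h n - y)) \<longlonglongrightarrow> f y" by (rule filterlim_compose)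
  thus ?thesis by simp
 qed
 have "(%n. integral\<^sup>L lborel (d n)) \<longlonglongrightarrow> f b - f a" unfolding eq using ab by (intro tendsto_diff lim_at) auto
 with lim1 show "(LBINT x:{a..b}. f' x) = f b - f a" by (rule LIMSEQ_unique)
qed

text \<open>The slope function \<open>d\<close> must be constant near \<open>x\<close> as well,
  which differentiability would not give: this is what finally makes the fields locally
  constant.\<close>

definition lin_at :: "(real => real) => (real => real) => real => bool" where
 "lin_at f d x \<longleftrightarrow> (\<forall>\<^sub>F y in nhds x. f y = f x + d x * (y - x) & d y = d x)"

lemma lin_at_eventually_lin_at:
 assumes "lin_at f d x" shows "\<forall>\<^sub>F y in nhds x. lin_at f d y"
proof -
 from assms have "\<forall>\<^sub>F y in nhds x. \<forall>\<^sub>F z in nhds y. f z = f x + d x * (z - x) & d z = d x"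
  unfolding lin_at_def by (simp add: eventually_eventually)
 thus ?thesis
 proof (eventually_elim)
  case (elim y)
  from eventually_nhds_x_imp_x[OF elim] have y: "f y = f x + d x * (y - x)" "d y = d x" by auto
  show ?case unfolding lin_at_def using elim by eventually_elim (auto simp: y algebra_simps)
 qed
qed

lemma lin_at_deriv:
 assumes "lin_at f d x" shows "(f has_real_derivative d x) (at x)"
proof -
 have "((%y. f x + d x * (y - x)) has_real_derivative d x) (at x)" by (auto intro!: derivative_eq_intros)
 moreover have "\<forall>\<^sub>F y in nhds x. f x + d x * (y - x) = f y" using assms unfolding lin_at_def by eventually_elim auto
 ultimately show ?thesis by (rule iffD1[OF DERIV_cong_ev[OF refl _ refl], rotated])
qed

lemma lin_at_isCont: "lin_at f d x ==> isCont f x" using lin_at_deriv DERIV_isCont by blast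

lemma lin_at_const: "lin_at (%_. c) (%_. 0) x" by (simp add: lin_at_def)

lemma lin_at_add:
 assumes "lin_at f d x" "lin_at g e x" shows "lin_at (%x. f x + g x) (%x. d x + e x) x"
 using assms unfolding lin_at_def by eventually_elim (simp add: algebra_simps)

lemma lin_at_cmult:
 assumes "lin_at f d x" shows "lin_at (%x. c * f x) (%x. c * d x) x" using assms unfolding lin_at_def by eventually_elim (auto simp: distrib_left)

lemma lin_at_diff:
 assumes "lin_at f d x" "lin_at g e x" shows "lin_at (%x. f x - g x) (%x. d x - e x) x"
 using assms unfolding lin_at_def by eventually_elim (simp add: algebra_simps)

lemma lin_at_affine: "lin_at (%x. c * x + b) (%_. c) x" by (simp add: lin_at_def algebra_simps)

text \<open>Where the inner slope vanishes the inner function is locally constant, so the outer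
  function may have a corner at that value; only crossings with nonzero slope matter.\<close>

lemma lin_at_compose:
 assumes g: "lin_at g e x" and f: "e x = 0 | lin_at f d (g x)" shows "lin_at (%x. f (g x)) (%x. d (g x) * e x) x"
proof (cases "e x = 0")
 case True
 from g show ?thesis unfolding lin_at_def by eventually_elim (auto simp: True)
next
 case False
 with f have f: "\<forall>\<^sub>F y in nhds (g x). f y = f (g x) + d (g x) * (y - g x) & d y = d (g x)" by (simp add: lin_at_def)
 have "filterlim g (nhds (g x)) (nhds x)" using lin_at_isCont[OF g] by (simp add: continuous_at tendsto_at_iff_tendsto_nhds)
 from filterlim_iff[THEN iffD1, rule_format, OF this f]
 have "\<forall>\<^sub>F y in nhds x. f (g y) = f (g x) + d (g x) * (g y - g x) & d (g y) = d (g x)" .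
 with g[unfolded lin_at_def] show ?thesis unfolding lin_at_def
 proof eventually_elim
  case (elim y)
  hence "f (g y) = f (g x) + d (g x) * (g x + e x * (y - x) - g x)" by metis
  with elim show ?case by simp
 qed
qed

lemma lin_at_cong:
 assumes "lin_at f d x" "\<forall>\<^sub>F y in nhds x. g y = f y & e y = d y" shows "lin_at g e x"
proof -
 from eventually_nhds_x_imp_x[OF assms(2)] have "g x = f x" "e x = d x" by auto
 with assms(1) have "\<forall>\<^sub>F y in nhds x. f y = g x + e x * (y - x) & d y = e x" by (simp add: lin_at_def)
 with assms(2) show ?thesis unfolding lin_at_def by eventually_elim auto
qed

lemma open_if_eventually_nhds:
 assumes "!!x. P x ==> \<forall>\<^sub>F y in nhds x. P y" shows "open {x. P x}"
proof (subst open_subopen, intro ballI)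
 fix x assume "x : {x. P x}"
 hence "\<forall>\<^sub>F y in nhds x. P y" using assms by simp
 then obtain S where "open S" "x : S" "ALL y:S. P y" unfolding eventually_nhds by blast
 thus "EX T. open T & x : T & T \<subseteq> {x. P x}" by blast
qed

lemma open_lin_at_nz: "open {x. lin_at f d x & d x ~= 0}"
proof (rule open_if_eventually_nhds)
 fix x assume x: "lin_at f d x & d x ~= 0"
 hence "\<forall>\<^sub>F y in nhds x. lin_at f d y" by (intro lin_at_eventually_lin_at) simp
 moreover from x have "\<forall>\<^sub>F y in nhds x. d y = d x" unfolding lin_at_def by (rule conjE) (erule eventually_mono, simp)
 ultimately show "\<forall>\<^sub>F y in nhds x. lin_at f d y & d y ~= 0" by eventually_elim (simp add: x)
qed

text \<open>A point of nonzero slope is isolated in its level set, so each such level set is locally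
  negligible, and a countable union of them stays negligible.\<close>

lemma negligible_lin_at_preimage:
 assumes "countable C" shows "negligible {x. lin_at f d x & d x ~= 0 & f x : C}"
proof -
 have "negligible {x. lin_at f d x & d x ~= 0 & f x = c}" (is "negligible ?S") for c
 proof (rule locally_negligible_alt[THEN iffD2], intro ballI)
  fix x assume x: "x : ?S"
  from x have "lin_at f d x" by simp
  hence "\<forall>\<^sub>F y in nhds x. f y = f x + d x * (y - x)" unfolding lin_at_def by eventually_elim simp
  then obtain U where U: "open U" "x : U" and aff: "ALL y:U. f y = f x + d x * (y - x)" unfolding eventually_nhds by blast
  have "y = x" if "y : ?S \<inter> U" for y
  proof -
   have "f y = f x + d x * (y - x)" using aff that by blast
   moreover have "f y = f x" "d x ~= 0" using that x by simp_all
   ultimately show ?thesis by simp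
  qed
  hence "?S \<inter> U \<subseteq> {x}" by blast
  hence N: "negligible (?S \<inter> U)" by (rule negligible_subset[OF negligible_sing])
  show "EX V. openin (top_of_set ?S) V & x : V & negligible V" by (intro exI[of _ "?S \<inter> U"] conjI IntI openin_open_Int U x N)
 qed
 hence "!!S. S : (%c. {x. lin_at f d x & d x ~= 0 & f x = c}) ` C ==> negligible S" by blast
 hence "negligible (\<Union>((%c. {x. lin_at f d x & d x ~= 0 & f x = c}) ` C))" by (rule negligible_countable_Union[OF countable_image[OF assms]])
 thus ?thesis by (rule negligible_subset) blast
qed

lemma AE_lin_at_nonzero_slope:
 assumes "countable C" shows "AE x in lborel. lin_at f d x --> d x ~= 0 --> f x ~: C"
 using negligible_imp_AE_lborel[OF negligible_lin_at_preimage[OF assms, of f d]] by (rule AE_mp) (simp only: mem_Collect_eq, blast)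

section \<open>Piecewise affine functions and tiles\<close>

lemma isCont_tendsto_nhds: "isCont f x ==> (f \<longlongrightarrow> f x) (nhds x)" by (simp add: continuous_at tendsto_at_iff_tendsto_nhds)

lemma AE_lborel_pairI:
 fixes P :: "'a::euclidean_space \<times> 'b::euclidean_space => bool"
 assumes "{z. P z} : sets borel" "AE x in lborel. AE y in lborel. P (x, y)" shows "AE z in lborel. P z"
proof -
 have "AE z in lborel \<Otimes>\<^sub>M lborel. P z" using assms by (intro lborel_pair.AE_pair_measure) (simp_all add: borel_prod[symmetric] space_pair_measure)
 thus ?thesis unfolding lborel_prod .
qed

lemma AE_lborel_pairI2:
 fixes P :: "'a::euclidean_space \<times> 'b::euclidean_space => bool"
 assumes "{z. P z} : sets borel" "AE y in lborel. AE x in lborel. P (x, y)" shows "AE z in lborel. P z"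
proof (rule AE_lborel_pairI[OF assms(1)])
 have "{x : space (lborel \<Otimes>\<^sub>M lborel). P (fst x, snd x)} : sets (lborel \<Otimes>\<^sub>M (lborel :: 'b measure))"
  using assms(1) by (simp add: borel_prod[symmetric] space_pair_measure)
 thus "AE x in lborel. AE y in lborel. P (x, y)" using assms(2) lborel_pair.AE_commute[of "%x y. P (x, y)"] by simp
qed

lemma AE_lborel_fst:
 assumes "AE x in lborel. P (x::'a::euclidean_space)" shows "AE z in (lborel :: ('a \<times> 'b::euclidean_space) measure). P (fst z)"
proof -
 from assms obtain N where N: "{x. ~ P x} \<subseteq> N" "N : null_sets lborel" unfolding eventually_ae_filter by auto
 hence "AE x in lborel. x ~: N" by (simp add: AE_not_in)
 have "AE z in (lborel :: ('a \<times> 'b) measure). fst z ~: N"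
 proof (rule AE_lborel_pairI)
  have "{z :: 'a \<times> 'b. fst z ~: N} = (- N) \<times> UNIV" by auto
  moreover have "(- N) \<times> (UNIV :: 'b set) : sets (borel \<Otimes>\<^sub>M borel)" using N by (intro pair_measureI) (auto simp: borel_comp)
  ultimately show "{z :: 'a \<times> 'b. fst z ~: N} : sets borel" by (simp add: borel_prod[symmetric])
  show "AE x in lborel. AE y::'b in lborel. fst (x, y) ~: N" using \<open>AE x in lborel. x ~: N\<close> by eventually_elim simp
 qed
 thus ?thesis by eventually_elim (use N in blast)
qed

lemma AE_lborel_snd:
 assumes "AE y in lborel. P (y::'b::euclidean_space)" shows "AE z in (lborel :: ('a::euclidean_space \<times> 'b) measure). P (snd z)"
proof -
 from assms obtain N where N: "{x. ~ P x} \<subseteq> N" "N : null_sets lborel" unfolding eventually_ae_filter by auto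
 hence "AE x in lborel. x ~: N" by (simp add: AE_not_in)
 have "AE z in (lborel :: ('a \<times> 'b) measure). snd z ~: N"
 proof (rule AE_lborel_pairI)
  have "{z :: 'a \<times> 'b. snd z ~: N} = UNIV \<times> (- N)" by auto
  moreover have "(UNIV :: 'a set) \<times> (- N) : sets (borel \<Otimes>\<^sub>M borel)" using N by (intro pair_measureI) (auto simp: borel_comp)
  ultimately show "{z :: 'a \<times> 'b. snd z ~: N} : sets borel" by (simp add: borel_prod[symmetric])
 qed (use \<open>AE x in lborel. x ~: N\<close> in simp)
 thus ?thesis by eventually_elim (use N in blast)
qed

text \<open>Piecewise affine with possibly infinitely many pieces: they need only fill the line up
  to a null set, and the global Lipschitz bound excludes hidden growth on that null set, so that
  integration by parts remains valid.\<close>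

definition ppl :: "(real => real) => (real => real) => bool" where
 "ppl f d \<longleftrightarrow> (EX L. L-lipschitz_on UNIV f) & d : bmeas & (AE x in lborel. lin_at f d x)"

lemma pplD:
 assumes "ppl f d" shows "EX L. L-lipschitz_on UNIV f" "d : bmeas" "AE x in lborel. lin_at f d x"
  "contU f" using assms lipschitz_on_continuous_on unfolding ppl_def by blast+

lemma ppl_const: "ppl (%_. c) (%_. 0)" unfolding ppl_def using lipschitz_on_constant lin_at_const by auto

lemma ppl_affine: "ppl (%x. c * x + b) (%_. c)"
proof -
 have "(abs c * 1 + 0)-lipschitz_on UNIV (%x::real. c * x + b)" by (intro lipschitz_intros)
 thus ?thesis unfolding ppl_def using lin_at_affine by auto
qed

lemma ppl_add:
 assumes "ppl f d" "ppl g e" shows "ppl (%x. f x + g x) (%x. d x + e x)" unfolding ppl_def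
proof (intro conjI)
 show "EX L. L-lipschitz_on UNIV (%x. f x + g x)" using pplD(1)[OF assms(1)] pplD(1)[OF assms(2)] lipschitz_on_add by blast
 show "(%x. d x + e x) : bmeas" using pplD(2)[OF assms(1)] pplD(2)[OF assms(2)] by measurable
 show "AE x in lborel. lin_at (%x. f x + g x) (%x. d x + e x) x" using pplD(3)[OF assms(1)] pplD(3)[OF assms(2)] by eventually_elim (rule lin_at_add)
qed

lemma ppl_cmult:
 assumes "ppl f d" shows "ppl (%x. c * f x) (%x. c * d x)" unfolding ppl_def
proof (intro conjI)
 show "EX L. L-lipschitz_on UNIV (%x. c * f x)" using pplD(1)[OF assms(1)] lipschitz_on_cmult_real by blast
 show "(%x. c * d x) : bmeas" using pplD(2)[OF assms(1)] by measurable
 show "AE x in lborel. lin_at (%x. c * f x) (%x. c * d x) x" using pplD(3)[OF assms(1)] by eventually_elim (rule lin_at_cmult)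
qed

lemma ppl_diff:
 assumes "ppl f d" "ppl g e" shows "ppl (%x. f x - g x) (%x. d x - e x)" using ppl_add[OF assms(1) ppl_cmult[OF assms(2), of "-1"]] by simp

lemma ppl_sum:
 assumes "finite A" "!!i. i : A ==> ppl (f i) (d i)" shows "ppl (%x. SUM i:A. f i x) (%x. SUM i:A. d i x)"
 using assms by (induction A rule: finite_induct) (auto intro: ppl_const ppl_add)

text \<open>The outer function has only countably many corners, and the points that reach one of
  them with nonzero inner slope form a null set.\<close>

lemma ppl_compose:
 assumes g: "ppl g e" and f: "ppl f d" and C: "countable C" "!!y. y ~: C ==> lin_at f d y" shows "ppl (%x. f (g x)) (%x. d (g x) * e x)" unfolding ppl_def
proof (intro conjI)
 from pplD(1)[OF g] pplD(1)[OF f] obtain L M where "L-lipschitz_on UNIV g" "M-lipschitz_on UNIV f" by blast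
 thus "EX L. L-lipschitz_on UNIV (%x. f (g x))" using lipschitz_on_compose2[of L UNIV g M f] lipschitz_on_subset[of M UNIV f "range g"] by blast
 have [measurable]: "g : bmeas" using pplD(4)[OF g] by (rule meas_cont)
 show "(%x. d (g x) * e x) : bmeas" using pplD(2)[OF g] pplD(2)[OF f] by measurable
 show "AE x in lborel. lin_at (%x. f (g x)) (%x. d (g x) * e x) x" using pplD(3)[OF g] AE_lin_at_nonzero_slope[OF C(1), of g e]
 proof eventually_elim
  case (elim x)
  thus ?case using C(2) by (intro lin_at_compose) blast+
 qed
qed

text \<open>A local notion that, unlike \<open>ppl\<close>, is stable under products; the margin in
  \<open>r+1\<close> is the one that \<open>lipschitz_FTC\<close> requires.\<close>

definition lipD :: "real => real => (real => real) => (real => real) => bool" where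
 "lipD s r f d \<longleftrightarrow> (EX L. L-lipschitz_on {s..r+1} f) & f : bmeas & d : bmeas \<and>
  (AE x in lborel. x : {s<..<r} --> (f has_real_derivative d x) (at x))"

lemma lipD_const: "lipD s r (%_. c) (%_. 0)" unfolding lipD_def by (auto intro!: exI[of _ 0] lipschitz_onI)

lemma lipD_add:
 assumes "lipD s r f d" "lipD s r g e" shows "lipD s r (%x. f x + g x) (%x. d x + e x)" unfolding lipD_def
proof (intro conjI)
 show "EX L. L-lipschitz_on {s..r+1} (%x. f x + g x)" using assms lipschitz_on_add unfolding lipD_def by blast
 show "(%x. f x + g x) : bmeas" "(%x. d x + e x) : bmeas" using assms unfolding lipD_def by auto
 have "AE x in lborel. x : {s<..<r} --> (f has_real_derivative d x) (at x)" "AE x in lborel. x : {s<..<r} --> (g has_real_derivative e x) (at x)"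
  using assms unfolding lipD_def by auto
 thus "AE x in lborel. x : {s<..<r} --> ((%x. f x + g x) has_real_derivative d x + e x) (at x)" by eventually_elim (blast intro: DERIV_add)
qed

lemma lipD_mult:
 assumes "lipD s r f d" "lipD s r g e" shows "lipD s r (%x. f x * g x) (%x. d x * g x + e x * f x)" unfolding lipD_def
proof (intro conjI)
 obtain L M where L: "L-lipschitz_on {s..r+1} f" and M: "M-lipschitz_on {s..r+1} g" using assms unfolding lipD_def by blast
 note c = lipschitz_imp_continuous_on[OF L] lipschitz_imp_continuous_on[OF M]
 obtain A B where A: "!!x. x : {s..r+1} ==> abs (f x) <= A" and B: "!!x. x : {s..r+1} ==> abs (g x) <= B"
  using compact_imp_bounded[OF compact_continuous_image[OF c(1)]] compact_imp_bounded[OF compact_continuous_image[OF c(2)]]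
  unfolding bounded_iff by (metis compact_Icc image_eqI real_norm_def)
 have LM: "0 <= L" "0 <= M" using L M lipschitz_on_nonneg by auto
 have "(L * abs B + M * abs A)-lipschitz_on {s..r+1} (%x. f x * g x)"
 proof (rule lipschitz_onI)
  fix x y assume x: "x : {s..r+1}" and y: "y : {s..r+1}"
  have "f x * g x - f y * g y = (f x - f y) * g x + (g x - g y) * f y" by (simp add: algebra_simps)
  also have "abs (...) <= abs (f x - f y) * abs (g x) + abs (g x - g y) * abs (f y)" by (metis abs_mult abs_triangle_ineq)
  also have "... <= (L * abs (x - y)) * abs B + (M * abs (x - y)) * abs A" using lipschitz_onD[OF L x y] lipschitz_onD[OF M x y] A[OF y] B[OF x] LM
   by (intro add_mono mult_mono) (auto simp: dist_real_def)
  finally show "dist (f x * g x) (f y * g y) <= (L * abs B + M * abs A) * dist x y" by (simp add: dist_real_def algebra_simps)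
 qed (use LM in simp)
 thus "EX L. L-lipschitz_on {s..r+1} (%x. f x * g x)" by blast
 show "(%x. f x * g x) : bmeas" "(%x. d x * g x + e x * f x) : bmeas" using assms unfolding lipD_def by auto
 have "AE x in lborel. x : {s<..<r} --> (f has_real_derivative d x) (at x)" "AE x in lborel. x : {s<..<r} --> (g has_real_derivative e x) (at x)"
  using assms unfolding lipD_def by auto
 thus "AE x in lborel. x : {s<..<r} --> ((%x. f x * g x) has_real_derivative d x * g x + e x * f x) (at x)" by eventually_elim (blast intro: DERIV_mult)
qed

lemma ppl_by_parts:
 assumes ab: "a <= b" and f: "ppl f d" and ph: "!!x. (ph has_real_derivative ph' x) (at x)" and c: "contU ph'" shows "sint {a..b} d"
  and "(LBINT x:{a..b}. d x * ph x + f x * ph' x) = f b * ph b - f a * ph a"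
proof -
 from pplD(1)[OF f] obtain L where "L-lipschitz_on UNIV f" by blast
 hence L: "L-lipschitz_on {a..b+1} f" by (rule lipschitz_on_subset) simp
 have f': "lipD a b f d" unfolding lipD_def using L pplD(2,4)[OF f] pplD(3)[OF f] by (auto intro: lin_at_deriv meas_cont elim: AE_mp)
 thus "sint {a..b} d" using lipschitz_FTC(1)[OF ab L] unfolding lipD_def by blast
 have cph: "contU ph" using ph DERIV_isCont by (blast intro: continuous_at_imp_continuous_on)
 have "bounded (ph' ` {a..b+1})" using continuous_on_subset[OF c] by (auto intro!: compact_imp_bounded compact_continuous_image)
 then obtain H where H: "!!x. x : {a..b+1} ==> abs (ph' x) <= H" unfolding bounded_iff by (metis imageI real_norm_def)
 have "(abs H)-lipschitz_on {a..b+1} ph"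
 proof (rule lipschitz_onI)
  show "dist (ph x) (ph y) <= abs H * dist x y" if "x : {a..b+1}" "y : {a..b+1}" for x y unfolding dist_norm
   by (rule field_differentiable_bound[of "{a..b+1}" ph ph']) (use H ph that has_field_derivative_at_within in \<open>force intro: order_trans[OF _ abs_ge_self]\<close>)+
 qed simp
 hence "lipD a b ph ph'" unfolding lipD_def using ph c cph by (auto intro: meas_cont)
 from lipD_mult[OF f' this] show "(LBINT x:{a..b}. d x * ph x + f x * ph' x) = f b * ph b - f a * ph a"
  unfolding lipD_def using lipschitz_FTC(2)[OF ab] by (auto simp: mult.commute)
qed

text \<open>A profile in \<open>x\<close> clamped at a height depending on \<open>t\<close>: it
  depends on \<open>x\<close> only where \<open>abs (Ph x) < rh t\<close> and on \<open>t\<close>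
  only where \<open>rh t < abs (Ph x)\<close>, so its two derivatives are never nonzero together.
  Every level of \<open>Y\<close> and \<open>Q\<close> is built from such tiles.\<close>

definition tile :: "(real => real) => (real => real) => real => real => real" where
 "tile rh Ph x t = max (- rh t) (min (rh t) (Ph x))"

definition tile_x :: "(real => real) => (real => real) => (real => real) => real => real => real" where
 "tile_x rh Ph ph x t = (if (abs (Ph x)) < rh t then ph x else 0)"

definition tile_t :: "(real => real) => (real => real) => (real => real) => real => real => real" where
 "tile_t rh r Ph x t = (if rh t < abs (Ph x) then sgn (Ph x) * r t else 0)"

lemma abs_clamp_diff: "abs (max (- r) (min r a) - max (- s) (min s b)) <= max (abs (a - b)) (abs (r - s))" for a b r s :: real
 by (simp add: max_def min_def abs_if)

lemma tile_lin_at_x: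
 assumes "lin_at Ph ph x" "ph x = 0 | abs (Ph x) ~= rh t" shows "lin_at (%x. tile rh Ph x t) (%x. tile_x rh Ph ph x t) x"
proof -
 have ev: "\<forall>\<^sub>F y in nhds x. Ph y = Ph x + ph x * (y - x) & ph y = ph x" using assms(1) by (simp add: lin_at_def)
 consider "ph x = 0" | "abs (Ph x) < rh t" | "rh t < abs (Ph x)" using assms(2) by linarith
 thus ?thesis
 proof cases
  case 1
  from ev show ?thesis unfolding lin_at_def by eventually_elim (simp add: 1 tile_def tile_x_def)
 next
  case 2
  have "isCont (%y. abs (Ph y)) x" using lin_at_isCont[OF assms(1)] by simp
  hence "\<forall>\<^sub>F y in nhds x. abs (Ph y) < rh t" using 2 by (intro order_tendstoD(2)[OF isCont_tendsto_nhds])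
  with ev show ?thesis unfolding lin_at_def
  proof eventually_elim
   case (elim y)
   thus ?case using 2 by (simp add: tile_def tile_x_def max_def min_def abs_less_iff)
  qed
 next
  case 3
  have "isCont (%y. sgn (Ph x) * Ph y) x" using lin_at_isCont[OF assms(1)] by simp
  hence "\<forall>\<^sub>F y in nhds x. rh t < sgn (Ph x) * Ph y"
   using 3 by (intro order_tendstoD(1)[OF isCont_tendsto_nhds]) (simp_all add: abs_sgn mult.commute)
  thus ?thesis unfolding lin_at_def
  proof eventually_elim
   case (elim y)
   thus ?case using 3 by (cases "Ph x" "0::real" rule: linorder_cases)
    (auto simp: tile_def tile_x_def max_def min_def abs_if split: if_splits)
  qed
 qed
qed

lemma tile_lin_at_t:
 assumes "lin_at rh r t" "r t = 0 | abs (Ph x) ~= rh t" and nn: "!!t. 0 <= rh t" shows "lin_at (%t. tile rh Ph x t) (%t. tile_t rh r Ph x t) t"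
proof -
 have ev: "\<forall>\<^sub>F y in nhds t. rh y = rh t + r t * (y - t) & r y = r t" using assms(1) by (simp add: lin_at_def)
 have c: "(rh \<longlongrightarrow> rh t) (nhds t)" using lin_at_isCont[OF assms(1)] by (simp add: continuous_at tendsto_at_iff_tendsto_nhds)
 consider "r t = 0" | "abs (Ph x) < rh t" | "rh t < abs (Ph x)" using assms(2) by linarith
 thus ?thesis
 proof cases
  case 1
  from ev show ?thesis unfolding lin_at_def by eventually_elim (simp add: 1 tile_def tile_t_def)
 next
  case 2
  have "\<forall>\<^sub>F y in nhds t. abs (Ph x) < rh y" using c 2 by (rule order_tendstoD(1))
  with ev show ?thesis unfolding lin_at_def
  proof eventually_elim
   case (elim y)
   have "~ rh y < abs (Ph x)" "~ rh t < abs (Ph x)" using elim 2 by linarith+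
   moreover have "tile rh Ph x y = Ph x" "tile rh Ph x t = Ph x" using elim 2 by (simp_all add: tile_def max_def min_def abs_less_iff)
   ultimately show ?case by (simp add: tile_t_def)
  qed
 next
  case 3
  have "\<forall>\<^sub>F y in nhds t. rh y < abs (Ph x)" using c 3 by (rule order_tendstoD(2))
  with ev show ?thesis unfolding lin_at_def
  proof eventually_elim
   case (elim y)
   have "0 <= rh t" "0 <= rh y" by (rule nn)+
   with elim 3 have "tile rh Ph x y = sgn (Ph x) * rh y" "tile rh Ph x t = sgn (Ph x) * rh t"
    "tile_t rh r Ph x y = sgn (Ph x) * r y" "tile_t rh r Ph x t = sgn (Ph x) * r t"
    by (cases "Ph x" "0::real" rule: linorder_cases; simp add: tile_def tile_t_def)+
   thus ?case using elim by (simp add: algebra_simps)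
  qed
 qed
qed

lemma AE_lin_at_abs: shows "AE x in lborel. lin_at Ph ph x --> ph x ~= 0 --> abs (Ph x) ~= c" using AE_lin_at_nonzero_slope[of "{c, -c}" Ph ph]
 by (rule AE_mp) (auto intro!: AE_I2 simp: abs_if split: if_splits)

lemma ppl_tile_x:
 assumes "ppl Ph ph" shows "ppl (%x. tile rh Ph x t) (%x. tile_x rh Ph ph x t)" unfolding ppl_def
proof (intro conjI)
 from pplD(1)[OF assms] obtain L where L: "L-lipschitz_on UNIV Ph" by blast
 have "L-lipschitz_on UNIV (%x. tile rh Ph x t)"
 proof (rule lipschitz_onI)
  fix x y show "dist (tile rh Ph x t) (tile rh Ph y t) <= L * dist x y" using abs_clamp_diff[of "rh t" "Ph x" "rh t" "Ph y"] lipschitz_onD[OF L, of x y]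
   by (simp add: tile_def dist_real_def)
 qed (use L lipschitz_on_nonneg in blast)
 thus "EX L. L-lipschitz_on UNIV (%x. tile rh Ph x t)" by blast
 have [measurable]: "Ph : bmeas" "ph : bmeas" using pplD[OF assms] by (auto intro: meas_cont)
 show "(%x. tile_x rh Ph ph x t) : bmeas" unfolding tile_x_def by measurable
 show "AE x in lborel. lin_at (%x. tile rh Ph x t) (%x. tile_x rh Ph ph x t) x" using pplD(3)[OF assms] AE_lin_at_abs[of Ph ph "rh t"]
 proof eventually_elim
  case (elim x)
  thus ?case by (intro tile_lin_at_x) blast+
 qed
qed

lemma ppl_tile_t:
 assumes "ppl rh r" "!!t. 0 <= rh t" shows "ppl (%t. tile rh Ph x t) (%t. tile_t rh r Ph x t)" unfolding ppl_def
proof (intro conjI)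
 from pplD(1)[OF assms(1)] obtain L where L: "L-lipschitz_on UNIV rh" by blast
 have "L-lipschitz_on UNIV (%t. tile rh Ph x t)"
 proof (rule lipschitz_onI)
  fix s t show "dist (tile rh Ph x s) (tile rh Ph x t) <= L * dist s t" using abs_clamp_diff[of "rh s" "Ph x" "rh t" "Ph x"] lipschitz_onD[OF L, of s t]
   by (simp add: tile_def dist_real_def)
 qed (use L lipschitz_on_nonneg in blast)
 thus "EX L. L-lipschitz_on UNIV (%t. tile rh Ph x t)" by blast
 have [measurable]: "rh : bmeas" "r : bmeas" using pplD[OF assms(1)] by (auto intro: meas_cont)
 show "(%t. tile_t rh r Ph x t) : bmeas" unfolding tile_t_def by measurable
 show "AE t in lborel. lin_at (%t. tile rh Ph x t) (%t. tile_t rh r Ph x t) t" using pplD(3)[OF assms(1)] AE_lin_at_abs[of rh r "abs (Ph x)"]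
 proof eventually_elim
  case (elim t)
  have "abs (rh t) = rh t" using assms(2) by simp
  thus ?case using elim by (intro tile_lin_at_t assms(2)) auto
 qed
qed

definition loc_const :: "('a::topological_space => 'b) => 'a => bool" where
 "loc_const g z \<longleftrightarrow> (\<forall>\<^sub>F y in nhds z. g y = g z)"

lemma open_loc_const: "open {z. loc_const g z}"
proof (rule open_if_eventually_nhds)
 fix z assume "loc_const g z"
 hence ev: "\<forall>\<^sub>F y in nhds z. \<forall>\<^sub>F w in nhds y. g w = g z" unfolding loc_const_def by (simp add: eventually_eventually)
 thus "\<forall>\<^sub>F y in nhds z. loc_const g y"
 proof eventually_elim
  case (elim y)
  from eventually_nhds_x_imp_x[OF elim] have "g y = g z" .
  with elim show ?case unfolding loc_const_def by simp
 qed
qed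

lemma eventually_nhds_fst:
 assumes "\<forall>\<^sub>F x in nhds (fst z). P x" shows "\<forall>\<^sub>F y in nhds z. P (fst y)"
proof -
 have "filterlim fst (nhds (fst z)) (nhds z)" by (intro tendsto_fst filterlim_ident)
 thus ?thesis using assms by (rule filterlim_iff[THEN iffD1, rule_format])
qed

lemma eventually_nhds_snd:
 assumes "\<forall>\<^sub>F x in nhds (snd z). P x" shows "\<forall>\<^sub>F y in nhds z. P (snd y)"
proof -
 have "filterlim snd (nhds (snd z)) (nhds z)" by (intro tendsto_snd filterlim_ident)
 thus ?thesis using assms by (rule filterlim_iff[THEN iffD1, rule_format])
qed

text \<open>Only ties \<open>abs (Ph x) = rh t\<close> can spoil local constancy. By Fubini almost
  every tie has zero slope in both variables: for fixed \<open>t\<close> the ties with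
  \<open>ph x ~= 0\<close> fill a null set of \<open>x\<close>, and likewise with the roles
  exchanged. Near a tie with both slopes zero both derivatives vanish.\<close>

lemma tile_loc_const:
 assumes Ph: "ppl Ph ph" and rh: "ppl rh r" and nn: "!!t. 0 <= rh t"
 shows "AE z in lborel. loc_const (%z. (tile_x rh Ph ph (fst z) (snd z), tile_t rh r Ph (fst z) (snd z))) z"
proof -
 have cPh: "contU (%z. abs (Ph (fst z)))" by (intro continuous_intros continuous_on_compose2[OF pplD(4)[OF Ph]]) auto
 have crh: "contU (%z. rh (snd z))" by (intro continuous_intros continuous_on_compose2[OF pplD(4)[OF rh]]) auto
 have m[measurable]: "{z::real * real. abs (Ph (fst z)) = rh (snd z)} : sets borel" using closed_Collect_eq[OF cPh crh] by (rule borel_closed)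
 have "open ({x. lin_at Ph ph x & ph x ~= 0} \<times> (UNIV::real set))" by (intro open_Times open_lin_at_nz open_UNIV)
 moreover have "{x. lin_at Ph ph x & ph x ~= 0} \<times> (UNIV::real set) = {z. lin_at Ph ph (fst z) & ph (fst z) ~= 0}" by auto
 ultimately have m1[measurable]: "{z::real * real. lin_at Ph ph (fst z) & ph (fst z) ~= 0} : sets borel" by simp
 have "open ((UNIV::real set) \<times> {t. lin_at rh r t & r t ~= 0})" by (intro open_Times open_lin_at_nz open_UNIV)
 moreover have "(UNIV::real set) \<times> {t. lin_at rh r t & r t ~= 0} = {z. lin_at rh r (snd z) & r (snd z) ~= 0}" by auto
 ultimately have m2[measurable]: "{z::real * real. lin_at rh r (snd z) & r (snd z) ~= 0} : sets borel" by simp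
 have n1: "AE z in lborel. lin_at Ph ph (fst z) & ph (fst z) ~= 0 --> abs (Ph (fst z)) ~= rh (snd z)"
 proof (rule AE_lborel_pairI2)
  have eq: "{z. lin_at Ph ph (fst z) & ph (fst z) ~= 0 --> abs (Ph (fst z)) ~= rh (snd z)} =
   - ({z. lin_at Ph ph (fst z) & ph (fst z) ~= 0} \<inter> {z. abs (Ph (fst z)) = rh (snd z)})" by blast
  show "{z. lin_at Ph ph (fst z) & ph (fst z) ~= 0 --> abs (Ph (fst z)) ~= rh (snd z)} : sets borel"
   by (rule back_subst[where P = "%S. S : sets borel", OF borel_comp[OF sets.Int[OF m1 m]] eq[symmetric]])
  have "AE x in lborel. lin_at Ph ph x & ph x ~= 0 --> abs (Ph x) ~= rh y" for y using AE_lin_at_abs[of Ph ph "rh y"] by eventually_elim simp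
  thus "AE y in lborel. AE x in lborel. lin_at Ph ph (fst (x, y)) & ph (fst (x, y)) ~= 0 --> abs (Ph (fst (x, y))) ~= rh (snd (x, y))"
   unfolding fst_conv snd_conv by (rule AE_I2)
 qed
 have n2: "AE z in lborel. lin_at rh r (snd z) & r (snd z) ~= 0 --> abs (Ph (fst z)) ~= rh (snd z)"
 proof (rule AE_lborel_pairI)
  have eq: "{z. lin_at rh r (snd z) & r (snd z) ~= 0 --> abs (Ph (fst z)) ~= rh (snd z)} =
   - ({z. lin_at rh r (snd z) & r (snd z) ~= 0} \<inter> {z. abs (Ph (fst z)) = rh (snd z)})" by blast
  show "{z. lin_at rh r (snd z) & r (snd z) ~= 0 --> abs (Ph (fst z)) ~= rh (snd z)} : sets borel"
   by (rule back_subst[where P = "%S. S : sets borel", OF borel_comp[OF sets.Int[OF m2 m]] eq[symmetric]])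
  have "AE y in lborel. lin_at rh r y & r y ~= 0 --> abs (Ph x) ~= rh y" for x
   using AE_lin_at_nonzero_slope[of "{abs (Ph x)}" rh r, OF countable_finite[OF finite.insertI[OF finite.emptyI]]] by eventually_elim (metis singletonI)
  thus "AE x in lborel. AE y in lborel. lin_at rh r (snd (x, y)) & r (snd (x, y)) ~= 0 --> abs (Ph (fst (x, y))) ~= rh (snd (x, y))"
   unfolding fst_conv snd_conv by (rule AE_I2)
 qed
 show ?thesis using AE_lborel_fst[OF pplD(3)[OF Ph]] AE_lborel_snd[OF pplD(3)[OF rh]] n1 n2
 proof eventually_elim
  case (elim z)
  obtain x t where z: "z = (x, t)" by (cases z)
  have ePh: "\<forall>\<^sub>F y in nhds z. Ph (fst y) = Ph x + ph x * (fst y - x) & ph (fst y) = ph x"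
   using elim(1) unfolding lin_at_def z by (intro eventually_nhds_fst) simp
  have erh: "\<forall>\<^sub>F y in nhds z. rh (snd y) = rh t + r t * (snd y - t) & r (snd y) = r t"
   using elim(2) unfolding lin_at_def z by (intro eventually_nhds_snd) simp
  have "contU (%z::real * real. Ph (fst z))" by (intro continuous_on_compose2[OF pplD(4)[OF Ph]] continuous_intros) auto
  hence iC: "isCont (%z. abs (Ph (fst z)) - rh (snd z)) z" "isCont (%z. Ph (fst z)) z"
   using continuous_on_diff[OF cPh crh] unfolding continuous_on_eq_continuous_at[OF open_UNIV] by blast+
  have lim: "((%z. abs (Ph (fst z)) - rh (snd z)) \<longlongrightarrow> (abs (Ph x)) - rh t) (nhds z)" "((%z. Ph (fst z)) \<longlongrightarrow> Ph x) (nhds z)"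
   using iC[THEN isCont_tendsto_nhds] by (simp_all add: z)
  consider "abs (Ph x) < rh t" | "rh t < abs (Ph x)" "Ph x > 0" | "rh t < abs (Ph x)" "Ph x < 0"
   | "ph x = 0" "r t = 0"
  proof -
   have "0 <= rh t" by (rule nn)
   have tie: "abs (Ph x) = rh t ==> ph x = 0 & r t = 0" using elim z by simp
   show thesis
   proof (cases "abs (Ph x)" "rh t" rule: linorder_cases)
    case less thus ?thesis by (rule that(1))
   next
    case equal thus ?thesis using tie that(4) by blast
   next
    case greater
    hence "Ph x ~= 0" using \<open>0 <= rh t\<close> by auto
    thus ?thesis using that(2,3) greater by linarith
   qed
  qed
  thus ?case
  proof cases
   case 1
   have "\<forall>\<^sub>F z in nhds z. abs (Ph (fst z)) - rh (snd z) < 0" by (rule order_tendstoD(2)[OF lim(1)]) (use 1 in simp)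
   with ePh show ?thesis unfolding loc_const_def z by eventually_elim (use 1 in \<open>simp add: tile_x_def tile_t_def\<close>)
  next
   case 2
   have "\<forall>\<^sub>F z in nhds z. abs (Ph (fst z)) - rh (snd z) > 0" by (rule order_tendstoD(1)[OF lim(1)]) (use 2 in simp)
   moreover have "\<forall>\<^sub>F z in nhds z. Ph (fst z) > 0" by (rule order_tendstoD(1)[OF lim(2)]) (use 2 in simp)
   ultimately show ?thesis using erh unfolding loc_const_def z by eventually_elim (use 2 in \<open>simp add: tile_x_def tile_t_def\<close>)
  next
   case 3
   have "\<forall>\<^sub>F z in nhds z. abs (Ph (fst z)) - rh (snd z) > 0" by (rule order_tendstoD(1)[OF lim(1)]) (use 3 in simp)
   moreover have "\<forall>\<^sub>F z in nhds z. Ph (fst z) < 0" by (rule order_tendstoD(2)[OF lim(2)]) (use 3 in simp)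
   ultimately show ?thesis using erh unfolding loc_const_def z by eventually_elim (use 3 in \<open>simp add: tile_x_def tile_t_def\<close>)
  next
   case 4
   from ePh erh show ?thesis unfolding loc_const_def z by eventually_elim (use 4 in \<open>simp add: tile_x_def tile_t_def\<close>)
  qed
 qed
qed

section \<open>Linear interpolation and ramps\<close>

definition interp :: "(int => real) => real => real" where
 "interp V y = V \<lfloor>y\<rfloor> + (y - of_int \<lfloor>y\<rfloor>) * (V (\<lfloor>y\<rfloor> + 1) - V \<lfloor>y\<rfloor>)"

definition interp' :: "(int => real) => real => real" where
 "interp' V y = V (\<lfloor>y\<rfloor> + 1) - V \<lfloor>y\<rfloor>"

lemma interp_nonneg:
 assumes "!!m. 0 <= V m" shows "0 <= interp V y"
proof -
 let ?r = "y - of_int \<lfloor>y\<rfloor>"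
 have "0 <= ?r" "0 <= 1 - ?r" by linarith+
 hence "0 <= (1 - ?r) * V \<lfloor>y\<rfloor> + ?r * V (\<lfloor>y\<rfloor> + 1)" using assms by (intro add_nonneg_nonneg mult_nonneg_nonneg)
 thus ?thesis by (simp add: interp_def algebra_simps)
qed

lemma abs_mult_bound: "0 <= c ==> abs v <= D ==> abs (c * v) <= D * (c::real)" using mult_right_mono[of "abs v" D c] by (simp add: abs_mult mult.commute)

lemma interp_lipschitz:
 assumes V: "!!m. abs (V (m + 1) - V m) <= D" shows "D-lipschitz_on UNIV (interp V)"
proof -
 have D0: "0 <= D" using V[of 0] by linarith
 have *: "abs (interp V y - interp V x) <= D * (y - x)" if "x <= y" for x y using that
 proof (induction "nat (\<lfloor>y\<rfloor> - \<lfloor>x\<rfloor>)" arbitrary: x)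
  case 0
  hence "\<lfloor>x\<rfloor> = \<lfloor>y\<rfloor>" using floor_mono[OF \<open>x <= y\<close>] by linarith
  hence "interp V y - interp V x = (y - x) * (V (\<lfloor>y\<rfloor> + 1) - V \<lfloor>y\<rfloor>)" by (simp add: interp_def algebra_simps)
  thus ?case using V[of "\<lfloor>y\<rfloor>"] \<open>x <= y\<close> by (simp only: abs_mult_bound diff_ge_0_iff_ge)
 next
  case (Suc n)
  \<comment> \<open>The first integer after \<open>x\<close>: cutting there leaves one affine piece
    and a path that crosses one integer less.\<close>
  let ?z = "of_int (\<lfloor>x\<rfloor> + 1) :: real"
  have zy: "?z <= y" using Suc.hyps(2) by linarith
  have fz: "\<lfloor>?z\<rfloor> = \<lfloor>x\<rfloor> + 1" by (rule floor_of_int)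
  have "n = nat (\<lfloor>y\<rfloor> - \<lfloor>?z\<rfloor>)" using Suc.hyps(2) fz by linarith
  from Suc.hyps(1)[OF this zy] have 1: "abs (interp V y - interp V ?z) <= D * (y - ?z)" .
  have iz: "interp V ?z = V (\<lfloor>x\<rfloor> + 1)" unfolding interp_def fz by simp
  have "interp V ?z - interp V x = (?z - x) * (V (\<lfloor>x\<rfloor> + 1) - V \<lfloor>x\<rfloor>)" unfolding iz by (simp add: interp_def algebra_simps)
  moreover have "0 <= ?z - x" by linarith
  ultimately have 2: "abs (interp V ?z - interp V x) <= D * (?z - x)" using V[of "\<lfloor>x\<rfloor>"] by (simp only: abs_mult_bound)
  have "D * (y - x) = D * (y - ?z) + D * (?z - x)" by (simp add: algebra_simps)
  thus ?case using 1 2 by linarith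
 qed
 show ?thesis
 proof (rule lipschitz_onI[OF _ D0])
  fix x y show "dist (interp V x) (interp V y) <= D * dist x y" using *[of x y] *[of y x] by (cases "x <= y") (auto simp: dist_real_def abs_minus_commute)
 qed
qed

lemma eventually_floor_eq:
 assumes "(y::real) ~: \<int>" shows "\<forall>\<^sub>F z in nhds y. \<lfloor>z\<rfloor> = \<lfloor>y\<rfloor>"
proof -
 have "of_int \<lfloor>y\<rfloor> ~= y" using assms Ints_of_int by metis
 hence "y : {of_int \<lfloor>y\<rfloor><..<of_int \<lfloor>y\<rfloor> + 1}" using of_int_floor_le[of y] by (simp add: less_le) linarith
 hence "\<forall>\<^sub>F z in nhds y. z : {of_int \<lfloor>y\<rfloor><..<of_int \<lfloor>y\<rfloor> + 1}" by (intro eventually_nhds_in_open) simp_all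
 thus ?thesis by eventually_elim (simp add: floor_eq_iff)
qed

lemma lin_at_interp:
 assumes "y ~: \<int>" shows "lin_at (interp V) (interp' V) y" unfolding lin_at_def using eventually_floor_eq[OF assms]
 by eventually_elim (simp add: interp_def interp'_def algebra_simps)

lemma borel_interp': "interp' V : bmeas"
proof -
 have "(%y::real. \<lfloor>y\<rfloor>) : measurable borel (count_space UNIV)" by measurable
 hence "(%y::real. (%m. V (m + 1) - V m) \<lfloor>y\<rfloor>) : bmeas" by (rule measurable_compose) simp
 thus ?thesis by (simp add: interp'_def[abs_def])
qed

lemma countable_Ints: "countable (\<int> :: real set)" by (simp add: Ints_def)

lemma ppl_interp:
 assumes "!!m. abs (V (m + 1) - V m) <= D" shows "ppl (interp V) (interp' V)" unfolding ppl_def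
proof (intro conjI)
 show "EX L. L-lipschitz_on UNIV (interp V)" using interp_lipschitz[of V D] assms by blast
 show "AE x in lborel. lin_at (interp V) (interp' V) x" using countable_imp_AE_lborel[OF countable_Ints] by eventually_elim (rule lin_at_interp)
qed (rule borel_interp')

lemma ppl_interp_scale:
 assumes "!!m. abs (V (m + 1) - V m) <= D" and et: "ppl et e" shows "ppl (%t. interp V (c * et t)) (%t. interp' V (c * et t) * (c * e t))"
 by (rule ppl_compose[OF ppl_cmult[OF et] ppl_interp[of V D] countable_Ints]) (rule assms lin_at_interp; assumption)+

definition ramp :: "real => real" where "ramp y = max 0 (min 1 y)"
definition ramp' :: "real => real" where "ramp' y = (if 0 < y & y < 1 then 1 else 0)"

lemma ramp_simps [simp]: "y <= 0 ==> ramp y = 0" "1 <= y ==> ramp y = 1" "0 <= y ==> y <= 1 ==> ramp y = y" by (auto simp: ramp_def)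

lemma ramp_bounds: "0 <= ramp y" "ramp y <= 1" by (auto simp: ramp_def)

lemma ramp_interior: "0 < ramp y & ramp y < 1 \<longleftrightarrow> 0 < y & y < 1" by (auto simp: ramp_def)

lemma ramp'_eq_0_iff: "ramp' y = 0 \<longleftrightarrow> ramp y : {0, 1}" by (auto simp: ramp'_def ramp_def)

lemma lin_at_ramp: assumes "y ~: {0, 1}" shows "lin_at ramp ramp' y"
proof -
 consider "y < 0" | "0 < y" "y < 1" | "1 < y" using assms by fastforce
 thus ?thesis
 proof cases
  case 1
  hence "\<forall>\<^sub>F z in nhds y. z < 0" by (intro order_tendstoD(2)[OF filterlim_ident])
  thus ?thesis unfolding lin_at_def by eventually_elim (use 1 in \<open>simp add: ramp'_def\<close>)
 next
  case 2
  hence "\<forall>\<^sub>F z in nhds y. 0 < z" "\<forall>\<^sub>F z in nhds y. z < 1" by (auto intro: order_tendstoD[OF filterlim_ident])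
  thus ?thesis unfolding lin_at_def by eventually_elim (use 2 in \<open>simp add: ramp'_def\<close>)
 next
  case 3
  hence "\<forall>\<^sub>F z in nhds y. 1 < z" by (intro order_tendstoD(1)[OF filterlim_ident])
  thus ?thesis unfolding lin_at_def by eventually_elim (use 3 in \<open>simp add: ramp'_def\<close>)
 qed
qed

lemma ppl_ramp: "ppl ramp ramp'"
proof -
 have "1-lipschitz_on UNIV ramp" by (rule lipschitz_onI) (auto simp: ramp_def dist_real_def max_def min_def abs_if)
 moreover have "ramp' : bmeas" unfolding ramp'_def by measurable
 moreover have "AE y in lborel. lin_at ramp ramp' y"
 proof -
  have "AE y in lborel. y ~: {0, 1::real}" by (rule countable_imp_AE_lborel) simp
  thus ?thesis by eventually_elim (rule lin_at_ramp)
 qed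
 ultimately show ?thesis unfolding ppl_def by blast
qed

lemma ppl_ramp_compose: "ppl g e ==> ppl (%x. ramp (g x)) (%x. ramp' (g x) * e x)" using ppl_compose[OF _ ppl_ramp, of g e "{0, 1}"] lin_at_ramp by simp

lemma lin_at_ramp_affine:
 "(x - a) / l ~: {0, 1} ==> lin_at (%x. ramp ((x - a) / l)) (%x. ramp' ((x - a) / l) / l) x"
 using lin_at_compose[OF lin_at_affine[of "1 / l" "- a / l" x], of ramp ramp'] lin_at_ramp[of "(x - a) / l"] by (simp add: diff_divide_distrib)

lemma ppl_ramp_affine: "ppl (%x. ramp ((x - a) / l)) (%x. ramp' ((x - a) / l) / l)"
 using ppl_ramp_compose[OF ppl_affine[of "1 / l" "- a / l"]] by (simp add: diff_divide_distrib)

section \<open>Nested cells\<close>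

text \<open>Address of the cell that is active during the \<open>m\<close>-th clock interval of
  length \<open>4 powr (- n)\<close>: every base-4 digit contributes its parity, deepest level
  first. So the two subcells take turns in the four quarters of an active interval.\<close>

fun wordz :: "nat => int => bool list" where
 "wordz 0 m = []"
| "wordz (Suc n) m = odd m # wordz n (m div 4)"

lemma length_wordz [simp]: "length (wordz n m) = n" by (induction n arbitrary: m) auto

text \<open>Height of the \<open>Y\<close>-tile of the cell \<open>w\<close>. The node
  \<open>m\<close> gets the value \<open>1\<close> if the clock interval on either side of it is
  active; hence the height is constantly \<open>1\<close> while \<open>w\<close> is active and ramps
  only in neighbouring inactive intervals.\<close>

definition rho :: "bool list => real => real" where
 "rho w s = interp (%m. if w = wordz (length w) (m - 1) | w = wordz (length w) m then 1 else 0) (4 ^ length w * s)"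

definition rho' :: "bool list => real => real" where
 "rho' w s = interp' (%m. if w = wordz (length w) (m - 1) | w = wordz (length w) m then 1 else 0) (4 ^ length w * s) * 4 ^ length w"

text \<open>Height of the \<open>Q\<close>-tile. While \<open>w\<close> is active it goes up, down,
  up and down between \<open>0\<close> and \<open>1 / 4\<close>, one quarter each; the rising
  quarters belong to the subcell \<open>False\<close>, the falling ones to
  \<open>True\<close>.\<close>

definition del :: "bool list => real => real" where
 "del w s = interp (%m. if odd m & w = wordz (length w) (m div 4) then 1 / 4 else 0) (4 ^ Suc (length w) * s)"

definition del' :: "bool list => real => real" where
 "del' w s = interp' (%m. if odd m & w = wordz (length w) (m div 4) then 1 / 4 else 0) (4 ^ Suc (length w) * s) * 4 ^ Suc (length w)"

definition actv :: "bool list => real => bool" where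
 "actv w s \<longleftrightarrow> w = wordz (length w) \<lfloor>4 ^ length w * s\<rfloor>"

definition alive :: "bool list => real => bool" where
 "alive w s \<longleftrightarrow> (\<exists>j\<in>{-1, 0, 1}. w = wordz (length w) (\<lfloor>4 ^ length w * s\<rfloor> + j))"

lemma actv_imp_alive: "actv w s ==> alive w s" unfolding actv_def alive_def by force

lemma rho_nonneg: "0 <= rho w s" unfolding rho_def by (rule interp_nonneg) simp
lemma del_nonneg: "0 <= del w s" unfolding del_def by (rule interp_nonneg) simp

lemma ppl_rho:
 assumes "ppl et e" shows "ppl (%t. rho w (et t)) (%t. rho' w (et t) * e t)"
 using ppl_interp_scale[OF _ assms, of "%m. if w = wordz (length w) (m - 1) | w = wordz (length w) m then 1 else 0" 1 "4 ^ length w"]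
 unfolding rho_def rho'_def by (simp add: mult.assoc)

lemma ppl_del:
 assumes "ppl et e" shows "ppl (%t. del w (et t)) (%t. del' w (et t) * e t)"
 using ppl_interp_scale[OF _ assms, of "%m. if odd m & w = wordz (length w) (m div 4) then 1 / 4 else 0" "1" "4 ^ Suc (length w)"]
 unfolding del_def del'_def by (simp add: mult.assoc)

lemma rho_actv: assumes "actv w s" shows "rho w s = 1" "rho' w s = 0" using assms unfolding actv_def rho_def rho'_def interp_def interp'_def by auto

lemma rho_not_alive: assumes "~ alive w s" shows "rho w s = 0" "rho' w s = 0"
proof -
 have *: "w ~= wordz (length w) (\<lfloor>4 ^ length w * s\<rfloor> - 1)" "w ~= wordz (length w) (\<lfloor>4 ^ length w * s\<rfloor>)"
   "w ~= wordz (length w) (\<lfloor>4 ^ length w * s\<rfloor> + 1)" using assms unfolding alive_def by auto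
 thus "rho w s = 0" "rho' w s = 0" unfolding rho_def rho'_def interp_def interp'_def by simp_all
qed

lemma rho'_bound: "abs (rho' w s) <= 4 ^ length w" unfolding rho'_def interp'_def by (simp add: abs_mult)

lemma rho_le_1: "rho w s <= 1"
proof -
 define r where "r = 4 ^ length w * s - of_int \<lfloor>4 ^ length w * s\<rfloor>"
 have "0 <= r" "r <= 1" unfolding r_def by linarith+
 thus ?thesis unfolding rho_def interp_def r_def[symmetric] by simp
qed

lemma floor_4_Suc_div: "\<lfloor>4 ^ Suc n * s\<rfloor> div 4 = \<lfloor>4 ^ n * (s::real)\<rfloor>"
proof -
 have "\<lfloor>4 ^ Suc n * s\<rfloor> div 4 = \<lfloor>4 ^ Suc n * s / of_int 4\<rfloor>" by (rule floor_divide_real_eq_div[symmetric]) simp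
 thus ?thesis by simp
qed

lemma even_Suc_div_4: "even m ==> (m + 1) div 4 = m div (4::int)" by presburger

lemma del_not_actv: assumes "~ actv w s" shows "del w s = 0" "del' w s = 0"
proof -
 define m where "m = \<lfloor>4 ^ Suc (length w) * s\<rfloor>"
 have m: "m div 4 = \<lfloor>4 ^ length w * s\<rfloor>" unfolding m_def by (rule floor_4_Suc_div)
 define V where "V = (%m. if odd m & w = wordz (length w) (m div 4) then 1 / 4 else (0::real))"
 \<comment> \<open>Only odd nodes carry a nonzero value, and an odd node has the same parent
   interval as the even node before it; so a neighbouring active cell cannot leak into this
   interval.\<close>
 have "V m = 0" "V (m + 1) = 0" using assms even_Suc_div_4[of m] unfolding V_def m actv_def by (auto simp: m)
 thus "del w s = 0" "del' w s = 0" unfolding del_def del'_def interp_def interp'_def m_def[symmetric] V_def[symmetric] by simp_all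
qed

text \<open>Off the base-4 grid the height is strictly below the plateau value \<open>1 / 4\<close>
  of \<open>psi\<close>, so the tile is really clipped and moves with the clock.\<close>

lemma del_actv:
 assumes "actv w s" shows "del' w s = (if odd \<lfloor>4 ^ Suc (length w) * s\<rfloor> then - (4 ^ length w) else 4 ^ length w)"
  and "4 ^ Suc (length w) * s ~: \<int> ==> del w s < 1 / 4"
proof -
 define m where "m = \<lfloor>4 ^ Suc (length w) * s\<rfloor>"
 have m: "m div 4 = \<lfloor>4 ^ length w * s\<rfloor>" unfolding m_def by (rule floor_4_Suc_div)
 have w: "w = wordz (length w) (m div 4)" using assms unfolding actv_def m .
 define V where "V = (%m. if odd m & w = wordz (length w) (m div 4) then 1 / 4 else (0::real))"
 have V: "odd m ==> V m = 1 / 4 & V (m + 1) = 0" "even m ==> V m = 0 & V (m + 1) = 1 / 4" using w even_Suc_div_4[of m] unfolding V_def by auto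
 show "del' w s = (if odd \<lfloor>4 ^ Suc (length w) * s\<rfloor> then - (4 ^ length w) else 4 ^ length w)"
  unfolding del'_def interp'_def m_def[symmetric] V_def[symmetric] using V by simp
 assume ni: "4 ^ Suc (length w) * s ~: \<int>"
 define r where "r = 4 ^ Suc (length w) * s - of_int m"
 have "of_int m ~= 4 ^ Suc (length w) * s" using ni Ints_of_int by metis
 hence r: "0 < r" "r < 1" unfolding r_def m_def by linarith+
 show "del w s < 1 / 4" unfolding del_def interp_def m_def[symmetric] V_def[symmetric] r_def[symmetric]
  by (cases "odd m") (use r in \<open>simp_all add: V\<close>)
qed

lemma del'_bound: "abs (del' w s) <= 4 ^ length w" using del_actv(1)[of w s] del_not_actv(2)[of w s] by (cases "actv w s") simp_all

lemma del_le: "del w s <= 1 / 4"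
proof -
 define r where "r = 4 ^ Suc (length w) * s - of_int \<lfloor>4 ^ Suc (length w) * s\<rfloor>"
 have "0 <= r" "r <= 1" unfolding r_def by linarith+
 thus ?thesis unfolding del_def interp_def r_def[symmetric] by simp
qed

lemma actv_Cons: "actv (b # w) s \<longleftrightarrow> actv w s & b = odd \<lfloor>4 ^ Suc (length w) * s\<rfloor>"
 unfolding actv_def using floor_4_Suc_div[of "length w" s] by auto

lemma actv_Nil [simp]: "actv [] s" by (simp add: actv_def)

text \<open>The bound \<open>th < 1 / 2\<close> leaves room for two subcells of ratio
  \<open>th\<close> with three equal gaps of length \<open>gp\<close>, one between them and one on
  either side.\<close>

locale cells =
 fixes th :: real
 assumes th: "0 < th" "th < 1 / 2"
begin

definition "gp = (1 - 2 * th) / 3"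
definition "off b = (if b then 2 * gp + th else gp)"

lemma gp: "0 < gp" "3 * gp + 2 * th = 1" using th by (simp_all add: gp_def field_simps)

text \<open>The coordinate is frozen at \<open>0\<close> or \<open>1\<close> outside the subcell, so
  a profile vanishing at both ends extends by zero without any case distinction.\<close>

definition "child b xi = ramp ((xi - off b) / th)"
definition "child' b xi = ramp' ((xi - off b) / th) / th"

text \<open>One refinement of the Cantor staircase: a staircase with two rises of
  \<open>1 / 2\<close>, minus the diagonal it replaces. The slope \<open>- 1\<close> in the gaps
  cancels the slope inherited from the parent.\<close>

definition "Psi xi = (child False xi + child True xi) / 2 - xi"
definition "Psi' xi = (child' False xi + child' True xi) / 2 - 1"

text \<open>Opposite plateaus on the two subcells, with all variation placed in the gaps, where the
  refined staircase is flat.\<close>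

definition "psi xi = (ramp (xi / gp) - 2 * ramp ((xi - gp - th) / gp) + ramp ((xi - 1 + gp) / gp)) / 4"
definition "psi' xi = (ramp' (xi / gp) - 2 * ramp' ((xi - gp - th) / gp) + ramp' ((xi - 1 + gp) / gp)) / (4 * gp)"

lemma child_01 [simp]: "child b 0 = 0" "child b 1 = 1" using th gp by (auto simp: child_def off_def divide_simps)

lemma child_wrong: "xi < 1 / 2 ==> child True xi = 0" "1 / 2 <= xi ==> child False xi = 1" using th gp by (auto simp: child_def off_def divide_simps)

lemma child'_eq_0: "child b xi : {0, 1} ==> child' b xi = 0" unfolding child_def child'_def using ramp'_eq_0_iff by simp

lemma Psi_01 [simp]: "Psi 0 = 0" "Psi 1 = 0" by (simp_all add: Psi_def)

lemma mean_bounds: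
 fixes a b x y :: real shows "0 < x ==> a <= 1 ==> b <= 1 ==> (a + b) / 2 - x < 1"
  "x < 1 ==> 0 <= a ==> 0 <= b ==> - 1 < (a + b) / 2 - x"
  "0 <= a ==> 0 <= b ==> a <= y ==> b <= y ==> abs ((a + b) / 2 - 1) <= 1 + y" by (auto simp: field_simps abs_le_iff)

text \<open>Strictness matters: at full height \<open>1\<close> the tile does not clip
  \<open>Psi\<close>, so an active level of \<open>Y\<close> does not depend on time.\<close>

lemma Psi_bound: assumes "0 <= xi" "xi <= 1" shows "abs (Psi xi) < 1"
proof -
 have c: "0 <= child b xi" "child b xi <= 1" for b by (simp_all add: child_def ramp_bounds)
 have "Psi xi < 1"
 proof (cases "xi = 0")
  case False
  hence "0 < xi" using assms by simp
  thus ?thesis unfolding Psi_def by (intro mean_bounds(1) c)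
 qed simp
 moreover have "- 1 < Psi xi"
 proof (cases "xi = 1")
  case False
  hence "xi < 1" using assms by simp
  thus ?thesis unfolding Psi_def by (intro mean_bounds(2) c)
 qed simp
 ultimately show ?thesis by simp
qed

lemma Psi'_inside: assumes "0 < child b xi" "child b xi < 1" shows "Psi' xi = 1 / (2 * th) - 1"
proof -
 have "ramp' ((xi - off b) / th) = 1" using assms ramp_interior[of "(xi - off b) / th"] unfolding child_def ramp'_def by simp
 moreover have "child' (~ b) xi = 0" using assms child_wrong[of xi] by (intro child'_eq_0) (cases b; cases "xi < 1 / 2"; simp)
 ultimately show ?thesis by (cases b) (simp_all add: Psi'_def child'_def)
qed

lemma Psi'_gap: assumes "child False xi : {0, 1}" "child True xi : {0, 1}" shows "Psi' xi = - 1" using assms by (simp add: Psi'_def child'_eq_0)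

lemma Psi'_bound: "abs (Psi' xi) <= 1 + 1 / th"
proof -
 have "0 <= child' b xi" "child' b xi <= 1 / th" for b using th by (simp_all add: child'_def ramp'_def divide_simps)
 thus ?thesis unfolding Psi'_def by (intro mean_bounds(3))
qed

lemma inside_iff: "0 < child b xi & child b xi < 1 \<longleftrightarrow> off b < xi & xi < off b + th"
 unfolding child_def ramp_interior using th by (simp add: field_simps)

lemma psi_inside: assumes "0 < child b xi" "child b xi < 1" shows "psi xi = (if b then - 1 / 4 else 1 / 4)" and "psi' xi = 0"
proof -
 have i: "off b < xi" "xi < off b + th" using assms inside_iff by blast+
 show "psi xi = (if b then - 1 / 4 else 1 / 4)"
 proof (cases b)
  case True
  have "1 <= xi / gp" "1 <= (xi - gp - th) / gp" "(xi - 1 + gp) / gp <= 0" using i gp th True by (simp_all add: off_def divide_simps)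
  thus ?thesis by (simp add: psi_def True)
 next
  case False
  have "1 <= xi / gp" "(xi - gp - th) / gp <= 0" "(xi - 1 + gp) / gp <= 0" using i gp th False by (simp_all add: off_def divide_simps)
  thus ?thesis by (simp add: psi_def False)
 qed
 show "psi' xi = 0"
 proof (cases b)
  case True
  have "1 <= xi / gp" "1 <= (xi - gp - th) / gp" "(xi - 1 + gp) / gp <= 0" using i gp th True by (simp_all add: off_def divide_simps)
  thus ?thesis by (simp add: psi'_def ramp'_def)
 next
  case False
  have "1 <= xi / gp" "(xi - gp - th) / gp <= 0" "(xi - 1 + gp) / gp <= 0" using i gp th False by (simp_all add: off_def divide_simps)
  thus ?thesis by (simp add: psi'_def ramp'_def)
 qed
qed

lemma psi_01 [simp]: "psi 0 = 0" "psi 1 = 0" using gp th by (simp_all add: psi_def divide_simps)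

lemma psi'_bound: "abs (psi' xi) <= 1 / gp"
proof -
 have "abs (ramp' (xi / gp) - 2 * ramp' ((xi - gp - th) / gp) + ramp' ((xi - 1 + gp) / gp)) <= 4" by (simp add: ramp'_def)
 thus ?thesis using gp by (simp add: psi'_def abs_mult divide_simps)
qed

definition "brk = {0, gp, gp + th, 2 * gp + th, 2 * gp + 2 * th, 1}"

lemma lin_at_Psi: assumes "xi ~: brk" shows "lin_at Psi Psi' xi"
proof -
 have "lin_at (child b) (child' b) xi" for b unfolding child_def[abs_def] child'_def[abs_def]
  using assms th by (intro lin_at_ramp_affine) (auto simp: brk_def off_def field_simps)
 from lin_at_diff[OF lin_at_cmult[OF lin_at_add[OF this[of False] this[of True]], of "1 / 2"] lin_at_affine[of 1 0]]
 show ?thesis unfolding Psi_def[abs_def] Psi'_def[abs_def] by simp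
qed

lemma lin_at_psi: assumes "xi ~: brk" shows "lin_at psi psi' xi"
proof -
 have "lin_at (%x. ramp ((x - 0) / gp)) (%x. ramp' ((x - 0) / gp) / gp) xi"
  "lin_at (%x. ramp ((x - (gp + th)) / gp)) (%x. ramp' ((x - (gp + th)) / gp) / gp) xi"
  "lin_at (%x. ramp ((x - (1 - gp)) / gp)) (%x. ramp' ((x - (1 - gp)) / gp) / gp) xi"
  using assms gp th by (intro lin_at_ramp_affine; auto simp: brk_def field_simps)+
 from lin_at_cmult[OF lin_at_add[OF lin_at_diff[OF this(1) lin_at_cmult[OF this(2), of 2]] this(3)], of "1 / 4"]
 show ?thesis unfolding psi_def[abs_def] psi'_def[abs_def] by (rule lin_at_cong) (use gp in \<open>auto intro!: always_eventually simp: field_simps\<close>)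
qed

lemma ppl_Psi: "ppl Psi Psi'"
proof -
 have "ppl (child b) (child' b)" for b unfolding child_def[abs_def] child'_def[abs_def] by (rule ppl_ramp_affine)
 from ppl_diff[OF ppl_cmult[OF ppl_add[OF this[of False] this[of True]], of "1 / 2"] ppl_affine[of 1 0]]
 show ?thesis unfolding Psi_def[abs_def] Psi'_def[abs_def] by simp
qed

lemma ppl_psi: "ppl psi psi'"
proof -
 have eq: "psi = (%x. 1 / 4 * (ramp ((x - 0) / gp) - 2 * ramp ((x - (gp + th)) / gp) + ramp ((x - (1 - gp)) / gp)))"
  "psi' = (%x. 1 / 4 * (ramp' ((x - 0) / gp) / gp - 2 * (ramp' ((x - (gp + th)) / gp) / gp) + ramp' ((x - (1 - gp)) / gp) / gp))"
  using gp by (auto simp: psi_def psi'_def fun_eq_iff field_simps)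
 show ?thesis unfolding eq by (intro ppl_cmult ppl_add ppl_diff ppl_ramp_affine)
qed

text \<open>Left end of the cell in the unit interval. The head of the word is the deepest digit,
  hence the scale \<open>th ^ length w\<close> in front of its offset.\<close>

fun pos :: "bool list => real" where
 "pos [] = 0"
| "pos (b # w) = pos w + th ^ length w * off b"

text \<open>A subcell lies inside the unit interval, so clamping to the parent first changes
  nothing; coordinates of nested cells therefore compose.\<close>

lemma ramp_ramp: "ramp ((ramp y - off b) / th) = ramp ((y - off b) / th)"
proof -
 have o: "0 <= off b" "off b + th <= 1" using gp th by (auto simp: off_def)
 consider "y <= 0" | "0 <= y" "y <= 1" | "1 <= y" by linarith
 thus ?thesis
 proof cases
  case 1
  have "(0 - off b) / th <= 0" "(y - off b) / th <= 0" using 1 o th by (simp_all add: divide_simps)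
  thus ?thesis using 1 by simp
 next
  case 3
  have "1 <= (1 - off b) / th" "1 <= (y - off b) / th" using 3 o th by (simp_all add: divide_simps)
  thus ?thesis using 3 by simp
 qed simp
qed

end

section \<open>Integration by parts for series\<close>

definition C1 :: "(real => real) => (real => real) => bool" where
 "C1 ph ph' \<longleftrightarrow> (ALL x. (ph has_real_derivative ph' x) (at x)) & contU ph'"

lemma C1_continuous: "C1 ph ph' ==> contU ph" unfolding C1_def using DERIV_isCont continuous_at_imp_continuous_on by blast

text \<open>Weak derivative with zero boundary values: the test functions need not vanish at the
  ends. This form survives \<open>L1\<close>-limits of the levels, whose sum need not be Lipschitz
  in \<open>x\<close>.\<close>

definition bp :: "real => real => (real => real) => (real => real) => bool" where
 "bp c e f d \<longleftrightarrow> sint {c..e} f & sint {c..e} d \<and>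
  (\<forall>ph ph'. C1 ph ph' --> (LBINT x:{c..e}. d x * ph x + f x * ph' x) = 0)"

lemma continuous_bounded_Icc:
 fixes ph :: "real => real"
 assumes "contU ph" shows "\<exists>B>0. ALL x:{c..e}. abs (ph x) <= B"
proof -
 have "compact (ph ` {c..e})" using continuous_on_subset[OF assms] by (intro compact_continuous_image) auto
 hence "bounded (ph ` {c..e})" by (rule compact_imp_bounded)
 then obtain B where "B > 0" "ALL y:ph ` {c..e}. norm y <= B" unfolding bounded_pos by blast
 thus ?thesis by auto
qed

lemma set_integrable_mult_cont:
 fixes f ph :: "real => real"
 assumes f: "sint {c..e} f" and ph: "contU ph" shows "sint {c..e} (%x. f x * ph x)"
proof -
 have [measurable]: "ph : bmeas" using ph by (rule meas_cont)
 obtain B where B: "!!x. x : {c..e} ==> abs (ph x) <= B" "0 < B" using continuous_bounded_Icc[OF ph] by blast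
 have m[measurable]: "(%x. indicator {c..e} x *\<^sub>R f x) : borel_measurable lborel"
  using f unfolding set_integrable_def by (rule borel_measurable_integrable)
 have "integrable lborel (%x. (indicator {c..e} x *\<^sub>R f x) * ph x)"
 proof (rule Bochner_Integration.integrable_bound)
  show "integrable lborel (%x. (indicator {c..e} x *\<^sub>R f x) * B)" using f unfolding set_integrable_def by (rule integrable_mult_left)
  show "AE x in lborel. norm ((indicator {c..e} x *\<^sub>R f x) * ph x) <= norm ((indicator {c..e} x *\<^sub>R f x) * B)"
  proof (rule AE_I2)
   fix x show "norm ((indicator {c..e} x *\<^sub>R f x) * ph x) <= norm ((indicator {c..e} x *\<^sub>R f x) * B)"
    using B(1)[of x] B(2) by (cases "x : {c..e}") (auto simp: abs_mult mult_left_mono)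
  qed
 qed measurable
 thus ?thesis unfolding set_integrable_def by (simp add: mult.assoc)
qed

lemma bpD:
 assumes "bp c e f d" shows "sint {c..e} f" "sint {c..e} d"
  "C1 ph ph' ==> (LBINT x:{c..e}. d x * ph x + f x * ph' x) = 0"
  "C1 ph ph' ==> sint {c..e} (%x. d x * ph x)"
  "C1 ph ph' ==> sint {c..e} (%x. f x * ph' x)" using assms unfolding bp_def by (auto intro!: set_integrable_mult_cont C1_continuous simp: C1_def)

lemma bp_ppl:
 assumes "ppl f d" "f c = 0" "f e = 0" "c <= e" shows "bp c e f d" unfolding bp_def
proof (intro conjI allI impI)
 show "sint {c..e} f" unfolding set_integrable_def by (rule borel_integrable_compact) (use pplD(4)[OF assms(1)] continuous_on_subset in auto)
 have "C1 (%_. 0) (%_. 0)" by (simp add: C1_def)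
 show "sint {c..e} d" by (rule ppl_by_parts(1)[OF assms(4,1), of "%_. 0" "%_. 0"]) auto
 fix ph ph' assume "C1 ph ph'"
 thus "(LBINT x:{c..e}. d x * ph x + f x * ph' x) = 0" using ppl_by_parts(2)[OF assms(4,1), of ph ph'] assms(2,3) unfolding C1_def by simp
qed

text \<open>Almost everywhere the series has finitely many terms, so pointwise absolute convergence
  is immediate, and summable \<open>L1\<close>-norms suffice for exchanging sum and
  integral.\<close>

lemma set_integral_suminf:
 fixes f :: "nat => real => real"
 assumes i: "!!N. sint A (f N)" and fin: "AE x in lborel. x : A --> (EX n. \<forall>N\<ge>n. f N x = 0)" and s: "summable (%N. LBINT x:A. abs (f N x))"
 shows "sint A (%x. \<Sum>N. f N x)" and "(LBINT x:A. (\<Sum>N. f N x)) = (\<Sum>N. LBINT x:A. f N x)" and "summable (%N. LBINT x:A. f N x)"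
  and "(LBINT x:A. abs (\<Sum>N. f N x)) <= (\<Sum>N. LBINT x:A. abs (f N x))"
proof -
 let ?g = "%N x. indicator A x *\<^sub>R f N x"
 have gi: "integrable lborel (?g N)" for N using i unfolding set_integrable_def .
 have gs: "AE x in lborel. summable (%N. norm (?g N x))" using fin
 proof eventually_elim
  case (elim x)
  show ?case
  proof (cases "x : A")
   case True
   with elim obtain n where "\<forall>N\<ge>n. f N x = 0" by blast
   thus ?thesis by (intro summable_finite[of "{..<n}"]) auto
  qed simp
 qed
 have gn: "summable (%N. integral\<^sup>L lborel (%x. norm (?g N x)))" using s unfolding lint_def by (simp add: abs_mult)
 have pt: "indicator A x *\<^sub>R (\<Sum>N. f N x) = (\<Sum>N. ?g N x)" for x by (cases "x : A") auto
 show "sint A (%x. \<Sum>N. f N x)" unfolding set_integrable_def pt using gi gs gn by (rule integrable_suminf)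
 show "(LBINT x:A. (\<Sum>N. f N x)) = (\<Sum>N. LBINT x:A. f N x)" unfolding lint_def pt using gi gs gn by (rule integral_suminf)
 show "summable (%N. LBINT x:A. f N x)" unfolding lint_def
  by (rule summable_norm_cancel, rule summable_comparison_test'[OF gn, of 0]) (simp add: integral_norm_bound[of lborel "?g _"])
 have absn: "integrable lborel (%x. \<Sum>N. norm (?g N x))" using gi gs gn by (intro integrable_suminf) auto
 have "(LBINT x:A. abs (\<Sum>N. f N x)) = (LINT x|lborel. norm (\<Sum>N. ?g N x))" unfolding lint_def pt[symmetric] by (simp add: abs_mult)
 also have "... <= (LINT x|lborel. (\<Sum>N. norm (?g N x)))"
 proof (rule integral_mono_AE[OF _ absn])
  show "integrable lborel (%x. norm (\<Sum>N. ?g N x))" using gi gs gn by (intro integrable_norm integrable_suminf)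
  show "AE x in lborel. norm (\<Sum>N. ?g N x) <= (\<Sum>N. norm (?g N x))" using gs by eventually_elim (rule summable_norm)
 qed
 also have "... = (\<Sum>N. LINT x|lborel. norm (?g N x))" using gi gs gn by (intro integral_suminf) auto
 finally show "(LBINT x:A. abs (\<Sum>N. f N x)) <= (\<Sum>N. LBINT x:A. abs (f N x))" unfolding lint_def by (simp add: abs_mult)
qed

lemma bp_suminf:
 assumes bp: "!!N. bp c e (f N) (d N)" and fin: "AE x in lborel. x : {c..e} --> (EX n. \<forall>N\<ge>n. f N x = 0 & d N x = 0)"
  and sf: "summable (%N. LBINT x:{c..e}. abs (f N x))" and sd: "summable (%N. LBINT x:{c..e}. abs (d N x))"
 shows "bp c e (%x. \<Sum>N. f N x) (%x. \<Sum>N. d N x)"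
proof -
 have finf: "AE x in lborel. x : {c..e} --> (EX n. \<forall>N\<ge>n. f N x = 0)" using fin by eventually_elim blast
 have find: "AE x in lborel. x : {c..e} --> (EX n. \<forall>N\<ge>n. d N x = 0)" using fin by eventually_elim blast
 show ?thesis unfolding bp_def
 proof (intro conjI allI impI)
  show "sint {c..e} (%x. \<Sum>N. f N x)" by (rule set_integral_suminf(1)[OF bpD(1)[OF bp] finf sf])
  show "sint {c..e} (%x. \<Sum>N. d N x)" by (rule set_integral_suminf(1)[OF bpD(2)[OF bp] find sd])
  fix ph ph' assume C: "C1 ph ph'"
  let ?h = "%N x. d N x * ph x + f N x * ph' x"
  have "contU (%x. abs (ph x) + abs (ph' x))" using C1_continuous[OF C] C unfolding C1_def by (intro continuous_intros) auto
  then obtain B where B: "!!x. x : {c..e} ==> abs (abs (ph x) + abs (ph' x)) <= B" "0 < B"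
   using continuous_bounded_Icc[of "%x. abs (ph x) + abs (ph' x)" c e] by blast
  have hi: "sint {c..e} (?h N)" for N using bpD(4,5)[OF bp C] by (rule set_integral_add(1))
  have hs: "summable (%N. LBINT x:{c..e}. abs (?h N x))"
  proof (rule summable_comparison_test'[where N = 0])
   show "summable (%N. B * (LBINT x:{c..e}. abs (d N x)) + B * (LBINT x:{c..e}. abs (f N x)))" by (intro summable_add summable_mult sf sd)
   fix N :: nat
   have i2: "sint {c..e} (%x. B * abs (d N x))" "sint {c..e} (%x. B * abs (f N x))"
    using bpD(1,2)[OF bp[of N]] by (auto intro!: set_integrable_mult_right set_integrable_abs)
   have "(LBINT x:{c..e}. abs (?h N x)) <= (LBINT x:{c..e}. B * abs (d N x) + B * abs (f N x))"
   proof (rule set_integral_mono[OF set_integrable_abs[OF hi] set_integral_add(1)[OF i2]])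
    fix x assume x: "x : {c..e}"
    have "abs (?h N x) <= abs (d N x) * abs (ph x) + abs (f N x) * abs (ph' x)"
     using abs_triangle_ineq[of "d N x * ph x" "f N x * ph' x"] by (simp add: abs_mult)
    also have "... <= abs (d N x) * B + abs (f N x) * B" using B(1)[OF x] by (intro add_mono mult_left_mono) linarith+
    finally show "abs (?h N x) <= B * abs (d N x) + B * abs (f N x)" by (simp add: mult.commute)
   qed
   also have "... = B * (LBINT x:{c..e}. abs (d N x)) + B * (LBINT x:{c..e}. abs (f N x))" using set_integral_add(2)[OF i2] by simp
   finally show "norm (LBINT x:{c..e}. abs (?h N x)) <= B * (LBINT x:{c..e}. abs (d N x)) + B * (LBINT x:{c..e}. abs (f N x))" by (simp add: lint_def)
  qed
  have hf: "AE x in lborel. x : {c..e} --> (EX n. \<forall>N\<ge>n. ?h N x = 0)" using fin by eventually_elim (metis add_0 mult_zero_left)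
  have "(LBINT x:{c..e}. (\<Sum>N. d N x) * ph x + (\<Sum>N. f N x) * ph' x) = (LBINT x:{c..e}. (\<Sum>N. ?h N x))" unfolding lint_def
  proof (rule integral_cong_AE)
   have [measurable]: "ph : bmeas" "ph' : bmeas" using C1_continuous[OF C] C unfolding C1_def by (auto intro: meas_cont)
   have "sint {c..e} (%x. (\<Sum>N. d N x) * ph x)" "sint {c..e} (%x. (\<Sum>N. f N x) * ph' x)"
    using set_integral_suminf(1)[OF bpD(2)[OF bp] find sd] set_integral_suminf(1)[OF bpD(1)[OF bp] finf sf]
     C1_continuous[OF C] C unfolding C1_def by (auto intro: set_integrable_mult_cont)
   from set_integral_add(1)[OF this]
   show "(%x. indicator {c..e} x *\<^sub>R ((\<Sum>N. d N x) * ph x + (\<Sum>N. f N x) * ph' x)) : borel_measurable lborel"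
    unfolding set_integrable_def by (rule borel_measurable_integrable)
   show "(%x. indicator {c..e} x *\<^sub>R (\<Sum>N. ?h N x)) : borel_measurable lborel"
    using set_integral_suminf(1)[OF hi hf hs] unfolding set_integrable_def by (rule borel_measurable_integrable)
   show "AE x in lborel. indicator {c..e} x *\<^sub>R ((\<Sum>N. d N x) * ph x + (\<Sum>N. f N x) * ph' x) = indicator {c..e} x *\<^sub>R (\<Sum>N. ?h N x)"
    using fin
   proof eventually_elim
    case (elim x)
    show ?case
    proof (cases "x : {c..e}")
     case True
     with elim obtain n where n: "\<forall>N\<ge>n. f N x = 0 & d N x = 0" by blast
     hence "(\<Sum>N. d N x) = (SUM N<n. d N x)" "(\<Sum>N. f N x) = (SUM N<n. f N x)" "(\<Sum>N. ?h N x) = (SUM N<n. ?h N x)" by (intro suminf_finite; simp)+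
     thus ?thesis by (simp add: sum.distrib sum_distrib_right)
    qed simp
   qed
  qed
  also have "... = (\<Sum>N. LBINT x:{c..e}. ?h N x)" by (rule set_integral_suminf(2)[OF hi hf hs])
  also have "... = 0" using bpD(3)[OF bp C] by simp
  finally show "(LBINT x:{c..e}. (\<Sum>N. d N x) * ph x + (\<Sum>N. f N x) * ph' x) = 0" .
 qed
qed

lemma bp_add:
 assumes "bp c e f d" "bp c e g h" shows "bp c e (%x. f x + g x) (%x. d x + h x)" unfolding bp_def
proof (intro conjI allI impI)
 show "sint {c..e} (%x. f x + g x)" "sint {c..e} (%x. d x + h x)" using bpD(1,2)[OF assms(1)] bpD(1,2)[OF assms(2)] by (auto intro: set_integral_add(1))
 fix ph ph' assume C: "C1 ph ph'"
 have "(LBINT x:{c..e}. (d x + h x) * ph x + (f x + g x) * ph' x) =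
   (LBINT x:{c..e}. (d x * ph x + f x * ph' x) + (h x * ph x + g x * ph' x))" by (simp add: algebra_simps)
 also have "... = (LBINT x:{c..e}. d x * ph x + f x * ph' x) + (LBINT x:{c..e}. h x * ph x + g x * ph' x)"
  by (intro set_integral_add(2) set_integral_add(1) bpD(4,5)[OF assms(1) C] bpD(4,5)[OF assms(2) C])
 finally show "(LBINT x:{c..e}. (d x + h x) * ph x + (f x + g x) * ph' x) = 0" using bpD(3)[OF assms(1) C] bpD(3)[OF assms(2) C] by simp
qed

section \<open>Local constancy under composition and sums\<close>

lemma loc_const_compose2:
 assumes "loc_const g z" "loc_const h z" shows "loc_const (%z. f (g z) (h z)) z" using assms unfolding loc_const_def by eventually_elim simp

lemma loc_const_compose:
 assumes "loc_const g z" shows "loc_const (%z. f (g z)) z" using assms unfolding loc_const_def by eventually_elim simp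

lemma loc_const_const: "loc_const (%_. c) z" by (simp add: loc_const_def)

lemma loc_const_sum:
 assumes "finite A" "!!i. i : A ==> loc_const (g i) z" shows "loc_const (%z. SUM i:A. g i z) z"
 using assms by (induction A rule: finite_induct) (auto intro: loc_const_const loc_const_compose2[where f = "(+)"])

lemma loc_const_cong:
 assumes "loc_const g z" "\<forall>\<^sub>F y in nhds z. h y = g y" shows "loc_const h z"
proof -
 from eventually_nhds_x_imp_x[OF assms(2)] have hz: "h z = g z" .
 from assms show ?thesis unfolding loc_const_def hz by eventually_elim simp
qed

section \<open>Oscillation along the active cells\<close>

definition words :: "nat => bool list set" where "words n = {w. length w = n}"

lemma finite_words [simp]: "finite (words n)" using finite_lists_length_eq[of "UNIV :: bool set" n] by (simp add: words_def)

lemma card_words: "card (words n) = 2 ^ n" using card_lists_length_eq[of "UNIV :: bool set" n] by (simp add: words_def)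

lemma wordz_tl: "b # w = wordz (Suc n) m ==> w = wordz n (m div 4)" by simp

text \<open>Adjacent clock intervals lie in equal or adjacent intervals of the level above.\<close>

lemma alive_Cons: assumes "alive (b # w) s" shows "alive w s"
proof -
 define m where "m = \<lfloor>4 ^ Suc (length w) * s\<rfloor>"
 have m: "m div 4 = \<lfloor>4 ^ length w * s\<rfloor>" unfolding m_def by (rule floor_4_Suc_div)
 obtain j where j: "j : {-1, 0, 1}" "b # w = wordz (Suc (length w)) (m + j)"
  using assms unfolding alive_def list.size(4) add_Suc_right add_0_right m_def[symmetric] by blast
 have "(m + j) div 4 - m div 4 : {-1, 0, 1}" using j(1) by (auto; presburger)
 moreover have "w = wordz (length w) (m div 4 + ((m + j) div 4 - m div 4))" using wordz_tl[OF j(2)] by simp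
 ultimately show ?thesis unfolding alive_def m by blast
qed

lemma card_alive: "card {w : words n. alive w s} <= 3"
proof -
 have "{w : words n. alive w s} \<subseteq> (%j. wordz n (\<lfloor>4 ^ n * s\<rfloor> + j)) ` {-1, 0, 1}" by (auto simp: words_def alive_def)
 hence "card {w : words n. alive w s} <= card ((%j. wordz n (\<lfloor>4 ^ n * s\<rfloor> + j)) ` {-1, 0, 1::int})" by (intro card_mono) auto
 also have "... <= card {-1, 0, 1::int}" by (rule card_image_le) simp
 finally show ?thesis by simp
qed

text \<open>Here \<open>et\<close> is the clock and \<open>e\<close> its rate. The strict bound by
  \<open>R\<close> keeps the plateau of the base profile \<open>PhB\<close> above the clock, so that
  on the root cell the base tile of \<open>Q\<close> shows the clock itself.\<close>

locale loop = cells +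
 fixes a l R :: real and et e :: "real => real"
 assumes l: "0 < l" and R: "0 < R" and et: "ppl et e" and et_bounds: "!!t. 0 <= et t" "!!t. et t < R"
begin

definition "arg w x = (x - (a + l * pos w)) / (l * th ^ length w)"
definition "cw w x = ramp (arg w x)"
definition "cw' w x = ramp' (arg w x) / (l * th ^ length w)"

text \<open>The half of the current cell decides the next digit. If \<open>x\<close> lies in some
  cell of level \<open>n\<close>, it is the cell \<open>wd x n\<close>; otherwise the word carries
  no information, and \<open>isin\<close> has to be checked separately.\<close>

fun wd :: "real => nat => bool list" where
 "wd x 0 = []"
| "wd x (Suc n) = (1 / 2 <= cw (wd x n) x) # wd x n"

lemma length_wd [simp]: "length (wd x n) = n" by (induction n) auto

lemma wd_words [simp]: "wd x n : words n" by (simp add: words_def)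

lemma lth: "0 < l * th ^ n" using l th by simp

lemma arg_Cons: "arg (b # w) x = (arg w x - off b) / th" using l th by (simp add: arg_def field_simps)

lemma cw_Cons: "cw (b # w) x = child b (cw w x)" unfolding cw_def arg_Cons child_def ramp_ramp ..

lemma cw_bounds: "0 <= cw w x" "cw w x <= 1" by (simp_all add: cw_def ramp_bounds)

definition "isin w x \<longleftrightarrow> 0 < cw w x & cw w x < 1"

lemma not_isin: "~ isin w x \<longleftrightarrow> cw w x : {0, 1}" using cw_bounds[of w x] unfolding isin_def by auto

lemma inside_iff_arg: "isin w x \<longleftrightarrow> 0 < arg w x & arg w x < 1" unfolding isin_def cw_def by (rule ramp_interior)

lemma inside_interval: "isin w x \<longleftrightarrow> a + l * pos w < x & x < a + l * pos w + l * th ^ length w"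
 unfolding inside_iff_arg arg_def using lth[of "length w"] by (auto simp: field_simps)

lemma inside_Cons: "isin (b # w) x \<longleftrightarrow> 0 < child b (cw w x) & child b (cw w x) < 1" unfolding isin_def cw_Cons ..

lemma inside_ConsD: "isin (b # w) x ==> isin w x" using not_isin[of w x] unfolding inside_Cons by force

lemma inside_wd: "isin w x ==> w = wd x (length w)"
proof (induction w)
 case (Cons b w)
 hence "isin w x" by (rule_tac inside_ConsD)
 with Cons have w: "w = wd x (length w)" by simp
 have "b = (1 / 2 <= cw w x)" using Cons(2) child_wrong[of "cw w x"] unfolding inside_Cons by (cases b; cases "cw w x < 1 / 2"; simp)
 thus ?case using w by simp
qed simp

lemma inside_wd_mono: "isin (wd x n) x ==> m <= n ==> isin (wd x m) x" by (induction n) (auto simp: le_Suc_eq dest: inside_ConsD)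

text \<open>Cells of one level are disjoint, so of the \<open>2 ^ n\<close> terms at most one is
  nonzero at a given point.\<close>

lemma sum_words:
 fixes F :: "bool list => real"
 assumes "!!w. ~ isin w x ==> F w = 0" shows "(SUM w:words n. F w) = F (wd x n)"
proof -
 have "F w = 0" if "w : words n - {wd x n}" for w using assms inside_wd[of w x] that by (auto simp: words_def)
 hence "(SUM w:words n. F w) = (SUM w:{wd x n}. F w)" by (intro sum.mono_neutral_right) auto
 thus ?thesis by simp
qed

lemma ppl_cw: "ppl (cw w) (cw' w)" unfolding cw_def[abs_def] cw'_def[abs_def] arg_def by (rule ppl_ramp_affine)

lemma cw'_outside: "~ isin w x ==> cw' w x = 0" unfolding not_isin cw_def cw'_def using ramp'_eq_0_iff by simp

lemma cw'_inside: "isin w x ==> cw' w x = 1 / (l * th ^ length w)" unfolding inside_iff_arg cw'_def ramp'_def by simp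

definition "cell w = {a + l * pos w <..< a + l * pos w + l * th ^ length w}"

lemma inside_cell: "{x. isin w x} = cell w" unfolding cell_def inside_interval by auto

lemma mem_cell: "x : cell w \<longleftrightarrow> isin w x" unfolding inside_cell[symmetric] by simp

lemma cell_measure [simp]: "emeasure lborel (cell w) = ennreal (l * th ^ length w)" unfolding cell_def using lth[of "length w"] by simp

lemma cell_sets [measurable, simp]: "cell w : sets borel" unfolding cell_def by simp

lemma AE_no_endpoint: "AE x in lborel. ALL w. arg w x ~: {0, 1}"
proof -
 have "countable (\<Union>w::bool list. {a + l * pos w, a + l * pos w + l * th ^ length w})" by (intro countable_UN) auto
 hence "AE x in lborel. x ~: (\<Union>w::bool list. {a + l * pos w, a + l * pos w + l * th ^ length w})" by (rule countable_imp_AE_lborel)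
 thus ?thesis
 proof eventually_elim
  case (elim x)
  show ?case
  proof
   fix w have "x ~= a + l * pos w" "x ~= a + l * pos w + l * th ^ length w" using elim by auto
   hence "x - (a + l * pos w) ~= 0" "x - (a + l * pos w) ~= l * th ^ length w" by linarith+
   thus "arg w x ~: {0, 1}" using lth[of "length w"] less_imp_neq[OF lth[of "length w"], symmetric]
    unfolding arg_def by (simp only: insert_iff empty_iff divide_eq_0_iff divide_eq_1_iff) blast
  qed
 qed
qed

text \<open>The cells of level \<open>n\<close> have total length \<open>l * (2 * th) ^ n\<close>,
  which tends to zero.\<close>

lemma AE_exit: "AE x in lborel. EX n. ~ isin (wd x n) x"
proof -
 define N where "N = (\<Inter>n. \<Union>w\<in>words n. cell w)"
 have N: "N : sets lborel" unfolding N_def by (simp add: countable_Un_Int)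
 have le: "emeasure lborel N <= ennreal (l * (2 * th) ^ n)" for n
 proof -
  have "emeasure lborel N <= emeasure lborel (\<Union>w\<in>words n. cell w)" by (intro emeasure_mono) (auto simp: N_def)
  also have "... <= (SUM w:words n. emeasure lborel (cell w))" by (intro emeasure_subadditive_finite) auto
  also have "... = (SUM w:words n. ennreal (l * th ^ n))" by (intro sum.cong) (auto simp: words_def)
  also have "... = ennreal (SUM w:words n. l * th ^ n)" using lth[of n] by (intro sum_ennreal) simp
  also have "(SUM w:words n. l * th ^ n) = l * (2 * th) ^ n" by (simp add: card_words power_mult_distrib)
  finally show ?thesis .
 qed
 have "(%n. l * (2 * th) ^ n) \<longlonglongrightarrow> l * 0" using th by (intro tendsto_intros LIMSEQ_realpow_zero) auto
 hence "(%n. ennreal (l * (2 * th) ^ n)) \<longlonglongrightarrow> ennreal 0" by (intro tendsto_ennrealI) simp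
 hence "emeasure lborel N <= ennreal 0" by (rule LIMSEQ_le_const) (use le in auto)
 hence "N : null_sets lborel" using N by (intro null_setsI) auto
 hence "AE x in lborel. x ~: N" by (rule AE_not_in)
 thus ?thesis
 proof eventually_elim
  case (elim x)
  then obtain n where "!!w. w : words n ==> ~ isin w x" unfolding N_def mem_cell by (auto simp: mem_cell)
  thus ?case by (intro exI[of _ n]) simp
 qed
qed

text \<open>\<open>ai n x s\<close>: at clock time \<open>s\<close> the level-\<open>n\<close> cell around \<open>x\<close> takes part in the oscillation.\<close>

definition "ai n x s \<longleftrightarrow> alive (wd x n) s & isin (wd x n) x"

lemma ai_Suc: "ai (Suc n) x s ==> ai n x s" unfolding ai_def using alive_Cons inside_ConsD by auto

lemma ai_mono: "ai n x s ==> m <= n ==> ai m x s" by (induction n) (auto simp: le_Suc_eq dest: ai_Suc)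

lemma ai_set: "{x. ai n x s} = (\<Union>w\<in>{w\<in>words n. alive w s}. cell w)"
proof -
 have "ai n x s \<longleftrightarrow> (\<exists>w\<in>words n. alive w s & isin w x)" for x
  using inside_wd[of _ x] unfolding ai_def words_def by (metis (mono_tags, lifting) length_wd mem_Collect_eq)
 thus ?thesis by (auto simp: mem_cell)
qed

lemma ai_sets [measurable]: "{x. ai n x s} : sets borel" unfolding ai_set by (intro sets.finite_UN) auto

lemma ai_measure: "emeasure lborel {x. ai n x s} <= ennreal (3 * (l * th ^ n))"
proof -
 have "emeasure lborel {x. ai n x s} <= (SUM w:{w\<in>words n. alive w s}. emeasure lborel (cell w))"
  unfolding ai_set by (intro emeasure_subadditive_finite) auto
 also have "... = (SUM w:{w\<in>words n. alive w s}. ennreal (l * th ^ n))" by (intro sum.cong) (auto simp: words_def)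
 also have "... = ennreal (SUM w:{w\<in>words n. alive w s}. l * th ^ n)" using lth[of n] by (intro sum_ennreal) simp
 also have "... <= ennreal (3 * (l * th ^ n))"
 proof (rule ennreal_leI)
  have "real (card {w : words n. alive w s}) <= 3" using card_alive[of n s] by linarith
  thus "(SUM w:{w\<in>words n. alive w s}. l * th ^ n) <= 3 * (l * th ^ n)" using lth[of n] by (simp add: mult_right_mono)
 qed
 finally show ?thesis .
qed

text \<open>Growth factor of the staircase slope per level: a cell carries half the rise of its
  parent on a length smaller by the factor \<open>th\<close>.\<close>

definition "al = 1 / (2 * th)"

lemma al: "1 < al" "al * th = 1 / 2" "(1 / 2) ^ n / th ^ n = al ^ n" using th by (simp_all add: al_def field_simps power_divide power_mult_distrib)

end

text \<open>Common frame for \<open>Y\<close> and \<open>Q\<close>: \<open>Ph\<close> is the profile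
  inside a cell and \<open>S\<close> the height as a function of the clock. A rate
  \<open>4 ^ n\<close> against the amplitude \<open>(1 / 2) ^ n\<close> produces time derivatives of
  size \<open>2 ^ n\<close>.\<close>

locale level = loop +
 fixes Ph Ph' :: "real => real" and S S' :: "bool list => real => real" and K :: real
 assumes Ph: "ppl Ph Ph'" "!!xi. xi ~: brk ==> lin_at Ph Ph' xi" "Ph 0 = 0" "Ph 1 = 0" "!!xi. abs (Ph' xi) <= K"
  and S: "!!w et e. ppl et e ==> ppl (%t. S w (et t)) (%t. S' w (et t) * e t)"
   "!!w s. 0 <= S w s" "!!w s. S w s <= 1" "!!w s. abs (S' w s) <= 4 ^ length w"
   "!!w s. ~ alive w s ==> S w s = 0" "!!w s. ~ alive w s ==> S' w s = 0"
begin

lemma K_nonneg: "0 <= K" using Ph(5)[of 0] by linarith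

definition "T w x t = tile (%t. S w (et t)) (%x. Ph (cw w x)) x t"
definition "Tx w x t = tile_x (%t. S w (et t)) (%x. Ph (cw w x)) (%x. Ph' (cw w x) * cw' w x) x t"
definition "Tt w x t = tile_t (%t. S w (et t)) (%t. S' w (et t) * e t) (%x. Ph (cw w x)) x t"

definition "lev n x t = (SUM w:words n. l * (1 / 2) ^ n * T w x t)"
definition "levx n x t = (SUM w:words n. l * (1 / 2) ^ n * Tx w x t)"
definition "levt n x t = (SUM w:words n. l * (1 / 2) ^ n * Tt w x t)"

lemma ppl_Phcw: "ppl (%x. Ph (cw w x)) (%x. Ph' (cw w x) * cw' w x)" by (rule ppl_compose[OF ppl_cw Ph(1), of brk]) (auto simp: brk_def intro: Ph(2))

lemma T_outside: assumes "~ isin w x" shows "T w x t = 0" "Tx w x t = 0" "Tt w x t = 0"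
proof -
 have "Ph (cw w x) = 0" using assms Ph(3,4) unfolding not_isin by auto
 thus "T w x t = 0" "Tx w x t = 0" "Tt w x t = 0"
  using S(2)[of w "et t"] cw'_outside[OF assms] by (simp_all add: T_def Tx_def Tt_def tile_def tile_x_def tile_t_def)
qed

lemma T_dead: assumes "~ alive w (et t)" shows "T w x t = 0" "Tx w x t = 0" "Tt w x t = 0"
 using S(5,6)[OF assms] by (simp_all add: T_def Tx_def Tt_def tile_def tile_x_def tile_t_def)

lemma T_bound: "abs (T w x t) <= 1" using S(2,3)[of w "et t"] by (auto simp: T_def tile_def)

lemma Tx_bound: "abs (Tx w x t) <= K / (l * th ^ length w)"
proof (cases "isin w x")
 case True
 hence "abs (Ph' (cw w x) * cw' w x) <= K / (l * th ^ length w)" using Ph(5)[of "cw w x"] less_imp_le[OF lth[of "length w"]]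
  by (simp add: cw'_inside abs_divide abs_of_nonneg[of "l * th ^ length w"] divide_right_mono del: abs_mult)
 thus ?thesis using K_nonneg lth[of "length w"] by (simp add: Tx_def tile_x_def)
qed (use T_outside K_nonneg lth[of "length w"] in simp)

lemma Tt_bound: "abs (Tt w x t) <= 4 ^ length w * abs (e t)"
 using mult_right_mono[OF S(4)[of w "et t"], of "abs (e t)"] by (simp add: Tt_def tile_t_def abs_mult abs_sgn_eq)

lemma lev_eq: "lev n x t = l * (1 / 2) ^ n * T (wd x n) x t"
 "levx n x t = l * (1 / 2) ^ n * Tx (wd x n) x t"
 "levt n x t = l * (1 / 2) ^ n * Tt (wd x n) x t" unfolding lev_def levx_def levt_def by (rule sum_words; simp add: T_outside)+

lemma lev_not_ai: assumes "~ ai n x (et t)" shows "lev n x t = 0" "levx n x t = 0" "levt n x t = 0"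
 using assms T_outside[of "wd x n" x t] T_dead[of "wd x n" t x] unfolding lev_eq ai_def by auto

lemma lev_outside: assumes "~ isin (wd x n) x" shows "lev n x t = 0" "levx n x t = 0" "levt n x t = 0" using T_outside[OF assms] by (simp_all add: lev_eq)

lemma lev_bound: "abs (lev n x t) <= l * (1 / 2) ^ n"
 using T_bound[of "wd x n" x t] l mult_left_mono[of "abs (T (wd x n) x t)" 1 "l * (1 / 2) ^ n"] by (simp add: lev_eq abs_mult)

lemma levx_bound: "abs (levx n x t) <= K * al ^ n"
proof -
 have "abs (levx n x t) <= l * (1 / 2) ^ n * (K / (l * th ^ n))"
  using Tx_bound[of "wd x n" x t] l mult_left_mono[of "abs (Tx (wd x n) x t)" "K / (l * th ^ n)" "l * (1 / 2) ^ n"] by (simp add: lev_eq abs_mult)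
 also have "... = K * ((1 / 2) ^ n / th ^ n)" using l th by (simp add: field_simps)
 finally show ?thesis unfolding al(3) .
qed

lemma levt_bound: "abs (levt n x t) <= l * abs (e t) * 2 ^ n"
proof -
 have "abs (levt n x t) <= l * (1 / 2) ^ n * (4 ^ n * abs (e t))"
  using Tt_bound[of "wd x n" x t] l mult_left_mono[of "abs (Tt (wd x n) x t)" "4 ^ n * abs (e t)" "l * (1 / 2) ^ n"] by (simp add: lev_eq abs_mult)
 also have "... = l * abs (e t) * ((1 / 2) ^ n * 4 ^ n)" by (simp add: mult_ac)
 also have "(1 / 2) ^ n * 4 ^ n = (2::real) ^ n" by (subst power_mult_distrib[symmetric]) simp
 finally show ?thesis .
qed

lemma ppl_lev_x: "ppl (%x. lev n x t) (%x. levx n x t)" unfolding lev_def levx_def T_def Tx_def by (intro ppl_sum ppl_cmult ppl_tile_x ppl_Phcw finite_words)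

lemma ppl_lev_t: "ppl (%t. lev n x t) (%t. levt n x t)" unfolding lev_def levt_def T_def Tt_def by (intro ppl_sum ppl_cmult ppl_tile_t S(1,2) et finite_words)

lemma lev_loc_const: "AE z in lborel. loc_const (%z. (levx n (fst z) (snd z), levt n (fst z) (snd z))) z"
proof -
 have "AE z in lborel. ALL w:words n. loc_const (%z. (Tx w (fst z) (snd z), Tt w (fst z) (snd z))) z"
  unfolding Tx_def Tt_def by (intro AE_finite_allI finite_words tile_loc_const ppl_Phcw S(1,2) et)
 thus ?thesis
 proof eventually_elim
  case (elim z)
  have 1: "loc_const (%z. levx n (fst z) (snd z)) z" unfolding levx_def
   using elim by (intro loc_const_sum finite_words loc_const_compose[where f = "%y. l * (1 / 2) ^ n * y"])
    (auto dest!: bspec dest: loc_const_compose[where f = fst])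
  have 2: "loc_const (%z. levt n (fst z) (snd z)) z" unfolding levt_def
   using elim by (intro loc_const_sum finite_words loc_const_compose[where f = "%y. l * (1 / 2) ^ n * y"])
    (auto dest!: bspec dest: loc_const_compose[where f = snd])
  show ?case by (rule loc_const_compose2[OF 1 2])
 qed
qed

lemma lev_measurable [measurable]:
 "(%z. lev n (fst z) (snd z)) : borel_measurable (borel \<Otimes>\<^sub>M borel)"
 "(%z. levx n (fst z) (snd z)) : borel_measurable (borel \<Otimes>\<^sub>M borel)"
 "(%z. levt n (fst z) (snd z)) : borel_measurable (borel \<Otimes>\<^sub>M borel)"
proof -
 have [measurable]: "(%x. Ph (cw w x)) : bmeas" "(%x. Ph' (cw w x) * cw' w x) : bmeas"
  "(%t. S w (et t)) : bmeas" "(%t. S' w (et t) * e t) : bmeas" for w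
  using pplD(2,4)[OF ppl_Phcw[of w]] pplD(2,4)[OF S(1)[OF et, of w]] by (auto intro: meas_cont)
 show "(%z. lev n (fst z) (snd z)) : borel_measurable (borel \<Otimes>\<^sub>M borel)" unfolding lev_def T_def tile_def by measurable
 show "(%z. levx n (fst z) (snd z)) : borel_measurable (borel \<Otimes>\<^sub>M borel)" unfolding levx_def Tx_def tile_x_def by measurable
 show "(%z. levt n (fst z) (snd z)) : borel_measurable (borel \<Otimes>\<^sub>M borel)" unfolding levt_def Tt_def tile_t_def by measurable
qed

end

context loop
begin

text \<open>A level has finitely many cells, and a point outside all of them that avoids the
  endpoints stays outside under small shifts. Near such a point every series over the levels is one
  and the same finite sum.\<close>

lemma eventually_exit:
 assumes "ALL w. arg w x ~: {0, 1}" "~ isin (wd x n) x" shows "\<forall>\<^sub>F y in nhds x. \<forall>m\<ge>n. ~ isin (wd y m) y"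
proof -
 have "\<forall>\<^sub>F y in nhds x. ~ isin w y" if "w : words n" for w
 proof -
  have "~ isin w x" using inside_wd[of w x] assms(2) that by (auto simp: words_def)
  moreover have "arg w x ~= 0" "arg w x ~= 1" using assms(1) by blast+
  ultimately have "arg w x < 0 | 1 < arg w x" unfolding inside_iff_arg by linarith
  moreover have "isCont (arg w) x" unfolding arg_def by (intro continuous_intros) (metis lth less_irrefl)
  hence "(arg w \<longlongrightarrow> arg w x) (nhds x)" by (rule isCont_tendsto_nhds)
  ultimately have "(\<forall>\<^sub>F y in nhds x. arg w y < 0) | (\<forall>\<^sub>F y in nhds x. 1 < arg w y)" using order_tendstoD by blast
  thus ?thesis unfolding inside_iff_arg by (auto elim!: eventually_mono)
 qed
 hence "\<forall>\<^sub>F y in nhds x. ALL w:words n. ~ isin w y" by (simp add: eventually_ball_finite)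
 thus ?thesis
 proof eventually_elim
  case (elim y)
  hence "~ isin (wd y n) y" using wd_words by blast
  thus ?case using inside_wd_mono by blast
 qed
qed

lemma isin_root: "isin (wd x 0) x \<longleftrightarrow> a < x & x < a + l" by (simp add: inside_interval)

lemma not_root: "~ (a < x & x < a + l) ==> ~ isin (wd x n) x" using inside_wd_mono[of x n 0] isin_root by blast

end

context level
begin

definition "tot x t = (\<Sum>n. lev n x t)"
definition "totx x t = (\<Sum>n. levx n x t)"
definition "tott x t = (\<Sum>n. levt n x t)"

lemma tot_exit:
 assumes "~ isin (wd x n) x" shows "tot x t = (SUM m<n. lev m x t)" "totx x t = (SUM m<n. levx m x t)" "tott x t = (SUM m<n. levt m x t)"
proof -
 have "~ isin (wd x m) x" if "m ~: {..<n}" for m using that inside_wd_mono[of x m n] assms by auto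
 thus "tot x t = (SUM m<n. lev m x t)" "totx x t = (SUM m<n. levx m x t)" "tott x t = (SUM m<n. levt m x t)"
  unfolding tot_def totx_def tott_def by (auto intro!: suminf_finite lev_outside)
qed

text \<open>At a fixed time the sums stop as soon as the cell around \<open>x\<close> is no longer
  alive. The exceptional set then has measure of order \<open>th ^ n\<close>; exit from all cells
  would only give the larger order \<open>(2 * th) ^ n\<close>.\<close>

lemma tot_not_ai:
 assumes "~ ai n x (et t)" shows "totx x t = (SUM m<n. levx m x t)" "tott x t = (SUM m<n. levt m x t)"
proof -
 have "~ ai m x (et t)" if "m ~: {..<n}" for m using that ai_mono[of m x "et t" n] assms by auto
 thus "totx x t = (SUM m<n. levx m x t)" "tott x t = (SUM m<n. levt m x t)" unfolding totx_def tott_def by (auto intro!: suminf_finite lev_not_ai)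
qed

lemma tot_measurable [measurable]:
 "bmeas2 tot"
 "bmeas2 totx"
 "bmeas2 tott" unfolding tot_def totx_def tott_def by measurable

lemma tot_loc_const: "AE z in lborel. loc_const (%z. (totx (fst z) (snd z), tott (fst z) (snd z))) z"
proof -
 have "AE z in lborel. ALL n. loc_const (%z. (levx n (fst z) (snd z), levt n (fst z) (snd z))) z" using lev_loc_const by (simp add: AE_all_countable)
 with AE_lborel_fst[OF AE_no_endpoint] AE_lborel_fst[OF AE_exit] show ?thesis
 proof eventually_elim
  case (elim z)
  then obtain n where n: "~ isin (wd (fst z) n) (fst z)" by blast
  have ev: "\<forall>\<^sub>F y in nhds z. \<forall>m\<ge>n. ~ isin (wd (fst y) m) (fst y)" using eventually_exit[OF elim(1) n] by (rule eventually_nhds_fst)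
  have 1: "loc_const (%z. SUM m<n. levx m (fst z) (snd z)) z" using elim(3) by (intro loc_const_sum) (auto dest!: spec dest: loc_const_compose[where f = fst])
  have 2: "loc_const (%z. SUM m<n. levt m (fst z) (snd z)) z" using elim(3) by (intro loc_const_sum) (auto dest!: spec dest: loc_const_compose[where f = snd])
  show ?case
  proof (rule loc_const_cong[OF loc_const_compose2[OF 1 2, where f = Pair]])
   show "\<forall>\<^sub>F y in nhds z. (totx (fst y) (snd y), tott (fst y) (snd y)) =
     (SUM m<n. levx m (fst y) (snd y), SUM m<n. levt m (fst y) (snd y))" using ev by eventually_elim (simp add: tot_exit)
  qed
 qed
qed

lemma ppl_tot_t: "AE x in lborel. ppl (tot x) (tott x)" using AE_exit
proof eventually_elim
 case (elim x)
 then obtain n where n: "~ isin (wd x n) x" by blast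
 have "ppl (%t. SUM m<n. lev m x t) (%t. SUM m<n. levt m x t)" by (intro ppl_sum ppl_lev_t) simp
 moreover have "tot x = (%t. SUM m<n. lev m x t)" "tott x = (%t. SUM m<n. levt m x t)" by (intro ext tot_exit[OF n])+
 ultimately show ?case by simp
qed

lemma lev_zero_ends:
 assumes "c <= a" "a + l <= d" shows "lev n c t = 0" "lev n d t = 0" using assms by (auto intro!: lev_outside not_root)

lemma bp_lev: assumes "c <= a" "a + l <= d" shows "bp c d (%x. lev n x t) (%x. levx n x t)"
 using lev_zero_ends[OF assms] assms l by (intro bp_ppl ppl_lev_x) auto

lemma set_integral_le_indicator:
 fixes f :: "real => real"
 assumes f: "sint {c..d} f" and U: "U : sets borel" "emeasure lborel U <= ennreal m" "0 <= m" "0 <= B" and le: "!!x. abs (f x) <= B * indicator U x"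
 shows "(LBINT x:{c..d}. abs (f x)) <= B * m"
proof -
 have fin: "emeasure lborel U < \<infinity>" using U(2) by (rule le_less_trans) simp
 have "(LBINT x:{c..d}. abs (f x)) <= (LINT x|lborel. B * indicator U x)" unfolding lint_def
 proof (rule integral_mono)
  show "integrable lborel (%x. indicator {c..d} x *\<^sub>R (abs (f x)))" using set_integrable_abs[OF f] unfolding set_integrable_def .
  show "integrable lborel (%x. B * indicator U x)" using fin U(1) by (intro integrable_mult_right integrable_real_indicator) auto
  fix x show "indicator {c..d} x *\<^sub>R (abs (f x)) <= B * indicator U x" using le[of x] U(4) by (cases "x : {c..d}"; cases "x : U") auto
 qed
 also have "... = B * measure lborel U" using U(1) by simp
 also have "... <= B * m" using U fin by (intro mult_left_mono) (auto simp: measure_def intro: enn2real_leI)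
 finally show ?thesis .
qed

lemma lev_integral_bounds:
 assumes "c <= a" "a + l <= d" shows "(LBINT x:{c..d}. abs (lev n x t)) <= 3 * l^2 * (1 / 2) ^ n"
  and "(LBINT x:{c..d}. abs (levx n x t)) <= 3 * K * l * (1 / 2) ^ n"
proof -
 have i: "indicator {x. ai n x (et t)} x = (if ai n x (et t) then 1 else (0::real))" for x by simp
 have "(LBINT x:{c..d}. abs (lev n x t)) <= (l * (1 / 2) ^ n) * (3 * (l * th ^ n))" using lev_bound[of n _ t] lev_not_ai(1)[of n _ t] l th
  by (intro set_integral_le_indicator[OF bpD(1)[OF bp_lev[OF assms]] ai_sets[of n "et t"] ai_measure[of n "et t"]]) (auto simp: i)
 also have "... <= (l * (1 / 2) ^ n) * (3 * (l * 1))" using l th by (intro mult_left_mono) (auto intro: power_le_one)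
 finally show "(LBINT x:{c..d}. abs (lev n x t)) <= 3 * l^2 * (1 / 2) ^ n" by (simp add: power2_eq_square mult_ac)
 \<comment> \<open>The slopes grow like \<open>al ^ n\<close>, but live on a set of measure of order
   \<open>th ^ n\<close>, and \<open>al * th = 1 / 2\<close> leaves a geometric decay.\<close>
 have "(LBINT x:{c..d}. abs (levx n x t)) <= (K * al ^ n) * (3 * (l * th ^ n))" using levx_bound[of n _ t] lev_not_ai(2)[of n _ t] l th K_nonneg al(1)
  by (intro set_integral_le_indicator[OF bpD(2)[OF bp_lev[OF assms]] ai_sets[of n "et t"] ai_measure[of n "et t"]]) (auto simp: i)
 also have "... = 3 * K * l * (al * th) ^ n" by (simp add: power_mult_distrib mult_ac)
 finally show "(LBINT x:{c..d}. abs (levx n x t)) <= 3 * K * l * (1 / 2) ^ n" unfolding al(2) .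
qed

lemma summable_lev:
 assumes "c <= a" "a + l <= d" shows "summable (%n. LBINT x:{c..d}. abs (lev n x t))" "summable (%n. LBINT x:{c..d}. abs (levx n x t))"
proof -
 have nn: "0 <= (LBINT x:{c..d}. abs (f x))" for f :: "real => real" by (simp add: lint_def)
 have "summable (%n. B * (1 / 2) ^ n :: real)" for B by (intro summable_mult summable_geometric) simp
 note g = this
 show "summable (%n. LBINT x:{c..d}. abs (lev n x t))"
  by (rule summable_comparison_test'[OF g[of "3 * l^2"], of 0]) (simp only: real_norm_def abs_of_nonneg[OF nn] lev_integral_bounds(1)[OF assms])
 show "summable (%n. LBINT x:{c..d}. abs (levx n x t))"
  by (rule summable_comparison_test'[OF g[of "3 * K * l"], of 0]) (simp only: real_norm_def abs_of_nonneg[OF nn] lev_integral_bounds(2)[OF assms])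
qed

lemma AE_lev_finite: "AE x in lborel. x : A --> (EX n. \<forall>N\<ge>n. lev N x t = 0 & levx N x t = 0)" using AE_exit
proof eventually_elim
 case (elim x)
 then obtain n where "~ isin (wd x n) x" by blast
 hence "~ isin (wd x m) x" if "m >= n" for m using that inside_wd_mono by blast
 thus ?case using lev_outside by blast
qed

lemma bp_tot:
 assumes "c <= a" "a + l <= d" shows "bp c d (%x. tot x t) (%x. totx x t)" unfolding tot_def totx_def
 by (intro bp_suminf bp_lev AE_lev_finite summable_lev assms)

lemma tot_bound: "abs (tot x t) <= 2 * l"
proof -
 have s: "summable (%n. l * (1 / 2) ^ n)" by (intro summable_mult summable_geometric) simp
 have "norm (\<Sum>n. lev n x t) <= (\<Sum>n. l * (1 / 2) ^ n)" using lev_bound by (intro norm_suminf_le s) simp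
 also have "... = l * (1 / (1 - 1 / 2))" by (subst suminf_mult) (auto simp: suminf_geometric)
 finally show ?thesis by (simp add: tot_def)
qed

lemma geometric_le: fixes x :: real assumes "1 < x" shows "(SUM m<n. x ^ m) <= x ^ n / (x - 1)" using assms by (simp add: geometric_sum divide_right_mono)

lemma totx_bound: assumes "~ ai (Suc M) x (et t)" shows "abs (totx x t) <= K * (al / (al - 1)) * al ^ M"
proof -
 have "abs (totx x t) <= (SUM m<Suc M. K * al ^ m)" unfolding tot_not_ai(1)[OF assms] by (rule order_trans[OF sum_abs]) (intro sum_mono levx_bound)
 also have "... = K * (SUM m<Suc M. al ^ m)" by (rule sum_distrib_left[symmetric])
 also have "... <= K * (al ^ Suc M / (al - 1))" by (intro mult_left_mono geometric_le al K_nonneg)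
 finally show ?thesis by (simp add: mult_ac)
qed

lemma tott_bound: assumes "~ ai (Suc M) x (et t)" shows "abs (tott x t) <= 2 * l * abs (e t) * 2 ^ M"
proof -
 have "abs (tott x t) <= (SUM m<Suc M. (l * abs (e t)) * 2 ^ m)" unfolding tot_not_ai(2)[OF assms] by (rule order_trans[OF sum_abs]) (intro sum_mono levt_bound)
 also have "... = (l * abs (e t)) * (SUM m<Suc M. 2 ^ m)" by (rule sum_distrib_left[symmetric])
 also have "... <= (l * abs (e t)) * (2 ^ Suc M / (2 - 1))" using l by (intro mult_left_mono geometric_le) auto
 finally show ?thesis by (simp add: mult_ac)
qed

end

section \<open>The potentials of one loop\<close>

sublocale loop \<subseteq> Yv: level th a l R et e Psi Psi' rho rho' "1 + 1 / th"
proof unfold_locales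
 show "!!xi. xi ~: brk ==> lin_at Psi Psi' xi" by (rule lin_at_Psi)
qed (rule ppl_Psi Psi_01 Psi'_bound ppl_rho rho_nonneg rho_le_1 rho'_bound rho_not_alive; assumption?)+

sublocale loop \<subseteq> Qv: level th a l R et e psi psi' del del' "1 / gp"
proof unfold_locales
 show "!!xi. xi ~: brk ==> lin_at psi psi' xi" by (rule lin_at_psi)
 show "del w s <= 1" for w s using del_le[of w s] by linarith
 show "!!w s. ~ alive w s ==> del w s = 0" "!!w s. ~ alive w s ==> del' w s = 0" using del_not_actv actv_imp_alive by blast+
qed (rule ppl_psi psi_01 psi'_bound ppl_del del_nonneg del'_bound; assumption?)+

context loop
begin

text \<open>Two overlapping trapezoids. \<open>baseY\<close> rises on the root cell, where
  \<open>PhB\<close> is constant, and descends only after \<open>PhB\<close> has returned to zero;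
  so both potentials have compact support, and outside the root the slope of \<open>baseY\<close>
  never meets the base part of \<open>Q\<close>.\<close>

definition "baseY x = l * (ramp ((x - a) / l) - ramp ((x - (a + 2 * l)) / l))"
definition "baseY' x = l * (ramp' ((x - a) / l) / l - ramp' ((x - (a + 2 * l)) / l) / l)"
definition "PhB x = R * (ramp ((x - (a - l)) / l) - ramp ((x - (a + l)) / l))"
definition "PhB' x = R * (ramp' ((x - (a - l)) / l) / l - ramp' ((x - (a + l)) / l) / l)"

definition "Y x t = baseY x + Yv.tot x t"
definition "Yx x t = baseY' x + Yv.totx x t"
definition "Yt x t = Yv.tott x t"
definition "Q x t = l * tile et PhB x t + Qv.tot x t"
definition "Qx x t = l * tile_x et PhB PhB' x t + Qv.totx x t"
definition "Qt x t = l * tile_t et e PhB x t + Qv.tott x t"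

lemma ppl_baseY: "ppl baseY baseY'" unfolding baseY_def[abs_def] baseY'_def[abs_def] by (intro ppl_cmult ppl_diff ppl_ramp_affine)

lemma ppl_PhB: "ppl PhB PhB'" unfolding PhB_def[abs_def] PhB'_def[abs_def] by (intro ppl_cmult ppl_diff ppl_ramp_affine)

lemma YQ_measurable:
 "bmeas2 Y"
 "bmeas2 Yx"
 "bmeas2 Yt"
 "bmeas2 Q"
 "bmeas2 Qx"
 "bmeas2 Qt"
proof -
 have [measurable]: "baseY : bmeas" "baseY' : bmeas"
  "PhB : bmeas" "PhB' : bmeas" "et : bmeas" "e : bmeas" using pplD(2,4)[OF ppl_baseY] pplD(2,4)[OF ppl_PhB] pplD(2,4)[OF et] by (auto intro: meas_cont)
 note [measurable] = Yv.tot_measurable Qv.tot_measurable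
 show "bmeas2 Y"
  "bmeas2 Yx"
  "bmeas2 Yt"
  "bmeas2 Q"
  "bmeas2 Qx"
  "bmeas2 Qt" unfolding Y_def Yx_def Yt_def Q_def Qx_def Qt_def tile_def tile_x_def tile_t_def by measurable
qed

lemma base_ends: "x <= a - l ==> baseY x = 0 & PhB x = 0 & baseY' x = 0 & PhB' x = 0"
 "a + 3 * l <= x ==> baseY x = 0 & PhB x = 0 & baseY' x = 0 & PhB' x = 0"
 using l by (simp_all add: baseY_def baseY'_def PhB_def PhB'_def ramp'_def divide_simps)

lemma YQ_outside:
 assumes "~ (a - l < x & x < a + 3 * l)" shows "Y x t = 0" "Yx x t = 0" "Yt x t = 0" "Q x t = 0" "Qx x t = 0" "Qt x t = 0"
proof -
 have "~ isin (wd x 0) x" using assms l by (intro not_root) auto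
 note z = Yv.tot_exit[OF this] Qv.tot_exit[OF this]
 have b: "baseY x = 0 & PhB x = 0 & baseY' x = 0 & PhB' x = 0" using assms base_ends by fastforce
 thus "Y x t = 0" "Yx x t = 0" "Yt x t = 0" "Q x t = 0" "Qx x t = 0" "Qt x t = 0"
  using et_bounds(1)[of t] by (simp_all add: Y_def Yx_def Yt_def Q_def Qx_def Qt_def z tile_def tile_x_def tile_t_def)
qed

lemma bp_YQ:
 assumes "c <= a - l" "a + 3 * l <= d" shows "bp c d (%x. Y x t) (%x. Yx x t)" "bp c d (%x. Q x t) (%x. Qx x t)"
proof -
 have cd: "c <= a" "a + l <= d" "c <= d" using assms l by auto
 have b: "baseY c = 0" "baseY d = 0" "PhB c = 0" "PhB d = 0" using base_ends assms by auto
 show "bp c d (%x. Y x t) (%x. Yx x t)" unfolding Y_def Yx_def by (intro bp_add bp_ppl ppl_baseY Yv.bp_tot b cd)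
 show "bp c d (%x. Q x t) (%x. Qx x t)" unfolding Q_def Qx_def
 proof (rule bp_add[OF bp_ppl Qv.bp_tot[OF cd(1,2)]])
  show "ppl (%x. l * tile et PhB x t) (%x. l * tile_x et PhB PhB' x t)" by (intro ppl_cmult ppl_tile_x ppl_PhB)
 qed (use b cd et_bounds(1)[of t] in \<open>simp_all add: tile_def\<close>)
qed

lemma ppl_YQ_t: "AE x in lborel. ppl (Y x) (Yt x) & ppl (Q x) (Qt x)" using Yv.ppl_tot_t Qv.ppl_tot_t
proof eventually_elim
 case (elim x)
 have "ppl (%t. baseY x + Yv.tot x t) (%t. 0 + Yv.tott x t)" by (intro ppl_add ppl_const elim)
 moreover have "ppl (%t. l * tile et PhB x t + Qv.tot x t) (%t. l * tile_t et e PhB x t + Qv.tott x t)"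
  by (intro ppl_add ppl_cmult ppl_tile_t et et_bounds elim)
 ultimately show ?case by (simp add: Y_def[abs_def] Yt_def[abs_def] Q_def[abs_def] Qt_def[abs_def])
qed

lemma YQ_loc_const:
 "AE z in lborel. loc_const (%z. (Yx (fst z) (snd z), Yt (fst z) (snd z), Qx (fst z) (snd z), Qt (fst z) (snd z))) z"
 using Yv.tot_loc_const Qv.tot_loc_const tile_loc_const[OF ppl_PhB et et_bounds(1)]
  AE_lborel_fst[OF pplD(3)[OF ppl_baseY]]
proof eventually_elim
 case (elim z)
 have "\<forall>\<^sub>F y in nhds (fst z). baseY' y = baseY' (fst z)" using elim(4) unfolding lin_at_def by eventually_elim simp
 hence b: "loc_const (%z. baseY' (fst z)) z" unfolding loc_const_def by (rule eventually_nhds_fst)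
 have 1: "loc_const (%z. (Yx (fst z) (snd z), Yt (fst z) (snd z))) z"
  using loc_const_compose2[OF b elim(1), of "%b y. (b + fst y, snd y)"] by (simp add: Yx_def Yt_def)
 have 2: "loc_const (%z. (Qx (fst z) (snd z), Qt (fst z) (snd z))) z"
  using loc_const_compose2[OF elim(3,2), of "%b y. (l * fst b + fst y, l * snd b + snd y)"] by (simp add: Qx_def Qt_def)
 show ?case using loc_const_compose2[OF 1 2, of "%u v. (fst u, snd u, fst v, snd v)"] by simp
qed

definition "KB = 1 + R + (1 + 1 / th + 1 / gp) * (al / (al - 1))"

lemma ramp'_diff_bound: "abs (l * (ramp' u / l - ramp' v / l)) <= 1" using l by (simp add: ramp'_def)

lemma YQ_bounds:
 assumes "~ ai (Suc M) x (et t)" shows "abs (Yx x t) <= KB * al ^ M" "abs (Qx x t) <= KB * al ^ M"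
  "abs (Yt x t) <= 3 * l * abs (e t) * 2 ^ M" "abs (Qt x t) <= 3 * l * abs (e t) * 2 ^ M"
proof -
 define G where "G = al / (al - 1)"
 have G: "0 <= G" using al(1) by (simp add: G_def)
 have a1: "1 <= al ^ M" using al(1) by (simp add: one_le_power)
 have p: "0 <= 1 / th" "0 <= 1 / gp" using th gp by auto
 have KB: "KB = 1 + R + (1 + 1 / th) * G + 1 / gp * G" unfolding KB_def G_def[symmetric] by (simp add: algebra_simps)
 have y: "abs (Yv.totx x t) <= (1 + 1 / th) * G * al ^ M" "abs (Qv.totx x t) <= 1 / gp * G * al ^ M"
  using Yv.totx_bound[OF assms] Qv.totx_bound[OF assms] by (simp_all add: G_def)
 have nn: "0 <= R * al ^ M" "0 <= (1 + 1 / th) * G * al ^ M" "0 <= 1 / gp * G * al ^ M" using G p R a1 by (auto intro!: mult_nonneg_nonneg)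
 have KBM: "KB * al ^ M = al ^ M + R * al ^ M + (1 + 1 / th) * G * al ^ M + 1 / gp * G * al ^ M" unfolding KB by (simp only: distrib_right mult_1_left)
 have "abs (baseY' x) <= 1" unfolding baseY'_def by (rule ramp'_diff_bound)
 thus "abs (Yx x t) <= KB * al ^ M" unfolding Yx_def KBM using y nn a1 by linarith
 have "abs (l * PhB' x) <= R"
 proof -
  have "l * PhB' x = R * (l * (ramp' ((x - (a - l)) / l) / l - ramp' ((x - (a + l)) / l) / l))" by (simp add: PhB'_def)
  hence "abs (l * PhB' x) = R * abs (l * (ramp' ((x - (a - l)) / l) / l - ramp' ((x - (a + l)) / l) / l))" by (simp only: abs_mult[of R] abs_of_pos[OF R])
  also have "... <= R * 1" using R by (intro mult_left_mono ramp'_diff_bound) simp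
  finally show ?thesis by simp
 qed
 hence "abs (l * tile_x et PhB PhB' x t) <= R" using R by (simp add: tile_x_def)
 moreover have "R <= R * al ^ M" using R a1 by simp
 ultimately show "abs (Qx x t) <= KB * al ^ M" unfolding Qx_def KBM using y nn a1 by linarith
 have le: "0 <= l * abs (e t)" using l by simp
 hence le2: "l * abs (e t) <= l * abs (e t) * 2 ^ M" using mult_left_mono[of 1 "2 ^ M" "l * abs (e t)"] by simp
 show "abs (Yt x t) <= 3 * l * abs (e t) * 2 ^ M" using Yv.tott_bound[OF assms] le le2 unfolding Yt_def by linarith
 have "abs (l * tile_t et e PhB x t) <= l * abs (e t)" using l by (simp add: tile_t_def abs_mult abs_sgn_eq)
 thus "abs (Qt x t) <= 3 * l * abs (e t) * 2 ^ M" using Qv.tott_bound[OF assms] le2 unfolding Qt_def by linarith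
qed

lemma YQ_abs_bound: "abs (Y x t) <= 3 * l" "abs (Q x t) <= (R + 2) * l"
proof -
 have "abs (ramp u - ramp v) <= 1" for u v using ramp_bounds[of u] ramp_bounds[of v] by linarith
 hence "abs (baseY x) <= l" using l mult_left_mono[of _ 1 l] by (simp add: baseY_def abs_mult)
 thus "abs (Y x t) <= 3 * l" using Yv.tot_bound[of x t] unfolding Y_def by linarith
 have "abs (tile et PhB x t) <= R" using et_bounds[of t] by (auto simp: tile_def)
 hence "abs (l * tile et PhB x t) <= l * R" using l by (simp add: abs_mult)
 thus "abs (Q x t) <= (R + 2) * l" using Qv.tot_bound[of x t] unfolding Q_def by (simp add: algebra_simps)
qed

end

section \<open>Orthogonality of the two fields of one loop\<close>

context loop
begin

lemma root_values:
 assumes "isin (wd x 0) x" shows "baseY' x = 1" "PhB x = R" "PhB' x = 0"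
proof -
 have x: "a < x" "x < a + l" using assms isin_root by auto
 have 1: "0 < (x - a) / l" "(x - a) / l < 1" "(x - (a + 2 * l)) / l <= 0" "1 <= (x - (a - l)) / l" "(x - (a + l)) / l <= 0"
  using x l by (simp_all add: divide_simps)
 thus "baseY' x = 1" "PhB x = R" "PhB' x = 0" using l by (simp_all add: baseY'_def PhB_def PhB'_def ramp'_def)
qed

lemma exit_chain:
 assumes "isin (wd x 0) x" "~ isin (wd x m) x"
 obtains n where "!!i. i <= n ==> isin (wd x i) x" "~ isin (wd x (Suc n)) x"
proof -
 define k where "k = (LEAST m. ~ isin (wd x m) x)"
 have k: "~ isin (wd x k) x" unfolding k_def by (rule LeastI[of _ m]) (rule assms(2))
 have "k ~= 0" using k assms(1) by metis
 then obtain n where n: "k = Suc n" using not0_implies_Suc by blast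
 have "isin (wd x i) x" if "i <= n" for i using not_less_Least[of i "%m. ~ isin (wd x m) x"] that n unfolding k_def by auto
 thus thesis using k n that by blast
qed

lemma digit_inside:
 assumes "isin (wd x (Suc i)) x" shows "Psi' (cw (wd x i) x) = al - 1" "psi' (cw (wd x i) x) = 0"
  "psi (cw (wd x i) x) = (if hd (wd x (Suc i)) then - 1 / 4 else 1 / 4)" using assms Psi'_inside psi_inside unfolding wd.simps inside_Cons al_def by auto

lemma digit_gap:
 assumes "~ isin (wd x (Suc i)) x" shows "Psi' (cw (wd x i) x) = - 1"
proof -
 let ?xi = "cw (wd x i) x"
 have "child (1 / 2 <= ?xi) ?xi : {0, 1}" using assms unfolding wd.simps not_isin cw_Cons .
 thus ?thesis using child_wrong[of ?xi] by (intro Psi'_gap) (cases "1 / 2 <= ?xi"; auto)+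
qed

lemma actv_wd_mono: "actv (wd x n) s ==> m <= n ==> actv (wd x m) s" by (induction n) (auto simp: le_Suc_eq actv_Cons)

lemma levx_actv:
 assumes "isin (wd x i) x" "actv (wd x i) (et t)" shows "Yv.levx i x t = al ^ i * Psi' (cw (wd x i) x)" "Yv.levt i x t = 0"
proof -
 have P: "abs (Psi (cw (wd x i) x)) < 1" using cw_bounds by (rule Psi_bound)
 have "Yv.Tx (wd x i) x t = Psi' (cw (wd x i) x) * (1 / (l * th ^ i))"
  using P rho_actv(1)[OF assms(2)] cw'_inside[OF assms(1)] by (simp add: Yv.Tx_def tile_x_def)
 hence "Yv.levx i x t = ((1 / 2) ^ i / th ^ i) * Psi' (cw (wd x i) x)" using l unfolding Yv.lev_eq by (simp add: field_simps)
 thus "Yv.levx i x t = al ^ i * Psi' (cw (wd x i) x)" unfolding al(3) .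
 show "Yv.levt i x t = 0" unfolding Yv.lev_eq using P rho_actv(1)[OF assms(2)] by (simp add: Yv.Tt_def tile_t_def)
qed

text \<open>An enclosing active level \<open>i\<close> contributes \<open>al ^ i * (al - 1)\<close>,
  and these terms telescope onto the unit slope of the base.\<close>

lemma sum_levx_actv:
 assumes "isin (wd x n) x" "actv (wd x n) (et t)" shows "baseY' x + (SUM i<n. Yv.levx i x t) = al ^ n"
proof -
 have "Yv.levx i x t = al ^ Suc i - al ^ i" if "i < n" for i
 proof -
  have "isin (wd x i) x" "isin (wd x (Suc i)) x" "actv (wd x i) (et t)"
   using that inside_wd_mono[OF assms(1)] actv_wd_mono[OF assms(2)] by (simp_all del: wd.simps)
  thus ?thesis by (simp add: levx_actv digit_inside algebra_simps del: wd.simps)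
 qed
 hence "(SUM i<n. Yv.levx i x t) = (SUM i<n. al ^ Suc i - al ^ i)" by simp
 also have "... = al ^ n - 1" using sum_lessThan_telescope[of "%i. al ^ i" n] by simp
 finally show ?thesis using root_values(1)[OF inside_wd_mono[OF assms(1)]] by simp
qed

lemma countable_grid: "countable {s. EX m. 4 ^ m * s : (\<int>::real set)}"
proof -
 have "{s. EX m. 4 ^ m * s : (\<int>::real set)} \<subseteq> (\<Union>m. (%k. k / 4 ^ m) ` \<int>)"
 proof
  fix s :: real assume "s : {s. EX m. 4 ^ m * s : (\<int>::real set)}"
  then obtain m where "4 ^ m * s : (\<int>::real set)" by blast
  thus "s : (\<Union>m. (%k. k / 4 ^ m) ` \<int>)" by (intro UN_I[of m] image_eqI[of _ _ "4 ^ m * s"]) auto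
 qed
 thus ?thesis by (rule countable_subset) (intro countable_UN countable_image countable_Ints countableI_type)
qed

text \<open>Where \<open>Yx\<close> can be nonzero the clock increments of all enclosing active cells cancel.\<close>

lemma sum_levt_Q:
 assumes n: "!!i. i <= n ==> isin (wd x i) x" and grid: "!!m. 4 ^ m * et t ~: \<int>"
 shows "l * e t + (SUM i<n. Qv.levt i x t) = (if actv (wd x n) (et t) then l * e t * 2 ^ n else 0)"
proof -
 have "l * e t + (SUM i<m. Qv.levt i x t) = (if actv (wd x m) (et t) then l * e t * 2 ^ m else 0)" if "m <= n" for m using that
 proof (induction m)
  case (Suc m)
  \<comment> \<open>The stroke of level \<open>m\<close> has speed \<open>l * e t * 2 ^ m\<close>,
    upwards on the active subcell and downwards on the other: the sum accumulated so far is either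
    doubled or annihilated.\<close>
  have lt: "Qv.levt m x t = (if actv (wd x m) (et t) then if actv (wd x (Suc m)) (et t) then l * e t * 2 ^ m else - (l * e t * 2 ^ m) else 0)"
  proof (cases "actv (wd x m) (et t)")
   case True
   have i: "isin (wd x (Suc m)) x" using n Suc.prems by (simp del: wd.simps)
   have d: "del (wd x m) (et t) < 1 / 4" by (rule del_actv(2)[OF True grid])
   have A: "actv (wd x (Suc m)) (et t) \<longleftrightarrow> hd (wd x (Suc m)) = odd \<lfloor>4 ^ Suc m * et t\<rfloor>"
    using True by (simp add: actv_Cons del: power_Suc)
   have d': "del' (wd x m) (et t) = (if odd \<lfloor>4 ^ Suc m * et t\<rfloor> then - (4 ^ m) else 4 ^ m)" using del_actv(1)[OF True] by (simp del: power_Suc)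
   have "Qv.Tt (wd x m) x t = (if hd (wd x (Suc m)) then - 1 else 1) * (del' (wd x m) (et t) * e t)"
    using d unfolding Qv.Tt_def tile_t_def digit_inside(3)[OF i] by (simp add: sgn_if del: wd.simps)
   also have "... = (if actv (wd x (Suc m)) (et t) then 4 ^ m * e t else - (4 ^ m * e t))" unfolding A d' by auto
   finally have T: "Qv.Tt (wd x m) x t = (if actv (wd x (Suc m)) (et t) then 4 ^ m * e t else - (4 ^ m * e t))" .
   have "(1 / 2) ^ m * 4 ^ m = (2::real) ^ m" by (subst power_mult_distrib[symmetric]) simp
   hence "l * (1 / 2) ^ m * (4 ^ m * e t) = l * e t * 2 ^ m" by (simp add: mult_ac)
   thus ?thesis unfolding Qv.lev_eq T using True by (simp del: wd.simps)
  next
   case False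
   thus ?thesis unfolding Qv.lev_eq using del_not_actv[OF False] by (simp add: Qv.Tt_def tile_t_def)
  qed
  have "actv (wd x (Suc m)) (et t) ==> actv (wd x m) (et t)" by (erule actv_wd_mono) simp
  thus ?case using Suc lt by (auto simp: algebra_simps simp del: wd.simps)
 qed simp
 thus ?thesis by simp
qed

text \<open>Let \<open>n\<close> be the last level whose cell contains \<open>x\<close>. If that
  cell is active, then \<open>x\<close> lies in one of its gaps: all enclosing levels of
  \<open>Y\<close> stand at full height, so \<open>Yt = 0\<close>, and the slope
  \<open>al ^ n\<close> is cancelled there, so \<open>Yx = 0\<close>. If it is inactive, active
  ancestors of \<open>Q\<close> are flat on their subcells, so \<open>Qx = 0\<close>, and the clock
  increments cancel, so \<open>Qt = 0\<close>.\<close>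

lemma det_zero: "AE z in lborel. Qx (fst z) (snd z) * Yt (fst z) (snd z) = Yx (fst z) (snd z) * Qt (fst z) (snd z)"
proof -
 \<comment> \<open>A moving clock meets the base-4 grid only on a null set of times; while it stands
   still all rates of \<open>Q\<close> are zero.\<close>
 have "AE t in lborel. lin_at et e t --> e t ~= 0 --> et t ~: {s. EX m. 4 ^ m * s : \<int>}" by (rule AE_lin_at_nonzero_slope[OF countable_grid])
 with pplD(3)[OF et] have "AE t in lborel. e t = 0 | (ALL m. 4 ^ m * et t ~: \<int>)" by eventually_elim blast
 from AE_lborel_snd[OF this] AE_lborel_fst[OF AE_exit] show ?thesis
 proof eventually_elim
  case (elim z)
  obtain x t where z: "z = (x, t)" by (cases z)
  have "Qx x t * Yt x t = Yx x t * Qt x t"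
  proof (cases "isin (wd x 0) x")
   case False
   note ex = Yv.tot_exit[OF False] Qv.tot_exit[OF False]
   have x: "x <= a | a + l <= x" using False unfolding isin_root by linarith
   have "baseY' x * tile_t et e PhB x t = 0"
   proof (cases "a + 2 * l < x")
    case True
    hence "PhB x = 0" using l by (simp add: PhB_def divide_simps)
    thus ?thesis using et_bounds(1)[of t] by (simp add: tile_t_def)
   next
    case False
    hence "(x - (a + 2 * l)) / l <= 0" "(x - a) / l <= 0 | 1 <= (x - a) / l" using x l by (auto simp: divide_simps)
    thus ?thesis by (auto simp: baseY'_def ramp'_def)
   qed
   thus ?thesis by (auto simp: Yt_def Yx_def Qt_def ex)
  next
   case True
   from elim(2) z obtain m where "~ isin (wd x m) x" by auto
   from exit_chain[OF True this] obtain n where n: "!!i. i <= n ==> isin (wd x i) x" "~ isin (wd x (Suc n)) x" by metis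
   note ex = Yv.tot_exit[OF n(2)] Qv.tot_exit[OF n(2)]
   show ?thesis
   proof (cases "actv (wd x n) (et t)")
    case A: True
    have "Yv.levt i x t = 0" if "i <= n" for i using that n(1) actv_wd_mono[OF A] by (intro levx_actv(2)) auto
    hence "Yt x t = 0" unfolding Yt_def ex by (intro sum.neutral) auto
    moreover have "Yx x t = 0" using sum_levx_actv[OF n(1)[OF order_refl] A] levx_actv(1)[OF n(1)[OF order_refl] A] digit_gap[OF n(2)] by (simp add: Yx_def ex)
    ultimately show ?thesis by simp
   next
    case A: False
    have "Qv.levx i x t = 0" if "i <= n" for i
    proof (cases "actv (wd x i) (et t)")
     case True
     with A that have "Suc i <= n" by (metis le_antisym not_less_eq_eq)
     hence "psi' (cw (wd x i) x) = 0" using n(1) by (intro digit_inside(2)) (simp del: wd.simps)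
     thus ?thesis unfolding Qv.lev_eq by (simp add: Qv.Tx_def tile_x_def)
    next
     case False
     thus ?thesis unfolding Qv.lev_eq using del_not_actv(1)[OF False] by (simp add: Qv.Tx_def tile_x_def)
    qed
    hence "Qv.totx x t = 0" unfolding ex by (intro sum.neutral) auto
    hence "Qx x t = 0" using root_values(3)[OF True] by (simp add: Qx_def tile_x_def)
    moreover have "Qt x t = 0"
    proof (cases "e t = 0")
     case True
     have "Qv.levt i x t = 0" for i unfolding Qv.lev_eq by (simp add: Qv.Tt_def tile_t_def True)
     thus ?thesis unfolding Qt_def ex by (simp add: tile_t_def True)
    next
     case False
     hence grid: "!!m. 4 ^ m * et t ~: \<int>" using elim(1) z by auto
     have "tile_t et e PhB x t = e t" using R et_bounds(2)[of t] unfolding tile_t_def root_values(2)[OF True] by simp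
     moreover have "Qv.levt n x t = 0" unfolding Qv.lev_eq using del_not_actv[OF A] by (simp add: Qv.Tt_def tile_t_def)
     ultimately show ?thesis using sum_levt_Q[OF n(1) grid, of n] A unfolding Qt_def ex by simp
    qed
    ultimately show ?thesis by simp
   qed
  qed
  thus ?case by (simp add: z)
 qed
qed

section \<open>Helicity integral of one loop\<close>

lemma wd_drop: "j <= m ==> wd x j = drop (m - j) (wd x m)"
proof (induction m)
 case (Suc m)
 thus ?case by (cases "j = Suc m") (simp_all add: Suc_diff_le)
qed simp

lemma integral_Tx_zero:
 assumes "c <= a" "a + l <= d" shows "sint {c..d} (%x. Yv.Tx w x t)" "(LBINT x:{c..d}. Yv.Tx w x t) = 0"
proof -
 have "~ isin w c" "~ isin w d" using inside_wd[of w] not_root[of _ "length w"] assms by (metis not_le)+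
 hence "Yv.T w c t = 0" "Yv.T w d t = 0" using Yv.T_outside by blast+
 moreover have "ppl (%x. Yv.T w x t) (%x. Yv.Tx w x t)" unfolding Yv.T_def Yv.Tx_def by (intro ppl_tile_x Yv.ppl_Phcw)
 ultimately have bp: "bp c d (%x. Yv.T w x t) (%x. Yv.Tx w x t)" using assms l by (intro bp_ppl) auto
 have "C1 (%_. 1) (%_. 0)" by (simp add: C1_def)
 from bpD(3)[OF bp this] bpD(2)[OF bp]
 show "sint {c..d} (%x. Yv.Tx w x t)" "(LBINT x:{c..d}. Yv.Tx w x t) = 0" by simp_all
qed

text \<open>A level of \<open>Q\<close> varies only in the gaps of its own cells, so it is constant
  on every deeper cell \<open>w'\<close>; the factor \<open>Tx w'\<close> hides all other
  points.\<close>

lemma Q_lev_const_on_cells: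
 assumes "n < length w'"
 obtains k where "!!x. Qv.lev n x t * Yv.Tx w' x t = k * Yv.Tx w' x t"
proof -
 let ?m = "length w'"
 let ?S = "del (drop (?m - n) w') (et t)"
 define k where "k = l * (1 / 2) ^ n * max (- ?S) (min ?S (if hd (drop (?m - Suc n) w') then - 1 / 4 else 1 / 4))"
 have "Qv.lev n x t * Yv.Tx w' x t = k * Yv.Tx w' x t" for x
 proof (cases "isin w' x")
  case True
  from inside_wd[OF True] have w: "w' = wd x ?m" .
  have i: "isin (wd x (Suc n)) x" using inside_wd_mono[of x ?m "Suc n"] True w assms by (metis Suc_leI)
  have "wd x n = drop (?m - n) w'" using wd_drop[of n ?m x] w assms by (metis less_imp_le)
  moreover have "wd x (Suc n) = drop (?m - Suc n) w'" using wd_drop[of "Suc n" ?m x] w assms by (metis Suc_leI)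
  ultimately have "Qv.lev n x t = k" unfolding Qv.lev_eq k_def Qv.T_def tile_def using digit_inside(3)[OF i] by presburger
  thus ?thesis by simp
 qed (use Yv.T_outside in simp)
 thus thesis using that by blast
qed

lemma set_integrable_mult_lev:
 assumes "sint {c..d} f" shows "sint {c..d} (%x. Qv.lev n x t * f x)"
 using set_integrable_mult_cont[OF assms pplD(4)[OF Qv.ppl_lev_x]] by (simp add: mult.commute)

lemma integral_Qlev_high:
 assumes "c <= a" "a + l <= d" "n < m" shows "sint {c..d} (%x. Qv.lev n x t * Yv.levx m x t)" "(LBINT x:{c..d}. Qv.lev n x t * Yv.levx m x t) = 0"
proof -
 show "sint {c..d} (%x. Qv.lev n x t * Yv.levx m x t)" by (intro set_integrable_mult_lev bpD(2)[OF Yv.bp_lev] assms)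
 have "EX k. ALL x. Qv.lev n x t * Yv.Tx w x t = k * Yv.Tx w x t" if "w : words m" for w
  using Q_lev_const_on_cells[of n w t] that assms(3) unfolding words_def by (metis (mono_tags) mem_Collect_eq)
 then obtain k where k: "!!w x. w : words m ==> Qv.lev n x t * Yv.Tx w x t = k w * Yv.Tx w x t" by metis
 have "Qv.lev n x t * Yv.levx m x t = (SUM w:words m. l * (1 / 2) ^ m * (k w * Yv.Tx w x t))" for x
  unfolding Yv.levx_def sum_distrib_left using k[of _ x] by (intro sum.cong refl) (metis mult.left_commute)
 hence "(LBINT x:{c..d}. Qv.lev n x t * Yv.levx m x t) = (LBINT x:{c..d}. (SUM w:words m. l * (1 / 2) ^ m * (k w * Yv.Tx w x t)))" by simp
 also have "... = (SUM w:words m. LBINT x:{c..d}. l * (1 / 2) ^ m * (k w * Yv.Tx w x t))"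
  using integral_Tx_zero(1)[OF assms(1,2)] unfolding lint_def scaleR_sum_right set_integrable_def
  by (intro bint_sum) (simp add: mult.left_commute[of "indicator _ _"])
 also have "... = 0" using integral_Tx_zero(2)[OF assms(1,2)] by (intro sum.neutral) simp
 finally show "(LBINT x:{c..d}. Qv.lev n x t * Yv.levx m x t) = 0" .
qed

text \<open>Up to level \<open>n\<close> the staircase has the same slope on both subcells of the
  active cell and slope zero in its gaps, while the level of \<open>Q\<close> takes opposite values
  on the two subcells. The product is a difference of two intervals of equal length, with integral
  zero.\<close>

lemma Q_lev_low:
 fixes n t
 defines "w == wordz n \<lfloor>4 ^ n * et t\<rfloor>" shows "Qv.lev n x t * (baseY' x + (SUM m<Suc n. Yv.levx m x t)) =
  l * (1 / 2) ^ n * del w (et t) * al ^ Suc n * (indicator (cell (False # w)) x - indicator (cell (True # w)) x)"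
proof (cases "isin w x")
 case False
 hence "~ isin (b # w) x" for b using inside_ConsD by blast
 moreover have "Qv.lev n x t = 0"
 proof (cases "wd x n = w")
  case True thus ?thesis using False Qv.lev_outside by blast
 next
  case nw: False
  hence "~ actv (wd x n) (et t)" unfolding actv_def w_def by simp
  thus ?thesis unfolding Qv.lev_eq using del_not_actv(1) by (simp add: Qv.T_def tile_def)
 qed
 ultimately show ?thesis by (simp add: mem_cell indicator_def)
next
 case True
 have w: "wd x n = w" using inside_wd[OF True] unfolding w_def by simp
 have i: "isin (wd x n) x" using True w by simp
 have A: "actv (wd x n) (et t)" unfolding w unfolding actv_def w_def by simp
 have "baseY' x + (SUM m<Suc n. Yv.levx m x t) = al ^ n * (1 + Psi' (cw (wd x n) x))"
  using sum_levx_actv[OF i A] levx_actv(1)[OF i A] by (simp add: algebra_simps)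
 note s = this
 have L: "Qv.lev n x t = l * (1 / 2) ^ n * max (- del w (et t)) (min (del w (et t)) (psi (cw (wd x n) x)))" unfolding Qv.lev_eq w Qv.T_def tile_def ..
 show ?thesis
 proof (cases "isin (wd x (Suc n)) x")
  case j: True
  obtain b where b: "wd x (Suc n) = b # w" using w by simp
  have "isin (b' # w) x \<longleftrightarrow> b' = b" for b' using inside_wd[of "b' # w" x] j b w by auto
  hence ind: "indicator (cell (b' # w)) x = (if b' = b then 1 else (0::real))" for b' by (simp add: mem_cell indicator_def)
  have "psi (cw (wd x n) x) = (if b then - 1 / 4 else 1 / 4)" using digit_inside(3)[OF j] unfolding b by simp
  hence "Qv.lev n x t = l * (1 / 2) ^ n * (if b then - del w (et t) else del w (et t))" unfolding L using del_le[of w "et t"] del_nonneg[of w "et t"] by simp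
  thus ?thesis unfolding s digit_inside(1)[OF j] ind by (cases b) (simp_all add: mult_ac)
 next
  case j: False
  have "~ isin (b # w) x" for b using inside_wd[of "b # w" x] j w by auto
  thus ?thesis unfolding s digit_gap[OF j] by (simp add: mem_cell indicator_def)
 qed
qed

lemma integral_cell:
 assumes "c <= a" "a + l <= d" shows "sint {c..d} (%x. indicator (cell w) x :: real)"
  "(LBINT x:{c..d}. indicator (cell w) x) = l * th ^ length w"
proof -
 have "cell w \<subseteq> {c..d}"
 proof
  fix x assume "x : cell w"
  hence "isin w x" by (simp add: mem_cell)
  hence "isin (wd x (length w)) x" using inside_wd by metis
  hence "a < x & x < a + l" using not_root by blast
  thus "x : {c..d}" using assms by auto
 qed
 hence eq: "indicator {c..d} x * indicator (cell w) x = (indicator (cell w) x :: real)" for x by (auto simp: indicator_def)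
 have "integrable lborel (indicator (cell w) :: real => real)" by (rule integrable_real_indicator) simp_all
 thus "sint {c..d} (%x. indicator (cell w) x :: real)" unfolding set_integrable_def real_scaleR_def eq .
 have "measure lborel (cell w) = l * th ^ length w" unfolding cell_def using lth[of "length w"] by simp
 thus "(LBINT x:{c..d}. indicator (cell w) x) = l * th ^ length w" unfolding lint_def by (simp add: eq)
qed

lemma integral_Qlev_Yx:
 assumes "c <= a - l" "a + 3 * l <= d" shows "sint {c..d} (%x. Qv.lev n x t * Yx x t)" "(LBINT x:{c..d}. Qv.lev n x t * Yx x t) = 0"
proof -
 have cd: "c <= a" "a + l <= d" using assms l by auto
 show i1: "sint {c..d} (%x. Qv.lev n x t * Yx x t)" by (intro set_integrable_mult_lev bpD(2)[OF bp_YQ(1)] assms)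
 define w where "w = wordz n \<lfloor>4 ^ n * et t\<rfloor>"
 define ka where "ka = l * (1 / 2) ^ n * del w (et t) * al ^ Suc n"
 let ?low = "%x. ka * (indicator (cell (False # w)) x - indicator (cell (True # w)) x)"
 let ?f = "%m x. Qv.lev n x t * Yv.levx (m + Suc n) x t"
 have low: "sint {c..d} ?low" "(LBINT x:{c..d}. ?low x) = 0"
 proof -
  have i: "sint {c..d} (%x. ka * indicator (cell v) x)" for v by (intro set_integrable_mult_right integral_cell(1) cd)
  from set_integral_diff[OF i[of "False # w"] i[of "True # w"]]
  show "sint {c..d} ?low" "(LBINT x:{c..d}. ?low x) = 0" using integral_cell(2)[OF cd] by (simp_all add: right_diff_distrib)
 qed
 have fi: "sint {c..d} (?f m)" "(LBINT x:{c..d}. ?f m x) = 0" for m using integral_Qlev_high[OF cd, of n "m + Suc n" t] by auto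
 have ff: "AE x in lborel. x : {c..d} --> (EX k. \<forall>m\<ge>k. ?f m x = 0)" using Yv.AE_lev_finite[of "{c..d}" t]
 proof eventually_elim
  case (elim x)
  show ?case
  proof
   assume "x : {c..d}"
   with elim obtain k where "\<forall>m\<ge>k. Yv.levx m x t = 0" by blast
   thus "EX k. \<forall>m\<ge>k. ?f m x = 0" by (intro exI[of _ k]) simp
  qed
 qed
 have fs: "summable (%m. LBINT x:{c..d}. abs (?f m x))"
 proof (rule summable_comparison_test'[where N = 0])
  show "summable (%m. (l * (1 / 2) ^ n) * (LBINT x:{c..d}. abs (Yv.levx (m + Suc n) x t)))"
   using Yv.summable_lev(2)[OF cd] by (intro summable_mult summable_ignore_initial_segment)
  fix m :: nat
  have "(LBINT x:{c..d}. abs (?f m x)) <= (LBINT x:{c..d}. (l * (1 / 2) ^ n) * abs (Yv.levx (m + Suc n) x t))"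
   by (intro set_integral_mono set_integrable_abs fi set_integrable_mult_right bpD(2)[OF Yv.bp_lev] cd)
    (simp add: abs_mult mult_right_mono Qv.lev_bound)
  thus "norm (LBINT x:{c..d}. abs (?f m x)) <= (l * (1 / 2) ^ n) * (LBINT x:{c..d}. abs (Yv.levx (m + Suc n) x t))" by (simp add: lint_def)
 qed
 note S = set_integral_suminf[OF fi(1) ff fs]
 have "(LBINT x:{c..d}. Qv.lev n x t * Yx x t) = (LBINT x:{c..d}. ?low x + (\<Sum>m. ?f m x))" unfolding lint_def
 proof (rule integral_cong_AE)
  show "(%x. indicator {c..d} x *\<^sub>R (Qv.lev n x t * Yx x t)) : borel_measurable lborel"
   using i1 unfolding set_integrable_def by (rule borel_measurable_integrable)
  show "(%x. indicator {c..d} x *\<^sub>R (?low x + (\<Sum>m. ?f m x))) : borel_measurable lborel"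
   using set_integral_add(1)[OF low(1) S(1)] unfolding set_integrable_def by (rule borel_measurable_integrable)
  show "AE x in lborel. indicator {c..d} x *\<^sub>R (Qv.lev n x t * Yx x t) = indicator {c..d} x *\<^sub>R (?low x + (\<Sum>m. ?f m x))" using AE_exit
  proof eventually_elim
   case (elim x)
   then obtain k where k: "~ isin (wd x k) x" by blast
   have out: "Yv.levx m x t = 0" if "k <= m" for m using that k inside_wd_mono by (intro Yv.lev_outside) blast
   hence sm: "summable (%m. Yv.levx m x t)" by (intro summable_finite[of "{..<k}"]) auto
   have "Yv.totx x t = (\<Sum>m. Yv.levx (m + Suc n) x t) + (SUM m<Suc n. Yv.levx m x t)" unfolding Yv.totx_def by (rule suminf_split_initial_segment[OF sm])
   hence "Qv.lev n x t * Yx x t = Qv.lev n x t * (baseY' x + (SUM m<Suc n. Yv.levx m x t)) + Qv.lev n x t * (\<Sum>m. Yv.levx (m + Suc n) x t)"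
    unfolding Yx_def by (simp only: distrib_left add_ac)
   also have "Qv.lev n x t * (\<Sum>m. Yv.levx (m + Suc n) x t) = (\<Sum>m. ?f m x)"
    by (rule suminf_mult[symmetric]) (use sm in \<open>rule summable_ignore_initial_segment\<close>)
   finally show ?case unfolding Q_lev_low w_def[symmetric] ka_def[symmetric] by simp
  qed
 qed
 also have "... = 0" using set_integral_add(2)[OF low(1) S(1)] low(2) S(2) fi(2) by simp
 finally show "(LBINT x:{c..d}. Qv.lev n x t * Yx x t) = 0" .
qed

text \<open>Every oscillating level of \<open>Q\<close> integrates to zero against
  \<open>Yx\<close>: the levels of \<open>Y\<close> above it by oscillation, those up to it by
  antisymmetry. What remains is the base value \<open>l * et t\<close> times the rise
  \<open>l\<close> of \<open>Y\<close> across the root cell.\<close>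

lemma integral_Q_Yx:
 assumes "c <= a - l" "a + 3 * l <= d" shows "sint {c..d} (%x. Q x t * Yx x t)" "(LBINT x:{c..d}. Q x t * Yx x t) = l^2 * et t"
proof -
 have cd: "c <= a" "a + l <= d" using assms l by auto
 have iY: "sint {c..d} (%x. Yx x t)" by (intro bpD(2)[OF bp_YQ(1)] assms)
 have base: "l * tile et PhB x t * Yx x t = l * et t * indicator (cell []) x + l * et t * Yv.totx x t" for x
 proof (cases "isin [] x")
  case True
  hence "isin (wd x 0) x" by simp
  note r = root_values[OF this]
  have "tile et PhB x t = et t" using et_bounds[of t] unfolding tile_def r by simp
  thus ?thesis unfolding Yx_def r using True by (simp add: mem_cell indicator_def algebra_simps)
 next
  case False
  hence F: "~ isin (wd x 0) x" by simp
  have x: "x <= a | a + l <= x" using F unfolding isin_root by linarith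
  have "baseY' x * tile et PhB x t = 0"
  proof (cases "a + 2 * l < x")
   case True
   hence "PhB x = 0" using l by (simp add: PhB_def divide_simps)
   thus ?thesis using et_bounds(1)[of t] by (simp add: tile_def)
  next
   case False
   hence "(x - (a + 2 * l)) / l <= 0" "(x - a) / l <= 0 | 1 <= (x - a) / l" using x l by (auto simp: divide_simps)
   thus ?thesis by (auto simp: baseY'_def ramp'_def)
  qed
  thus ?thesis unfolding Yx_def Yv.tot_exit[OF F] using False by (auto simp: mem_cell indicator_def)
 qed
 have it: "sint {c..d} (%x. l * et t * Yv.totx x t)" by (intro set_integrable_mult_right bpD(2)[OF Yv.bp_tot] cd)
 have ic: "sint {c..d} (%x. l * et t * indicator (cell []) x)" by (intro set_integrable_mult_right integral_cell(1) cd)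
 have "C1 (%_. 1) (%_. 0)" by (simp add: C1_def)
 from bpD(3)[OF Yv.bp_tot[OF cd] this] have t0: "(LBINT x:{c..d}. Yv.totx x t) = 0" by simp
 have b1: "sint {c..d} (%x. l * tile et PhB x t * Yx x t)"
  "(LBINT x:{c..d}. l * tile et PhB x t * Yx x t) = l^2 * et t" unfolding base using set_integral_add[OF ic it] t0 integral_cell(2)[OF cd, of "[]"]
  by (simp_all add: power2_eq_square mult_ac)
 let ?f = "%n x. Qv.lev n x t * Yx x t"
 have fi: "sint {c..d} (?f n)" "(LBINT x:{c..d}. ?f n x) = 0" for n using integral_Qlev_Yx[OF assms] by auto
 have ff: "AE x in lborel. x : {c..d} --> (EX k. \<forall>m\<ge>k. ?f m x = 0)" using Qv.AE_lev_finite[of "{c..d}" t]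
 proof eventually_elim
  case (elim x)
  show ?case
  proof
   assume "x : {c..d}"
   with elim obtain k where "\<forall>m\<ge>k. Qv.lev m x t = 0" by blast
   thus "EX k. \<forall>m\<ge>k. ?f m x = 0" by (intro exI[of _ k]) simp
  qed
 qed
 have fs: "summable (%n. LBINT x:{c..d}. abs (?f n x))"
 proof (rule summable_comparison_test'[where N = 0])
  show "summable (%n. l * (1 / 2) ^ n * (LBINT x:{c..d}. abs (Yx x t)))" by (intro summable_mult2 summable_mult summable_geometric) simp
  fix n :: nat
  have "(LBINT x:{c..d}. abs (?f n x)) <= (LBINT x:{c..d}. (l * (1 / 2) ^ n) * abs (Yx x t))"
   by (intro set_integral_mono set_integrable_abs fi set_integrable_mult_right iY)
    (simp add: abs_mult mult_right_mono Qv.lev_bound)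
  thus "norm (LBINT x:{c..d}. abs (?f n x)) <= l * (1 / 2) ^ n * (LBINT x:{c..d}. abs (Yx x t))" by (simp add: lint_def)
 qed
 note S = set_integral_suminf[OF fi(1) ff fs]
 note A = set_integral_add[OF b1(1) S(1)]
 have eq: "Q x t * Yx x t = l * tile et PhB x t * Yx x t + (\<Sum>n. ?f n x)" for x
 proof -
  have "summable (%n. Qv.lev n x t)" by (rule summable_comparison_test'[where N = 0 and g = "%n. l * (1 / 2) ^ n"])
    (simp_all add: summable_mult summable_geometric Qv.lev_bound)
  thus ?thesis unfolding Q_def Qv.tot_def by (simp add: suminf_mult2 distrib_right)
 qed
 show "sint {c..d} (%x. Q x t * Yx x t)" unfolding eq by (rule A(1))
 show "(LBINT x:{c..d}. Q x t * Yx x t) = l^2 * et t" unfolding eq A(2) b1(2) S(2) fi(2) by simp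
qed

end

context level
begin

lemma totx_integral:
 assumes "c <= a" "a + l <= d" shows "(LBINT x:{c..d}. abs (totx x t)) <= 6 * K * l"
proof -
 have "(LBINT x:{c..d}. abs (totx x t)) <= (\<Sum>n. LBINT x:{c..d}. abs (levx n x t))" unfolding totx_def
 proof (rule set_integral_suminf(4)[OF bpD(2)[OF bp_lev[OF assms]] _ summable_lev(2)[OF assms]])
  show "AE x in lborel. x : {c..d} --> (EX n. \<forall>N\<ge>n. levx N x t = 0)" using AE_lev_finite[of "{c..d}" t] by eventually_elim blast
 qed
 also have "... <= (\<Sum>n. 3 * K * l * (1 / 2) ^ n)" by (intro suminf_le lev_integral_bounds summable_lev summable_mult summable_geometric assms) simp
 also have "... = 3 * K * l * (1 / (1 - 1 / 2))" by (subst suminf_mult) (auto simp: suminf_geometric)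
 finally show ?thesis by simp
qed

end

context loop
begin

lemma YQ_integral_bounds:
 assumes "c <= a - l" "a + 3 * l <= d" shows "(LBINT x:{c..d}. abs (Y x t)) <= 12 * l^2" "(LBINT x:{c..d}. abs (Q x t)) <= 4 * (R + 2) * l^2"
  "(LBINT x:{c..d}. abs (Yx x t)) <= (4 + 6 * (1 + 1 / th)) * l"
  "(LBINT x:{c..d}. abs (Qx x t)) <= (4 * R + 6 / gp) * l"
proof -
 have cd: "c <= a" "a + l <= d" "c <= d" using assms l by auto
 let ?U = "{a - l..a + 3 * l}"
 have U: "?U : sets borel" "emeasure lborel ?U <= ennreal (4 * l)" "0 <= 4 * l" using l by simp_all
 have out: "~ (a - l < x & x < a + 3 * l)" if "x ~: ?U" for x using that by auto
 have "(LBINT x:{c..d}. abs (Y x t)) <= 3 * l * (4 * l)" by (rule Yv.set_integral_le_indicator[OF bpD(1)[OF bp_YQ(1)[OF assms]] U])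
   (use l YQ_abs_bound YQ_outside(1)[OF out] in \<open>auto simp: indicator_def\<close>)
 thus "(LBINT x:{c..d}. abs (Y x t)) <= 12 * l^2" by (simp add: power2_eq_square)
 have "(LBINT x:{c..d}. abs (Q x t)) <= (R + 2) * l * (4 * l)" by (rule Yv.set_integral_le_indicator[OF bpD(1)[OF bp_YQ(2)[OF assms]] U])
   (use l R YQ_abs_bound YQ_outside(4)[OF out] in \<open>auto simp: indicator_def\<close>)
 thus "(LBINT x:{c..d}. abs (Q x t)) <= 4 * (R + 2) * l^2" by (simp add: power2_eq_square mult_ac)
 have b: "baseY c = 0" "baseY d = 0" "PhB c = 0" "PhB d = 0" using base_ends assms by auto
 have out': "baseY' x = 0" "PhB' x = 0" if "x ~: ?U" for x using that base_ends(1)[of x] base_ends(2)[of x] by auto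
 have iY: "sint {c..d} baseY'" using bpD(2)[OF bp_ppl[OF ppl_baseY b(1,2) cd(3)]] .
 have "abs (baseY' x) <= 1" for x unfolding baseY'_def by (rule ramp'_diff_bound)
 hence "(LBINT x:{c..d}. abs (baseY' x)) <= 1 * (4 * l)" by (intro Yv.set_integral_le_indicator[OF iY U]) (use out' in \<open>auto simp: indicator_def\<close>)
 note 1 = this
 have i1: "sint {c..d} (%x. abs (baseY' x))" "sint {c..d} (%x. abs (Yv.totx x t))" by (intro set_integrable_abs iY bpD(2)[OF Yv.bp_tot] cd)+
 have "(LBINT x:{c..d}. abs (Yx x t)) <= (LBINT x:{c..d}. abs (baseY' x) + abs (Yv.totx x t))"
  by (intro set_integral_mono set_integrable_abs bpD(2)[OF bp_YQ(1)] assms set_integral_add(1) i1) (simp add: Yx_def)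
 also have "... <= 4 * l + 6 * (1 + 1 / th) * l" using 1 Yv.totx_integral[OF cd(1,2), of t] set_integral_add(2)[OF i1] by simp
 finally show "(LBINT x:{c..d}. abs (Yx x t)) <= (4 + 6 * (1 + 1 / th)) * l" by (simp add: distrib_right)
 have iQ: "sint {c..d} (%x. l * tile_x et PhB PhB' x t)"
 proof (rule bpD(2)[OF bp_ppl[of "%x. l * tile et PhB x t"]])
  show "ppl (%x. l * tile et PhB x t) (%x. l * tile_x et PhB PhB' x t)" by (intro ppl_cmult ppl_tile_x ppl_PhB)
 qed (use b cd et_bounds(1)[of t] in \<open>simp_all add: tile_def\<close>)
 have "abs (l * tile_x et PhB PhB' x t) <= R" for x
 proof -
  have "l * PhB' x = R * (l * (ramp' ((x - (a - l)) / l) / l - ramp' ((x - (a + l)) / l) / l))" by (simp add: PhB'_def)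
  hence "abs (l * PhB' x) = R * abs (l * (ramp' ((x - (a - l)) / l) / l - ramp' ((x - (a + l)) / l) / l))" by (simp only: abs_mult[of R] abs_of_pos[OF R])
  also have "... <= R * 1" using R by (intro mult_left_mono ramp'_diff_bound) simp
  finally show ?thesis using R by (simp add: tile_x_def)
 qed
 moreover have "tile_x et PhB PhB' x t = 0" if "x ~: ?U" for x using out'(2)[OF that] by (simp add: tile_x_def)
 ultimately have "(LBINT x:{c..d}. abs (l * tile_x et PhB PhB' x t)) <= R * (4 * l)"
  by (intro Yv.set_integral_le_indicator[OF iQ U]) (use R in \<open>auto simp: indicator_def\<close>)
 note 2 = this
 have i2: "sint {c..d} (%x. abs (l * tile_x et PhB PhB' x t))" "sint {c..d} (%x. abs (Qv.totx x t))" by (intro set_integrable_abs iQ bpD(2)[OF Qv.bp_tot] cd)+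
 have "(LBINT x:{c..d}. abs (Qx x t)) <= (LBINT x:{c..d}. abs (l * tile_x et PhB PhB' x t) + abs (Qv.totx x t))"
  by (intro set_integral_mono set_integrable_abs bpD(2)[OF bp_YQ(2)] assms set_integral_add(1) i2) (simp add: Qx_def)
 also have "... <= R * (4 * l) + 6 * (1 / gp) * l" using 2 Qv.totx_integral[OF cd(1,2), of t] set_integral_add(2)[OF i2] by simp
 finally show "(LBINT x:{c..d}. abs (Qx x t)) <= (4 * R + 6 / gp) * l" by (simp add: algebra_simps)
qed

end

section \<open>Superposition of loops\<close>

locale loops = cells +
 fixes R E :: real and et e :: "nat => real => real"
 assumes R: "0 < R" and et: "!!k. ppl (et k) (e k)" and et_bounds: "!!k t. 0 <= et k t" "!!k t. et k t < R" and e_bound: "!!k t. abs (e k t) <= E"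
begin

text \<open>With \<open>aa k = 5 * ll k\<close> the support of loop \<open>k\<close>, four lengths
  long, is the dyadic interval between \<open>(1 / 2) ^ Suc k\<close> and
  \<open>(1 / 2) ^ k\<close>; so the loops are disjoint and fill the unit interval.\<close>

definition ll :: "nat => real" where "ll k = (1 / 2) ^ k / 8"
definition aa :: "nat => real" where "aa k = 5 * ll k"

lemma ll: "0 < ll k" "ll k <= 1" "ll k = (1 / 8) * (1 / 2) ^ k" using power_le_one[of "1 / 2 :: real" k] by (auto simp: ll_def)

sublocale L: loop th "aa k" "ll k" R "et k" "e k" for k by unfold_locales (rule ll R et et_bounds)+

text \<open>The sign is put on \<open>Y\<close> only: this reverses the helicity of the loop
  \<open>0\<close> and keeps all bounds and the orthogonality.\<close>

definition sg :: "nat => real" where "sg k = (if k = 0 then - 1 else 1)"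

lemma abs_sg [simp]: "abs (sg k) = 1" by (simp add: sg_def)

definition "supp k x \<longleftrightarrow> 4 * ll k < x & x < 8 * ll k"

lemma ends: "0 <= aa k - ll k" "aa k + 3 * ll k <= 1" using ll[of k] by (auto simp: aa_def ll_def power_le_one)

lemma supp_iff: "supp k x \<longleftrightarrow> aa k - ll k < x & x < aa k + 3 * ll k" by (simp add: supp_def aa_def)

lemma supp_unique: assumes "supp k x" "supp k' x" shows "k = k'"
proof -
 have *: False if "supp k x" "supp k' x" "k < k'" for k k'
 proof -
  have "(1 / 2) ^ k' <= (1 / 2 :: real) ^ Suc k" using that(3) by (intro power_decreasing) auto
  hence "8 * ll k' <= 4 * ll k" by (simp add: ll_def)
  thus False using that(1,2) unfolding supp_def by linarith
 qed
 show ?thesis using *[of k k'] *[of k' k] assms by (cases k k' rule: linorder_cases) auto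
qed

definition "Y x t = (\<Sum>k. sg k * L.Y k x t)"
definition "Yx x t = (\<Sum>k. sg k * L.Yx k x t)"
definition "Yt x t = (\<Sum>k. sg k * L.Yt k x t)"
definition "Q x t = (\<Sum>k. L.Q k x t)"
definition "Qx x t = (\<Sum>k. L.Qx k x t)"
definition "Qt x t = (\<Sum>k. L.Qt k x t)"

lemma not_supp:
 assumes "~ supp k x" shows "L.Y k x t = 0" "L.Yx k x t = 0" "L.Yt k x t = 0" "L.Q k x t = 0" "L.Qx k x t = 0" "L.Qt k x t = 0"
 using L.YQ_outside[of k x t] assms unfolding supp_iff by blast+

lemma single:
 assumes "!!k'. k' ~= k ==> ~ supp k' x" shows "Y x t = sg k * L.Y k x t" "Yx x t = sg k * L.Yx k x t" "Yt x t = sg k * L.Yt k x t"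
  "Q x t = L.Q k x t" "Qx x t = L.Qx k x t" "Qt x t = L.Qt k x t"
proof -
 have s: "(\<Sum>k. f k) = f k" if "!!k'. ~ supp k' x ==> f k' = 0" for f :: "nat => real" using suminf_finite[of "{k}" f] that assms by simp
 show "Y x t = sg k * L.Y k x t" "Yx x t = sg k * L.Yx k x t" "Yt x t = sg k * L.Yt k x t"
  "Q x t = L.Q k x t" "Qx x t = L.Qx k x t" "Qt x t = L.Qt k x t" unfolding Y_def Yx_def Yt_def Q_def Qx_def Qt_def by (rule s, simp add: not_supp)+
qed

lemma ex_single: "EX k. ALL k'. k' ~= k --> ~ supp k' x" using supp_unique by blast

lemma measurables:
 "bmeas2 Y"
 "bmeas2 Yx"
 "bmeas2 Yt"
 "bmeas2 Q"
 "bmeas2 Qx"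
 "bmeas2 Qt" unfolding Y_def Yx_def Yt_def Q_def Qx_def Qt_def by (intro borel_measurable_suminf borel_measurable_times borel_measurable_const L.YQ_measurable)+

lemma abs_bounds: "abs (Y x t) <= 3" "abs (Q x t) <= R + 2"
proof -
 obtain k where k: "!!k'. k' ~= k ==> ~ supp k' x" using ex_single by metis
 have "abs (Y x t) <= 3 * ll k" using L.YQ_abs_bound(1)[of k x t] by (simp add: single[OF k] abs_mult)
 thus "abs (Y x t) <= 3" using ll(2)[of k] by linarith
 have "abs (Q x t) <= (R + 2) * ll k" using L.YQ_abs_bound(2)[of k x t] by (simp add: single[OF k])
 also have "... <= (R + 2) * 1" using ll(2)[of k] R by (intro mult_left_mono) auto
 finally show "abs (Q x t) <= R + 2" by simp
qed

lemma supp_eventually: "EX n. \<forall>k\<ge>n. ~ supp k x"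
proof (cases "EX k. supp k x")
 case True
 then obtain k where "supp k x" by blast
 hence "\<forall>k'\<ge>Suc k. ~ supp k' x" using supp_unique by fastforce
 thus ?thesis by blast
qed blast

lemma summable_ll: "summable (%k. C * ll k)" "summable (%k. C * (ll k)^2)"
proof -
 have 1: "summable (%k. (1 / 2 :: real) ^ k)" by (rule summable_geometric) simp
 thus s: "summable (%k. C * ll k)" for C unfolding ll(3) by (intro summable_mult)
 have "(ll k)^2 <= ll k" for k using mult_right_mono[OF ll(2) less_imp_le[OF ll(1)], of k k] by (simp add: power2_eq_square)
 hence "summable (%k. (ll k)^2)" by (intro summable_comparison_test'[OF s[of 1], of 0]) simp
 thus "summable (%k. C * (ll k)^2)" by (rule summable_mult)
qed

lemma set_lebesgue_abs_nonneg: "0 <= (LBINT x:A. abs (f x :: real))" by (simp add: lint_def)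

lemma bp_cmult: assumes "bp c d f g" shows "bp c d (%x. r * f x) (%x. r * g x)" unfolding bp_def
proof (intro conjI allI impI)
 show "sint {c..d} (%x. r * f x)" "sint {c..d} (%x. r * g x)" using bpD(1,2)[OF assms] by simp_all
 fix ph ph' assume C: "C1 ph ph'"
 have "(LBINT x:{c..d}. r * g x * ph x + r * f x * ph' x) = (LBINT x:{c..d}. r * (g x * ph x + f x * ph' x))" by (simp add: algebra_simps)
 thus "(LBINT x:{c..d}. r * g x * ph x + r * f x * ph' x) = 0" using bpD(3)[OF assms C] by simp
qed

lemma bps: "bp 0 1 (%x. Y x t) (%x. Yx x t)" "bp 0 1 (%x. Q x t) (%x. Qx x t)"
proof -
 note b = L.YQ_integral_bounds[OF ends]
 show "bp 0 1 (%x. Y x t) (%x. Yx x t)" unfolding Y_def Yx_def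
 proof (rule bp_suminf)
  show "bp 0 1 (%x. sg k * L.Y k x t) (%x. sg k * L.Yx k x t)" for k by (intro bp_cmult L.bp_YQ ends)
  show "AE x in lborel. x : {0..1} --> (EX n. \<forall>N\<ge>n. sg N * L.Y N x t = 0 & sg N * L.Yx N x t = 0)"
   using supp_eventually not_supp by (intro AE_I2 impI) (metis mult_zero_right)
  show "summable (%N. LBINT x:{0..1}. abs (sg N * L.Y N x t))" by (rule summable_comparison_test'[OF summable_ll(2)[of 12], of 0])
    (simp only: abs_mult abs_sg mult_1_left real_norm_def abs_of_nonneg[OF set_lebesgue_abs_nonneg] b)
  show "summable (%N. LBINT x:{0..1}. abs (sg N * L.Yx N x t))" by (rule summable_comparison_test'[OF summable_ll(1)[of "4 + 6 * (1 + 1 / th)"], of 0])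
    (simp only: abs_mult abs_sg mult_1_left real_norm_def abs_of_nonneg[OF set_lebesgue_abs_nonneg] b)
 qed
 show "bp 0 1 (%x. Q x t) (%x. Qx x t)" unfolding Q_def Qx_def
 proof (rule bp_suminf)
  show "bp 0 1 (%x. L.Q k x t) (%x. L.Qx k x t)" for k by (intro L.bp_YQ ends)
  show "AE x in lborel. x : {0..1} --> (EX n. \<forall>N\<ge>n. L.Q N x t = 0 & L.Qx N x t = 0)" using supp_eventually not_supp by (intro AE_I2 impI) metis
  show "summable (%N. LBINT x:{0..1}. abs (L.Q N x t))" by (rule summable_comparison_test'[OF summable_ll(2)[of "4 * (R + 2)"], of 0])
    (simp only: real_norm_def abs_of_nonneg[OF set_lebesgue_abs_nonneg] b)
  show "summable (%N. LBINT x:{0..1}. abs (L.Qx N x t))" by (rule summable_comparison_test'[OF summable_ll(1)[of "4 * R + 6 / gp"], of 0])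
    (simp only: real_norm_def abs_of_nonneg[OF set_lebesgue_abs_nonneg] b)
 qed
qed

lemma ppl_t: "AE x in lborel. ppl (Y x) (Yt x) & ppl (Q x) (Qt x)"
proof -
 have "AE x in lborel. ALL k. ppl (L.Y k x) (L.Yt k x) & ppl (L.Q k x) (L.Qt k x)" unfolding AE_all_countable using L.ppl_YQ_t by blast
 thus ?thesis
 proof eventually_elim
  case (elim x)
  obtain k where k: "!!k'. k' ~= k ==> ~ supp k' x" using ex_single by metis
  have "Y x = (%t. sg k * L.Y k x t)" "Yt x = (%t. sg k * L.Yt k x t)" "Q x = L.Q k x" "Qt x = L.Qt k x" by (intro ext; simp add: single[OF k])+
  thus ?case using elim[rule_format, of k] by (simp add: ppl_cmult)
 qed
qed

lemma det: "AE z in lborel. Qx (fst z) (snd z) * Yt (fst z) (snd z) = Yx (fst z) (snd z) * Qt (fst z) (snd z)"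
proof -
 have "AE z in lborel. ALL k. L.Qx k (fst z) (snd z) * L.Yt k (fst z) (snd z) = L.Yx k (fst z) (snd z) * L.Qt k (fst z) (snd z)"
  unfolding AE_all_countable using L.det_zero by blast
 thus ?thesis
 proof eventually_elim
  case (elim z)
  obtain k where k: "!!k'. k' ~= k ==> ~ supp k' (fst z)" using ex_single by metis
  show ?case using elim[rule_format, of k] by (simp add: single[OF k] mult.left_commute mult.assoc)
 qed
qed

lemma locally_constant:
 "AE z in lborel. loc_const (%z. (Yx (fst z) (snd z), Yt (fst z) (snd z), Qx (fst z) (snd z), Qt (fst z) (snd z))) z"
proof -
 have 1: "AE z in lborel. ALL k. loc_const (%z. (L.Yx k (fst z) (snd z), L.Yt k (fst z) (snd z), L.Qx k (fst z) (snd z), L.Qt k (fst z) (snd z))) z"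
  unfolding AE_all_countable using L.YQ_loc_const by blast
 \<comment> \<open>The supports accumulate only at \<open>0\<close>; away from \<open>0\<close> and
   from the common endpoints at most one loop is visible near a point.\<close>
 have "countable (insert 0 (range (%k. 8 * ll k)))" by simp
 from AE_lborel_fst[OF countable_imp_AE_lborel[OF this]] 1 show ?thesis
 proof eventually_elim
  case (elim z)
  let ?x = "fst z"
  have "EX k. \<forall>\<^sub>F y in nhds ?x. ALL k'. k' ~= k --> ~ supp k' y"
  proof (cases "EX k. supp k ?x")
   case True
   then obtain k where k: "supp k ?x" by blast
   hence "\<forall>\<^sub>F y in nhds ?x. y : {4 * ll k <..< 8 * ll k}" by (intro eventually_nhds_in_open) (auto simp: supp_def)
   hence "\<forall>\<^sub>F y in nhds ?x. ALL k'. k' ~= k --> ~ supp k' y"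
   proof eventually_elim
    case (elim y) hence "supp k y" by (simp add: supp_def)
    thus ?case using supp_unique by blast
   qed
   thus ?thesis ..
  next
   case False
   have "\<forall>\<^sub>F y in nhds ?x. ALL k'. ~ supp k' y"
   proof (cases "?x < 0")
    case True
    hence "\<forall>\<^sub>F y in nhds ?x. y < 0" by (intro order_tendstoD(2)[OF filterlim_ident])
    thus ?thesis
    proof eventually_elim
     case (elim y) thus ?case using ll(1) unfolding supp_def by (auto simp: not_less)
    qed
   next
    case F: False
    have x0: "0 < ?x" using F elim(1) by simp
    have "1 < ?x"
    proof (rule ccontr)
     assume "~ 1 < ?x"
     define k where "k = (LEAST n. 4 * ll n < ?x)"
     have "(%n. (1 / 2 :: real) ^ n) \<longlonglongrightarrow> 0" by (rule LIMSEQ_realpow_zero) auto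
     hence "\<forall>\<^sub>F n in sequentially. (1 / 2) ^ n < ?x" using x0 by (rule order_tendstoD(2))
     then obtain n where "(1 / 2) ^ n < ?x" by (auto simp: eventually_sequentially)
     hence "4 * ll n < ?x" using x0 by (simp add: ll_def)
     hence k: "4 * ll k < ?x" unfolding k_def by (rule LeastI)
     have "?x <= 8 * ll k"
     proof (cases k)
      case 0 thus ?thesis using \<open>~ 1 < ?x\<close> by (simp add: ll_def)
     next
      case (Suc j)
      hence "~ 4 * ll j < ?x" using not_less_Least[of j "%n. 4 * ll n < ?x"] unfolding k_def by simp
      thus ?thesis using Suc by (simp add: ll_def)
     qed
     moreover have "?x ~= 8 * ll k" using elim(1) by auto
     ultimately have "supp k ?x" using k by (simp add: supp_def)
     thus False using False by blast
    qed
    hence "\<forall>\<^sub>F y in nhds ?x. 1 < y" by (intro order_tendstoD(1)[OF filterlim_ident])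
    thus ?thesis
    proof eventually_elim
     case (elim y)
     have "8 * ll k' <= 1" for k' by (simp add: ll_def power_le_one)
     thus ?case using elim unfolding supp_def by (metis less_le_trans not_less_iff_gr_or_eq)
    qed
   qed
   hence "\<forall>\<^sub>F y in nhds ?x. ALL k'. k' ~= 0 --> ~ supp k' y" by eventually_elim blast
   thus ?thesis ..
  qed
  then obtain k where k: "\<forall>\<^sub>F y in nhds ?x. ALL k'. k' ~= k --> ~ supp k' y" by blast
  have lc: "loc_const (%z. (sg k * L.Yx k (fst z) (snd z), sg k * L.Yt k (fst z) (snd z), L.Qx k (fst z) (snd z), L.Qt k (fst z) (snd z))) z"
   using loc_const_compose[OF elim(2)[rule_format, of k], of "%(a, b, c, d). (sg k * a, sg k * b, c, d)"] by simp
  show ?case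
  proof (rule loc_const_cong[OF lc])
   show "\<forall>\<^sub>F y in nhds z. (Yx (fst y) (snd y), Yt (fst y) (snd y), Qx (fst y) (snd y), Qt (fst y) (snd y)) =
    (sg k * L.Yx k (fst y) (snd y), sg k * L.Yt k (fst y) (snd y), L.Qx k (fst y) (snd y), L.Qt k (fst y) (snd y))"
    using eventually_nhds_fst[OF k] by eventually_elim (simp add: single)
  qed
 qed
qed

lemma sum_ll: "(\<Sum>k. ll k) = 1 / 4"
proof -
 have "(\<Sum>k. ll k) = 1 / 8 * (\<Sum>k. (1 / 2) ^ k)" unfolding ll(3) by (intro suminf_mult summable_geometric) simp
 thus ?thesis by (simp add: suminf_geometric)
qed

text \<open>The exceptional set collects, over all loops, the alive cells of level
  \<open>Suc M\<close>. Its length is at most \<open>3 * th ^ Suc M\<close> times the total length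
  \<open>1 / 4\<close> of the roots.\<close>

lemma weak_bounds:
 "\<exists>W\<in>sets borel. emeasure lborel W <= ennreal (th ^ M) \<and>
  (ALL x. x ~: W --> abs (Yx x t) <= L.KB * L.al ^ M & abs (Qx x t) <= L.KB * L.al ^ M \<and>
    (abs (Yt x t)) <= 3 * E * 2 ^ M & abs (Qt x t) <= 3 * E * 2 ^ M)"
proof (intro bexI conjI allI impI)
 define W where "W = (\<Union>k. {x. L.ai k (Suc M) x (et k t)})"
 show "W : sets borel" unfolding W_def by (intro sets.countable_UN) (auto intro: L.ai_sets)
 have s: "summable (%k. 3 * (ll k * th ^ Suc M))" using summable_ll(1)[of "3 * th ^ Suc M"] by (simp add: mult_ac)
 have "emeasure lborel W <= (\<Sum>k. emeasure lborel {x. L.ai k (Suc M) x (et k t)})"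
  unfolding W_def using L.ai_sets by (intro emeasure_subadditive_countably) auto
 also have "... <= (\<Sum>k. ennreal (3 * (ll k * th ^ Suc M)))" by (intro suminf_le L.ai_measure) auto
 also have "... = ennreal (\<Sum>k. 3 * (ll k * th ^ Suc M))" using ll(1) th s by (intro suminf_ennreal2) (auto intro!: mult_nonneg_nonneg less_imp_le)
 also have "(\<Sum>k. 3 * (ll k * th ^ Suc M)) = 3 * (th ^ Suc M / 4)"
 proof -
  have "(\<Sum>k. 3 * (ll k * th ^ Suc M)) = (\<Sum>k. (3 * th ^ Suc M) * ll k)" by (simp only: mult_ac)
  also have "... = (3 * th ^ Suc M) * (\<Sum>k. ll k)" using summable_ll(1)[of 1] by (intro suminf_mult) simp
  finally show ?thesis unfolding sum_ll by simp
 qed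
 also have "... <= th ^ M" using th by (simp add: mult_le_one)
 finally show "emeasure lborel W <= ennreal (th ^ M)" by (simp add: ennreal_leI)
 fix x assume x: "x ~: W"
 obtain k where k: "!!k'. k' ~= k ==> ~ supp k' x" using ex_single by metis
 have "~ L.ai k (Suc M) x (et k t)" using x unfolding W_def by blast
 note b = L.YQ_bounds[OF this]
 show "abs (Yx x t) <= L.KB * L.al ^ M" "abs (Qx x t) <= L.KB * L.al ^ M" using b by (simp_all add: single[OF k] abs_mult)
 have "ll k * abs (e k t) <= 1 * E" using ll[of k] e_bound[of k t] by (intro mult_mono) auto
 hence "3 * ll k * abs (e k t) * 2 ^ M <= 3 * E * 2 ^ M" by (simp add: mult.assoc)
 note le = order_trans[OF _ this]
 show "abs (Yt x t) <= 3 * E * 2 ^ M" "abs (Qt x t) <= 3 * E * 2 ^ M" using le[OF b(3)] le[OF b(4)] by (simp_all add: single[OF k] abs_mult)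
qed

text \<open>Disjoint supports exclude cross terms between loops, also between \<open>Q\<close> of
  one and \<open>Yx\<close> of another.\<close>

lemma integral_QYx: shows "sint {0..1} (%x. Q x t * Yx x t)" and "(LBINT x:{0..1}. Q x t * Yx x t) = (\<Sum>k. sg k * ((ll k)^2 * et k t))"
proof -
 let ?f = "%k x. sg k * (L.Q k x t * L.Yx k x t)"
 have eq: "Q x t * Yx x t = (\<Sum>k. ?f k x)" for x
 proof -
  obtain k where k: "!!k'. k' ~= k ==> ~ supp k' x" using ex_single by metis
  have "(\<Sum>k. ?f k x) = ?f k x" using suminf_finite[of "{k}" "%k. ?f k x"] k not_supp by simp
  thus ?thesis by (simp add: single[OF k])
 qed
 have i: "sint {0..1} (?f k)" "(LBINT x:{0..1}. ?f k x) = sg k * ((ll k)^2 * et k t)" for k using L.integral_Q_Yx[OF ends, of k t] by simp_all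
 have fin: "AE x in lborel. x : {0..1} --> (EX n. \<forall>N\<ge>n. ?f N x = 0)" using supp_eventually not_supp by (intro AE_I2 impI) (metis mult_zero_right)
 have s: "summable (%k. LBINT x:{0..1}. abs (?f k x))"
 proof (rule summable_comparison_test'[OF summable_ll(1)[of "(R + 2) * (4 + 6 * (1 + 1 / th))"], of 0])
  fix k
  have "(LBINT x:{0..1}. abs (?f k x)) <= (LBINT x:{0..1}. (R + 2) * abs (L.Yx k x t))"
  proof (intro set_integral_mono set_integrable_abs i set_integrable_mult_right bpD(2)[OF L.bp_YQ(1)[OF ends]])
   fix x
   have "abs (L.Q k x t) <= (R + 2) * ll k" by (rule L.YQ_abs_bound)
   also have "... <= (R + 2) * 1" using ll(2)[of k] R by (intro mult_left_mono) auto
   finally show "abs (?f k x) <= (R + 2) * abs (L.Yx k x t)" by (simp add: abs_mult mult_right_mono)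
  qed
  also have "... <= (R + 2) * ((4 + 6 * (1 + 1 / th)) * ll k)" using R L.YQ_integral_bounds(3)[OF ends, of k t] by (simp add: mult_left_mono)
  finally show "norm (LBINT x:{0..1}. abs (?f k x)) <= (R + 2) * (4 + 6 * (1 + 1 / th)) * ll k"
   by (simp only: real_norm_def abs_of_nonneg[OF set_lebesgue_abs_nonneg] mult.assoc)
 qed
 note S = set_integral_suminf[OF i(1) fin s]
 show "sint {0..1} (%x. Q x t * Yx x t)" unfolding eq by (rule S(1))
 show "(LBINT x:{0..1}. Q x t * Yx x t) = (\<Sum>k. sg k * ((ll k)^2 * et k t))" unfolding eq S(2) i(2) ..
qed

end

section \<open>Integration over the torus\<close>

text \<open>Coordinate \<open>i\<close> is listed first, so that Fubini singles out the lines in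
  direction \<open>i\<close>; the other two keep their order.\<close>

definition mk :: "3 => real * real \<times> real => real^3" where
 "mk i = (%(s, a, b). if i = 1 then vector [s, a, b] else if i = 2 then vector [a, s, b] else vector [a, b, s])"

lemma mk_nth:
 "mk i (s, a, b) $ 1 = (if i = 1 then s else a)"
 "mk i (s, a, b) $ 2 = (if i = 1 then a else if i = 2 then s else b)"
 "mk i (s, a, b) $ 3 = (if i = 1 | i = 2 then b else s)" by (auto simp: mk_def)

lemma three_distinct [simp]: "(1::3) ~= 2" "(2::3) ~= 3" "(1::3) ~= 3" "(2::3) ~= 1" "(3::3) ~= 2" "(3::3) ~= 1" by simp_all

lemma mk_shift: "mk i (s + h, a, b) = mk i (s, a, b) + h *\<^sub>R axis i 1" using exhaust_3[of i] by (auto simp: vec_eq_iff forall_3 mk_nth axis_def)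

lemma continuous_mk: "continuous_on S (mk i)"
proof -
 have *: "continuous_on S (%z::real * real \<times> real. (vector [f z, g z, h z] :: real^3))"
  if "continuous_on S f" "continuous_on S g" "continuous_on S h" for f g h :: "real * real \<times> real => real"
 proof -
  have eq: "(%z. (vector [f z, g z, h z] :: real^3)) = (%z. \<chi> i. if i = 1 then f z else if i = 2 then g z else h z)"
   by (auto simp: fun_eq_iff vec_eq_iff forall_3)
  have "continuous_on S (%z. if i = 1 then f z else if i = 2 then g z else h z)" for i :: 3 using that by (cases "i = 1"; cases "i = 2") auto
  thus ?thesis unfolding eq by (rule continuous_on_vec_lambda)
 qed
 show ?thesis unfolding mk_def case_prod_unfold by (cases "i = 1"; cases "i = 2"; simp) (intro *; intro continuous_intros)+
qed

lemma measurable_mk [measurable]: "mk i : bmeas" by (rule meas_cont) (rule continuous_mk)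

lemma prod_UNIV_3: "prod f (UNIV :: 3 set) = f 1 * f 2 * f 3" unfolding UNIV_3 by (simp add: mult_ac)

lemma prod_Basis_3: "(\<Prod>b\<in>Basis. (x::real^3) \<bullet> b) = x $ 1 * x $ 2 * x $ 3"
proof -
 have "(Basis :: (real^3) set) = (%i. axis i 1) ` UNIV" by (auto simp: Basis_vec_def)
 hence "(\<Prod>b\<in>Basis. x \<bullet> b) = (\<Prod>b\<in>(%i. axis i 1) ` UNIV. x \<bullet> b)" by (rule arg_cong)
 also have "... = (\<Prod>i\<in>UNIV. x \<bullet> axis i 1)" by (subst prod.reindex) (auto simp: inj_on_def axis_eq_axis)
 finally show ?thesis by (simp add: prod_UNIV_3 inner_axis)
qed

text \<open>A permutation of the coordinates maps boxes to boxes of the same volume, and boxes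
  determine Lebesgue measure.\<close>

lemma lborel_mk: "distr lborel borel (mk i) = lborel"
proof (rule lborel_eqI[symmetric])
 fix l u :: "real^3" assume "!!b. b : Basis ==> l \<bullet> b <= u \<bullet> b"
 note le = this
 have lu: "l $ j <= u $ j" for j using le[of "axis j 1"] by (simp add: inner_axis axis_in_Basis_iff)
 define p where "p = (%x::real^3. if i = 1 then (x $ 1, x $ 2, x $ 3) else if i = 2 then (x $ 2, x $ 1, x $ 3) else (x $ 3, x $ 1, x $ 2))"
 have "emeasure (distr lborel borel (mk i)) (box l u) = emeasure lborel (mk i -` box l u)" by (simp add: emeasure_distr)
 also have "mk i -` box l u = box (p l) (p u)" by (auto simp: mem_box_cart forall_3 mk_nth p_def mem_box Basis_prod_def split: if_splits)
 also have "emeasure lborel (box (p l) (p u)) = (\<Prod>b\<in>Basis. (p u - p l) \<bullet> b)"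
  using lu by (intro emeasure_lborel_box) (auto simp: p_def Basis_prod_def)
 also have "(\<Prod>b\<in>Basis. (p u - p l) \<bullet> b) = (\<Prod>b\<in>Basis. (u - l) \<bullet> b)"
  unfolding prod_Basis_3 by (auto simp: p_def Basis_prod_def prod.union_disjoint image_Un image_iff mult_ac)
 finally show "emeasure (distr lborel borel (mk i)) (box l u) = ennreal (\<Prod>b\<in>Basis. (u - l) \<bullet> b)" .
qed simp

lemma cbox01: "x : cbox 0 (1::real^3) \<longleftrightarrow> (ALL i. x $ i : {0..1})" by (auto simp: mem_box_cart)

lemma indicator_mk:
 "indicator (cbox 0 1) (mk i (s, a, b)) = (indicator {0..1} s * indicator ({0..1} \<times> {0..1}) (a, b) :: real)"
proof -
 have "mk i (s, a, b) : cbox 0 1 \<longleftrightarrow> s : {0..1} & a : {0..1} & b : {0..1}"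
  using exhaust_3[of i] unfolding cbox01 forall_3 by (elim disjE) (simp_all add: mk_nth conj_commute conj_left_commute)
 thus ?thesis by (simp add: indicator_def)
qed

lemma unit_square:
 "{0..1} \<times> {0..1} : sets (borel :: (real * real) measure)"
 "emeasure lborel ({0..1} \<times> {0..1} :: (real * real) set) = 1"
proof -
 show "{0..1} \<times> {0..1} : sets (borel :: (real * real) measure)" by (simp add: borel_prod[symmetric])
 show "emeasure lborel ({0..1} \<times> {0..1} :: (real * real) set) = 1" unfolding lborel_prod[symmetric] by (subst lborel.emeasure_pair_measure_Times) auto
qed

lemma torus_integral:
 fixes f :: "real^3 => 'b::{banach, second_countable_topology}"
 assumes "f : bmeas" shows "integral\<^sup>L torus f = (LINT x|lborel. indicator (cbox 0 1) x *\<^sub>R f x)"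
  and "integrable torus f \<longleftrightarrow> integrable lborel (%x. indicator (cbox 0 1) x *\<^sub>R f x)"
proof -
 have m: "(%x. indicator (cbox 0 1) x *\<^sub>R f x) : lborel \<rightarrow>\<^sub>M borel" using assms by measurable
 show "integral\<^sup>L torus f = (LINT x|lborel. indicator (cbox 0 1) x *\<^sub>R f x)"
  unfolding torus_def by (subst integral_restrict_space) (auto simp: integral_completion[OF m])
 show "integrable torus f \<longleftrightarrow> integrable lborel (%x. indicator (cbox 0 1) x *\<^sub>R f x)"
  unfolding torus_def by (subst integrable_restrict_space) (auto simp: integrable_completion[OF m])
qed

lemma space_torus [simp]: "space torus = cbox 0 1" by (simp add: torus_def)

lemma borel_measurable_torus: "f : bmeas ==> f : borel_measurable torus" unfolding torus_def by (intro measurable_restrict_space1 measurable_completion) simp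

lemma AE_torus: "(AE x in torus. P x) \<longleftrightarrow> (AE x in lborel. x : cbox 0 1 --> P x)"
 unfolding torus_def by (simp add: AE_restrict_space_iff AE_completion_iff)

lemma nn_integral_torus:
 assumes [measurable]: "f : bmeas" shows "(\<integral>\<^sup>+x. f x \<partial>torus) = (\<integral>\<^sup>+x. f x * indicator (cbox 0 1) x \<partial>lborel)"
 unfolding torus_def by (subst nn_integral_restrict_space) (auto simp: nn_integral_completion)

lemma finite_measure_torus: "finite_measure torus" by (rule finite_measureI) (simp add: torus_def emeasure_restrict_space emeasure_lborel_cbox_eq)

lemma measure_torus: "measure torus (space torus) = 1" by (simp add: torus_def measure_restrict_space content_cbox_if_cart interval_ne_empty_cart)

lemma integrable_torus_bounded:
 fixes f :: "real^3 => 'b::{banach, second_countable_topology}"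
 assumes "f : bmeas" "!!x. x : cbox 0 1 ==> norm (f x) <= C" shows "integrable torus f"
proof -
 interpret finite_measure torus by (rule finite_measure_torus)
 show ?thesis using assms by (intro integrable_const_bound[of _ C]) (auto intro: borel_measurable_torus)
qed

lemma integrable_torus_continuous:
 fixes f :: "real^3 => 'b::{banach, second_countable_topology}"
 assumes "contU f" shows "integrable torus f"
proof -
 have "compact (f ` cbox 0 1)" using assms continuous_on_subset by (intro compact_continuous_image) auto
 then obtain C where "ALL y:f ` cbox 0 1. norm y <= C" using compact_imp_bounded bounded_iff by metis
 thus ?thesis using assms by (intro integrable_torus_bounded[of f C]) (auto intro: meas_cont)
qed

lemma torus_integral_mk:
 fixes f :: "real^3 => real"
 assumes f[measurable]: "f : bmeas" and i: "integrable torus f"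
 shows "integral\<^sup>L torus f = (LINT p|lborel. indicator ({0..1} \<times> {0..1}) p * (LBINT s:{0..1}. f (mk i (s, p))))"
proof -
 let ?g = "%x. indicator (cbox 0 1) x *\<^sub>R f x"
 have "integrable lborel ?g" using i torus_integral(2)[OF f] by simp
 hence "integrable (distr lborel borel (mk i)) ?g" by (simp add: lborel_mk)
 hence i2: "integrable lborel (%z. ?g (mk i z))" by (subst (asm) integrable_distr_eq) auto
 have "integral\<^sup>L torus f = integral\<^sup>L (distr lborel borel (mk i)) ?g" by (simp add: lborel_mk torus_integral(1)[OF f])
 also have "... = (LINT z|lborel. ?g (mk i z))" by (subst integral_distr) auto
 also have "... = (\<integral>z. case_prod (%s p. ?g (mk i (s, p))) z \<partial>(lborel \<Otimes>\<^sub>M lborel))"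
  unfolding lborel_prod by (simp add: case_prod_unfold)
 also have "... = (LINT p|lborel. (LINT s|lborel. ?g (mk i (s, p))))"
 proof (rule lborel_pair.integral_snd[symmetric])
  show "integrable (lborel \<Otimes>\<^sub>M lborel) (%(s, p). ?g (mk i (s, p)))" unfolding lborel_prod using i2 by (simp add: case_prod_unfold)
 qed
 also have "... = (LINT p|lborel. indicator ({0..1} \<times> {0..1}) p * (LBINT s:{0..1}. f (mk i (s, p))))"
 proof (intro bint_cong refl)
  fix p :: "real * real"
  have eq: "?g (mk i (s, p)) = indicator ({0..1} \<times> {0..1}) p * (indicator {0..1} s *\<^sub>R f (mk i (s, p)))" for s
   using indicator_mk[of i s "fst p" "snd p"] by simp
  show "(LINT s|lborel. ?g (mk i (s, p))) = indicator ({0..1} \<times> {0..1}) p * (LBINT s:{0..1}. f (mk i (s, p)))"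
   unfolding lint_def eq by (rule integral_mult_right_zero)
 qed
 finally show ?thesis .
qed

lemma torus_integral_slices_zero:
 fixes f :: "real^3 => real"
 assumes f: "f : bmeas" and z: "!!p. (LBINT s:{0..1}. f (mk i (s, p))) = 0" shows "integral\<^sup>L torus f = 0"
proof (cases "integrable torus f")
 case True
 show ?thesis unfolding torus_integral_mk[OF f True, of i] z by simp
\<comment> \<open>The Bochner integral of a function that is not integrable has the default value
  \<open>0\<close>.\<close>
qed (rule not_integrable_integral_eq)

lemma nn_integral_torus_1:
 assumes h[measurable]: "h : bmeas"
 shows "(\<integral>\<^sup>+x. h (x $ 1) \<partial>torus) = (\<integral>\<^sup>+s. h s * indicator {0..1} s \<partial>lborel)"
proof -
 have [measurable]: "(%x::real^3. h (x $ 1)) : bmeas" by (rule measurable_compose[OF meas_cont h]) (intro continuous_intros)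
 have "(\<integral>\<^sup>+x. h (x $ 1) \<partial>torus) = (\<integral>\<^sup>+x. h (x $ 1) * indicator (cbox 0 1) x \<partial>distr lborel borel (mk 1))"
  by (subst nn_integral_torus) (simp_all add: lborel_mk)
 also have "... = (\<integral>\<^sup>+z. h (mk 1 z $ 1) * indicator (cbox 0 1) (mk 1 z) \<partial>lborel)" by (subst nn_integral_distr) auto
 also have "... = (\<integral>\<^sup>+(z :: real * real \<times> real). (h (fst z) * indicator {0..1} (fst z)) * indicator ({0..1} \<times> {0..1}) (snd z) \<partial>lborel)"
 proof (rule nn_integral_cong)
  fix z :: "real * real \<times> real"
  obtain s a b where z: "z = (s, a, b)" by (cases z)
  show "h (mk 1 z $ 1) * indicator (cbox 0 1) (mk 1 z) = (h (fst z) * indicator {0..1} (fst z)) * indicator ({0..1} \<times> {0..1}) (snd z)"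
   unfolding z by (auto simp: mk_nth cbox01 forall_3 split: split_indicator)
 qed
 also have "... = (\<integral>\<^sup>+s. (\<integral>\<^sup>+(p :: real * real). (h s * indicator {0..1} s) * indicator ({0..1} \<times> {0..1}) p \<partial>lborel) \<partial>lborel)"
 proof -
  note [measurable] = unit_square(1)
  show ?thesis by (subst lborel_prod[symmetric], subst lborel.nn_integral_fst[symmetric]) simp_all
 qed
 also have "... = (\<integral>\<^sup>+s. h s * indicator {0..1} s \<partial>lborel)"
 proof (rule nn_integral_cong)
  fix s
  have "(\<integral>\<^sup>+p. (h s * indicator {0..1} s) * indicator ({0..1} \<times> {0..1}) (p :: real * real) \<partial>lborel)
    = (h s * indicator {0..1} s) * emeasure lborel ({0..1} \<times> {0..1} :: (real * real) set)"
   using unit_square(1) by (intro nn_integral_cmult_indicator) simp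
  thus "(\<integral>\<^sup>+p. (h s * indicator {0..1} s) * indicator ({0..1} \<times> {0..1}) (p :: real * real) \<partial>lborel) = h s * indicator {0..1} s"
   unfolding unit_square(2) by simp
 qed
 finally show ?thesis .
qed

lemma measurable_1: "h : bmeas ==> (%x::real^3. h (x $ 1)) : bmeas" by (rule measurable_compose[OF meas_cont]) (auto intro: continuous_intros)

lemma integrable_torus_1:
 fixes h :: "real => real"
 assumes h[measurable]: "h : bmeas" and i: "sint {0..1} h" shows "integrable torus (%x. h (x $ 1))"
proof (rule integrableI_bounded)
 show "(%x. h (x $ 1)) : borel_measurable torus" by (intro borel_measurable_torus measurable_1 h)
 have "(\<integral>\<^sup>+x. ennreal (norm (h (x $ 1))) \<partial>torus) = (\<integral>\<^sup>+s. ennreal (norm (h s)) * indicator {0..1} s \<partial>lborel)"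
  by (rule nn_integral_torus_1) simp
 also have "... = (\<integral>\<^sup>+s. ennreal (norm (indicator {0..1} s *\<^sub>R h s)) \<partial>lborel)"
  by (intro nn_integral_cong) (auto split: split_indicator)
 also have "... < \<infinity>" using i unfolding set_integrable_def integrable_iff_bounded by blast
 finally show "(\<integral>\<^sup>+x. ennreal (norm (h (x $ 1))) \<partial>torus) < \<infinity>" .
qed

lemma integral_torus_1:
 fixes h :: "real => real"
 assumes h: "h : bmeas" and i: "sint {0..1} h" shows "(LINT x|torus. h (x $ 1)) = (LBINT s:{0..1}. h s)"
proof -
 have "(LINT x|torus. h (x $ 1)) = (LINT p|lborel. indicator ({0..1} \<times> {0..1}) p * (LBINT s:{0..1}. h (mk 1 (s, p) $ 1)))"
  by (rule torus_integral_mk[OF measurable_1[OF h] integrable_torus_1[OF h i]])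
 also have "... = (LINT p|lborel. indicator ({0..1} \<times> {0..1}) (p :: real * real) * (LBINT s:{0..1}. h s))" by (intro bint_cong refl) (auto simp: mk_nth)
 also have "... = measure lborel ({0..1} \<times> {0..1} :: (real * real) set) * (LBINT s:{0..1}. h s)" using unit_square(1) by simp
 also have "measure lborel ({0..1} \<times> {0..1} :: (real * real) set) = 1" unfolding measure_def unit_square(2) by simp
 finally show ?thesis by simp
qed

lemma emeasure_torus_1:
 assumes [measurable]: "W : sets borel" shows "emeasure torus {x : space torus. x $ 1 : W} = emeasure lborel (W \<inter> {0..1})"
proof -
 have [measurable]: "{x::real^3. x $ 1 : W} : sets borel"
  using measurable_sets[OF meas_cont[OF continuous_on_component[OF continuous_on_id, of UNIV "1::3"]] assms] by (simp add: vimage_def)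
 let ?V = "{x::real^3. x $ 1 : W}"
 have "{x : space torus. x $ 1 : W} = ?V \<inter> space torus" by auto
 moreover have "?V \<inter> space torus : sets torus" by (simp add: torus_def sets_restrict_space_iff sets_completionI_sets)
 ultimately have "emeasure torus {x : space torus. x $ 1 : W} = (\<integral>\<^sup>+x. indicator (?V \<inter> space torus) x \<partial>torus)" by simp
 also have "... = (\<integral>\<^sup>+x. indicator W (x $ 1) \<partial>torus)" by (intro nn_integral_cong) (auto simp: indicator_def)
 also have "... = (\<integral>\<^sup>+s. indicator W s * indicator {0..1} s \<partial>lborel)" by (rule nn_integral_torus_1) simp
 also have "... = emeasure lborel (W \<inter> {0..1})" by (simp flip: indicator_inter_arith)
 finally show ?thesis .
qed

section \<open>Calculus of smooth periodic functions\<close>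

lemma C_infinityD:
 assumes "C_infinity f" shows "f differentiable (at x)" "contU f"
  "i : Basis ==> C_infinity (%x. fder f x i)"
proof -
 have "C_k 1 f" "C_k 0 f" "!!k. C_k (Suc k) f" using assms unfolding C_infinity_def by blast+
 thus "f differentiable (at x)" "contU f"
  "i : Basis ==> C_infinity (%x. fder f x i)" by (simp_all add: C_infinity_def)
qed

text \<open>Smoothness by induction on the order over a whole class that is stable under partial
  derivatives; no higher derivative has to be computed.\<close>

lemma C_infinity_closed:
 assumes "!!g. g : G ==> (ALL x. g differentiable (at x)) & (ALL i:Basis. (%x. fder g x i) : G)" and "g : G" shows "C_infinity g"
proof -
 have "C_k k g" if "g : G" for k g using that
 proof (induction k arbitrary: g)
  case 0
  hence "ALL x. g differentiable (at x)" using assms(1) by blast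
  thus ?case by (simp add: differentiable_imp_continuous_within continuous_at_imp_continuous_on)
 next
  case (Suc k)
  thus ?case using assms(1) by simp
 qed
 thus ?thesis using assms(2) by (simp add: C_infinity_def)
qed

lemma axis_Basis [simp]: "(axis i 1 :: real^3) : Basis" by (simp add: axis_in_Basis_iff)

lemma mk_line: "mk i (s, p) = mk i (0, p) + s *\<^sub>R axis i 1" using mk_shift[of i 0 s "fst p" "snd p"] by simp

lemma continuous_mk_line: "continuous_on S (%s. mk i (s, p))" by (intro continuous_on_compose2[OF continuous_mk] continuous_intros) auto

lemma C_infinity_partial:
 assumes "C_infinity f" shows "((%s. f (mk i (s, p))) has_vector_derivative partial i f (mk i (s, p))) (at s)"
  and "C_infinity (partial i f)" "contU (partial i f)"
proof -
 have "(f has_derivative fder f (mk i (s, p))) (at (mk i (s, p)))" using C_infinityD(1)[OF assms] by (simp add: frechet_derivative_works)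
 moreover have "((%s. mk i (s, p)) has_derivative (%h. h *\<^sub>R axis i 1)) (at s)"
 proof -
  have "(%s. mk i (s, p)) = (%s. mk i (0, p) + s *\<^sub>R axis i 1)" by (rule ext) (rule mk_line)
  thus ?thesis by (auto intro!: derivative_eq_intros)
 qed
 ultimately have "((%s. f (mk i (s, p))) has_derivative (%h. fder f (mk i (s, p)) (h *\<^sub>R axis i 1))) (at s)" by (rule has_derivative_compose[rotated])
 moreover have "fder f (mk i (s, p)) (h *\<^sub>R axis i 1) = h *\<^sub>R partial i f (mk i (s, p))" for h unfolding partial_def using C_infinityD(1)[OF assms]
  by (simp add: linear_frechet_derivative linear_cmul)
 ultimately show "((%s. f (mk i (s, p))) has_vector_derivative partial i f (mk i (s, p))) (at s)" unfolding has_vector_derivative_def by simp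
 show c: "C_infinity (partial i f)" unfolding partial_def[abs_def] by (rule C_infinityD(3)[OF assms axis_Basis])
 show "contU (partial i f)" by (rule C_infinityD(2)[OF c])
qed

lemma axis_lattice: "axis i 1 : lattice" by (auto simp: lattice_def axis_def)

lemma periodic_mk: "periodic f ==> f (mk i (1, p)) = f (mk i (0, p))" unfolding mk_line[of i 1 p] using axis_lattice[of i] by (simp add: periodic_def)

lemma torus_partial_zero:
 fixes f g :: "real^3 => real"
 assumes der: "!!s p. ((%s. f (mk i (s, p))) has_real_derivative g (mk i (s, p))) (at s)" and g: "contU g" and per: "periodic f"
 shows "integral\<^sup>L torus g = 0"
proof (rule torus_integral_slices_zero[where i = i])
 show "g : bmeas" by (rule meas_cont[OF g])
 fix p
 have c: "contU (%s. g (mk i (s, p)))" by (rule continuous_on_compose2[OF g continuous_mk_line]) simp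
 have "(LINT s|lborel. g (mk i (s, p)) * indicator {0..1} s) = f (mk i (1, p)) - f (mk i (0, p))"
  using der c by (intro integral_FTC_Icc_real) (auto simp: continuous_on_eq_continuous_at)
 thus "(LBINT s:{0..1}. g (mk i (s, p))) = 0" unfolding lint_def using periodic_mk[OF per] by (simp add: mult.commute)
qed

lemma C1_mk:
 fixes ph ps :: "real^3 => real"
 assumes "!!s p. ((%s. ph (mk i (s, p))) has_real_derivative ps (mk i (s, p))) (at s)" "contU ps" shows "C1 (%s. ph (mk i (s, p))) (%s. ps (mk i (s, p)))"
proof -
 have "contU (%s. ps (mk i (s, p)))" by (rule continuous_on_compose2[OF assms(2) continuous_mk_line]) simp
 thus ?thesis unfolding C1_def using assms(1) by blast
qed

lemma torus_weak_1:
 fixes ph ps :: "real^3 => real"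
 assumes bp: "bp 0 1 u v" and m: "u : bmeas" "v : bmeas" and ph: "!!s p. ((%s. ph (mk 1 (s, p))) has_real_derivative ps (mk 1 (s, p))) (at s)"
  and c: "contU ph" "contU ps" shows "(LINT x|torus. v (x $ 1) * ph x + u (x $ 1) * ps x) = 0"
proof (rule torus_integral_slices_zero[where i = 1])
 have [measurable]: "ph : bmeas" "ps : bmeas" using c by (auto intro: meas_cont)
 note [measurable] = measurable_1[OF m(1)] measurable_1[OF m(2)]
 show "(%x. v (x $ 1) * ph x + u (x $ 1) * ps x) : bmeas" by measurable
 fix p :: "real * real"
 obtain a b where p: "p = (a, b)" by (cases p)
 show "(LBINT s:{0..1}. v (mk 1 (s, p) $ 1) * ph (mk 1 (s, p)) + u (mk 1 (s, p) $ 1) * ps (mk 1 (s, p))) = 0"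
  using bpD(3)[OF bp C1_mk[OF ph c(2), of p]] unfolding p mk_nth by simp
qed

text \<open>On lines in a direction other than the first the factor \<open>h\<close> is constant,
  and the derivative of a periodic function integrates to zero.\<close>

lemma torus_trans_zero:
 fixes f g :: "real^3 => real"
 assumes der: "!!s p. ((%s. f (mk i (s, p))) has_real_derivative g (mk i (s, p))) (at s)"
  and g: "contU g" and per: "periodic f" and i: "i ~= 1" and h: "h : bmeas" shows "(LINT x|torus. h (x $ 1) * g x) = 0"
proof (rule torus_integral_slices_zero[where i = i])
 have [measurable]: "g : bmeas" by (rule meas_cont[OF g])
 note [measurable] = measurable_1[OF h]
 show "(%x. h (x $ 1) * g x) : bmeas" by measurable
 fix p :: "real * real"
 obtain a b where p: "p = (a, b)" by (cases p)
 have c: "contU (%s. g (mk i (s, p)))" by (rule continuous_on_compose2[OF g continuous_mk_line]) simp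
 have "(LINT s|lborel. g (mk i (s, p)) * indicator {0..1} s) = f (mk i (1, p)) - f (mk i (0, p))"
  using der c by (intro integral_FTC_Icc_real) (auto simp: continuous_on_eq_continuous_at)
 hence "(LBINT s:{0..1}. g (mk i (s, p))) = 0" unfolding lint_def using periodic_mk[OF per] by (simp add: mult.commute)
 moreover have "mk i (s, p) $ 1 = a" for s using i unfolding p mk_nth by simp
 ultimately show "(LBINT s:{0..1}. h (mk i (s, p) $ 1) * g (mk i (s, p))) = 0" by simp
qed

lemma vector_derivative_component:
 fixes f :: "real => real^3"
 assumes "(f has_vector_derivative d) (at s)" shows "((%s. f s $ j) has_real_derivative d $ j) (at s)"
 using bounded_linear.has_vector_derivative[OF bounded_linear_vec_nth assms, of j] by (simp add: real_vector_deriv)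

lemma smooth_component:
 fixes ph :: "real^3 => real^3"
 assumes "C_infinity ph" shows "((%s. ph (mk i (s, p)) $ j) has_real_derivative partial i ph (mk i (s, p)) $ j) (at s)"
  and "contU (%x. partial i ph x $ j)" "contU (%x. ph x $ j)" using vector_derivative_component[OF C_infinity_partial(1)[OF assms]]
  C_infinity_partial(3)[OF assms] C_infinityD(2)[OF assms] by (auto intro: continuous_intros)

lemma smooth_scalar:
 fixes ps :: "real^3 => real"
 assumes "C_infinity ps" shows "((%s. ps (mk i (s, p))) has_real_derivative partial i ps (mk i (s, p))) (at s)"
 using C_infinity_partial(1)[OF assms] by (simp add: real_vector_deriv)

lemma periodic_component: "periodic ph ==> periodic (%x. ph x $ j)" by (simp add: periodic_def)

lemma curl_nth:
 "curl F x $ 1 = partial 2 F x $ 3 - partial 3 F x $ 2"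
 "curl F x $ 2 = partial 3 F x $ 1 - partial 1 F x $ 3"
 "curl F x $ 3 = partial 1 F x $ 2 - partial 2 F x $ 1" by (simp_all add: curl_def)

lemma inner_3: "(u::real^3) \<bullet> v = u $ 1 * v $ 1 + u $ 2 * v $ 2 + u $ 3 * v $ 3" by (simp add: inner_vec_def sum_3)

lemma continuous_curl: "C_infinity F ==> contU (curl F)"
proof -
 assume F: "C_infinity F"
 have eq: "curl F = (%x. \<chi> i. if i = 1 then partial 2 F x $ 3 - partial 3 F x $ 2
   else if i = 2 then partial 3 F x $ 1 - partial 1 F x $ 3 else partial 1 F x $ 2 - partial 2 F x $ 1)" by (auto simp: fun_eq_iff vec_eq_iff forall_3 curl_nth)
 have "contU (%x. if i = 1 then partial 2 F x $ 3 - partial 3 F x $ 2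
   else if i = 2 then partial 3 F x $ 1 - partial 1 F x $ 3 else partial 1 F x $ 2 - partial 2 F x $ 1)" for i :: 3
  using smooth_component(2)[OF F] by (cases "i = 1"; cases "i = 2") (auto intro!: continuous_on_diff)
 thus ?thesis unfolding eq by (rule continuous_on_vec_lambda)
qed

lemma continuous_grad: assumes "C_infinity ps" shows "contU (grad ps)"
 unfolding grad_def[abs_def] by (intro continuous_on_vec_lambda C_infinity_partial(3) assms)

section \<open>Trigonometric functions\<close>

text \<open>The Hartley kernel: one real function per frequency gives an orthonormal system indexed
  by the lattice. The price is that differentiation leads from \<open>cas k\<close> to a multiple of
  \<open>cas (- k)\<close>, whence the signs of the indices in what follows.\<close>

definition cas :: "real^3 => real^3 => real" where
 "cas k x = cos (2 * pi * (k \<bullet> x)) + sin (2 * pi * (k \<bullet> x))"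

lemma cas_derivative: "(cas k has_derivative (%h. 2 * pi * (k \<bullet> h) * cas (- k) x)) (at x)" unfolding cas_def[abs_def]
 by (auto intro!: derivative_eq_intros simp: algebra_simps)

lemma cas_0 [simp]: "cas 0 x = 1" by (simp add: cas_def)

lemma continuous_cas: "continuous_on S (cas k)" unfolding cas_def[abs_def] by (intro continuous_intros)

lemma measurable_cas [measurable]: "cas k : bmeas" by (rule meas_cont) (rule continuous_cas)

lemma abs_cas_le: "abs (cas k x) <= 2"
 using abs_cos_le_one[of "2 * pi * (k \<bullet> x)"] abs_sin_le_one[of "2 * pi * (k \<bullet> x)"] unfolding cas_def by linarith

lemma lattice_uminus: "k : lattice ==> - k : lattice" by (simp add: lattice_def)
lemma lattice_add: "k : lattice ==> m : lattice ==> k + m : lattice" by (simp add: lattice_def)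
lemma lattice_diff: "k : lattice ==> m : lattice ==> k - m : lattice" by (simp add: lattice_def)
lemma lattice_0: "0 : lattice" by (simp add: lattice_def)

lemma lattice_inner: "k : lattice ==> m : lattice ==> k \<bullet> m : \<int>" by (simp add: lattice_def inner_3)

lemma trig_periodic:
 assumes "k : lattice" "m : lattice"
 shows "cos (2 * pi * (k \<bullet> (x + m))) = cos (2 * pi * (k \<bullet> x))" "sin (2 * pi * (k \<bullet> (x + m))) = sin (2 * pi * (k \<bullet> x))"
proof -
 obtain n where n: "k \<bullet> m = of_int n" using lattice_inner[OF assms] by (auto elim: Ints_cases)
 have e: "2 * pi * (k \<bullet> (x + m)) = 2 * pi * (k \<bullet> x) + 2 * pi * of_int n" by (simp add: inner_add_right n algebra_simps)
 show "cos (2 * pi * (k \<bullet> (x + m))) = cos (2 * pi * (k \<bullet> x))" "sin (2 * pi * (k \<bullet> (x + m))) = sin (2 * pi * (k \<bullet> x))"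
  unfolding e cos_add sin_add by simp_all
qed

lemma periodic_cas: "k : lattice ==> periodic (cas k)" by (simp add: periodic_def cas_def trig_periodic)

lemma cas_vec_derivative: "((%x. (c * cas k x) *\<^sub>R v) has_derivative (%h. (c * (2 * pi * (k \<bullet> h)) * cas (- k) x) *\<^sub>R v)) (at x)"
 by (rule derivative_eq_intros cas_derivative refl | simp add: algebra_simps)+

lemma C_infinity_cas: "C_infinity (%x. (c * cas k x) *\<^sub>R (v :: 'b::real_normed_vector))"
proof (rule C_infinity_closed[where G = "{g. EX c k. g = (%x. (c * cas k x) *\<^sub>R v)}"])
 fix g assume "g : {g. EX c k. g = (%x. (c * cas k x) *\<^sub>R v)}"
 then obtain c k where g: "g = (%x. (c * cas k x) *\<^sub>R v)" by blast
 have d: "(g has_derivative (%h. (c * (2 * pi * (k \<bullet> h)) * cas (- k) x) *\<^sub>R v)) (at x)" for x unfolding g by (rule cas_vec_derivative)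
 show "(ALL x. g differentiable (at x)) & (ALL i:Basis. (%x. fder g x i) : {g. EX c k. g = (%x. (c * cas k x) *\<^sub>R v)})"
  using d frechet_derivative_at[OF d, symmetric] by (auto simp: differentiable_def)
qed blast

lemma partial_cas: "partial i (%x. (c * cas k x) *\<^sub>R v) x = (c * (2 * pi * k $ i) * cas (- k) x) *\<^sub>R v"
 unfolding partial_def frechet_derivative_at[OF cas_vec_derivative, symmetric] by (simp add: inner_axis)

lemma torus_test_cas: "k : lattice ==> torus_test (%x. (c * cas k x) *\<^sub>R v)"
 unfolding torus_test_def using C_infinity_cas periodic_cas[of k] by (simp add: periodic_def)

lemma integral_trig:
 assumes "k : lattice" "k ~= 0" shows "(LINT x|torus. cos (2 * pi * (k \<bullet> x))) = 0" "(LINT x|torus. sin (2 * pi * (k \<bullet> x))) = 0"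
proof -
 obtain i where i: "k $ i ~= 0" using assms(2) by (auto simp: vec_eq_iff)
 have inner: "EX c. ALL s. k \<bullet> mk i (s, p) = c + s * k $ i" for p
 proof (intro exI allI)
  show "k \<bullet> mk i (s, p) = k \<bullet> mk i (0, p) + s * k $ i" for s by (subst mk_line) (simp add: inner_add_right inner_axis)
 qed
 show "(LINT x|torus. cos (2 * pi * (k \<bullet> x))) = 0"
 proof (rule torus_partial_zero[where i = i and f = "%x. sin (2 * pi * (k \<bullet> x)) / (2 * pi * k $ i)"])
  show "((%s. sin (2 * pi * (k \<bullet> mk i (s, p))) / (2 * pi * k $ i)) has_real_derivative cos (2 * pi * (k \<bullet> mk i (s, p)))) (at s)" for s p
  proof -
   obtain c where c: "!!s. k \<bullet> mk i (s, p) = c + s * k $ i" using inner by blast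
   show ?thesis unfolding c using i by (auto intro!: derivative_eq_intros)
  qed
  show "contU (%x. cos (2 * pi * (k \<bullet> x)))" by (intro continuous_intros)
  show "periodic (%x. sin (2 * pi * (k \<bullet> x)) / (2 * pi * k $ i))" using trig_periodic[OF assms(1)] by (simp add: periodic_def)
 qed
 show "(LINT x|torus. sin (2 * pi * (k \<bullet> x))) = 0"
 proof (rule torus_partial_zero[where i = i and f = "%x. - cos (2 * pi * (k \<bullet> x)) / (2 * pi * k $ i)"])
  show "((%s. - cos (2 * pi * (k \<bullet> mk i (s, p))) / (2 * pi * k $ i)) has_real_derivative sin (2 * pi * (k \<bullet> mk i (s, p)))) (at s)" for s p
  proof -
   obtain c where c: "!!s. k \<bullet> mk i (s, p) = c + s * k $ i" using inner by blast
   show ?thesis unfolding c using i by (auto intro!: derivative_eq_intros)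
  qed
  show "contU (%x. sin (2 * pi * (k \<bullet> x)))" by (intro continuous_intros)
  show "periodic (%x. - cos (2 * pi * (k \<bullet> x)) / (2 * pi * k $ i))" using trig_periodic[OF assms(1)] by (simp add: periodic_def)
 qed
qed

text \<open>The sine term always has zero integral, so orthonormality depends on the difference of
  the frequencies alone.\<close>

lemma cas_mult: "cas k x * cas m x = cos (2 * pi * ((k - m) \<bullet> x)) + sin (2 * pi * ((k + m) \<bullet> x))"
proof -
 have 1: "2 * pi * ((k - m) \<bullet> x) = 2 * pi * (k \<bullet> x) - 2 * pi * (m \<bullet> x)"
  "2 * pi * ((k + m) \<bullet> x) = 2 * pi * (k \<bullet> x) + 2 * pi * (m \<bullet> x)" by (simp_all add: inner_diff_left inner_add_left algebra_simps)
 show ?thesis unfolding cas_def 1 cos_diff sin_add by (simp add: algebra_simps)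
qed

lemma cas_orthonormal:
 assumes "k : lattice" "m : lattice" shows "(LINT x|torus. cas k x * cas m x) = (if k = m then 1 else 0)"
proof -
 have int: "integrable torus (%x. cos (2 * pi * (n \<bullet> x)))" "integrable torus (%x. sin (2 * pi * (n \<bullet> x)))" for n
  by (intro integrable_torus_continuous continuous_intros)+
 have s: "(LINT x|torus. sin (2 * pi * (n \<bullet> x))) = 0" if "n : lattice" for n using integral_trig(2)[OF that] by (cases "n = 0") simp_all
 have c: "(LINT x|torus. cos (2 * pi * (n \<bullet> x))) = (if n = 0 then 1 else 0)" if "n : lattice" for n
  using integral_trig(1)[OF that] measure_torus by (cases "n = 0") simp_all
 have "(LINT x|torus. cas k x * cas m x) = (LINT x|torus. cos (2 * pi * ((k - m) \<bullet> x))) + (LINT x|torus. sin (2 * pi * ((k + m) \<bullet> x)))"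
  unfolding cas_mult by (rule bint_add[OF int])
 thus ?thesis using s[OF lattice_add[OF assms]] c[OF lattice_diff[OF assms]] by simp
qed

section \<open>Fourier series on the torus\<close>

lemma integrable_mult_bounded:
 fixes D g :: "'a => real"
 assumes D: "integrable M D" and g: "g : borel_measurable M" "!!x. x : space M ==> abs (g x) <= C" shows "integrable M (%x. D x * g x)"
proof (rule Bochner_Integration.integrable_bound[of _ "%x. D x * C"])
 show "(%x. D x * g x) : borel_measurable M" using D g(1) by measurable
 show "AE x in M. norm (D x * g x) <= norm (D x * C)"
 proof (rule AE_I2)
  fix x assume "x : space M"
  hence "abs (g x) <= abs C" using g(2)[of x] by linarith
  thus "norm (D x * g x) <= norm (D x * C)" by (simp add: abs_mult mult_left_mono)
 qed
qed (use D in simp)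

text \<open>Embeds the torus as a product of circles. Trigonometric polynomials become restrictions
  of ordinary polynomials to a compact set, where Stone-Weierstrass applies.\<close>

definition trigmap :: "real^3 => (real^3) \<times> (real^3)" where
 "trigmap x = (\<chi> i. cos (2 * pi * x $ i), \<chi> i. sin (2 * pi * x $ i))"

text \<open>Recovers a number in \<open>[0, 1)\<close> from the cosine and sine of its angle; the
  clamp makes \<open>arccos\<close> continuous on the whole line, hence the map Borel.\<close>

definition ang :: "real => real => real" where
 "ang c s = (if 0 <= s then arccos (max (-1) (min 1 c)) / (2 * pi) else 1 - arccos (max (-1) (min 1 c)) / (2 * pi))"

definition trigmap_inv :: "(real^3) \<times> (real^3) => real^3" where
 "trigmap_inv z = (\<chi> i. ang (fst z $ i) (snd z $ i))"

lemma ang_inverse: assumes "0 <= y" "y < 1" shows "ang (cos (2 * pi * y)) (sin (2 * pi * y)) = y"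
proof (cases "y <= 1 / 2")
 case True
 have b: "0 <= 2 * pi * y" "2 * pi * y <= pi" using assms True by (auto simp: field_simps)
 hence "0 <= sin (2 * pi * y)" by (rule sin_ge_zero)
 thus ?thesis using arccos_cos[OF b] by (simp add: ang_def)
next
 case False
 have b: "0 <= 2 * pi * (1 - y)" "2 * pi * (1 - y) <= pi" "0 < 2 * pi * (1 - y)" "2 * pi * (1 - y) < pi" using assms False by (auto simp: field_simps)
 have e: "2 * pi * y = - (2 * pi * (1 - y)) + 2 * pi" by (simp add: algebra_simps)
 have "0 < sin (2 * pi * (1 - y))" using b(3,4) by (rule sin_gt_zero)
 hence s: "~ 0 <= sin (2 * pi * y)" unfolding e by simp
 have c: "cos (2 * pi * y) = cos (2 * pi * (1 - y))" unfolding e by (simp add: cos_diff)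
 show ?thesis using s arccos_cos[OF b(1,2)] unfolding ang_def c by (simp add: field_simps)
qed

lemma trigmap_inverse: assumes "!!i. 0 <= x $ i & x $ i < 1" shows "trigmap_inv (trigmap x) = x"
 using assms by (simp add: trigmap_inv_def trigmap_def vec_eq_iff ang_inverse)

lemma measurable_trigmap_inv: "trigmap_inv : bmeas"
proof (rule borel_measurable_euclidean_space[THEN iffD2], intro ballI)
 fix b :: "real^3" assume "b : Basis"
 then obtain i where b: "b = axis i 1" by (auto simp: Basis_vec_def)
 have [measurable]: "(%z::(real^3) \<times> (real^3). fst z $ i) : bmeas" "(%z::(real^3) \<times> (real^3). snd z $ i) : bmeas"
  by (intro meas_cont continuous_intros)+
 have "contU (%c. arccos (max (-1) (min 1 c)))" by (rule continuous_on_compose2[OF continuous_on_arccos']) (auto intro!: continuous_intros)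
 hence [measurable]: "(%c. arccos (max (-1) (min 1 c))) : bmeas" by (rule meas_cont)
 have "(%z. trigmap_inv z \<bullet> b) = (%z. ang (fst z $ i) (snd z $ i))" by (simp add: trigmap_inv_def b inner_axis fun_eq_iff)
 thus "(%z. trigmap_inv z \<bullet> b) : bmeas" unfolding ang_def by simp
qed

lemma continuous_trigmap: "continuous_on S trigmap" unfolding trigmap_def[abs_def] by (intro continuous_intros continuous_on_vec_lambda)

lemma trigmap_compact: "EX K. compact K & range trigmap \<subseteq> K"
proof (intro exI conjI)
 show "compact (cbox (-1) 1 \<times> cbox (-1) 1 :: ((real^3) \<times> (real^3)) set)" by (intro compact_Times compact_cbox)
 show "range trigmap \<subseteq> cbox (-1) 1 \<times> cbox (-1) 1" by (auto simp: trigmap_def mem_box_cart)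
qed

lemma cas_times_cos: "cos (2 * pi * x $ i) * cas k x = (cas (k + axis i 1) x + cas (k - axis i 1) x) / 2"
proof -
 have e: "2 * pi * ((k + axis i 1) \<bullet> x) = 2 * pi * (k \<bullet> x) + 2 * pi * x $ i" "2 * pi * ((k - axis i 1) \<bullet> x) = 2 * pi * (k \<bullet> x) - 2 * pi * x $ i"
  by (simp_all add: inner_add_left inner_diff_left inner_axis' algebra_simps)
 show ?thesis unfolding cas_def e by (simp add: sin_add cos_add sin_diff cos_diff algebra_simps)
qed

lemma cas_times_sin: "sin (2 * pi * x $ i) * cas k x = (cas (- k + axis i 1) x - cas (- k - axis i 1) x) / 2"
proof -
 have e: "2 * pi * ((- k + axis i 1) \<bullet> x) = 2 * pi * x $ i - 2 * pi * (k \<bullet> x)" "2 * pi * ((- k - axis i 1) \<bullet> x) = - (2 * pi * (k \<bullet> x) + 2 * pi * x $ i)"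
  by (simp_all add: inner_add_left inner_diff_left inner_axis' algebra_simps)
 show ?thesis unfolding cas_def e sin_minus cos_minus by (simp add: sin_add cos_add sin_diff cos_diff algebra_simps)
qed

lemma inner_trigmap_Basis:
 assumes "b : Basis" shows "EX i. (ALL x. trigmap x \<bullet> b = cos (2 * pi * x $ i)) | (ALL x. trigmap x \<bullet> b = sin (2 * pi * x $ i))"
proof -
 from assms consider i where "b = (axis i 1, 0)" | i where "b = (0, axis i 1)" by (auto simp: Basis_prod_def Basis_vec_def)
 thus ?thesis by cases (auto simp: trigmap_def inner_axis)
qed

context
 fixes D :: "real^3 => real"
 assumes D: "integrable torus D" and coeffs: "!!k. k : lattice ==> (LINT x|torus. cas k x * D x) = 0"
begin

text \<open>The multiplier algebra of the annihilator of the trigonometric system is all polynomials.\<close>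

definition V :: "(real^3 => real) set" where
 "V = {g. contU g & (EX C. ALL x. abs (g x) <= C) & (ALL k:lattice. (LINT x|torus. D x * (g x * cas k x)) = 0)}"

definition Mult :: "(real^3 => real) set" where
 "Mult = {m. ALL g:V. (%x. m x * g x) : V}"

lemma V_int: "g : V ==> integrable torus (%x. D x * (g x * cas k x))"
proof -
 assume "g : V"
 then obtain C where g: "contU g" "!!x. abs (g x) <= C" unfolding V_def by blast
 show ?thesis
 proof (rule integrable_mult_bounded[OF D])
  show "(%x. g x * cas k x) : borel_measurable torus" by (intro borel_measurable_torus meas_cont continuous_intros g continuous_cas)
  fix x
  show "abs (g x * cas k x) <= C * 2" unfolding abs_mult using g(2)[of x] abs_cas_le[of k x] by (intro mult_mono) auto
 qed
qed

lemma Mult_trig: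
 assumes m: "contU m" "!!x. abs (m x) <= 1"
  and e: "!!k. k : lattice ==> EX a b s. a : lattice & b : lattice & (ALL x. m x * cas k x = (cas a x + s * cas b x) / 2)" shows "m : Mult" unfolding Mult_def
proof safe
 fix g assume g: "g : V"
 then obtain C where C: "contU g" "!!x. abs (g x) <= C" unfolding V_def by blast
 show "(%x. m x * g x) : V" unfolding V_def
 proof (intro CollectI conjI ballI exI allI)
  show "contU (%x. m x * g x)" by (intro continuous_intros C m)
  show "abs (m x * g x) <= 1 * C" for x unfolding abs_mult using C(2)[of x] m(2) by (intro mult_mono) auto
  fix k :: "real^3" assume "k : lattice"
  from e[OF this] obtain a b s where ab: "a : lattice" "b : lattice" and k: "!!x. m x * cas k x = (cas a x + s * cas b x) / 2" by blast
  have "D x * (m x * g x * cas k x) = D x * g x * (m x * cas k x)" for x by (simp only: mult_ac)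
  hence "(LINT x|torus. D x * (m x * g x * cas k x)) = (LINT x|torus. 1 / 2 * (D x * (g x * cas a x) + s * (D x * (g x * cas b x))))"
   unfolding k by (simp add: algebra_simps add_divide_distrib)
  also have "... = 0" using g ab V_int[OF g, of a] V_int[OF g, of b] unfolding V_def by simp
  finally show "(LINT x|torus. D x * (m x * g x * cas k x)) = 0" .
 qed
qed

lemma Mult_cos: "(%x. cos (2 * pi * x $ i)) : Mult"
proof (rule Mult_trig)
 fix k assume k: "k : lattice"
 show "EX a b s. a : lattice & b : lattice & (ALL x. cos (2 * pi * x $ i) * cas k x = (cas a x + s * cas b x) / 2)"
  using cas_times_cos[of _ i k] lattice_add[OF k axis_lattice] lattice_diff[OF k axis_lattice]
  by (intro exI[of _ "k + axis i 1"] exI[of _ "k - axis i 1"] exI[of _ 1]) simp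
qed (auto intro!: continuous_intros)

lemma Mult_sin: "(%x. sin (2 * pi * x $ i)) : Mult"
proof (rule Mult_trig)
 fix k assume k: "k : lattice"
 show "EX a b s. a : lattice & b : lattice & (ALL x. sin (2 * pi * x $ i) * cas k x = (cas a x + s * cas b x) / 2)"
  using cas_times_sin[of _ i k] lattice_add[OF lattice_uminus[OF k] axis_lattice] lattice_diff[OF lattice_uminus[OF k] axis_lattice]
  by (intro exI[of _ "- k + axis i 1"] exI[of _ "- k - axis i 1"] exI[of _ "- 1"]) simp
qed (auto intro!: continuous_intros)

lemma V_add: assumes "g : V" "h : V" shows "(%x. g x + h x) : V"
proof -
 from assms obtain B C where g: "contU g" "!!x. abs (g x) <= B" and h: "contU h" "!!x. abs (h x) <= C" unfolding V_def by blast
 show ?thesis unfolding V_def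
 proof (intro CollectI conjI ballI exI allI)
  show "contU (%x. g x + h x)" by (intro continuous_intros g h)
  show "abs (g x + h x) <= B + C" for x using g(2)[of x] h(2)[of x] by linarith
  fix k :: "real^3" assume k: "k : lattice"
  have "(LINT x|torus. D x * ((g x + h x) * cas k x)) = (LINT x|torus. D x * (g x * cas k x) + D x * (h x * cas k x))" by (simp add: algebra_simps)
  also have "... = 0" using bint_add[OF V_int[OF assms(1)] V_int[OF assms(2)]] assms k unfolding V_def by simp
  finally show "(LINT x|torus. D x * ((g x + h x) * cas k x)) = 0" .
 qed
qed

lemma V_cmult: assumes "g : V" shows "(%x. c * g x) : V"
proof -
 from assms obtain B where g: "contU g" "!!x. abs (g x) <= B" unfolding V_def by blast
 show ?thesis unfolding V_def
 proof (intro CollectI conjI ballI exI allI)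
  show "contU (%x. c * g x)" by (intro continuous_intros g)
  show "abs (c * g x) <= abs c * B" for x using g(2)[of x] by (simp add: abs_mult mult_left_mono)
  fix k :: "real^3" assume k: "k : lattice"
  have "(LINT x|torus. D x * (c * g x * cas k x)) = (LINT x|torus. c * (D x * (g x * cas k x)))" by (intro bint_cong) (simp_all add: mult_ac)
  also have "... = 0" using assms k unfolding V_def by simp
  finally show "(LINT x|torus. D x * (c * g x * cas k x)) = 0" .
 qed
qed

lemma Mult_add: "m : Mult ==> n : Mult ==> (%x. m x + n x) : Mult" unfolding Mult_def using V_add by (simp add: distrib_right)

lemma Mult_mult: "m : Mult ==> n : Mult ==> (%x. m x * n x) : Mult" unfolding Mult_def by (simp add: mult.assoc)

lemma Mult_const: "(%x. c) : Mult" unfolding Mult_def using V_cmult by simp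

lemma Mult_sum: "finite A ==> (!!i. i : A ==> m i : Mult) ==> (%x. SUM i:A. m i x) : Mult"
 by (induction A rule: finite_induct) (auto intro: Mult_const Mult_add)

lemma Mult_polynomial:
 assumes "real_polynomial_function p" shows "(%x. p (trigmap x)) : Mult" using assms
proof induction
 case (linear f)
 have e: "f z = (SUM b:Basis. f b * (z \<bullet> b))" for z
 proof -
  have "f z = f (SUM b:Basis. (z \<bullet> b) *\<^sub>R b)" by (simp add: euclidean_representation)
  also have "... = (SUM b:Basis. (z \<bullet> b) *\<^sub>R f b)" using linear by (simp add: linear_sum bounded_linear.linear linear_cmul)
  finally show ?thesis by (simp add: mult.commute)
 qed
 have "(%x. SUM b:Basis. f b * (trigmap x \<bullet> b)) : Mult"
 proof (intro Mult_sum finite_Basis Mult_mult Mult_const)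
  fix b :: "(real^3) \<times> (real^3)" assume "b : Basis"
  from inner_trigmap_Basis[OF this] show "(%x. trigmap x \<bullet> b) : Mult" using Mult_cos Mult_sin by auto
 qed
 moreover have "(%x. f (trigmap x)) = (%x. SUM b:Basis. f b * (trigmap x \<bullet> b))" by (rule ext) (rule e)
 ultimately show ?case by simp
next
 case (const c) show ?case by (rule Mult_const)
next
 case (add f g) from add.IH show ?case by (rule Mult_add)
next
 case (mult f g) from mult.IH show ?case by (rule Mult_mult)
qed

lemma one_in_V: "(%x. 1) : V" unfolding V_def using coeffs by (auto intro!: exI[of _ 1] simp: mult.commute)

lemma integral_polynomial_zero:
 assumes "real_polynomial_function p" shows "(LINT x|torus. D x * p (trigmap x)) = 0"
proof -
 have "ALL g:V. (%x. p (trigmap x) * g x) : V" using Mult_polynomial[OF assms] unfolding Mult_def by (rule CollectD)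
 from bspec[OF this one_in_V] have "(%x. p (trigmap x) * 1) : V" .
 hence "ALL k:lattice. (LINT x|torus. D x * (p (trigmap x) * 1 * cas k x)) = 0" unfolding V_def by simp
 from bspec[OF this lattice_0] show ?thesis by (simp add: cas_def)
qed

lemma integral_continuous_zero:
 assumes F: "contU F" shows "(LINT x|torus. D x * F (trigmap x)) = 0"
proof -
 obtain K where K: "compact K" "range trigmap \<subseteq> K" using trigmap_compact by blast
 define I where "I = (LINT x|torus. abs (D x))"
 have "abs (LINT x|torus. D x * F (trigmap x)) <= e * I" if "0 < e" for e
 proof -
  obtain p where p: "real_polynomial_function p" "!!z. z : K ==> abs (F z - p z) < e"
   using Stone_Weierstrass_real_polynomial_function[OF K(1) continuous_on_subset[OF F] \<open>0 < e\<close>] by blast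
  have mp: "contU p" using continuous_on_polymonial_function p(1) real_polynomial_function_eq by blast
  have diff: "contU (%x. F (trigmap x) - p (trigmap x))"
   by (intro continuous_intros continuous_on_compose2[OF F continuous_trigmap] continuous_on_compose2[OF mp continuous_trigmap]) auto
  have b: "abs (F (trigmap x) - p (trigmap x)) <= e" for x using p(2)[of "trigmap x"] K(2) by force
  have i1: "integrable torus (%x. D x * (F (trigmap x) - p (trigmap x)))"
   by (rule integrable_mult_bounded[OF D _ b]) (intro borel_measurable_torus meas_cont diff)
  have "bounded (p ` K)" using K(1) mp continuous_on_subset by (intro compact_imp_bounded compact_continuous_image) auto
  then obtain B where B: "!!z. z : K ==> abs (p z) <= B" unfolding bounded_iff by (auto simp del: all_simps)
  have i2: "integrable torus (%x. D x * p (trigmap x))"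
  proof (rule integrable_mult_bounded[OF D])
   show "(%x. p (trigmap x)) : borel_measurable torus" by (intro borel_measurable_torus meas_cont continuous_on_compose2[OF mp continuous_trigmap]) auto
   show "abs (p (trigmap x)) <= B" for x using B K(2) by blast
  qed
  have "(LINT x|torus. D x * F (trigmap x)) = (LINT x|torus. D x * (F (trigmap x) - p (trigmap x)) + D x * p (trigmap x))" by (simp add: algebra_simps)
  also have "... = (LINT x|torus. D x * (F (trigmap x) - p (trigmap x)))" using bint_add[OF i1 i2] integral_polynomial_zero[OF p(1)] by simp
  also have "abs (...) <= (LINT x|torus. abs (D x * (F (trigmap x) - p (trigmap x))))"
   using integral_norm_bound[of torus "%x. D x * (F (trigmap x) - p (trigmap x))"] by simp
  also have "... <= (LINT x|torus. e * abs (D x))"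
  proof (rule integral_mono)
   show "integrable torus (%x. abs (D x * (F (trigmap x) - p (trigmap x))))" using i1 by simp
   show "integrable torus (%x. e * abs (D x))" using D by simp
   fix x show "abs (D x * (F (trigmap x) - p (trigmap x))) <= e * abs (D x)"
    using mult_left_mono[OF b[of x], of "abs (D x)"] by (simp add: abs_mult mult.commute)
  qed
  finally show ?thesis by (simp add: I_def)
 qed
 note le = this
 have "I >= 0" unfolding I_def by simp
 have "abs (LINT x|torus. D x * F (trigmap x)) <= 0 + e" if "0 < e" for e
 proof -
  have "abs (LINT x|torus. D x * F (trigmap x)) <= e / (I + 1) * I" using that \<open>I >= 0\<close> by (intro le) simp
  also have "... <= e" using that \<open>I >= 0\<close> by (simp add: field_simps)
  finally show ?thesis by simp
 qed
 hence "abs (LINT x|torus. D x * F (trigmap x)) <= 0" by (rule field_le_epsilon)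
 thus ?thesis by simp
qed

lemma measurable_trigmap: "trigmap : bmeas" by (rule meas_cont) (rule continuous_trigmap)

lemma ind_trig_int:
 assumes "A : sets borel" shows "integrable torus (%x. D x * indicator A (trigmap x))"
proof (rule integrable_mult_bounded[OF D])
 have "(%x. indicator A (trigmap x) :: real) : bmeas" using measurable_compose[OF measurable_trigmap borel_measurable_indicator[OF assms]] by simp
 thus "(%x. indicator A (trigmap x) :: real) : borel_measurable torus" by (rule borel_measurable_torus)
 show "abs (indicator A (trigmap x) :: real) <= 1" for x by (auto simp: indicator_def)
qed

lemma integral_closed_zero:
 assumes A: "closed A" shows "(LINT x|torus. D x * indicator A (trigmap x)) = 0"
proof (cases "A = {}")
 case False
 \<comment> \<open>Continuous cut-offs that decrease to the indicator of the closed set.\<close>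
 define F where "F n z = max 0 (1 - real n * infdist z A)" for n z
 have F: "contU (F n)" for n unfolding F_def by (intro continuous_intros)
 have lim: "(%n. F n z) \<longlonglongrightarrow> indicator A z" for z
 proof (cases "z : A")
  case True
  thus ?thesis by (simp add: F_def)
 next
  case nz: False
  hence p: "0 < infdist z A" using A False infdist_nonneg[of z A] in_closed_iff_infdist_zero[OF A False, of z] by linarith
  obtain N where N: "1 / infdist z A < real N" using reals_Archimedean2 by blast
  have "F n z = 0" if "n >= N" for n
  proof -
   have "1 / infdist z A < real n" using N that by (meson less_le_trans of_nat_le_iff)
   hence "1 < real n * infdist z A" using p by (simp add: field_simps)
   thus ?thesis by (simp add: F_def)
  qed
  hence "\<forall>\<^sub>F n in sequentially. F n z = indicator A z" using nz by (auto simp: eventually_sequentially)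
  thus ?thesis by (rule tendsto_eventually)
 qed
 have Fb: "abs (F n z) <= 1" for n z using infdist_nonneg[of z A] by (simp add: F_def)
 have m: "(%x. D x * F n (trigmap x)) : borel_measurable torus" for n
 proof -
  have "(%x. F n (trigmap x)) : borel_measurable torus" by (intro borel_measurable_torus meas_cont continuous_on_compose2[OF F continuous_trigmap]) auto
  thus ?thesis using borel_measurable_integrable[OF D] by measurable
 qed
 have "(%n. LINT x|torus. D x * F n (trigmap x)) \<longlonglongrightarrow> (LINT x|torus. D x * indicator A (trigmap x))"
 proof (rule integral_dominated_convergence[where w = "%x. abs (D x)"])
  show "(%x. D x * indicator A (trigmap x)) : borel_measurable torus" using ind_trig_int[of A] A by (intro borel_measurable_integrable) simp
  show "AE x in torus. (%n. D x * F n (trigmap x)) \<longlonglongrightarrow> D x * indicator A (trigmap x)" by (intro AE_I2 tendsto_intros lim)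
  show "AE x in torus. norm (D x * F n (trigmap x)) <= abs (D x)" for n using Fb by (intro AE_I2) (simp add: abs_mult mult_left_le)
 qed (use D m in auto)
 moreover have "(LINT x|torus. D x * F n (trigmap x)) = 0" for n by (rule integral_continuous_zero[OF F])
 ultimately show ?thesis by (simp add: LIMSEQ_const_iff)
qed simp

lemma integral_borel_zero:
 assumes "A : sets borel" shows "(LINT x|torus. D x * indicator A (trigmap x)) = 0"
proof -
 have sig: "sets borel = sigma_sets UNIV (Collect closed :: ((real^3) \<times> (real^3)) set set)" unfolding borel_eq_closed by (rule sets_measure_of) simp
 have "A : sigma_sets UNIV (Collect closed)" using assms sig by simp
 note A = this
 have "Int_stable (Collect closed :: ((real^3) \<times> (real^3)) set set)" by (auto simp: Int_stable_def)
 moreover have "(Collect closed :: ((real^3) \<times> (real^3)) set set) \<subseteq> Pow UNIV" by simp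
 ultimately show ?thesis using A
 proof (induction rule: sigma_sets_induct_disjoint)
  case (basic A) thus ?case using integral_closed_zero by simp
 next
  case empty thus ?case by simp
 next
  case (compl A)
  hence A: "A : sets borel" using sig by simp
  have "(LINT x|torus. D x * indicator (UNIV - A) (trigmap x)) = (LINT x|torus. D x - D x * indicator A (trigmap x))"
   by (intro bint_cong) (auto simp: indicator_def)
  also have "... = (LINT x|torus. D x)" using bint_diff[OF D ind_trig_int[OF A]] compl(2) by simp
  also have "... = 0" using coeffs[OF lattice_0] by simp
  finally show ?case .
 next
  case (union A)
  have A: "A i : sets borel" for i using union(2) sig by auto
  have U: "(\<Union>i. A i) : sets borel" using A by auto
  have "(%n. LINT x|torus. D x * indicator (\<Union>i<n. A i) (trigmap x)) \<longlonglongrightarrow> (LINT x|torus. D x * indicator (\<Union>i. A i) (trigmap x))"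
  proof (rule integral_dominated_convergence[where w = "%x. abs (D x)"])
   show "(%x. D x * indicator (\<Union>i. A i) (trigmap x)) : borel_measurable torus" by (rule borel_measurable_integrable[OF ind_trig_int[OF U]])
   show "(%x. D x * indicator (\<Union>i<n. A i) (trigmap x)) : borel_measurable torus" for n
    using A by (intro borel_measurable_integrable[OF ind_trig_int]) auto
   show "AE x in torus. (%n. D x * indicator (\<Union>i<n. A i) (trigmap x)) \<longlonglongrightarrow> D x * indicator (\<Union>i. A i) (trigmap x)"
    by (intro AE_I2 tendsto_intros LIMSEQ_indicator_UN)
   show "AE x in torus. norm (D x * indicator (\<Union>i<n. A i) (trigmap x)) <= abs (D x)" for n by (intro AE_I2) (auto simp: indicator_def)
  qed (use D in auto)
  moreover have "(LINT x|torus. D x * indicator (\<Union>i<n. A i) (trigmap x)) = 0" for n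
  proof -
   have "indicator (\<Union>i<n. A i) z = (SUM i<n. indicator (A i) z :: real)" for z
    using union(1) by (subst indicator_UN_disjoint) (auto simp: disjoint_family_on_def)
   hence "(LINT x|torus. D x * indicator (\<Union>i<n. A i) (trigmap x)) = (LINT x|torus. (SUM i<n. D x * indicator (A i) (trigmap x)))"
    by (simp add: sum_distrib_left)
   also have "... = (SUM i<n. LINT x|torus. D x * indicator (A i) (trigmap x))" by (intro bint_sum ind_trig_int A)
   finally show ?thesis using union(3) by simp
  qed
  ultimately show ?case by (simp add: LIMSEQ_const_iff)
 qed
qed

text \<open>Vanishing passes from polynomials to continuous functions, to closed sets and, by a
  Dynkin argument, to Borel sets in the image of \<open>trigmap\<close>. Since
  \<open>trigmap\<close> has a Borel inverse off the boundary of the cube, these pull back to all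
  measurable subsets of the cube up to null sets.\<close>

lemma fourier_unique: "AE x in torus. D x = 0"
proof -
 interpret finite_measure torus by (rule finite_measure_torus)
 show ?thesis
 proof (rule density_zero[OF D])
 fix A assume "A : sets torus"
 hence "A : sets lebesgue" "A \<subseteq> cbox 0 1" by (auto simp: torus_def sets_restrict_space)
 then obtain U N N' where A: "A = U \<union> N" "N \<subseteq> N'" "N' : null_sets lborel" "U : sets lborel" by (auto elim: sets_completionE)
 have bd: "AE x in lborel. x ~: cbox 0 1 - box 0 (1::real^3)" by (intro negligible_imp_AE_lborel negligible_frontier_interval)
 have ae: "AE x in torus. indicator A x *\<^sub>R D x = D x * indicator (trigmap_inv -` U) (trigmap x)" unfolding AE_torus using AE_not_in[OF A(3)] bd
 proof eventually_elim
  case (elim x)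
  show ?case
  proof
   assume "x : cbox 0 1"
   hence "x : box 0 1" using elim by blast
   hence "trigmap_inv (trigmap x) = x" by (intro trigmap_inverse) (auto simp: mem_box_cart less_imp_le)
   moreover have "x : A \<longleftrightarrow> x : U" using A elim by auto
   ultimately show "indicator A x *\<^sub>R D x = D x * indicator (trigmap_inv -` U) (trigmap x)" by (simp add: indicator_def)
  qed
 qed
 have U: "trigmap_inv -` U : sets borel" using measurable_sets[OF measurable_trigmap_inv, of U] A(4) by simp
 have "set_lebesgue_integral torus A D = (LINT x|torus. D x * indicator (trigmap_inv -` U) (trigmap x))" unfolding lint_def
 proof (rule integral_cong_AE[OF _ _ ae])
  show "(%x. indicator A x *\<^sub>R D x) : borel_measurable torus" using \<open>A : sets torus\<close> borel_measurable_integrable[OF D] by measurable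
  show "(%x. D x * indicator (trigmap_inv -` U) (trigmap x)) : borel_measurable torus" by (rule borel_measurable_integrable[OF ind_trig_int[OF U]])
 qed
 thus "set_lebesgue_integral torus A D = 0" using integral_borel_zero[OF U] by simp
qed
qed

end

text \<open>Cubes of frequencies exhaust the lattice and are symmetric under the change from
  \<open>k\<close> to \<open>- k\<close>, which differentiation of \<open>cas\<close> brings
  in.\<close>

definition lat :: "nat => (real^3) set" where
 "lat K = {k : lattice. ALL i. abs (k $ i) <= real K}"

lemma finite_lat: "finite (lat K)"
proof (rule finite_subset)
 show "lat K \<subseteq> (%(a, b, c). vector [of_int a, of_int b, of_int c]) ` ({- int K..int K} \<times> {- int K..int K} \<times> {- int K..int K})"
 proof
  fix k assume k: "k : lat K"
  hence "\<exists>n\<in>{- int K..int K}. k $ i = of_int n" for i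
  proof -
   from k obtain n where n: "k $ i = of_int n" unfolding lat_def lattice_def by (blast elim: Ints_cases)
   have "abs (k $ i) <= real K" using k unfolding lat_def by simp
   hence "n : {- int K..int K}" unfolding n by simp linarith
   thus ?thesis using n by blast
  qed
  then obtain n where n: "!!i. n i : {- int K..int K}" "!!i. k $ i = of_int (n i)" by metis
  show "k : (%(a, b, c). vector [of_int a, of_int b, of_int c]) ` ({- int K..int K} \<times> {- int K..int K} \<times> {- int K..int K})"
  proof (rule image_eqI[where x = "(n 1, n 2, n 3)"])
   show "k = (case (n 1, n 2, n 3) of (a, b, c) => vector [of_int a, of_int b, of_int c])" by (simp add: vec_eq_iff forall_3 vector_3 n(2))
  qed (use n(1) in simp)
 qed
qed simp

lemma lat_lattice: "lat K \<subseteq> lattice" unfolding lat_def by blast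

lemma lat_mono: "K <= L ==> lat K \<subseteq> lat L" unfolding lat_def by (auto intro: order_trans)

lemma lattice_lat: assumes "k : lattice" obtains N where "!!K. N <= K ==> k : lat K"
proof
 fix K assume K: "nat \<lceil>norm k\<rceil> <= K"
 have "abs (k $ i) <= real K" for i using component_le_norm_cart[of k i] K real_nat_ceiling_ge[of "norm k"] by (smt (verit) of_nat_le_iff)
 thus "k : lat K" using assms unfolding lat_def by blast
qed

lemma uminus_lat: "k : lat K ==> - k : lat K" unfolding lat_def by (simp add: lattice_uminus)

lemma sum_lat_uminus: "(SUM k:lat K. f (- k)) = (SUM k:lat K. f k)" by (rule sum.reindex_bij_witness[of _ uminus uminus]) (auto simp: uminus_lat)

section \<open>Fourier coefficients: Bessel, Riesz-Fischer and Parseval\<close>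

definition coef :: "real^3 => (real^3 => real) => real" where
 "coef k f = (LINT x|torus. cas k x * f x)"

definition vcoef :: "real^3 => (real^3 => real^3) => real^3" where
 "vcoef k F = (LINT x|torus. cas k x *\<^sub>R F x)"

lemma cas_vec_integrable:
 assumes "integrable torus (F :: real^3 => real^3)" shows "integrable torus (%x. cas k x *\<^sub>R F x)"
proof (rule Bochner_Integration.integrable_bound[of _ "%x. 2 *\<^sub>R F x"])
 show "(%x. cas k x *\<^sub>R F x) : borel_measurable torus" using borel_measurable_integrable[OF assms] borel_measurable_torus[OF measurable_cas] by measurable
 show "AE x in torus. norm (cas k x *\<^sub>R F x) <= norm (2 *\<^sub>R F x)" by (intro AE_I2) (simp add: mult_right_mono abs_cas_le)
qed (use assms in simp)

lemma integrable_nth: "integrable M F ==> integrable M (%x. (F x :: real^3) $ i)" using integrable_inner_left[of "axis i 1" M F] by (simp add: inner_axis)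

lemma integral_nth: "integrable M F ==> (LINT x|M. F x) $ i = (LINT x|M. (F x :: real^3) $ i)"
 using integral_inner_left[of "axis i 1" M F] by (simp add: inner_axis)

lemma integrable_vecI:
 assumes "!!i. integrable M (%x. (F x :: real^3) $ i)" shows "integrable M F"
proof -
 have "integrable M (%x. SUM i:UNIV. (F x $ i) *\<^sub>R axis i (1::real))" using assms by (intro Bochner_Integration.integrable_sum integrable_scaleR_left)
 moreover have "(SUM i:UNIV. (F x $ i) *\<^sub>R axis i (1::real)) = F x" for x using basis_expansion[of "F x"] by (simp add: scalar_mult_eq_scaleR)
 ultimately show ?thesis by simp
qed

lemma vcoef_nth: "integrable torus F ==> vcoef k F $ i = coef k (%x. F x $ i)"
 unfolding vcoef_def coef_def using integral_nth[OF cas_vec_integrable, of F k i] by simp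

lemma vcoef_inner:
 assumes "integrable torus F" shows "(LINT x|torus. F x \<bullet> ((c * cas k x) *\<^sub>R v)) = c * (vcoef k F \<bullet> v)"
proof -
 have "(LINT x|torus. F x \<bullet> ((c * cas k x) *\<^sub>R v)) = (LINT x|torus. c * ((cas k x *\<^sub>R F x) \<bullet> v))" by (simp add: mult_ac)
 also have "... = c * (vcoef k F \<bullet> v)"
  unfolding vcoef_def using integral_inner_left[of v torus "%x. cas k x *\<^sub>R F x"] cas_vec_integrable[OF assms] by simp
 finally show ?thesis .
qed

lemma borel_nth: "F : borel_measurable M ==> (%x. (F x :: real^3) $ i) : borel_measurable M"
 using borel_measurable_inner[of F M "%_. axis i 1"] by (simp add: inner_axis)

lemma borel_vecI:
 assumes "!!i. (%x. (F x :: real^3) $ i) : borel_measurable M" shows "F : borel_measurable M"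
proof (rule borel_measurable_euclidean_space[THEN iffD2], intro ballI)
 fix b :: "real^3" assume "b : Basis"
 then obtain i where "b = axis i 1" by (auto simp: Basis_vec_def)
 thus "(%x. F x \<bullet> b) : borel_measurable M" using assms by (simp add: inner_axis)
qed

text \<open>The factor \<open>1\<close> keeps the summands in the shape for which the lemmas on
  \<open>cas\<close> are stated.\<close>

definition tsum :: "(real^3 => real^3) => (real^3) set => real^3 => real^3" where
 "tsum c A x = (SUM k:A. (1 * cas k x) *\<^sub>R c k)"

lemma continuous_tsum: "continuous_on S (tsum c A)" unfolding tsum_def[abs_def] by (intro continuous_intros continuous_cas)

lemma integral_tsum:
 assumes f: "integrable torus f"
 shows "integrable torus (%x. f x \<bullet> tsum c A x)" "(LINT x|torus. f x \<bullet> tsum c A x) = (SUM k:A. c k \<bullet> vcoef k f)"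
proof -
 have i: "integrable torus (%x. f x \<bullet> ((1 * cas k x) *\<^sub>R c k))" for k
  using integrable_inner_left[of "c k" torus "%x. cas k x *\<^sub>R f x"] cas_vec_integrable[OF f, of k] by simp
 thus "integrable torus (%x. f x \<bullet> tsum c A x)" unfolding tsum_def inner_sum_right by (intro Bochner_Integration.integrable_sum)
 show "(LINT x|torus. f x \<bullet> tsum c A x) = (SUM k:A. c k \<bullet> vcoef k f)"
  unfolding tsum_def inner_sum_right bint_sum[OF i] vcoef_inner[OF f] by (simp add: inner_commute)
qed

lemma vcoef_cas: "m : lattice ==> k : lattice ==> vcoef m (%x. (1 * cas k x) *\<^sub>R v) = (if m = k then v else 0)"
 unfolding vcoef_def using cas_orthonormal[of m k] integrable_torus_continuous[of "%x. cas m x * cas k x"] by (simp add: continuous_cas continuous_on_mult)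

lemma vcoef_tsum:
 assumes "finite A" "A \<subseteq> lattice" "m : lattice" shows "vcoef m (tsum c A) = (if m : A then c m else 0)"
proof -
 have i: "integrable torus (%x. cas m x *\<^sub>R (1 * cas k x) *\<^sub>R c k)" for k by (intro integrable_torus_continuous continuous_intros continuous_cas)
 have "vcoef m (tsum c A) = (SUM k:A. vcoef m (%x. (1 * cas k x) *\<^sub>R c k))" unfolding vcoef_def tsum_def scaleR_sum_right by (rule bint_sum[OF i])
 also have "... = (SUM k:A. if m = k then c k else 0)" using assms by (intro sum.cong refl vcoef_cas) auto
 finally show ?thesis using assms by simp
qed

lemma integral_tsum_square:
 assumes "finite A" "A \<subseteq> lattice"
 shows "integrable torus (%x. (norm (tsum c A x))^2)" "(LINT x|torus. (norm (tsum c A x))^2) = (SUM k:A. (norm (c k))^2)"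
proof -
 note i = integral_tsum[OF integrable_torus_continuous[OF continuous_tsum], of c A c A]
 show "integrable torus (%x. (norm (tsum c A x))^2)" using i(1) by (simp add: power2_norm_eq_inner)
 show "(LINT x|torus. (norm (tsum c A x))^2) = (SUM k:A. (norm (c k))^2)"
  unfolding power2_norm_eq_inner i(2) using vcoef_tsum[OF assms] assms by (intro sum.cong refl) auto
qed

lemma bounded_integrable:
 fixes f :: "real^3 => 'b::{banach, second_countable_topology}"
 assumes "f : bmeas" "!!x. norm (f x) <= C" shows "integrable torus f" using assms by (intro integrable_torus_bounded[where C = C]) auto

lemma bessel:
 fixes f :: "real^3 => real^3"
 assumes f: "f : bmeas" "!!x. norm (f x) <= C" and A: "finite A" "A \<subseteq> lattice" shows "(SUM k:A. (norm (vcoef k f))^2) <= C^2"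
proof -
 let ?s = "tsum (%k. vcoef k f) A"
 have n: "(norm (f x))^2 <= C^2" for x using power_mono[OF f(2)[of x], of 2] by simp
 hence i2: "integrable torus (%x. (norm (f x))^2)" using f(1) by (intro bounded_integrable[where C = "C^2"]) auto
 note s = integral_tsum[OF bounded_integrable[OF f], of "%k. vcoef k f" A] integral_tsum_square[OF A, of "%k. vcoef k f"]
 have "0 <= (LINT x|torus. (norm (f x - ?s x))^2)" by simp
 also have "... = (LINT x|torus. ((norm (f x))^2 - 2 * (f x \<bullet> ?s x)) + (norm (?s x))^2)"
  by (simp add: power2_norm_eq_inner inner_diff inner_commute algebra_simps)
 also have "... = (LINT x|torus. (norm (f x))^2) - 2 * (LINT x|torus. f x \<bullet> ?s x) + (LINT x|torus. (norm (?s x))^2)" using i2 s(1,3) by simp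
 also have "... = (LINT x|torus. (norm (f x))^2) - (SUM k:A. (norm (vcoef k f))^2)" unfolding s(2,4) by (simp add: power2_norm_eq_inner)
 also have "(LINT x|torus. (norm (f x))^2) <= (LINT x|torus. C^2)" by (rule integral_mono[OF i2 _ n]) (intro integrable_torus_continuous continuous_intros)
 finally show ?thesis using measure_torus by simp
qed

lemma lat_sum_convergent:
 fixes f :: "real^3 => real"
 assumes "!!k. 0 <= f k" "!!K. (SUM k:lat K. f k) <= B" shows "convergent (%K. SUM k:lat K. f k)"
proof (rule Bseq_mono_convergent)
 show "Bseq (%K. SUM k:lat K. f k)" using assms by (intro BseqI'[where K = B]) (simp add: sum_nonneg)
 show "ALL m. \<forall>n\<ge>m. (SUM k:lat m. f k) <= (SUM k:lat n. f k)" using assms by (intro allI impI sum_mono2 finite_lat lat_mono) auto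
qed

text \<open>The sums of \<open>c k \<bullet> d k\<close> are differences of two monotone bounded
  sequences, those of \<open>c k \<bullet> d k + abs (c k \<bullet> d k)\<close> and of
  \<open>abs (c k \<bullet> d k)\<close>.\<close>

lemma lat_product_convergent:
 fixes c d :: "real^3 => real^3"
 assumes c: "!!K. (SUM k:lat K. (norm (c k))^2) <= M" and d: "!!K. (SUM k:lat K. (norm (d k))^2) <= N" shows "convergent (%K. SUM k:lat K. c k \<bullet> d k)"
proof -
 have b: "abs (c k \<bullet> d k) <= (norm (c k))^2 + (norm (d k))^2" for k
  using Cauchy_Schwarz_ineq2[of "c k" "d k"] sum_squares_bound[of "norm (c k)" "norm (d k)"]
   mult_nonneg_nonneg[OF norm_ge_zero[of "c k"] norm_ge_zero[of "d k"]] by linarith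
 have 1: "convergent (%K. SUM k:lat K. abs (c k \<bullet> d k))"
 proof (rule lat_sum_convergent)
  show "(SUM k:lat K. abs (c k \<bullet> d k)) <= M + N" for K
   using sum_mono[of "lat K" "%k. abs (c k \<bullet> d k)" "%k. (norm (c k))^2 + (norm (d k))^2", OF b] c[of K] d[of K] by (simp add: sum.distrib)
 qed simp
 have 2: "convergent (%K. SUM k:lat K. c k \<bullet> d k + abs (c k \<bullet> d k))"
 proof (rule lat_sum_convergent)
  show "(SUM k:lat K. c k \<bullet> d k + abs (c k \<bullet> d k)) <= 2 * (M + N)" for K
  proof -
   have "c k \<bullet> d k + abs (c k \<bullet> d k) <= 2 * ((norm (c k))^2 + (norm (d k))^2)" for k using b[of k] abs_ge_self[of "c k \<bullet> d k"] unfolding distrib_left by linarith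
   hence "(SUM k:lat K. c k \<bullet> d k + abs (c k \<bullet> d k)) <= (SUM k:lat K. 2 * ((norm (c k))^2 + (norm (d k))^2))" by (rule sum_mono)
   thus ?thesis using c[of K] d[of K] by (simp add: sum.distrib sum_distrib_left[symmetric])
  qed
  show "0 <= c k \<bullet> d k + abs (c k \<bullet> d k)" for k by linarith
 qed
 from convergent_diff[OF 2 1] show ?thesis by (simp add: sum.distrib)
qed

text \<open>The function is a sum, absolutely convergent almost everywhere, of frequency blocks
  between fast growing cubes. Its pairing with a bounded \<open>g\<close> is first found along the
  subsequence \<open>r\<close>; since all partial sums over cubes converge, the limit is the
  same.\<close>

lemma riesz_fischer:
 fixes c :: "real^3 => real^3"
 assumes bound: "!!K. (SUM k:lat K. (norm (c k))^2) <= M"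
 obtains F :: "real^3 => real^3" where "periodic F" "F : bmeas" "integrable torus F"
  "ALL g C. g : bmeas --> (ALL x. norm (g x) <= C) --> (%K. SUM k:lat K. c k \<bullet> vcoef k g) \<longlonglongrightarrow> (LINT x|torus. F x \<bullet> g x)"
  "!!k. k : lattice ==> vcoef k F = c k"
proof -
 define S where "S K = (SUM k:lat K. (norm (c k))^2)" for K
 have "convergent S" unfolding S_def[abs_def] using bound by (intro lat_sum_convergent) auto
 hence "Cauchy S" by (rule convergent_Cauchy)
 hence "EX N. \<forall>m\<ge>N. \<forall>n\<ge>N. abs (S m - S n) < (1 / 4) ^ j" for j unfolding Cauchy_def dist_real_def by simp
 then obtain N where N: "!!j m n. m >= N j ==> n >= N j ==> abs (S m - S n) < (1 / 4) ^ j" by metis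
 \<comment> \<open>The sum guarantees \<open>N j <= r j\<close>, and the summand \<open>j\<close>
   makes \<open>r\<close> strictly increasing.\<close>
 define r where "r j = j + (\<Sum>i\<le>j. N i)" for j
 have r: "strict_mono r" unfolding strict_mono_Suc_iff r_def by simp
 have rN: "N j <= r j" for j unfolding r_def using member_le_sum[of j "{..j}" N] by simp
 have rS: "r j <= r (Suc j)" for j using r by (simp add: strict_mono_Suc_iff less_imp_le)
 define A where "A j = (case j of 0 => lat (r 0) | Suc i => lat (r (Suc i)) - lat (r i))" for j
 have A: "finite (A j)" "A j \<subseteq> lattice" for j unfolding A_def using finite_lat lat_lattice by (auto split: nat.split)
 have sumA: "(SUM j<Suc n. SUM k:A j. h k) = (SUM k:lat (r n). h k)" for h :: "real^3 => real" and n
 proof (induction n)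
  case (Suc n)
  have "(SUM k:lat (r (Suc n)). h k) = (SUM k:lat (r (Suc n)) - lat (r n). h k) + (SUM k:lat (r n). h k)"
   by (rule sum.subset_diff[OF lat_mono[OF rS] finite_lat])
  thus ?case using Suc by (simp add: A_def)
 qed (simp add: A_def)
 define d where "d j = tsum c (A j)" for j
 have md[measurable]: "d j : bmeas" for j unfolding d_def by (rule meas_cont[OF continuous_tsum])
 have id: "integrable torus (d j)" for j unfolding d_def by (rule integrable_torus_continuous[OF continuous_tsum])
 have dS: "(LINT x|torus. norm (d (Suc j) x)) <= (1 / 2) ^ j" for j
 proof -
  note sq = integral_tsum_square[OF A, of c "Suc j", folded d_def]
  have "(SUM k:A (Suc j). (norm (c k))^2) = S (r (Suc j)) - S (r j)"
   unfolding S_def A_def using sum.subset_diff[OF lat_mono[OF rS] finite_lat, of "%k. (norm (c k))^2" j] by simp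
  also have "... <= (1 / 4) ^ j" using N[of j "r (Suc j)" "r j"] rN[of j] rS[of j] by linarith
  finally have s: "(LINT x|torus. (norm (d (Suc j) x))^2) <= (1 / 4) ^ j" using sq(2) by simp
  have "(LINT x|torus. norm (d (Suc j) x)) <= (LINT x|torus. ((1 / 2) ^ j + 2 ^ j * (norm (d (Suc j) x))^2) / 2)"
  proof (rule integral_mono)
   show "integrable torus (%x. norm (d (Suc j) x))" using id by simp
   show "integrable torus (%x. ((1 / 2) ^ j + 2 ^ j * (norm (d (Suc j) x))^2) / 2)"
    using integrable_torus_continuous[of "%_. (1 / 2 :: real) ^ j"] sq(1) by simp
   fix x
   \<comment> \<open>Young's inequality with weight \<open>2 ^ j\<close>: it converts the bound
     \<open>(1 / 4) ^ j\<close> for the square integral into the bound \<open>(1 / 2) ^ j\<close>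
     for the \<open>L1\<close>-norm.\<close>
   have "0 <= (1 - 2 ^ j * norm (d (Suc j) x))^2 / 2 ^ j" by simp
   also have "... = (1 / 2) ^ j + 2 ^ j * (norm (d (Suc j) x))^2 - 2 * norm (d (Suc j) x)" by (simp add: power2_eq_square field_simps power_one_over)
   finally show "norm (d (Suc j) x) <= ((1 / 2) ^ j + 2 ^ j * (norm (d (Suc j) x))^2) / 2" by simp
  qed
  also have "... = ((1 / 2) ^ j + 2 ^ j * (LINT x|torus. (norm (d (Suc j) x))^2)) / 2"
   using sq(1) integrable_torus_continuous[of "%_. (1 / 2 :: real) ^ j"] measure_torus by simp
  also have "... <= ((1 / 2) ^ j + 2 ^ j * (1 / 4) ^ j) / 2" using s by simp
  also have "... = (1 / 2) ^ j" by (simp add: power_mult_distrib[symmetric])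
  finally show ?thesis .
 qed
 have sn: "summable (%j. LINT x|torus. norm (d j x))"
 proof (subst summable_Suc_iff[symmetric], rule summable_comparison_test[where g = "%j. (1 / 2) ^ j"], intro exI allI impI)
  show "norm (LINT x|torus. norm (d (Suc j) x)) <= (1 / 2) ^ j" for j using dS[of j] by simp
 qed (simp add: summable_geometric)
 have aes: "AE x in torus. summable (%j. norm (d j x))"
 proof -
  have "(\<integral>\<^sup>+x. (\<Sum>j. ennreal (norm (d j x))) \<partial>torus) = (\<Sum>j. \<integral>\<^sup>+x. ennreal (norm (d j x)) \<partial>torus)"
   by (intro nn_integral_suminf borel_measurable_torus) measurable
  also have "... = (\<Sum>j. ennreal (LINT x|torus. norm (d j x)))" using id by (intro suminf_cong nn_integral_eq_integral) auto
  also have "... = ennreal (\<Sum>j. LINT x|torus. norm (d j x))" using sn by (intro suminf_ennreal2) auto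
  finally have "AE x in torus. (\<Sum>j. ennreal (norm (d j x))) ~= \<infinity>" by (intro nn_integral_noteq_infinite borel_measurable_torus) auto
  thus ?thesis by eventually_elim (rule summable_suminf_not_top, auto)
 qed
 define F where "F x = (\<Sum>j. d j x)" for x
 have mF: "F : bmeas" unfolding F_def[abs_def] by measurable
 have iF: "integrable torus F" unfolding F_def[abs_def] by (rule integrable_suminf[OF id]) (use aes sn in auto)
 have pF: "periodic F"
 proof -
  have "d j (x + k) = d j x" if "k : lattice" for j x k
   unfolding d_def tsum_def using A(2)[of j] periodic_cas that unfolding periodic_def by (intro sum.cong refl) auto
  thus ?thesis unfolding periodic_def F_def by simp
 qed
 have main: "(%K. SUM k:lat K. c k \<bullet> vcoef k g) \<longlonglongrightarrow> (LINT x|torus. F x \<bullet> g x)"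
  if g: "g : bmeas" "!!x. norm (g x) <= C" for g C
 proof -
  have dg: "integrable torus (%x. d j x \<bullet> g x)" "(LINT x|torus. d j x \<bullet> g x) = (SUM k:A j. c k \<bullet> vcoef k g)" for j
   using integral_tsum[OF bounded_integrable[OF g], of c "A j"] by (simp_all add: d_def inner_commute)
  have "(%j. LINT x|torus. d j x \<bullet> g x) sums (LINT x|torus. (\<Sum>j. d j x \<bullet> g x))"
  proof (rule sums_integral[OF dg(1)])
   show "AE x in torus. summable (%j. norm (d j x \<bullet> g x))" using aes
   proof eventually_elim
    case (elim x)
    show ?case by (rule summable_comparison_test'[OF summable_mult2[OF elim, of "norm (g x)"], of 0]) (simp add: Cauchy_Schwarz_ineq2)
   qed
   show "summable (%j. LINT x|torus. norm (d j x \<bullet> g x))"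
   proof (rule summable_comparison_test[OF _ summable_mult2[OF sn, of C]], intro exI allI impI)
    fix j
    have "(LINT x|torus. norm (d j x \<bullet> g x)) <= (LINT x|torus. norm (d j x) * C)"
    proof (rule integral_mono)
     show "norm (d j x \<bullet> g x) <= norm (d j x) * C" for x using order_trans[OF Cauchy_Schwarz_ineq2 mult_left_mono[OF g(2)[of x] norm_ge_zero]] by simp
    qed (use dg(1)[of j] id[of j] in \<open>auto simp del: real_norm_def\<close>)
    thus "norm (LINT x|torus. norm (d j x \<bullet> g x)) <= (LINT x|torus. norm (d j x)) * C" by simp
   qed
  qed
  moreover have "(LINT x|torus. (\<Sum>j. d j x \<bullet> g x)) = (LINT x|torus. F x \<bullet> g x)"
  proof (rule integral_cong_AE)
   show "AE x in torus. (\<Sum>j. d j x \<bullet> g x) = F x \<bullet> g x" using aes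
   proof eventually_elim
    case (elim x)
    show ?case unfolding F_def by (rule bounded_linear.suminf[OF bounded_linear_inner_left summable_norm_cancel[OF elim], symmetric])
   qed
  qed (use g(1) mF in \<open>auto intro!: borel_measurable_torus\<close>)
  ultimately have "(%j. SUM k:A j. c k \<bullet> vcoef k g) sums (LINT x|torus. F x \<bullet> g x)" by (simp add: dg(2))
  hence "(%n. SUM j<Suc n. SUM k:A j. c k \<bullet> vcoef k g) \<longlonglongrightarrow> (LINT x|torus. F x \<bullet> g x)"
   unfolding sums_def by (rule LIMSEQ_Suc)
  hence sub: "((%K. SUM k:lat K. c k \<bullet> vcoef k g) \<circ> r) \<longlonglongrightarrow> (LINT x|torus. F x \<bullet> g x)"
   unfolding sumA by (simp add: comp_def)
  have "convergent (%K. SUM k:lat K. c k \<bullet> vcoef k g)" by (rule lat_product_convergent[OF bound bessel[OF g finite_lat lat_lattice]])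
  then obtain L where L: "(%K. SUM k:lat K. c k \<bullet> vcoef k g) \<longlonglongrightarrow> L" unfolding convergent_def by blast
  from LIMSEQ_subseq_LIMSEQ[OF L r] sub have "L = (LINT x|torus. F x \<bullet> g x)" by (rule LIMSEQ_unique)
  with L show ?thesis by simp
 qed
 have "vcoef k F = c k" if k: "k : lattice" for k
 proof -
  obtain N where N: "!!K. N <= K ==> k : lat K" using lattice_lat[OF k] by blast
  have "vcoef k F \<bullet> v = c k \<bullet> v" for v
  proof -
   let ?g = "%x. (1 * cas k x) *\<^sub>R v"
   have "(SUM m:lat K. c m \<bullet> vcoef m ?g) = c k \<bullet> v" if "N <= K" for K
   proof -
    have "(SUM m:lat K. c m \<bullet> vcoef m ?g) = (SUM m:lat K. if m = k then c m \<bullet> v else 0)"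
     using lat_lattice[of K] k by (intro sum.cong refl) (auto simp: vcoef_cas[simplified])
    thus ?thesis using N[OF that] by (simp add: finite_lat)
   qed
   hence lim: "(%K. SUM m:lat K. c m \<bullet> vcoef m ?g) \<longlonglongrightarrow> c k \<bullet> v" by (intro tendsto_eventually eventually_sequentiallyI)
   have gm: "?g : bmeas" by (intro meas_cont continuous_intros continuous_cas)
   have gb: "norm (?g x) <= 2 * norm v" for x using abs_cas_le[of k x] by (simp add: mult_right_mono)
   show ?thesis using LIMSEQ_unique[OF main[OF gm gb] lim] vcoef_inner[OF iF, of 1 k v] by simp
  qed
  thus ?thesis using vector_eq_rdot by blast
 qed
 thus thesis using that[OF pF mF iF] main by blast
qed

lemma vector_fourier_unique:
 assumes D: "integrable torus (D :: real^3 => real^3)" and z: "!!k. k : lattice ==> vcoef k D = 0" shows "AE x in torus. D x = 0"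
proof -
 have "AE x in torus. D x $ i = 0" for i
 proof (rule fourier_unique[OF integrable_nth[OF D]])
  fix k :: "real^3" assume "k : lattice"
  with z vcoef_nth[OF D, of k i] show "(LINT x|torus. cas k x * D x $ i) = 0" by (simp add: coef_def)
 qed
 from this[of 1] this[of 2] this[of 3] show ?thesis by eventually_elim (simp add: vec_eq_iff forall_3)
qed

lemma vcoef_diff:
 assumes "integrable torus F" "integrable torus G" shows "vcoef k (%x. F x - G x) = vcoef k F - vcoef k G"
 unfolding vcoef_def scaleR_diff_right using cas_vec_integrable[OF assms(1)] cas_vec_integrable[OF assms(2)] by simp

text \<open>The function that Riesz-Fischer builds from the coefficients of \<open>f\<close> has
  those coefficients again, so it is \<open>f\<close> almost everywhere.\<close>

lemma parseval:
 assumes f: "f : bmeas" "!!x. norm (f x) <= C" and g: "g : bmeas" "!!x. norm (g x) <= C'"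
 shows "(%K. SUM k:lat K. vcoef k f \<bullet> vcoef k g) \<longlonglongrightarrow> (LINT x|torus. f x \<bullet> g x)"
proof -
 have fi: "integrable torus f" by (rule bounded_integrable[OF f])
 obtain F where F: "F : bmeas" "integrable torus F"
  "(%K. SUM k:lat K. vcoef k f \<bullet> vcoef k g) \<longlonglongrightarrow> (LINT x|torus. F x \<bullet> g x)" "!!k. k : lattice ==> vcoef k F = vcoef k f"
  using riesz_fischer[OF bessel[OF f finite_lat lat_lattice], of thesis] g by blast
 have "AE x in torus. F x - f x = 0" by (rule vector_fourier_unique) (use F(2,4) fi in \<open>auto simp: vcoef_diff\<close>)
 hence "(LINT x|torus. F x \<bullet> g x) = (LINT x|torus. f x \<bullet> g x)"
  by (intro integral_cong_AE borel_measurable_torus borel_measurable_inner F(1) f(1) g(1)) auto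
 with F(3) show ?thesis by simp
qed

section \<open>The vector potential\<close>

lemma curl_cas: "curl (%x. (c * cas k x) *\<^sub>R v) x = ((2 * pi * c) * cas (- k) x) *\<^sub>R cross3 k v"
 unfolding curl_def partial_cas by (simp add: vec_eq_iff forall_3 cross3_def algebra_simps)

lemma grad_cas: "grad (cas k) x = ((2 * pi) * cas (- k) x) *\<^sub>R k" using partial_cas[of _ 1 k "1::real" x] unfolding grad_def by (simp add: vec_eq_iff)

lemma vcoef_weak_curl:
 assumes "weak_curl_eq A B" "integrable torus A" "integrable torus B" "k : lattice" shows "vcoef k B = (2 * pi) *\<^sub>R cross3 (vcoef (- k) A) k"
proof -
 have "vcoef k B \<bullet> v = ((2 * pi) *\<^sub>R cross3 (vcoef (- k) A) k) \<bullet> v" for v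
 proof -
  have "(LINT x|torus. A x \<bullet> curl (%x. (1 * cas k x) *\<^sub>R v) x) = (LINT x|torus. B x \<bullet> ((1 * cas k x) *\<^sub>R v))"
   using assms(1) torus_test_cas[OF assms(4)] unfolding weak_curl_eq_def by blast
  hence "vcoef k B \<bullet> v = (2 * pi) * (vcoef (- k) A \<bullet> cross3 k v)" unfolding curl_cas vcoef_inner[OF assms(2)] vcoef_inner[OF assms(3)] by simp
  thus ?thesis by (simp add: cross3_def inner_3 algebra_simps)
 qed
 thus ?thesis using vector_eq_rdot by blast
qed

lemma vcoef_weak_div:
 assumes "weak_div_free B" "integrable torus B" "k : lattice" shows "vcoef k B \<bullet> k = 0"
proof -
 have "torus_test (%x. (1 * cas (- k) x) *\<^sub>R (1::real))" by (rule torus_test_cas[OF lattice_uminus[OF assms(3)]])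
 hence "(LINT x|torus. B x \<bullet> grad (cas (- k)) x) = 0" using assms(1) unfolding weak_div_free_def by simp
 thus ?thesis unfolding grad_cas vcoef_inner[OF assms(2)] by simp
qed

lemma norm_cross_dot': "(norm (cross3 x y))^2 + (x \<bullet> y)^2 = (norm x)^2 * (norm y)^2"
 using norm_and_cross_eq_0 unfolding power2_norm_eq_inner by (simp add: cross3_def inner_3 power2_eq_square algebra_simps)

text \<open>A coefficient of the difference has zero cross product and zero inner product with
  \<open>k\<close>, so it vanishes for \<open>k ~= 0\<close>; the zero mean settles
  \<open>k = 0\<close>.\<close>

lemma vector_potential_unique:
 assumes A: "vector_potential B A" and A': "vector_potential B A'" and B: "integrable torus B" shows "AE x in torus. A x = A' x"
proof -
 have i: "integrable torus A" "integrable torus A'" using A A' unfolding vector_potential_def zero_mean_def by auto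
 have "AE x in torus. A x - A' x = 0"
 proof (rule vector_fourier_unique)
  show "integrable torus (%x. A x - A' x)" using i by simp
  fix k :: "real^3" assume k: "k : lattice"
  show "vcoef k (%x. A x - A' x) = 0"
  proof (cases "k = 0")
   case True
   thus ?thesis unfolding vcoef_diff[OF i] using A A' by (simp add: vcoef_def vector_potential_def zero_mean_def)
  next
   case False
   let ?d = "vcoef k A - vcoef k A'"
   have "(2 * pi) *\<^sub>R cross3 (vcoef k A) (- k) = (2 * pi) *\<^sub>R cross3 (vcoef k A') (- k)"
    using vcoef_weak_curl[OF _ i(1) B lattice_uminus[OF k]] vcoef_weak_curl[OF _ i(2) B lattice_uminus[OF k]] A A' unfolding vector_potential_def by simp
   hence "cross3 ?d k = 0" by (simp add: cross3_def vec_eq_iff forall_3 algebra_simps)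
   moreover have "?d \<bullet> k = 0" using vcoef_weak_div[OF _ i(1) k] vcoef_weak_div[OF _ i(2) k] A A'
    unfolding vector_potential_def by (simp add: inner_diff_left)
   ultimately have "?d = 0" using norm_cross_dot'[of ?d k] False by simp
   thus ?thesis by (simp add: vcoef_diff[OF i])
  qed
 qed
 thus ?thesis by simp
qed

text \<open>Uniqueness almost everywhere lets any explicit potential replace the one selected by
  \<open>SOME\<close>.\<close>

lemma helicity_eq:
 assumes A: "vector_potential B A" and B: "integrable torus B" shows "helicity B = (LINT x|torus. A x \<bullet> B x)"
proof -
 have v: "vector_potential B (inverse_curl B)" unfolding inverse_curl_def by (rule someI[of _ A]) (rule A)
 have "A : borel_measurable torus" "inverse_curl B : borel_measurable torus" using A v unfolding vector_potential_def zero_mean_def by auto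
 thus ?thesis unfolding helicity_def using vector_potential_unique[OF v A B] borel_measurable_integrable[OF B]
  by (intro integral_cong_AE borel_measurable_inner) auto
qed

lemma vector_potential_cong:
 assumes ae: "AE x in torus. B x = b x" and i: "integrable torus B" "integrable torus b" and A: "vector_potential b A" shows "vector_potential B A"
proof -
 have "(LINT x|torus. B x \<bullet> ph x) = (LINT x|torus. b x \<bullet> ph x)" if "torus_test ph" for ph
 proof (rule integral_cong_AE)
  have "ph : borel_measurable torus" using that C_infinityD(2) by (intro borel_measurable_torus meas_cont) (auto simp: torus_test_def)
  thus "(%x. B x \<bullet> ph x) : borel_measurable torus" "(%x. b x \<bullet> ph x) : borel_measurable torus" using i by auto
  show "AE x in torus. B x \<bullet> ph x = b x \<bullet> ph x" using ae by eventually_elim simp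
 qed
 thus ?thesis using A unfolding vector_potential_def weak_curl_eq_def by simp
qed

lemma helicity_cong:
 assumes ae: "AE x in torus. B x = b x" and i: "integrable torus B" "integrable torus b" and A: "vector_potential b A" shows "helicity B = helicity b"
proof -
 have "A : borel_measurable torus" using A unfolding vector_potential_def zero_mean_def by auto
 hence "(LINT x|torus. A x \<bullet> B x) = (LINT x|torus. A x \<bullet> b x)"
 proof (intro integral_cong_AE borel_measurable_inner)
  show "AE x in torus. A x \<bullet> B x = A x \<bullet> b x" using ae by eventually_elim simp
 qed (use i in auto)
 thus ?thesis unfolding helicity_eq[OF A i(2)] helicity_eq[OF vector_potential_cong[OF assms] i(1)] .
qed

lemma periodic_bounded:
 fixes g :: "real^3 => 'b::real_normed_vector"
 assumes "contU g" "periodic g" obtains C where "!!x. norm (g x) <= C"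
proof -
 have "bounded (g ` cbox 0 1)" using assms(1) continuous_on_subset by (intro compact_imp_bounded compact_continuous_image compact_cbox) auto
 then obtain C where C: "!!x. x : cbox 0 1 ==> norm (g x) <= C" unfolding bounded_iff by (meson imageI)
 show thesis
 proof
  fix x :: "real^3"
  define k :: "real^3" where "k = (\<chi> i. - of_int \<lfloor>x $ i\<rfloor>)"
  have "k : lattice" unfolding lattice_def k_def by simp
  hence "g (x + k) = g x" using assms(2) unfolding periodic_def by blast
  moreover have "x + k : cbox 0 1" unfolding cbox01 k_def by (simp add: le_diff_eq) linarith
  ultimately show "norm (g x) <= C" using C[of "x + k"] by simp
 qed
qed

text \<open>Helicity truncated to the frequencies in \<open>lat K\<close>, with the potential
  written out in terms of the coefficients of the field. The term \<open>k = 0\<close> is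
  zero.\<close>

definition H :: "nat => (real^3 => real^3) => real" where
 "H K b = - (SUM k:lat K. (cross3 k (b (- k)) \<bullet> b k) / (2 * pi * (norm k)^2))"

lemma coef_partial:
 fixes f :: "real^3 => real"
 assumes der: "!!s p. ((%s. f (mk i (s, p))) has_real_derivative g (mk i (s, p))) (at s)" and c: "contU f" "contU g" and per: "periodic f" and k: "k : lattice"
 shows "coef k g = - (2 * pi * k $ i) * coef (- k) f"
proof -
 have d: "((%s. cas k (mk i (s, p)) * f (mk i (s, p))) has_real_derivative
   (2 * pi * k $ i) * (cas (- k) (mk i (s, p)) * f (mk i (s, p))) + cas k (mk i (s, p)) * g (mk i (s, p))) (at s)" for s p
 proof -
  have "((%s. cas k (mk i (s, p))) has_real_derivative (2 * pi * k $ i) * cas (- k) (mk i (s, p))) (at s)"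
   using C_infinity_partial(1)[OF C_infinity_cas[of 1 k "1::real"], of i p s] partial_cas[of i 1 k "1::real"] by (simp add: real_vector_deriv)
  from DERIV_mult[OF this der[of p s]] show ?thesis by (simp add: algebra_simps)
 qed
 have p: "periodic (%x. cas k x * f x)" using per periodic_cas[OF k] unfolding periodic_def by simp
 have "(LINT x|torus. (2 * pi * k $ i) * (cas (- k) x * f x) + cas k x * g x) = 0"
  by (rule torus_partial_zero[OF d _ p]) (intro continuous_intros c continuous_cas)
 moreover have "integrable torus (%x. cas (- k) x * f x)" "integrable torus (%x. cas k x * g x)"
  by (intro integrable_torus_continuous continuous_intros c continuous_cas)+
 ultimately show ?thesis unfolding coef_def by simp
qed

lemma vcoef_curl:
 assumes ph: "torus_test ph" and k: "k : lattice" shows "vcoef k (curl ph) = - (2 * pi) *\<^sub>R cross3 k (vcoef (- k) ph)"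
proof -
 have C: "C_infinity ph" and p: "periodic ph" using ph by (auto simp: torus_test_def)
 have i: "integrable torus (curl ph)" "integrable torus ph" by (auto intro: integrable_torus_continuous continuous_curl C_infinityD C)
 have e: "coef k (%x. partial i ph x $ j) = - (2 * pi * k $ i) * coef (- k) (%x. ph x $ j)" for i j
  using coef_partial[OF smooth_component(1)[OF C] smooth_component(3,2)[OF C] periodic_component[OF p] k] .
 have d: "coef k (%x. partial i ph x $ j - partial i' ph x $ j') = coef k (%x. partial i ph x $ j) - coef k (%x. partial i' ph x $ j')" for i j i' j'
  unfolding coef_def right_diff_distrib by (intro bint_diff integrable_torus_continuous continuous_intros continuous_cas smooth_component[OF C])
 show ?thesis by (simp add: vec_eq_iff forall_3 vcoef_nth[OF i(1)] curl_nth d e cross3_def vcoef_nth[OF i(2)] algebra_simps)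
qed

lemma vcoef_grad:
 assumes ps: "torus_test ps" and k: "k : lattice" shows "vcoef k (grad ps) = - (2 * pi * coef (- k) ps) *\<^sub>R k"
proof -
 have C: "C_infinity ps" and p: "periodic ps" using ps by (auto simp: torus_test_def)
 have i: "integrable torus (grad ps)" by (auto intro: integrable_torus_continuous continuous_grad C)
 have e: "coef k (partial i ps) = - (2 * pi * k $ i) * coef (- k) ps" for i
  using smooth_scalar[OF C] C_infinityD(2)[OF C] C_infinity_partial(3)[OF C] p k by (intro coef_partial) auto
 have "(%x. grad ps x $ i) = partial i ps" for i by (simp add: grad_def fun_eq_iff)
 thus ?thesis by (simp add: vec_eq_iff vcoef_nth[OF i] e)
qed

lemma periodic_partial:
 fixes ph :: "real^3 => 'b::real_normed_vector"
 assumes "torus_test ph" shows "periodic (partial i ph)" unfolding periodic_def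
proof (intro allI ballI)
 fix x k :: "real^3" assume k: "k : lattice"
 have d: "(ph has_derivative fder ph (x + k)) (at (x + k))"
  using assms C_infinityD(1) unfolding torus_test_def by (blast intro: frechet_derivative_works[THEN iffD1])
 have "((%y. ph (y + k)) has_derivative fder ph (x + k)) (at x)" using has_derivative_compose[OF has_derivative_add_const[OF has_derivative_ident] d] by simp
 moreover have "(%y. ph (y + k)) = ph" using assms k unfolding torus_test_def periodic_def by auto
 ultimately show "partial i ph (x + k) = partial i ph x" unfolding partial_def using frechet_derivative_at by metis
qed

lemma lattice_norm_ge_1: assumes "k : lattice" "k ~= 0" shows "1 <= norm k"
proof -
 obtain i where i: "k $ i ~= 0" using assms(2) by (auto simp: vec_eq_iff)
 moreover have "k $ i : \<int>" using assms(1) unfolding lattice_def by simp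
 ultimately have "1 <= abs (k $ i)" by (rule Ints_nonzero_abs_ge1[rotated])
 thus ?thesis using component_le_norm_cart[of k i] by linarith
qed

lemma vector_potential_fourier:
 assumes B: "B : bmeas" "!!x. norm (B x) <= C" and b0: "vcoef 0 B = 0" and bdiv: "!!k. k : lattice ==> vcoef k B \<bullet> k = 0"
 obtains A where "vector_potential B A" and "(%K. H K (%k. vcoef k B)) \<longlonglongrightarrow> (LINT x|torus. A x \<bullet> B x)"
proof -
 have C0: "0 <= C" using B(2)[of 0] norm_ge_zero[of "B 0"] by linarith
 \<comment> \<open>Biot-Savart law in frequency space: the coefficients of the potential that is
   orthogonal to \<open>k\<close>. The sign and the index \<open>- k\<close> come from
   differentiating \<open>cas\<close>.\<close>
 define a where "a k = - (1 / (2 * pi * (norm k)^2)) *\<^sub>R cross3 k (vcoef (- k) B)" for k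
 have na: "(norm (a k))^2 <= (norm (vcoef (- k) B))^2" if k: "k : lattice" for k
 proof (cases "k = 0")
  case False
  note n1 = lattice_norm_ge_1[OF k False]
  have "norm (a k) = norm (cross3 k (vcoef (- k) B)) / (2 * pi * (norm k)^2)" unfolding a_def by simp
  also have "... <= norm k * norm (vcoef (- k) B) / (2 * pi * (norm k)^2)"
  proof (intro divide_right_mono)
   show "norm (cross3 k (vcoef (- k) B)) <= norm k * norm (vcoef (- k) B)"
    
   proof (rule power2_le_imp_le)
    show "(norm (cross3 k (vcoef (- k) B)))^2 <= (norm k * norm (vcoef (- k) B))^2"
     using norm_cross_dot'[of k "vcoef (- k) B"] zero_le_power2[of "k \<bullet> vcoef (- k) B"] unfolding power_mult_distrib by linarith
   qed simp
  qed simp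
  also have "... = norm (vcoef (- k) B) * (1 / (2 * pi * norm k))" using False by (simp add: power2_eq_square)
  also have "... <= norm (vcoef (- k) B) * 1"
  proof (intro mult_left_mono)
   have "1 * 1 <= (2 * pi) * norm k" using n1 pi_gt3 by (intro mult_mono) auto
   thus "1 / (2 * pi * norm k) <= 1" by (simp add: divide_le_eq)
  qed simp
  finally show ?thesis by (simp add: power_mono)
 qed (simp add: a_def)
 have "(SUM k:lat K. (norm (a k))^2) <= C^2" for K
 proof -
  have "(SUM k:lat K. (norm (a k))^2) <= (SUM k:lat K. (norm (vcoef (- k) B))^2)" using lat_lattice by (intro sum_mono na) auto
  also have "... <= C^2" unfolding sum_lat_uminus[of "%k. (norm (vcoef k B))^2"] by (rule bessel[OF B finite_lat lat_lattice])
  finally show ?thesis .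
 qed
 note aK = this
 obtain A where A: "periodic A" "A : bmeas" "integrable torus A"
  "ALL g C. g : bmeas --> (ALL x. norm (g x) <= C) --> (%K. SUM k:lat K. a k \<bullet> vcoef k g) \<longlonglongrightarrow> (LINT x|torus. A x \<bullet> g x)"
  "!!k. k : lattice ==> vcoef k A = a k" using riesz_fischer[OF aK] by blast
 have lim: "(%K. SUM k:lat K. a k \<bullet> vcoef k g) \<longlonglongrightarrow> (LINT x|torus. A x \<bullet> g x)"
  if "g : bmeas" "!!x. norm (g x) <= C" for g C using A(4) that by blast
 have pc: "periodic (curl ph)" if ph: "torus_test ph" for ph unfolding periodic_def curl_def using periodic_partial[OF ph] by (simp add: periodic_def)
 have "weak_curl_eq A B" unfolding weak_curl_eq_def
 proof (intro allI impI)
  fix ph :: "real^3 => real^3" assume ph: "torus_test ph"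
  hence C: "C_infinity ph" by (simp add: torus_test_def)
  obtain C' where C': "!!x. norm (ph x) <= C'" using periodic_bounded ph C_infinityD(2)[OF C] unfolding torus_test_def by metis
  obtain C'' where C'': "!!x. norm (curl ph x) <= C''" using periodic_bounded[OF continuous_curl[OF C] pc[OF ph]] by metis
  have "a k \<bullet> vcoef k (curl ph) = vcoef (- k) B \<bullet> vcoef (- k) ph" if k: "k : lat K" for k K
  proof (cases "k = 0")
   case False
   have kl: "k : lattice" using k lat_lattice by blast
   have "a k \<bullet> vcoef k (curl ph) = (cross3 k (vcoef (- k) B) \<bullet> cross3 k (vcoef (- k) ph)) / (norm k)^2"
    unfolding a_def vcoef_curl[OF ph kl] by (simp add: field_simps)
   also have "cross3 k (vcoef (- k) B) \<bullet> cross3 k (vcoef (- k) ph) =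
     (norm k)^2 * (vcoef (- k) B \<bullet> vcoef (- k) ph) - (vcoef (- k) B \<bullet> k) * (k \<bullet> vcoef (- k) ph)"
    unfolding power2_norm_eq_inner by (simp add: cross3_def inner_3 algebra_simps)
   also have "vcoef (- k) B \<bullet> k = 0" using bdiv[OF lattice_uminus[OF kl]] by simp
   finally show ?thesis using False by simp
  qed (simp add: a_def b0)
  hence "(SUM k:lat K. a k \<bullet> vcoef k (curl ph)) = (SUM k:lat K. vcoef k B \<bullet> vcoef k ph)" for K
   using sum_lat_uminus[of "%k. vcoef k B \<bullet> vcoef k ph" K] by simp
  hence "(%K. SUM k:lat K. vcoef k B \<bullet> vcoef k ph) \<longlonglongrightarrow> (LINT x|torus. A x \<bullet> curl ph x)"
   using lim[OF meas_cont[OF continuous_curl[OF C]] C''] by simp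
  moreover have "(%K. SUM k:lat K. vcoef k B \<bullet> vcoef k ph) \<longlonglongrightarrow> (LINT x|torus. B x \<bullet> ph x)"
   by (rule parseval[OF B meas_cont[OF C_infinityD(2)[OF C]] C'])
  ultimately show "(LINT x|torus. A x \<bullet> curl ph x) = (LINT x|torus. B x \<bullet> ph x)" by (rule LIMSEQ_unique)
 qed
 moreover have "weak_div_free A" unfolding weak_div_free_def
 proof (intro allI impI)
  fix ps :: "real^3 => real" assume ps: "torus_test ps"
  hence C: "C_infinity ps" by (simp add: torus_test_def)
  have pg: "periodic (grad ps)" unfolding periodic_def grad_def using periodic_partial[OF ps] by (simp add: periodic_def)
  obtain C'' where C'': "!!x. norm (grad ps x) <= C''" using periodic_bounded[OF continuous_grad[OF C] pg] by metis
  have "a k \<bullet> vcoef k (grad ps) = 0" if k: "k : lat K" for k K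
  proof -
   have kl: "k : lattice" using k lat_lattice by blast
   show ?thesis unfolding a_def vcoef_grad[OF ps kl] by (simp add: cross3_def inner_3 algebra_simps)
  qed
  hence "(%K. 0) \<longlonglongrightarrow> (LINT x|torus. A x \<bullet> grad ps x)" using lim[OF meas_cont[OF continuous_grad[OF C]] C''] by simp
  thus "(LINT x|torus. A x \<bullet> grad ps x) = 0" by (simp add: LIMSEQ_const_iff)
 qed
 moreover have "zero_mean A" using A(3,5) A(5)[OF lattice_0] unfolding zero_mean_def vcoef_def by (simp add: a_def)
 ultimately have "vector_potential B A" using A(1) unfolding vector_potential_def by blast
 moreover have "(%K. H K (%k. vcoef k B)) \<longlonglongrightarrow> (LINT x|torus. A x \<bullet> B x)"
 proof -
  have "H K (%k. vcoef k B) = (SUM k:lat K. a k \<bullet> vcoef k B)" for K unfolding H_def a_def by (simp add: sum_negf)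
  thus ?thesis using lim[OF B] by simp
 qed
 ultimately show thesis by (rule that)
qed

section \<open>Functions on the torus depending on time\<close>

lemma torus_time_integral:
 fixes F :: "(real^3) * real => 'b::{banach, second_countable_topology}"
 assumes "F : bmeas" shows "integral\<^sup>L (torus_time T) F = (LINT z|lborel. indicator (cbox 0 1 \<times> {0<..<T}) z *\<^sub>R F z)"
  and "integrable (torus_time T) F \<longleftrightarrow> integrable lborel (%z. indicator (cbox 0 1 \<times> {0<..<T}) z *\<^sub>R F z)"
proof -
 have s: "cbox 0 1 \<times> {0<..<T} : sets (borel :: ((real^3) * real) measure)" by (intro borel_Times) auto
 have m: "(%z. indicator (cbox 0 1 \<times> {0<..<T}) z *\<^sub>R F z) : lborel \<rightarrow>\<^sub>M borel" using assms s by measurable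
 show "integral\<^sup>L (torus_time T) F = (LINT z|lborel. indicator (cbox 0 1 \<times> {0<..<T}) z *\<^sub>R F z)"
  unfolding torus_time_def using s by (subst integral_restrict_space) (auto simp: integral_completion[OF m])
 show "integrable (torus_time T) F \<longleftrightarrow> integrable lborel (%z. indicator (cbox 0 1 \<times> {0<..<T}) z *\<^sub>R F z)"
  unfolding torus_time_def using s by (subst integrable_restrict_space) (auto simp: integrable_completion[OF m])
qed

lemma borel_measurable_torus_time: "F : bmeas ==> F : borel_measurable (torus_time T)"
 unfolding torus_time_def by (intro measurable_restrict_space1 measurable_completion) simp

lemma AE_torus_time: "(AE z in torus_time T. P z) \<longleftrightarrow> (AE z in lborel. z : cbox 0 1 \<times> {0<..<T} --> P z)"
proof -
 have s: "cbox 0 1 \<times> {0<..<T} : sets (borel :: ((real^3) * real) measure)" by (intro borel_Times) auto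
 thus ?thesis unfolding torus_time_def by (subst AE_restrict_space_iff) (simp_all add: AE_completion_iff)
qed

lemma AE_time: "(AE t in lebesgue_on {0<..<T::real}. P t) \<longleftrightarrow> (AE t in lborel. t : {0<..<T} --> P t)"
 by (subst AE_restrict_space_iff) (simp_all add: AE_completion_iff)

lemma pair_swap_measurable:
 fixes F :: "(real^3) * real => 'b::topological_space"
 assumes "F : bmeas" shows "(%(t, x). F (x, t)) : borel_measurable (borel \<Otimes>\<^sub>M lborel)" and "(%x. F (x, t)) : bmeas" and "(%t. F (x, t)) : bmeas"
proof -
 have F: "F : borel_measurable (borel \<Otimes>\<^sub>M borel)" using assms by (simp add: borel_prod)
 show "(%(t, x). F (x, t)) : borel_measurable (borel \<Otimes>\<^sub>M lborel)" using F by measurable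
 show "(%x. F (x, t)) : bmeas" "(%t. F (x, t)) : bmeas" using F by measurable
qed

lemma torus_slice_measurable:
 fixes F :: "(real^3) * real => 'b::{banach, second_countable_topology}"
 assumes "F : bmeas" shows "(%t. LINT x|torus. F (x, t)) : bmeas"
proof -
 note [measurable] = pair_swap_measurable(1)[OF assms]
 have "(%t. LINT x|lborel. indicator (cbox 0 1) x *\<^sub>R F (x, t)) : bmeas" by (rule lborel.borel_measurable_lebesgue_integral) simp
 thus ?thesis unfolding torus_integral(1)[OF pair_swap_measurable(2)[OF assms]] .
qed

lemma torus_time_fubini:
 fixes F :: "(real^3) * real => real"
 assumes F: "F : bmeas" and i: "integrable (torus_time T) F" shows "integral\<^sup>L (torus_time T) F = (LBINT t:{0<..<T}. (LINT x|torus. F (x, t)))"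
proof -
 let ?g = "%x t. indicator (cbox 0 1 \<times> {0<..<T}) (x, t) *\<^sub>R F (x, t)"
 have "integral\<^sup>L (torus_time T) F = (\<integral>z. case_prod ?g z \<partial>(lborel \<Otimes>\<^sub>M lborel))"
  unfolding lborel_prod torus_time_integral(1)[OF F] by (simp add: case_prod_unfold)
 also have "... = (LINT t|lborel. (LINT x|lborel. ?g x t))"
 proof (rule lborel_pair.integral_snd[symmetric])
  show "integrable (lborel \<Otimes>\<^sub>M lborel) (case_prod ?g)"
   unfolding lborel_prod using i unfolding torus_time_integral(2)[OF F] by (simp add: case_prod_unfold)
 qed
 also have "... = (LBINT t:{0<..<T}. (LINT x|torus. F (x, t)))" unfolding lint_def
 proof (intro bint_cong refl)
  fix t
  have e: "?g x t = indicator {0<..<T} t *\<^sub>R (indicator (cbox 0 1) x *\<^sub>R F (x, t))" for x by (auto simp: indicator_def)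
  show "(LINT x|lborel. ?g x t) = indicator {0<..<T} t *\<^sub>R (LINT x|torus. F (x, t))"
   unfolding torus_integral(1)[OF pair_swap_measurable(2)[OF F]] e by (rule integral_scaleR_right)
 qed
 finally show ?thesis .
qed

lemma integrable_torus_time_bounded:
 fixes F :: "(real^3) * real => 'b::{banach, second_countable_topology}"
 assumes F: "F : bmeas" and b: "!!z. norm (F z) <= C" shows "integrable (torus_time T) F"
proof -
 have fin: "emeasure lborel (cbox 0 1 \<times> {0<..<T} :: ((real^3) * real) set) < \<infinity>" by (rule emeasure_bounded_finite) (auto intro: bounded_Times)
 have s: "cbox 0 1 \<times> {0<..<T} : sets (borel :: ((real^3) * real) measure)" by (intro borel_Times) auto
 have "integrable lborel (%z. indicator (cbox 0 1 \<times> {0<..<T}) z *\<^sub>R F z)"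
  by (rule integrableI_bounded_set[where A = "cbox 0 1 \<times> {0<..<T}" and B = C]) (use s fin F b in auto)
 thus ?thesis unfolding torus_time_integral(2)[OF F] .
qed

lemma isCont_torus_integral:
 fixes F :: "(real^3) * real => 'b::{banach, second_countable_topology}"
 assumes F: "F : bmeas" and b: "!!z. norm (F z) <= C" and c: "AE x in torus. isCont (%s. F (x, s)) t" shows "isCont (%s. LINT x|torus. F (x, s)) t"
 unfolding continuous_at_sequentially comp_def
proof (intro allI impI)
 fix s :: "nat => real" assume s: "s \<longlonglongrightarrow> t"
 show "(%n. LINT x|torus. F (x, s n)) \<longlonglongrightarrow> (LINT x|torus. F (x, t))"
 proof (rule integral_dominated_convergence[where w = "%_. C"])
  show "AE x in torus. (%n. F (x, s n)) \<longlonglongrightarrow> F (x, t)" using c by eventually_elim (rule isCont_tendsto_compose[OF _ s])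
 qed (use b integrable_torus_continuous[of "%_. C"] borel_measurable_torus[OF pair_swap_measurable(2)[OF F]] in auto)
qed

subsection \<open>Smooth functions of compact support in time\<close>

text \<open>The powers in the denominator make the family closed under differentiation up to linear
  combinations; \<open>i = 0\<close> is the classical flat function.\<close>

definition flat :: "nat => real => real" where
 "flat i r = (if r <= 0 then 0 else exp (- 1 / r) / r ^ i)"

lemma flat_tendsto_0: "(flat i \<longlongrightarrow> 0) (at 0)"
proof -
 have "((%y::real. y ^ i / exp y) \<longlongrightarrow> 0) at_top" by (rule tendsto_power_div_exp_0)
 from filterlim_compose[OF this filterlim_inverse_at_top_right] have r: "((%r::real. inverse r ^ i / exp (inverse r)) \<longlongrightarrow> 0) (at_right 0)" .
 have "\<forall>\<^sub>F r in at_right (0::real). inverse r ^ i / exp (inverse r) = flat i r"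
  unfolding eventually_at_right_field flat_def by (intro exI[of _ 1]) (simp add: exp_minus divide_simps)
 with r have "(flat i \<longlongrightarrow> 0) (at_right 0)" by (rule Lim_transform_eventually)
 moreover have "(flat i \<longlongrightarrow> 0) (at_left 0)" by (rule tendsto_eventually) (auto simp: eventually_at_left_field flat_def intro!: exI[of _ "-1"])
 ultimately show ?thesis by (simp add: filterlim_split_at)
qed

lemma flat_derivative: "(flat i has_real_derivative (flat (i + 2) r - real i * flat (Suc i) r)) (at r)"
proof -
 consider "r < 0" | "r = 0" | "0 < r" by linarith
 thus ?thesis
 proof cases
  case 1
  have "((%_. 0) has_real_derivative 0) (at r)" by simp
  hence "(flat i has_real_derivative 0) (at r)"
   by (rule has_field_derivative_transform_within_open[where S = "{..<0}"]) (use 1 in \<open>auto simp: flat_def\<close>)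
  thus ?thesis using 1 by (simp add: flat_def)
 next
  case 2
  have "(flat i h - flat i 0) / (h - 0) = flat (Suc i) h" for h by (simp add: flat_def)
  hence "(flat i has_real_derivative 0) (at 0)" using flat_tendsto_0[of "Suc i"] unfolding has_field_derivative_iff by simp
  thus ?thesis using 2 by (simp add: flat_def)
 next
  case 3
  have "((%r. exp (- 1 / r) / r ^ i) has_real_derivative (flat (i + 2) r - real i * flat (Suc i) r)) (at r)"
   using 3 by (auto intro!: derivative_eq_intros simp: flat_def power2_eq_square divide_simps power_add)
    (cases i; simp add: algebra_simps)
  thus ?thesis by (rule has_field_derivative_transform_within_open[where S = "{0<..}"]) (use 3 in \<open>auto simp: flat_def\<close>)
 qed
qed

text \<open>A class closed under differentiation and rich enough to contain smooth steps, so that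
  membership replaces a computation of higher derivatives.\<close>

inductive_set bumps :: "(real => real) set" where
 flat: "(%r. flat i (a + b * r)) : bumps"
| const: "(%_. c) : bumps"
| add: "f : bumps ==> g : bumps ==> (%r. f r + g r) : bumps"
| mult: "f : bumps ==> g : bumps ==> (%r. f r * g r) : bumps"
| inv: "f : bumps ==> (!!r. f r ~= 0) ==> (%r. inverse (f r)) : bumps"

lemma bumps_derivative: "f : bumps ==> \<exists>f'\<in>bumps. ALL r. (f has_real_derivative f' r) (at r)"
proof (induction rule: bumps.induct)
 case (flat i a b)
 have "((%r. flat i (a + b * r)) has_real_derivative (flat (i + 2) (a + b * r) + (- real i) * flat (Suc i) (a + b * r)) * b) (at r)" for r
  by (rule DERIV_chain2[OF flat_derivative[THEN DERIV_cong]]) (auto intro!: derivative_eq_intros)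
 moreover have "(%r. (flat (i + 2) (a + b * r) + (- real i) * flat (Suc i) (a + b * r)) * b) : bumps" by (intro bumps.add bumps.mult bumps.const bumps.flat)
 ultimately show ?case by (intro bexI[rotated]) auto
next
 case (const c) thus ?case by (intro bexI[OF _ bumps.const[of 0]]) simp
next
 case (add f g)
 then obtain f' g' where d: "f' : bumps" "g' : bumps" "!!r. (f has_real_derivative f' r) (at r)" "!!r. (g has_real_derivative g' r) (at r)" by blast
 show ?case by (intro bexI[OF _ bumps.add[OF d(1,2)]] allI DERIV_add d(3,4))
next
 case (mult f g)
 then obtain f' g' where d: "f' : bumps" "g' : bumps" "!!r. (f has_real_derivative f' r) (at r)" "!!r. (g has_real_derivative g' r) (at r)" by blast
 show ?case by (intro bexI[OF _ bumps.add[OF bumps.mult[OF d(1) mult(2)] bumps.mult[OF d(2) mult(1)]]] allI DERIV_mult d(3,4))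
next
 case (inv f)
 then obtain f' where d: "f' : bumps" "!!r. (f has_real_derivative f' r) (at r)" by blast
 note b = bumps.inv[OF inv(1,2)]
 have "((%r. inverse (f r)) has_real_derivative (-1) * (inverse (f r) * (f' r * inverse (f r)))) (at r)" for r
  using DERIV_inverse'[OF d(2) inv(2), of r] by (simp add: mult.assoc)
 thus ?case by (intro bexI[OF _ bumps.mult[OF bumps.const bumps.mult[OF b bumps.mult[OF d(1) b]]]] allI)
qed

lemma bumps_affine: "f : bumps ==> (%r. f (a + b * r)) : bumps"
proof (induction rule: bumps.induct)
 case (flat i c d)
 have "c + d * (a + b * r) = (c + d * a) + (d * b) * r" for r by (simp add: algebra_simps)
 thus ?case using bumps.flat[of i "c + d * a" "d * b"] by presburger
qed (auto intro: bumps.intros)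

definition step :: "(real => real) => (real => real) => bool" where
 "step sgm sgm' \<longleftrightarrow> sgm : bumps & sgm' : bumps & (ALL r. (sgm has_real_derivative sgm' r) (at r)) \<and>
  (\<forall>r\<le>0. sgm r = 0) & (\<forall>r\<ge>1. sgm r = 1) & (ALL r. abs (sgm r) <= 1) & (ALL r. r ~: {0..1} --> sgm' r = 0)"

lemma stepD:
 assumes "step sgm sgm'" shows "sgm : bumps" "sgm' : bumps" "(sgm has_real_derivative sgm' r) (at r)" "r <= 0 ==> sgm r = 0"
  "1 <= r ==> sgm r = 1" "abs (sgm r) <= 1" "r ~: {0..1} ==> sgm' r = 0" using assms unfolding step_def by auto

lemma step_exists: obtains sgm sgm' where "step sgm sgm'"
proof -
 have nn: "0 <= flat 0 r" for r by (simp add: flat_def)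
 have pos: "0 < flat 0 r + flat 0 (1 - r)" for r by (cases "r <= 0") (auto simp: flat_def add_pos_nonneg add_nonneg_pos)
 define sgm where "sgm = (%r. flat 0 (0 + 1 * r) * inverse (flat 0 (0 + 1 * r) + flat 0 (1 + (-1) * r)))"
 have b: "sgm : bumps" unfolding sgm_def by (intro bumps.mult bumps.inv bumps.add bumps.flat) (use pos in \<open>simp add: less_imp_neq[symmetric]\<close>)
 obtain sgm' where s: "sgm' : bumps" "!!r. (sgm has_real_derivative sgm' r) (at r)" using bumps_derivative[OF b] by blast
 have 0: "sgm r = 0" if "r <= 0" for r using that by (simp add: sgm_def flat_def)
 have 1: "sgm r = 1" if "1 <= r" for r using that by (simp add: sgm_def flat_def)
 have "sgm' r = 0" if "r ~: {0..1}" for r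
 proof -
  have e: "EX c. ((%_. c) has_real_derivative sgm' r) (at r)"
  proof (cases "r < 0")
   case True
   have "((%_. 0) has_real_derivative sgm' r) (at r)" by (rule has_field_derivative_transform_within_open[OF s(2), where S = "{..<0}"]) (use True 0 in auto)
   thus ?thesis by blast
  next
   case False
   have "((%_. 1) has_real_derivative sgm' r) (at r)"
    by (rule has_field_derivative_transform_within_open[OF s(2), where S = "{1<..}"]) (use False that 1 in auto)
   thus ?thesis by blast
  qed
  thus ?thesis using DERIV_unique DERIV_const by metis
 qed
 moreover have "abs (sgm r) <= 1" for r using nn[of r] nn[of "1 - r"] pos[of r] by (simp add: sgm_def abs_mult divide_simps flip: divide_inverse)
 ultimately have "step sgm sgm'" unfolding step_def using b s 0 1 by auto
 thus thesis by (rule that)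
qed

lemma bump_C_infinity:
 assumes "th : bumps" shows "C_infinity (%z :: (real^3) * real. (th (snd z) * (c * cas k (fst z))) *\<^sub>R (v :: 'b::real_normed_vector))"
proof (rule C_infinity_closed[where G = "{g. \<exists>th c k. th : bumps & g = (%z. (th (snd z) * (c * cas k (fst z))) *\<^sub>R v)}"])
 fix g :: "(real^3) * real => 'b" assume "g : {g. \<exists>th c k. th : bumps & g = (%z. (th (snd z) * (c * cas k (fst z))) *\<^sub>R v)}"
 then obtain th c k where th: "th : bumps" and g: "g = (%z. (th (snd z) * (c * cas k (fst z))) *\<^sub>R v)" by blast
 obtain th' where th': "th' : bumps" "!!r. (th has_real_derivative th' r) (at r)" using bumps_derivative[OF th] by blast
 have d: "(g has_derivative (%h. (th (snd z) * (c * (2 * pi * (k \<bullet> fst h) * cas (- k) (fst z))) +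
   th' (snd z) * snd h * (c * cas k (fst z))) *\<^sub>R v)) (at z)" for z
 proof -
  have "((%z. th (snd z)) has_derivative (%h. th' (snd z) * snd h)) (at z)"
   using has_derivative_compose[OF has_derivative_snd[OF has_derivative_ident] th'(2)[of "snd z", unfolded has_field_derivative_def], of UNIV] by simp
  moreover have "((%z. cas k (fst z)) has_derivative (%h. 2 * pi * (k \<bullet> fst h) * cas (- k) (fst z))) (at z)"
   by (rule has_derivative_compose[OF has_derivative_fst[OF has_derivative_ident] cas_derivative])
  ultimately show ?thesis unfolding g by (intro has_derivative_scaleR_left has_derivative_mult has_derivative_mult_right)
 qed
 show "(ALL x. g differentiable (at x)) & (ALL i:Basis. (%x. fder g x i) : {g. \<exists>th c k. th : bumps & g = (%z. (th (snd z) * (c * cas k (fst z))) *\<^sub>R v)})"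
 proof (intro conjI allI ballI)
  show "g differentiable (at z)" for z using d[of z] unfolding differentiable_def by blast
  fix h :: "(real^3) * real" assume "h : Basis"
  hence "snd h = 0 | fst h = 0" by (auto simp: Basis_prod_def)
  moreover have "(%z. fder g z h) = (%z. (th (snd z) * ((c * (2 * pi * (k \<bullet> fst h))) * cas (- k) (fst z))) *\<^sub>R v)" if "snd h = 0"
   using that frechet_derivative_at[OF d, symmetric] by (simp add: mult.assoc)
  moreover have "(%z. fder g z h) = (%z. (th' (snd z) * ((snd h * c) * cas k (fst z))) *\<^sub>R v)" if "fst h = 0"
   using that frechet_derivative_at[OF d, symmetric] by (simp add: mult.assoc)
  ultimately show "(%x. fder g x h) : {g. \<exists>th c k. th : bumps & g = (%z. (th (snd z) * (c * cas k (fst z))) *\<^sub>R v)}" using th th'(1) by blast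
 qed
qed (use assms in blast)

lemma bump_test:
 assumes "th : bumps" "k : lattice" "0 < a" "b < T" "!!t. t ~: {a..b} ==> th t = 0"
 shows "torus_time_test T (%(x, t). (th t * cas k x) *\<^sub>R (v :: 'b::real_normed_vector))"
proof -
 have "C_infinity (%(x, t). (th t * cas k x) *\<^sub>R v)" using bump_C_infinity[OF assms(1), of 1 k v] by (simp add: case_prod_unfold)
 moreover have "periodic (%x. (th t * cas k x) *\<^sub>R v)" for t using periodic_cas[OF assms(2)] unfolding periodic_def by simp
 ultimately show ?thesis unfolding torus_time_test_def using assms(3-5) by auto
qed

lemma bumps_continuous: assumes "f : bumps" shows "continuous_on S f"
proof -
 obtain f' where "!!r. (f has_real_derivative f' r) (at r)" using bumps_derivative[OF assms] by blast
 thus ?thesis using DERIV_isCont by (blast intro: continuous_at_imp_continuous_on)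
qed

text \<open>The rescaled derivative of a smooth step is an approximate identity supported to the
  right of \<open>s\<close>; for bounded \<open>f\<close>, continuity at the single point
  \<open>s\<close> gives the limit.\<close>

lemma bump_mollify:
 fixes f :: "real => real"
 assumes sgm: "sgm' : bumps" "!!r. (sgm has_real_derivative sgm' r) (at r)" "sgm 0 = 0" "sgm 1 = 1" and z: "!!r. r ~: {0..1} ==> sgm' r = 0"
  and f: "f : bmeas" "!!t. abs (f t) <= C" and c: "isCont f s"
 shows "(%n. LINT u|lborel. (real (Suc n) * sgm' (real (Suc n) * (u - s))) * f u) \<longlonglongrightarrow> f s"
proof -
 note cont = bumps_continuous[OF sgm(1)]
 have "(LINT u|lborel. (real (Suc n) * sgm' (real (Suc n) * (u - s))) * f u) = (LINT x|lborel. sgm' x * f (s + (1 / real (Suc n)) * x))" for n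
 proof -
  have "real (Suc n) * sgm' (real (Suc n) * (s + 1 / real (Suc n) * x - s)) * f (s + 1 / real (Suc n) * x) =
    real (Suc n) * (sgm' x * f (s + 1 / real (Suc n) * x))" for x by (simp del: of_nat_Suc)
  thus ?thesis by (subst lborel_integral_real_affine[where t = s and c = "1 / real (Suc n)"])
   (simp_all only: integral_mult_right_zero, simp_all del: of_nat_Suc)
 qed
 moreover have "(%n. LINT x|lborel. sgm' x * f (s + (1 / real (Suc n)) * x)) \<longlonglongrightarrow> (LINT x|lborel. sgm' x * f s)"
 proof (rule integral_dominated_convergence[where w = "%x. abs (sgm' x) * C"])
  have m[measurable]: "sgm' : bmeas" by (rule meas_cont) (rule cont)
  have si: "sint {0..1} (%x. abs (sgm' x))" by (rule borel_integrable_atLeastAtMost') (intro continuous_intros cont)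
  have "(%x. indicator {0..1} x *\<^sub>R (abs (sgm' x))) = (%x. abs (sgm' x))" using z by (auto simp: fun_eq_iff indicator_def)
  with si show "integrable lborel (%x. abs (sgm' x) * C)" unfolding set_integrable_def by simp
  show "(%x. sgm' x * f (s + (1 / real (Suc n)) * x)) : borel_measurable lborel" for n using f(1) by measurable
  show "AE x in lborel. (%n. sgm' x * f (s + (1 / real (Suc n)) * x)) \<longlonglongrightarrow> sgm' x * f s"
  proof (intro AE_I2 tendsto_intros isCont_tendsto_compose[OF c])
   fix x
   have "(%n. s + inverse (real (Suc n)) * x) \<longlonglongrightarrow> s + 0 * x" by (intro tendsto_intros LIMSEQ_inverse_real_of_nat)
   thus "(%n. s + 1 / real (Suc n) * x) \<longlonglongrightarrow> s" by (simp add: inverse_eq_divide)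
  qed
  show "AE x in lborel. norm (sgm' x * f (s + 1 / real (Suc n) * x)) <= abs (sgm' x) * C" for n using f(2) by (intro AE_I2) (simp add: abs_mult mult_left_mono)
  show "(%x. sgm' x * f s) : borel_measurable lborel" by measurable
 qed
 moreover have "(LINT x|lborel. sgm' x * f s) = f s"
 proof -
  have "(LINT x|lborel. sgm' x * indicator {0..1} x) = sgm 1 - sgm 0"
   using sgm(2) cont[of UNIV] by (intro integral_FTC_Icc_real) (auto simp: continuous_on_eq_continuous_at)
  moreover have "(%x. sgm' x * indicator {0..1} x) = sgm'" using z by (auto simp: fun_eq_iff indicator_def)
  ultimately show ?thesis using sgm(3,4) by simp
 qed
 ultimately show ?thesis by (simp only:)
qed

section \<open>Helicity of a bounded solution of the Faraday--Maxwell system\<close>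

lemma lipD_sum:
 assumes "finite A" "!!k. k : A ==> lipD s r (f k) (d k)" shows "lipD s r (%x. SUM k:A. f k x) (%x. SUM k:A. d k x)"
 using assms by (induction A rule: finite_induct) (auto intro: lipD_const lipD_add)

lemma lipD_cmult:
 assumes "lipD s r f d" shows "lipD s r (%x. c * f x) (%x. c * d x)" using lipD_mult[OF lipD_const[of s r c] assms] by (simp add: mult.commute)

lemma lipD_diff:
 assumes "lipD s r f d" "lipD s r g e" shows "lipD s r (%x. f x - g x) (%x. d x - e x)" using lipD_add[OF assms(1) lipD_cmult[OF assms(2), of "-1"]] by simp

lemma lipD_triple:
 fixes X Y X' Y' :: "real => real^3"
 assumes X: "!!i. lipD s r (%t. X t $ i) (%t. X' t $ i)" and Y: "!!i. lipD s r (%t. Y t $ i) (%t. Y' t $ i)"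
 shows "lipD s r (%t. cross3 k (X t) \<bullet> Y t) (%t. cross3 k (X' t) \<bullet> Y t + cross3 k (X t) \<bullet> Y' t)"
proof -
 have "lipD s r (%t. cross3 k (X t) $ i) (%t. cross3 k (X' t) $ i)" for i using exhaust_3[of i] by (auto simp: cross3_def intro!: lipD_diff lipD_cmult X)
 from lipD_mult[OF this Y] have "lipD s r (%t. cross3 k (X t) $ i * Y t $ i) (%t. cross3 k (X' t) $ i * Y t $ i + Y' t $ i * cross3 k (X t) $ i)" for i .
 from lipD_add[OF lipD_add[OF this[of 1] this[of 2]] this[of 3]] show ?thesis by (simp add: inner_3 algebra_simps)
qed

lemma bounded_integral:
 fixes w :: "real => real"
 assumes w: "w : bmeas" "!!u. abs (w u) <= M" shows "sint {a..b} w" "w integrable_on {a..b}" "(LBINT u:{a..b}. w u) = integral {a..b} w"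
  and "M-lipschitz_on UNIV (%t. c + integral {s..t} w)" "a <= b ==> abs (integral {a..b} w) <= M * (b - a)"
proof -
 have si: "sint {a..b} w" for a b unfolding set_integrable_def
  by (rule integrableI_bounded_set[where A = "{a..b}" and B = M]) (use w emeasure_lborel_Icc_eq[of a b] in \<open>auto intro!: AE_I2\<close>)
 have i: "w integrable_on {a..b}" for a b by (rule set_borel_integral_eq_integral(1)[OF si])
 show "sint {a..b} w" "w integrable_on {a..b}" by (fact si i)+
 show "(LBINT u:{a..b}. w u) = integral {a..b} w" by (rule set_borel_integral_eq_integral(2)[OF si])
 have M0: "0 <= M" using w(2)[of 0] by linarith
 have b: "abs (integral {a..b} w) <= M * (b - a)" if "a <= b" for a b
  using integral_norm_bound_integral[OF i[of a b] integrable_const_ivl[of M a b]] w(2) that by (simp add: mult.commute)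
 show "M-lipschitz_on UNIV (%t. c + integral {s..t} w)"
 proof (rule lipschitz_onI[OF _ M0])
  have le: "abs (integral {s..y} w - integral {s..x} w) <= M * (y - x)" if xy: "x <= y" for x y
  proof (cases "s <= x")
   case True
   thus ?thesis using Henstock_Kurzweil_Integration.integral_combine[OF True xy i] b[OF xy] by (simp add: algebra_simps)
  next
   case False
   show ?thesis
   proof (cases "s <= y")
    case True
    have "M * (y - s) <= M * (y - x)" using False M0 by (intro mult_left_mono) auto
    thus ?thesis using b[OF True] False by simp
   qed (use False xy M0 in simp)
  qed
  show "dist (c + integral {s..x} w) (c + integral {s..y} w) <= M * dist x y" for x y
   using le[of x y] le[of y x] by (cases "x <= y") (simp_all add: dist_real_def abs_minus_commute)
 qed
 show "a <= b ==> abs (integral {a..b} w) <= M * (b - a)" by (rule b)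
qed

lemma lipD_integral:
 fixes w :: "real => real"
 assumes w: "w : bmeas" "!!u. abs (w u) <= M" and c: "AE u in lborel. u : {s<..<r} --> isCont w u" shows "lipD s r (%t. c + integral {s..t} w) w"
 unfolding lipD_def
proof (intro conjI)
 have "M-lipschitz_on UNIV (%t. c + integral {s..t} w)" by (rule bounded_integral(4)[OF w])
 thus "EX L. L-lipschitz_on {s..r+1} (%t. c + integral {s..t} w)" "(%t. c + integral {s..t} w) : bmeas"
  by (auto intro: lipschitz_on_subset meas_cont lipschitz_imp_continuous_on)
 show "w : bmeas" by fact
 show "AE u in lborel. u : {s<..<r} --> ((%t. c + integral {s..t} w) has_real_derivative w u) (at u)" using c
 proof eventually_elim
  case (elim u)
  show ?case
  proof
   assume u: "u : {s<..<r}"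
   hence "continuous (at u within {s..r} - {}) w" using elim by (simp add: continuous_at_imp_continuous_at_within)
   with u have "((%t. integral {s..t} w) has_vector_derivative w u) (at u within {s..r} - {})"
    by (intro integral_has_vector_derivative_continuous_at bounded_integral(2)[OF w]) auto
   hence "((%t. integral {s..t} w) has_vector_derivative w u) (at u)" using u at_within_Icc_at[of s u r] by simp
   thus "((%t. c + integral {s..t} w) has_real_derivative w u) (at u)" by (auto intro!: derivative_eq_intros simp: real_vector_deriv)
  qed
 qed
qed

text \<open>Borel representatives bounded everywhere, with a set \<open>G\<close> of full measure of
  good times: there both fields are continuous in time at almost every point. Distributional
  identities become pointwise in time on \<open>G\<close>.\<close>

locale flow =
 fixes T C :: real and b e :: "(real^3) * real => real^3" and G :: "real set"
 assumes T: "0 < T" and borel: "b : bmeas" "e : bmeas" and bounded: "!!z. norm (b z) <= C" "!!z. norm (e z) <= C"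
  and G: "G \<subseteq> {0<..<T}" and AE_G: "AE t in lborel. t : {0<..<T} --> t : G"
  and cont: "!!t. t : G ==> AE x in torus. isCont (%s. b (x, s)) t & isCont (%s. e (x, s)) t" and faraday: "faraday_maxwell T b e"
  and mean: "!!t. t : G ==> (LINT x|torus. b (x, t)) = 0"
begin

definition "bc k t = vcoef k (%x. b (x, t))"
definition "ec k t = vcoef k (%x. e (x, t))"

lemma C0: "0 <= C" using order_trans[OF norm_ge_zero bounded(1)] .

lemma vcoef_slice:
 fixes F :: "(real^3) * real => real^3"
 assumes F: "F : bmeas" "!!z. norm (F z) <= C" shows "(%t. vcoef k (%x. F (x, t))) : bmeas" "norm (vcoef k (%x. F (x, t))) <= 2 * C"
  "AE x in torus. isCont (%s. F (x, s)) t ==> isCont (%t. vcoef k (%x. F (x, t))) t"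
proof -
 have m: "(%z. cas k (fst z) *\<^sub>R F z) : bmeas"
  by (intro borel_measurable_scaleR F(1) meas_cont continuous_on_compose2[OF continuous_cas[of UNIV]] continuous_intros) auto
 have b: "norm (cas k (fst z) *\<^sub>R F z) <= 2 * C" for z using F(2)[of z] abs_cas_le[of k "fst z"] by (simp add: mult_mono)
 show "(%t. vcoef k (%x. F (x, t))) : bmeas" unfolding vcoef_def using torus_slice_measurable[OF m] by simp
 show "isCont (%t. vcoef k (%x. F (x, t))) t" if c: "AE x in torus. isCont (%s. F (x, s)) t"
 proof -
  have "AE x in torus. isCont (%s. cas k (fst (x, s)) *\<^sub>R F (x, s)) t" using c by eventually_elim (simp add: continuous_intros)
  from isCont_torus_integral[OF m b this] show ?thesis unfolding vcoef_def by simp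
 qed
 have "norm (vcoef k (%x. F (x, t))) <= (LINT x|torus. norm (cas k x *\<^sub>R F (x, t)))" unfolding vcoef_def by (rule integral_norm_bound)
 also have "... <= (LINT x|torus. 2 * C)"
 proof (rule integral_mono)
  show "norm (cas k x *\<^sub>R F (x, t)) <= 2 * C" for x using b[of "(x, t)"] by simp
  show "integrable torus (%x. norm (cas k x *\<^sub>R F (x, t)))"
   by (rule integrable_norm, rule bounded_integrable[where C = "2 * C"]) (use pair_swap_measurable(2)[OF m, of t] b[of "(_, t)"] in auto)
 qed (intro integrable_torus_continuous continuous_intros)
 also have "... = 2 * C" using measure_torus by simp
 finally show "norm (vcoef k (%x. F (x, t))) <= 2 * C" .
qed

lemmas bc = vcoef_slice[OF borel(1) bounded(1), folded bc_def]
lemmas ec = vcoef_slice[OF borel(2) bounded(2), folded ec_def]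

lemma G_cont: assumes "t : G" shows "isCont (bc k) t" "isCont (ec k) t"
proof -
 have c: "AE x in torus. isCont (%s. b (x, s)) t" "AE x in torus. isCont (%s. e (x, s)) t" using cont[OF assms] by auto
 show "isCont (bc k) t" "isCont (ec k) t" using bc(3)[OF c(1), of k] ec(3)[OF c(2), of k] by (simp_all add: eta_contract_eq)
qed

lemma slice_integrable: "integrable torus (%x. b (x, t))" "integrable torus (%x. e (x, t))"
 using bounded_integrable pair_swap_measurable(2) borel bounded by metis+

text \<open>A test field that is a product of a function of time and \<open>cas k\<close> reduces
  the integral over space and time to a time integral of one Fourier coefficient.\<close>

lemma pairing:
 assumes F: "F : bmeas" "!!z. norm (F z) <= C" and th: "contU th" "!!t. t ~: {a..d} ==> th t = 0" and ad: "0 < a" "d < T"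
 shows "(\<integral>(x, t). F (x, t) \<bullet> ((th t * cas k x) *\<^sub>R v) \<partial>torus_time T) = (LINT t|lborel. th t * (vcoef k (%x. F (x, t)) \<bullet> v))"
proof -
 let ?F = "%z. F z \<bullet> ((th (snd z) * cas k (fst z)) *\<^sub>R v)"
 obtain M where M: "0 < M" "ALL t:{a..d}. abs (th t) <= M" using continuous_bounded_Icc[OF th(1)] by blast
 hence M': "abs (th t) <= M" for t using th(2)[of t] by (cases "t : {a..d}") auto
 have m: "?F : bmeas"
  by (intro borel_measurable_inner F(1) meas_cont continuous_intros continuous_on_compose2[OF continuous_cas[of UNIV]] continuous_on_compose2[OF th(1)]) auto
 have bd: "norm (?F z) <= C * (M * 2 * norm v)" for z
 proof -
  have "norm (?F z) <= norm (F z) * norm ((th (snd z) * cas k (fst z)) *\<^sub>R v)" by (simp only: real_norm_def Cauchy_Schwarz_ineq2)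
  also have "... <= C * (M * 2 * norm v)" unfolding norm_scaleR abs_mult using F(2) M' M(1) C0 abs_cas_le by (intro mult_mono) auto
  finally show ?thesis .
 qed
 have "(\<integral>(x, t). F (x, t) \<bullet> ((th t * cas k x) *\<^sub>R v) \<partial>torus_time T) = (LBINT t:{0<..<T}. (LINT x|torus. ?F (x, t)))"
  using torus_time_fubini[OF m integrable_torus_time_bounded[OF m bd]] by (simp add: case_prod_unfold)
 also have "... = (LINT t|lborel. th t * (vcoef k (%x. F (x, t)) \<bullet> v))" unfolding lint_def
 proof (intro bint_cong refl)
  fix t
  have "integrable torus (%x. F (x, t))" by (rule bounded_integrable[OF pair_swap_measurable(2)[OF F(1)] F(2)])
  from vcoef_inner[OF this] show "indicator {0<..<T} t *\<^sub>R (LINT x|torus. ?F (x, t)) = th t * (vcoef k (%x. F (x, t)) \<bullet> v)"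
   using th(2)[of t] ad by (cases "t : {a..d}") (auto simp: indicator_def)
 qed
 finally show ?thesis .
qed

lemma weak_faraday:
 assumes th: "th : bumps" "th' : bumps" "!!t. (th has_real_derivative th' t) (at t)"
  and z: "!!t. t ~: {a..d} ==> th t = 0" "!!t. t ~: {a..d} ==> th' t = 0" and ad: "0 < a" "d < T" and k: "k : lattice"
 shows "(LINT t|lborel. th' t * (bc k t \<bullet> v)) = (LINT t|lborel. th t * (ec (- k) t \<bullet> ((2 * pi) *\<^sub>R cross3 k v)))"
proof -
 let ?ph = "%(x, t). (th t * cas k x) *\<^sub>R v"
 have "torus_time_test T ?ph" by (rule bump_test[OF th(1) k ad z(1)])
 hence "- (\<integral>(x, t). b (x, t) \<bullet> vector_derivative (%s. ?ph (x, s)) (at t) \<partial>torus_time T)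
    + (\<integral>(x, t). e (x, t) \<bullet> curl (%y. ?ph (y, t)) x \<partial>torus_time T) = 0" using faraday unfolding faraday_maxwell_def by blast
 moreover have "vector_derivative (%s. ?ph (x, s)) (at t) = (th' t * cas k x) *\<^sub>R v" for x t
 proof (rule vector_derivative_at)
  have "((%s. th s * cas k x) has_real_derivative th' t * cas k x) (at t)" by (rule DERIV_cmult_right[OF th(3)])
  hence "((%s. th s * cas k x) has_vector_derivative th' t * cas k x) (at t)" by (simp add: real_vector_deriv)
  from has_vector_derivative_scaleR[OF DERIV_cmult_right[OF th(3)] has_vector_derivative_const]
  show "((%s. ?ph (x, s)) has_vector_derivative (th' t * cas k x) *\<^sub>R v) (at t)" by simp
 qed
 moreover have "curl (%y. ?ph (y, t)) x = (th t * cas (- k) x) *\<^sub>R ((2 * pi) *\<^sub>R cross3 k v)" for x t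
  using curl_cas[of "th t" k v x] by (simp add: mult_ac)
 ultimately show ?thesis using pairing[OF borel(1) bounded(1) bumps_continuous[OF th(2)] z(2) ad, of k v]
   pairing[OF borel(2) bounded(2) bumps_continuous[OF th(1)] z(1) ad, of "- k" "(2 * pi) *\<^sub>R cross3 k v"] unfolding bc_def ec_def by simp
qed

lemma weak_div:
 assumes th: "th : bumps" and z: "!!t. t ~: {a..d} ==> th t = 0" and ad: "0 < a" "d < T" and k: "k : lattice"
 shows "(LINT t|lborel. th t * (bc k t \<bullet> k)) = 0"
proof -
 let ?ps = "%(x, t). (th t * cas (- k) x) *\<^sub>R (1::real)"
 have "torus_time_test T ?ps" by (rule bump_test[OF th(1) lattice_uminus[OF k] ad z(1)])
 hence "(\<integral>(x, t). b (x, t) \<bullet> grad (%y. ?ps (y, t)) x \<partial>torus_time T) = 0" using faraday unfolding faraday_maxwell_def by auto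
 moreover have "grad (%y. ?ps (y, t)) x = (th t * cas k x) *\<^sub>R (- (2 * pi) *\<^sub>R k)" for x t
  using partial_cas[of _ "th t" "- k" "1::real" x] unfolding grad_def by (simp add: vec_eq_iff)
 moreover have "(\<integral>(x, t). b (x, t) \<bullet> ((th t * cas k x) *\<^sub>R (- (2 * pi) *\<^sub>R k)) \<partial>torus_time T) =
   (LINT t|lborel. th t * (bc k t \<bullet> (- (2 * pi) *\<^sub>R k)))" unfolding bc_def by (rule pairing[OF borel(1) bounded(1) bumps_continuous[OF th] z ad])
 ultimately have "(LINT t|lborel. th t * (bc k t \<bullet> (- (2 * pi) *\<^sub>R k))) = 0" by (simp only: prod.case)
 moreover have "th t * (bc k t \<bullet> (- (2 * pi) *\<^sub>R k)) = - (2 * pi) * (th t * (bc k t \<bullet> k))" for t by simp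
 ultimately show ?thesis by (simp only: integral_mult_right_zero) simp
qed

text \<open>The distributional equation gives only time averages; approximate identities at a good
  time recover the value there.\<close>

lemma div_free: assumes t: "t : G" and k: "k : lattice" shows "bc k t \<bullet> k = 0"
proof -
 obtain sgm sgm' where stsgm: "step sgm sgm'" using step_exists by blast
 note sgm = stepD[OF stsgm]
 have m: "(%t. bc k t \<bullet> k) : bmeas" using bc(1) by (intro borel_measurable_inner) auto
 have bd: "abs (bc k t \<bullet> k) <= 2 * C * norm k" for t using order_trans[OF Cauchy_Schwarz_ineq2 mult_right_mono[OF bc(2) norm_ge_zero]] .
 have "isCont (%t. bc k t \<bullet> k) t" by (intro continuous_intros G_cont t)
 from bump_mollify[OF sgm(2,3) _ _ sgm(7) m bd this] sgm(4,5)
 have lim: "(%n. LINT u|lborel. (real (Suc n) * sgm' (real (Suc n) * (u - t))) * (bc k u \<bullet> k)) \<longlonglongrightarrow> bc k t \<bullet> k" by simp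
 have "0 < t" "t < T" using t G by auto
 then obtain N where N: "1 / real (Suc N) < T - t" using nat_approx_posE[of "T - t"] by auto
 have "(LINT u|lborel. (real (Suc n) * sgm' (real (Suc n) * (u - t))) * (bc k u \<bullet> k)) = 0" if n: "N <= n" for n
 proof (rule weak_div[OF _ _ \<open>0 < t\<close> _ k])
  have "1 / real (Suc n) <= 1 / real (Suc N)" using n by (simp add: frac_le)
  thus "t + 1 / real (Suc n) < T" using N by linarith
  have "(%u. real (Suc n) * sgm' (- (real (Suc n) * t) + real (Suc n) * u)) : bumps" by (intro bumps.mult bumps.const bumps_affine sgm(2))
  thus "(%u. real (Suc n) * sgm' (real (Suc n) * (u - t))) : bumps" by (simp add: algebra_simps)
  fix u assume "u ~: {t..t + 1 / real (Suc n)}"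
  hence "real (Suc n) * (u - t) ~: {0..1}" by (auto simp: field_simps zero_le_mult_iff simp del: of_nat_Suc)
  thus "real (Suc n) * sgm' (real (Suc n) * (u - t)) = 0" using sgm(7) by simp
 qed
 hence "(%n. LINT u|lborel. (real (Suc n) * sgm' (real (Suc n) * (u - t))) * (bc k u \<bullet> k)) \<longlonglongrightarrow> 0"
  by (intro tendsto_eventually eventually_sequentiallyI[of N]) auto
 from LIMSEQ_unique[OF lim this] show ?thesis .
qed

text \<open>The rate at which the Faraday law makes \<open>bc k\<close> change; the index
  \<open>- k\<close> again stems from differentiating \<open>cas\<close>.\<close>

definition "wc k u = (2 * pi) *\<^sub>R cross3 k (ec (- k) u)"

lemma wc_props: "(%u. wc k u $ i) : bmeas" "abs (wc k u $ i) <= 2 * pi * (norm k * (2 * C))" "t : G ==> isCont (%u. wc k u $ i) t"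
proof -
 have m: "(%u. cross3 k (ec (- k) u)) : bmeas" unfolding cross3_def
 proof (rule borel_vecI)
  fix j :: 3
  show "(%u. vector [k $ 2 * ec (- k) u $ 3 - k $ 3 * ec (- k) u $ 2, k $ 3 * ec (- k) u $ 1 - k $ 1 * ec (- k) u $ 3,
    k $ 1 * ec (- k) u $ 2 - k $ 2 * ec (- k) u $ 1] $ j) : bmeas"
   using exhaust_3[of j] borel_nth[OF ec(1), of "- k"] by (auto intro!: borel_measurable_diff borel_measurable_times)
 qed
 show "(%u. wc k u $ i) : bmeas" unfolding wc_def using borel_nth[OF m, of i] by simp
 have "norm (cross3 k (ec (- k) u)) <= norm k * norm (ec (- k) u)"
 proof (rule power2_le_imp_le)
  show "(norm (cross3 k (ec (- k) u)))^2 <= (norm k * norm (ec (- k) u))^2"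
   using norm_cross_dot'[of k "ec (- k) u"] zero_le_power2[of "k \<bullet> ec (- k) u"] unfolding power_mult_distrib by linarith
 qed simp
 also have "... <= norm k * (2 * C)" by (intro mult_left_mono ec(2)) simp
 finally have "norm (cross3 k (ec (- k) u)) <= norm k * (2 * C)" .
 hence "abs (cross3 k (ec (- k) u) $ i) <= norm k * (2 * C)" using component_le_norm_cart order_trans by blast
 thus "abs (wc k u $ i) <= 2 * pi * (norm k * (2 * C))" unfolding wc_def by (simp add: abs_mult mult_ac)
 show "isCont (%u. wc k u $ i) t" if "t : G"
 proof -
  have c: "isCont (%u. ec (- k) u $ j) t" for j using G_cont(2)[OF that, of "- k"] by (rule continuous_component)
  have "isCont (%u. wc k u $ 1) t" "isCont (%u. wc k u $ 2) t" "isCont (%u. wc k u $ 3) t"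
   unfolding wc_def cross3_def by (simp_all, (intro continuous_intros c)+)
  thus ?thesis using exhaust_3[of i] by auto
 qed
qed

text \<open>The time factor \<open>th n\<close> of the test field is a smooth plateau over the
  interval from \<open>s\<close> to \<open>t\<close>. Its derivative mollifies \<open>bc k\<close>
  at the two ends, which are good times, and the plateau itself tends to the indicator of the
  half-open interval.\<close>

lemma coef_integral:
 assumes st: "s : G" "t : G" "s <= t" and k: "k : lattice" shows "bc k t $ i = bc k s $ i + integral {s..t} (%u. wc k u $ i)"
proof (cases "s = t")
 case False
 with st have lt: "s < t" by simp
 let ?v = "axis i (1::real) :: real^3"
 have b0: "0 < s" "t < T" using st G by auto
 obtain sgm sgm' where stsgm: "step sgm sgm'" using step_exists by blast
 note sgm = stepD[OF stsgm]
 \<comment> \<open>A step that rises between \<open>y\<close> and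
   \<open>y + 1 / real (Suc n)\<close>, in the affine form needed for
   \<open>bumps_affine\<close>.\<close>
 define ta where "ta n y u = sgm (- (real (Suc n) * y) + real (Suc n) * u)" for n y u
 define ta' where "ta' n y u = real (Suc n) * sgm' (real (Suc n) * (u - y))" for n y u
 have ta_b: "ta n y : bumps" for n y unfolding ta_def by (rule bumps_affine[OF sgm(1)])
 have ta'_b: "ta' n y : bumps" for n y
 proof -
  have "(%u. real (Suc n) * sgm' (- (real (Suc n) * y) + real (Suc n) * u)) : bumps" by (intro bumps.mult bumps.const bumps_affine sgm(2))
  thus ?thesis unfolding ta'_def[abs_def] by (simp add: algebra_simps)
 qed
 have ta_d: "(ta n y has_real_derivative ta' n y u) (at u)" for n y u
 proof -
  have "((%u. sgm (- (real (Suc n) * y) + real (Suc n) * u)) has_real_derivative sgm' (- (real (Suc n) * y) + real (Suc n) * u) * real (Suc n)) (at u)"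
   by (rule DERIV_chain2[OF sgm(3)]) (auto intro!: derivative_eq_intros)
  thus ?thesis unfolding ta_def[abs_def] ta'_def by (simp add: algebra_simps)
 qed
 have ta_e: "ta n y u = sgm (real (Suc n) * (u - y))" for n y u unfolding ta_def by (simp add: algebra_simps)
 have ta0: "ta n y u = 0" if "u <= y" for n y u unfolding ta_e using that sgm(4) by (simp add: mult_nonneg_nonpos)
 have ta1: "ta n y u = 1" if "y + 1 / real (Suc n) <= u" for n y u
  unfolding ta_e by (rule sgm(5)) (use that in \<open>simp add: field_simps del: of_nat_Suc\<close>)
 have ta'0: "ta' n y u = 0" if "u < y | y + 1 / real (Suc n) < u" for n y u
 proof -
  have "real (Suc n) * (u - y) ~: {0..1}" using that by (auto simp: field_simps zero_le_mult_iff simp del: of_nat_Suc)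
  thus ?thesis using sgm(7) unfolding ta'_def by simp
 qed
 define th where "th n u = ta n s u + (- 1) * ta n t u" for n u
 define th' where "th' n u = ta' n s u + (- 1) * ta' n t u" for n u
 let ?f = "%u. bc k u \<bullet> ?v" and ?w = "%u. ec (- k) u \<bullet> ((2 * pi) *\<^sub>R cross3 k ?v)"
 have fm: "?f : bmeas" and wm: "?w : bmeas" using bc(1) ec(1) by (auto intro!: borel_measurable_inner)
 have fb: "abs (?f u) <= 2 * C * norm ?v" for u using order_trans[OF Cauchy_Schwarz_ineq2 mult_right_mono[OF bc(2) norm_ge_zero]] .
 have wb: "abs (?w u) <= 2 * C * norm ((2 * pi) *\<^sub>R cross3 k ?v)" for u
  using order_trans[OF Cauchy_Schwarz_ineq2 mult_right_mono[OF ec(2) norm_ge_zero]] .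
 have mol: "(%n. LINT u|lborel. ta' n y u * ?f u) \<longlonglongrightarrow> ?f y" if "y : G" for y
 proof -
  have "isCont ?f y" by (intro continuous_intros G_cont that)
  from bump_mollify[OF sgm(2,3) _ _ sgm(7) fm fb this] sgm(4,5) show ?thesis unfolding ta'_def by simp
 qed
 have ti: "integrable lborel (%u. ta' n y u * ?f u)" for n y
 proof -
  have c: "contU (ta' n y)" by (rule bumps_continuous[OF ta'_b])
  obtain M where M: "0 < M" "ALL u:{y..y + 1 / real (Suc n)}. abs (ta' n y u) <= M" using continuous_bounded_Icc[OF c] by blast
  show ?thesis
  proof (rule integrableI_bounded_set[where A = "{y..y + 1 / real (Suc n)}" and B = "M * (2 * C * norm ?v)"])
   show "(%u. ta' n y u * ?f u) : borel_measurable lborel" using fm meas_cont[OF c] by simp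
   show "AE u in lborel. u : {y..y + 1 / real (Suc n)} --> norm (ta' n y u * ?f u) <= M * (2 * C * norm ?v)"
    unfolding real_norm_def abs_mult using M fb by (intro AE_I2 impI mult_mono) auto
   show "AE u in lborel. u ~: {y..y + 1 / real (Suc n)} --> ta' n y u * ?f u = 0" using ta'0[of _ y n] by (intro AE_I2) auto
  qed (auto simp: emeasure_lborel_Icc_eq)
 qed
 have l1: "(%n. LINT u|lborel. th' n u * ?f u) \<longlonglongrightarrow> ?f s - ?f t"
 proof -
  have "(LINT u|lborel. th' n u * ?f u) = (LINT u|lborel. ta' n s u * ?f u) - (LINT u|lborel. ta' n t u * ?f u)" for n
   unfolding bint_diff[OF ti ti, symmetric] th'_def by (simp add: algebra_simps)
  thus ?thesis using tendsto_diff[OF mol[OF st(1)] mol[OF st(2)]] by simp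
 qed
 have l2: "(%n. LINT u|lborel. th n u * ?w u) \<longlonglongrightarrow> (LINT u|lborel. indicator {s<..t} u * ?w u)"
 proof (rule integral_dominated_convergence[where w = "%u. indicator {s..t + 1} u * (2 * (2 * C * norm ((2 * pi) *\<^sub>R cross3 k ?v)))"])
  show "(%u. th n u * ?w u) : borel_measurable lborel" for n unfolding th_def using wm meas_cont[OF bumps_continuous[OF ta_b]] by simp
  show "integrable lborel (%u. indicator {s..t + 1} u * (2 * (2 * C * norm ((2 * pi) *\<^sub>R cross3 k ?v))))"
   by (intro integrable_mult_left integrable_real_indicator) (auto simp: emeasure_lborel_Icc_eq)
  show "AE u in lborel. norm (th n u * ?w u) <= indicator {s..t + 1} u * (2 * (2 * C * norm ((2 * pi) *\<^sub>R cross3 k ?v)))" for n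
  proof (intro AE_I2)
   fix u
   have "abs (th n u) <= 2 * indicator {s..t + 1} u"
   proof (cases "u : {s..t + 1}")
    case True
    have "abs (ta n s u) <= 1" "abs (ta n t u) <= 1" unfolding ta_e by (rule sgm(6))+
    thus ?thesis using True unfolding th_def by simp
   next
    case False
    have n1: "1 / real (Suc n) <= 1" by simp
    have "ta n s u = ta n t u"
    proof (cases "u < s")
     case True
     thus ?thesis using lt ta0[of u s n] ta0[of u t n] by linarith
    next
     case ns: False
     hence "t + 1 < u" using False by auto
     hence "s + 1 / real (Suc n) <= u" "t + 1 / real (Suc n) <= u" using n1 lt by linarith+
     thus ?thesis using ta1[of s n u] ta1[of t n u] by linarith
    qed
    thus ?thesis using False unfolding th_def by simp
   qed
   hence "abs (th n u) * abs (?w u) <= (2 * indicator {s..t + 1} u) * (2 * C * norm ((2 * pi) *\<^sub>R cross3 k ?v))" using wb[of u] by (intro mult_mono) auto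
   thus "norm (th n u * ?w u) <= indicator {s..t + 1} u * (2 * (2 * C * norm ((2 * pi) *\<^sub>R cross3 k ?v)))" by (simp only: real_norm_def abs_mult mult_ac)
  qed
  have lim: "(%n. ta n y u) \<longlonglongrightarrow> indicator {y<..} u" for y u
  proof (cases "y < u")
   case True
   then obtain N where N: "1 / real (Suc N) < u - y" using nat_approx_posE[of "u - y"] by auto
   have "ta n y u = 1" if "N <= n" for n
   proof (rule ta1)
    have "1 / real (Suc n) <= 1 / real (Suc N)" using that by (simp add: frac_le)
    thus "y + 1 / real (Suc n) <= u" using N by linarith
   qed
   thus ?thesis using True by (intro tendsto_eventually eventually_sequentiallyI[of N]) simp
  qed (simp add: ta0)
  show "AE u in lborel. (%n. th n u * ?w u) \<longlonglongrightarrow> indicator {s<..t} u * ?w u"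
  proof (intro AE_I2 tendsto_intros)
   fix u
   have "(%n. th n u) \<longlonglongrightarrow> indicator {s<..} u + (- 1) * indicator {t<..} u" unfolding th_def by (intro tendsto_intros lim)
   also have "indicator {s<..} u + (- 1) * indicator {t<..} u = (indicator {s<..t} u :: real)" using lt by (simp add: indicator_def)
   finally show "(%n. th n u) \<longlonglongrightarrow> indicator {s<..t} u" .
  qed
  show "(%u. indicator {s<..t} u * ?w u) : borel_measurable lborel" using wm by simp
 qed
 obtain N where N: "1 / real (Suc N) < T - t" using nat_approx_posE[of "T - t"] b0 by auto
 have "(LINT u|lborel. th' n u * ?f u) = (LINT u|lborel. th n u * ?w u)" if n: "N <= n" for n
 proof (rule weak_faraday[OF _ _ _ _ _ b0(1) _ k])
  have "1 / real (Suc n) <= 1 / real (Suc N)" using n by (simp add: frac_le)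
  thus "t + 1 / real (Suc n) < T" using N by linarith
  show "th n : bumps" "th' n : bumps" unfolding th_def[abs_def] th'_def[abs_def] by (intro bumps.add bumps.mult bumps.const ta_b ta'_b)+
  show "(th n has_real_derivative th' n u) (at u)" for u unfolding th_def[abs_def] th'_def by (intro DERIV_add DERIV_cmult ta_d)
  fix u assume u: "u ~: {s..t + 1 / real (Suc n)}"
  show "th n u = 0" "th' n u = 0" using u lt ta0[of u s n] ta0[of u t n] ta1[of s n u] ta1[of t n u] ta'0[of u s n] ta'0[of u t n]
   unfolding th_def th'_def by (cases "u < s"; simp)+
 qed
 hence "\<forall>\<^sub>F n in sequentially. (LINT u|lborel. th' n u * ?f u) = (LINT u|lborel. th n u * ?w u)" by (intro eventually_sequentiallyI[of N])
 from LIMSEQ_unique[OF Lim_transform_eventually[OF l1 this] l2]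
 have "?f s - ?f t = (LINT u|lborel. indicator {s<..t} u * ?w u)" .
 also have "... = (LBINT u:{s..t}. - (wc k u $ i))" unfolding lint_def
 proof (rule integral_cong_AE)
  show "AE u in lborel. indicator {s<..t} u * ?w u = indicator {s..t} u *\<^sub>R - (wc k u $ i)"
  proof -
   have e: "?w u = - (wc k u $ i)" for u unfolding wc_def using exhaust_3[of i] by (auto simp: cross3_def inner_3 axis_def algebra_simps)
   have "AE u in lborel. u ~= s" by (rule AE_lborel_singleton)
   thus ?thesis unfolding e by eventually_elim (auto simp: indicator_def)
  qed
 qed (use wm wc_props(1)[of k i] in auto)
 also have "... = - integral {s..t} (%u. wc k u $ i)"
 proof -
  have "sint {s..t} (%u. - (wc k u $ i))" unfolding set_integrable_def
   by (rule integrableI_bounded_set[where A = "{s..t}" and B = "2 * pi * (norm k * (2 * C))"])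
    (use wc_props(1,2)[of k] lt in \<open>auto simp: emeasure_lborel_Icc_eq intro!: AE_I2\<close>)
  from set_borel_integral_eq_integral(2)[OF this] show ?thesis by simp
 qed
 finally show ?thesis by (simp add: inner_axis)
qed simp

end

lemma continuous_vector_3:
 fixes f g h :: "'a::topological_space => real"
 assumes "continuous_on S f" "continuous_on S g" "continuous_on S h" shows "continuous_on S (%x. vector [f x, g x, h x] :: real^3)"
proof -
 have "vector [f x, g x, h x] = f x *\<^sub>R axis 1 1 + g x *\<^sub>R axis 2 1 + h x *\<^sub>R (axis 3 1 :: real^3)" for x
  by (simp add: vec_eq_iff forall_3 axis_def)
 thus ?thesis by (simp only:) (intro continuous_intros assms)
qed

lemma test_slice:
 fixes ph :: "(real^3) * real => 'b::real_normed_vector"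
 assumes "C_infinity ph" shows "partial i (%y. ph (y, t)) x = fder ph (x, t) (axis i 1, 0)"
  and "((%s. ph (x, s)) has_vector_derivative fder ph (x, t) (0, 1)) (at t)" and "h : {(axis i 1, 0), (0, 1)} ==> C_infinity (%z. fder ph z h)"
  and "((%s. ph (mk i (s, p), t)) has_vector_derivative fder ph (mk i (s, p), t) (axis i 1, 0)) (at s)"
proof -
 have d: "(ph has_derivative fder ph z) (at z)" for z using C_infinityD(1)[OF assms] frechet_derivative_works by blast
 hence l: "linear (fder ph z)" for z by (rule has_derivative_linear)
 have x: "((%y. (y, t)) has_derivative (%h. (h, 0))) (at x)" for x :: "real^3" by (intro derivative_intros)
 have "((%y. ph (y, t)) has_derivative (%h. fder ph (x, t) (h, 0))) (at x)" by (rule has_derivative_compose[OF x d])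
 thus "partial i (%y. ph (y, t)) x = fder ph (x, t) (axis i 1, 0)" unfolding partial_def by (simp add: frechet_derivative_at[symmetric])
 have "((%s. (x, s)) has_derivative (%h. (0, h))) (at t)" by (intro derivative_intros)
 from has_derivative_compose[OF this d]
 have "((%s. ph (x, s)) has_derivative (%h. fder ph (x, t) (0, h))) (at t)" .
 moreover have "(%h. fder ph (x, t) (0, h)) = (%h. h *\<^sub>R fder ph (x, t) (0, 1))"
  using linear_scale[OF l, of "(x, t)" _ "(0, 1)"] by (intro ext) (metis mult.right_neutral real_scaleR_def scaleR_Pair scaleR_zero_right)
 ultimately show "((%s. ph (x, s)) has_vector_derivative fder ph (x, t) (0, 1)) (at t)" unfolding has_vector_derivative_def by (simp only:)
 have "((%s. (mk i (0, p) + s *\<^sub>R axis i 1, t)) has_derivative (%h. (h *\<^sub>R axis i 1, 0))) (at s)" by (auto intro!: derivative_eq_intros)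
 from has_derivative_compose[OF this d]
 have "((%s. ph (mk i (s, p), t)) has_derivative (%h. fder ph (mk i (s, p), t) (h *\<^sub>R axis i 1, 0))) (at s)" unfolding mk_line[of i _ p, symmetric] .
 moreover have "(%h. fder ph z (h *\<^sub>R axis i 1, 0)) = (%h. h *\<^sub>R fder ph z (axis i 1, 0))" for z
  using linear_scale[OF l, of z _ "(axis i 1, 0)"] by (intro ext) (metis scaleR_Pair scaleR_zero_right)
 ultimately show "((%s. ph (mk i (s, p), t)) has_vector_derivative fder ph (mk i (s, p), t) (axis i 1, 0)) (at s)"
  unfolding has_vector_derivative_def by (simp only:)
 show "C_infinity (%z. fder ph z h)" if "h : {(axis i 1, 0), (0, 1)}" by (rule C_infinityD(3)[OF assms]) (use that in \<open>auto simp: Basis_prod_def\<close>)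
qed

lemma test_continuous:
 fixes ph :: "(real^3) * real => real^3"
 assumes C: "C_infinity ph" shows "contU (%z. vector_derivative (%s. ph (fst z, s)) (at (snd z)))" and "contU (%z. curl (%y. ph (y, snd z)) (fst z))"
proof -
 have "vector_derivative (%s. ph (fst z, s)) (at (snd z)) = fder ph z (0, 1)" for z
  using vector_derivative_at[OF test_slice(2)[OF C, of "fst z" "snd z"]] by simp
 thus "contU (%z. vector_derivative (%s. ph (fst z, s)) (at (snd z)))" using C_infinityD(2)[OF test_slice(3)[OF C, of "(0, 1)"]] by simp
 have "contU (%z. fder ph z (axis i 1, 0))" for i using C_infinityD(2)[OF test_slice(3)[OF C, of "(axis i 1, 0)" i]] by simp
 thus "contU (%z. curl (%y. ph (y, snd z)) (fst z))" unfolding curl_def test_slice(1)[OF C] by (intro continuous_vector_3 continuous_intros) simp_all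
qed

lemma grad_test_continuous:
 fixes ps :: "(real^3) * real => real"
 assumes C: "C_infinity ps" shows "contU (%z. grad (%y. ps (y, snd z)) (fst z))"
 unfolding grad_def test_slice(1)[OF C] using C_infinityD(2)[OF test_slice(3)[OF C]] by (auto intro!: continuous_on_vec_lambda)

context flow
begin

text \<open>The formal time derivative of the helicity.\<close>

definition "g t = - 2 * (LINT x|torus. b (x, t) \<bullet> e (x, t))"

lemma g_props: "g : bmeas" "abs (g t) <= 2 * C^2" "t : G ==> isCont g t"
proof -
 have m: "(%z. b z \<bullet> e z) : bmeas" using borel by (rule borel_measurable_inner)
 have bd: "norm (b z \<bullet> e z) <= C^2" for z
  using order_trans[OF Cauchy_Schwarz_ineq2 mult_mono[OF bounded C0 norm_ge_zero]] by (simp add: power2_eq_square)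
 show "g : bmeas" unfolding g_def[abs_def] using torus_slice_measurable[OF m] by simp
 have "abs (LINT x|torus. b (x, t) \<bullet> e (x, t)) <= (LINT x|torus. C^2)"
 proof (rule integral_abs_bound_integral)
  show "integrable torus (%x. b (x, t) \<bullet> e (x, t))" using bounded_integrable[OF pair_swap_measurable(2)[OF m, of t], of "C^2"] bd by simp
 qed (use bd in \<open>auto intro: integrable_torus_continuous continuous_intros\<close>)
 thus "abs (g t) <= 2 * C^2" using measure_torus by (simp add: g_def abs_mult)
 show "isCont g t" if "t : G"
 proof -
  have "AE x in torus. isCont (%s. b (x, s) \<bullet> e (x, s)) t" using cont[OF that] by eventually_elim (auto intro: continuous_intros)
  from isCont_torus_integral[OF m bd this] show ?thesis unfolding g_def[abs_def] by (intro continuous_intros)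
 qed
qed

lemma potential:
 assumes t: "t : G" shows "EX A. vector_potential (%x. b (x, t)) A" "(%K. H K (%k. bc k t)) \<longlonglongrightarrow> helicity (%x. b (x, t))"
proof -
 have 0: "vcoef 0 (%x. b (x, t)) = 0" using mean[OF t] by (simp add: vcoef_def)
 obtain A where A: "vector_potential (%x. b (x, t)) A"
   "(%K. H K (%k. vcoef k (%x. b (x, t)))) \<longlonglongrightarrow> (LINT x|torus. A x \<bullet> b (x, t))"
  by (rule vector_potential_fourier[OF pair_swap_measurable(2)[OF borel(1), of t] bounded(1) 0 div_free[OF t, unfolded bc_def]])
 thus "EX A. vector_potential (%x. b (x, t)) A" by blast
 show "(%K. H K (%k. bc k t)) \<longlonglongrightarrow> helicity (%x. b (x, t))" using A(2) helicity_eq[OF A(1) slice_integrable(1)] by (simp add: bc_def)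
qed

text \<open>The coefficients are controlled only at good times, so \<open>F k\<close> replaces
  \<open>bc k\<close> by the Lipschitz primitive that agrees with it there, and the fundamental
  theorem applies to the truncated helicity. Symmetry under \<open>k\<close> and \<open>- k\<close>
  collects both parts of the product rule into one sum.\<close>

lemma H_derivative:
 assumes st: "s : G" "r : G" "s <= r" shows "sint {s..r} (%u. - 2 * (SUM k:lat K. bc k u \<bullet> ec k u))"
  and "H K (%k. bc k r) - H K (%k. bc k s) = (LBINT u:{s..r}. - 2 * (SUM k:lat K. bc k u \<bullet> ec k u))"
proof -
 define F where "F k t = (\<chi> i. bc k s $ i + integral {s..t} (%u. wc k u $ i))" for k t
 have sr: "{s<..<r} \<subseteq> {0<..<T}" using subsetD[OF G st(1)] subsetD[OF G st(2)] by auto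
 have aeG: "AE u in lborel. u : {s<..<r} --> u : G" using AE_G by eventually_elim (use sr in blast)
 have lF: "lipD s r (%t. F k t $ i) (%t. wc k t $ i)" for k i
 proof -
  have "AE u in lborel. u : {s<..<r} --> isCont (%u. wc k u $ i) u" using aeG by eventually_elim (use wc_props(3) in blast)
  from lipD_integral[OF wc_props(1,2) this] show ?thesis unfolding F_def by simp
 qed
 have FG: "F k t = bc k t" if "t : G" "s <= t" "k : lattice" for k t using coef_integral[OF st(1) that(1,2,3)] unfolding F_def by (simp add: vec_eq_iff)
 let ?d = "%t. SUM k:lat K. (- 1 / (2 * pi * (norm k)^2)) * (cross3 k (wc (- k) t) \<bullet> F k t + cross3 k (F (- k) t) \<bullet> wc k t)"
 have HF: "H K (%k. F k t) = (SUM k:lat K. (- 1 / (2 * pi * (norm k)^2)) * (cross3 k (F (- k) t) \<bullet> F k t))" for t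
  unfolding H_def by (simp add: sum_negf)
 have L: "lipD s r (%t. H K (%k. F k t)) ?d" unfolding HF by (intro lipD_sum finite_lat lipD_cmult lipD_triple lF)
 have d: "?d u = - 2 * (SUM k:lat K. bc k u \<bullet> ec k u)" if u: "u : G" "s <= u" for u
 proof -
  have "(- 1 / (2 * pi * (norm k)^2)) * (cross3 k (wc (- k) u) \<bullet> F k u + cross3 k (F (- k) u) \<bullet> wc k u) =
    - (bc k u \<bullet> ec k u) - (bc (- k) u \<bullet> ec (- k) u)" if k: "k : lat K" for k
  proof (cases "k = 0")
   case True
   have "bc 0 u = 0" using mean[OF u(1)] by (simp add: bc_def vcoef_def)
   thus ?thesis using True by simp
  next
   case False
   have kl: "k : lattice" using k lat_lattice by blast
   note e = FG[OF u kl] FG[OF u lattice_uminus[OF kl]]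
   \<comment> \<open>Lagrange's identity for the double cross product; the last term drops out since
     the field is divergence-free.\<close>
   have 1: "cross3 k (wc (- k) u) \<bullet> bc k u = (2 * pi) * ((norm k)^2 * (bc k u \<bullet> ec k u) - (k \<bullet> ec k u) * (bc k u \<bullet> k))"
    unfolding wc_def power2_norm_eq_inner by (simp add: cross3_def inner_3 algebra_simps)
   have 2: "cross3 k (bc (- k) u) \<bullet> wc k u = (2 * pi) * ((norm k)^2 * (bc (- k) u \<bullet> ec (- k) u) + (k \<bullet> ec (- k) u) * (bc (- k) u \<bullet> - k))"
    unfolding wc_def power2_norm_eq_inner by (simp add: cross3_def inner_3 algebra_simps)
   show ?thesis unfolding e 1 2 div_free[OF u(1) kl] div_free[OF u(1) lattice_uminus[OF kl]] using False by (simp add: field_simps)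
  qed
  hence "?d u = (SUM k:lat K. - (bc k u \<bullet> ec k u) - (bc (- k) u \<bullet> ec (- k) u))" by (intro sum.cong refl) auto
  thus ?thesis using sum_lat_uminus[of "%k. bc k u \<bullet> ec k u" K] by (simp add: sum_subtractf sum_negf)
 qed
 obtain Lc where Lc: "Lc-lipschitz_on {s..r+1} (%t. H K (%k. F k t))" using L unfolding lipD_def by blast
 have m: "(%u. - 2 * (SUM k:lat K. bc k u \<bullet> ec k u)) : bmeas"
  by (intro borel_measurable_times borel_measurable_const borel_measurable_sum borel_measurable_inner bc(1) ec(1))
 have der: "AE u in lborel. u : {s<..<r} --> ((%t. H K (%k. F k t)) has_real_derivative - 2 * (SUM k:lat K. bc k u \<bullet> ec k u)) (at u)"
 proof -
  have "AE u in lborel. u : {s<..<r} --> ((%t. H K (%k. F k t)) has_real_derivative ?d u) (at u)" using L unfolding lipD_def by blast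
  thus ?thesis using aeG
  proof eventually_elim
   case (elim u) thus ?case using d[of u] by auto
  qed
 qed
 note ftc = lipschitz_FTC[OF st(3) Lc der m]
 show "sint {s..r} (%u. - 2 * (SUM k:lat K. bc k u \<bullet> ec k u))" by (rule ftc(1))
 have "H K (%k. bc k t) = H K (%k. F k t)" if "t : G" "s <= t" for t
  unfolding H_def using FG[OF that] lat_lattice lattice_uminus by (intro arg_cong[of _ _ uminus] sum.cong refl) (auto simp: subset_eq)
 thus "H K (%k. bc k r) - H K (%k. bc k s) = (LBINT u:{s..r}. - 2 * (SUM k:lat K. bc k u \<bullet> ec k u))" unfolding ftc(2) using st by simp
qed

text \<open>Parseval gives the pointwise limit of the truncated rates, and Bessel bounds them by
  \<open>2 * C^2\<close> uniformly in \<open>K\<close>, as dominated convergence requires.\<close>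

lemma helicity_diff:
 assumes st: "s : G" "r : G" "s <= r" shows "helicity (%x. b (x, r)) - helicity (%x. b (x, s)) = (LBINT u:{s..r}. g u)"
proof -
 have 1: "(%K. LBINT u:{s..r}. - 2 * (SUM k:lat K. bc k u \<bullet> ec k u)) \<longlonglongrightarrow> helicity (%x. b (x, r)) - helicity (%x. b (x, s))"
  unfolding H_derivative(2)[OF st, symmetric] by (intro tendsto_diff potential(2) st(1,2))
 have "(%K. LBINT u:{s..r}. - 2 * (SUM k:lat K. bc k u \<bullet> ec k u)) \<longlonglongrightarrow> (LBINT u:{s..r}. g u)" unfolding lint_def
 proof (rule integral_dominated_convergence[where w = "%u. indicator {s..r} u * (2 * C^2)"])
  show "(%u. indicator {s..r} u *\<^sub>R g u) : borel_measurable lborel" using g_props(1) by simp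
  show "(%u. indicator {s..r} u *\<^sub>R (- 2 * (SUM k:lat K. bc k u \<bullet> ec k u))) : borel_measurable lborel" for K
   using H_derivative(1)[OF st, of K] unfolding set_integrable_def by (rule borel_measurable_integrable)
  show "integrable lborel (%u. indicator {s..r} u * (2 * C^2))" by (intro integrable_mult_left integrable_real_indicator) (auto simp: emeasure_lborel_Icc_eq)
  have lim: "(%K. - 2 * (SUM k:lat K. bc k u \<bullet> ec k u)) \<longlonglongrightarrow> g u" for u unfolding g_def bc_def ec_def
   by (intro tendsto_mult tendsto_const parseval[OF pair_swap_measurable(2)[OF borel(1)] bounded(1) pair_swap_measurable(2)[OF borel(2)] bounded(2)])
  show "AE u in lborel. (%K. indicator {s..r} u *\<^sub>R (- 2 * (SUM k:lat K. bc k u \<bullet> ec k u))) \<longlonglongrightarrow> indicator {s..r} u *\<^sub>R g u"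
   by (intro AE_I2 tendsto_intros lim)
  show "AE u in lborel. norm (indicator {s..r} u *\<^sub>R (- 2 * (SUM k:lat K. bc k u \<bullet> ec k u))) <= indicator {s..r} u * (2 * C^2)" for K
  proof (intro AE_I2)
   fix u
   have "abs (2 * (bc k u \<bullet> ec k u)) <= (norm (bc k u))^2 + (norm (ec k u))^2" for k
    using Cauchy_Schwarz_ineq2[of "bc k u" "ec k u"] sum_squares_bound[of "norm (bc k u)" "norm (ec k u)"] by (simp add: abs_mult)
   hence "abs (SUM k:lat K. 2 * (bc k u \<bullet> ec k u)) <= (SUM k:lat K. (norm (bc k u))^2 + (norm (ec k u))^2)" by (intro order_trans[OF sum_abs] sum_mono)
   also have "... <= C^2 + C^2" unfolding sum.distrib bc_def ec_def
    by (intro add_mono bessel[OF pair_swap_measurable(2)[OF borel(1)] bounded(1) finite_lat lat_lattice]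
      bessel[OF pair_swap_measurable(2)[OF borel(2)] bounded(2) finite_lat lat_lattice])
   finally have "abs (- 2 * (SUM k:lat K. bc k u \<bullet> ec k u)) <= 2 * C^2" by (simp add: sum_distrib_left[symmetric] abs_mult)
   thus "norm (indicator {s..r} u *\<^sub>R (- 2 * (SUM k:lat K. bc k u \<bullet> ec k u))) <= indicator {s..r} u * (2 * C^2)" by (simp add: indicator_def)
  qed
 qed
 with 1 show ?thesis by (rule LIMSEQ_unique)
qed

end

lemma AE_lborel_slices:
 assumes "AE z in lborel. P (z :: 'a::euclidean_space \<times> 'b::euclidean_space)" shows "AE t in lborel. AE x in lborel. P (x, t)"
proof -
 have "AE z in lborel \<Otimes>\<^sub>M lborel. P z" using assms unfolding lborel_prod .
 then obtain N where N: "N : null_sets (lborel \<Otimes>\<^sub>M lborel)" "{z. ~ P z} \<subseteq> N" by (auto simp: eventually_ae_filter space_pair_measure)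
 have "{x : space (lborel \<Otimes>\<^sub>M lborel). (fst x, snd x) ~: N} = space (lborel \<Otimes>\<^sub>M (lborel :: 'b measure)) - N" by auto
 hence m: "{x : space (lborel \<Otimes>\<^sub>M lborel). (fst x, snd x) ~: N} : sets (lborel \<Otimes>\<^sub>M (lborel :: 'b measure))"
  using N(1) by (simp only: sets.compl_sets null_setsD2)
 have "AE z in lborel \<Otimes>\<^sub>M lborel. z ~: N" by (rule AE_not_in[OF N(1)])
 hence "AE x in lborel. AE y in lborel. (x, y) ~: N" by (rule lborel_pair.AE_pair)
 hence "AE t in lborel. AE x in lborel. (x, t) ~: N" using lborel_pair.AE_commute[of "%x y. (x, y) ~: N"] m by simp
 thus ?thesis
 proof eventually_elim
  case (elim t) thus ?case by eventually_elim (use N(2) in blast)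
 qed
qed

text \<open>On the open set \<open>W\<close> both fields are locally constant and bounded; setting
  them to zero elsewhere gives Borel representatives with bounds everywhere. A time is good if
  almost all of its slice lies in \<open>W\<close>, since there both fields are constant in time for
  a short while.\<close>

lemma given_helicity:
 assumes T: "0 < T" and L: "L_infinity T B0" "L_infinity T E0" and pc: "piecewise_constant T B0" "piecewise_constant T E0"
  and fm: "faraday_maxwell T B0 E0" and zm: "AE t in lebesgue_on {0<..<T}. zero_mean (%x. B0 (x, t))"
 obtains G g M s where "G \<subseteq> {0<..<T}" "AE t in lborel. t : {0<..<T} --> t : G" "g : bmeas"
  "ALL t. abs (g t) <= M" "ALL t:G. isCont g t" "s : G"
  "ALL t:G. ALL s:G. s <= t --> helicity (%x. B0 (x, t)) - helicity (%x. B0 (x, s)) = (LBINT u:{s..t}. g u)"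
proof -
 obtain Qb where Qb: "ALL Q:Qb. torus_time_open T Q" "negligible (UNIV \<times> {0<..<T} - \<Union>Qb)" "ALL Q:Qb. B0 constant_on Q"
  using pc(1) unfolding piecewise_constant_def by blast
 obtain Qe where Qe: "ALL Q:Qe. torus_time_open T Q" "negligible (UNIV \<times> {0<..<T} - \<Union>Qe)" "ALL Q:Qe. E0 constant_on Q"
  using pc(2) unfolding piecewise_constant_def by blast
 have lc: "loc_const v z" if zQ: "z : \<Union>QQ" and to: "ALL Q:QQ. torus_time_open T Q" and vc: "ALL Q:QQ. v constant_on Q" for v :: "(real^3) * real => real^3" and z QQ
 proof -
  obtain Q where Q: "Q : QQ" "z : Q" using zQ by blast
  hence "open Q" using to unfolding torus_time_open_def by blast
  hence Q': "\<forall>\<^sub>F y in nhds z. y : Q" using Q(2) eventually_nhds by blast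
  obtain c where c: "ALL y:Q. v y = c" using vc Q(1) unfolding constant_on_def by blast
  show ?thesis unfolding loc_const_def using Q' by eventually_elim (use Q(2) c in simp)
 qed
 obtain C1 C2 where C: "AE z in torus_time T. norm (B0 z) <= C1" "AE z in torus_time T. norm (E0 z) <= C2" using L unfolding L_infinity_def by blast
 define C where "C = max (max C1 C2) 0"
 define W where "W = {z. loc_const (%z. (B0 z, E0 z)) z & snd z : {0<..<T} & norm (B0 z) <= C & norm (E0 z) <= C}"
 have W: "open W" unfolding W_def
 proof (rule open_if_eventually_nhds)
  fix z assume z: "loc_const (%z. (B0 z, E0 z)) z & snd z : {0<..<T} & norm (B0 z) <= C & norm (E0 z) <= C"
  have "\<forall>\<^sub>F y in nhds z. loc_const (%z. (B0 z, E0 z)) y" using open_loc_const[of "%z. (B0 z, E0 z)"] z eventually_nhds by blast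
  moreover have "\<forall>\<^sub>F y in nhds z. snd y : {0<..<T}" by (rule eventually_nhds_snd, rule eventually_nhds_in_open) (use z in auto)
  moreover have "\<forall>\<^sub>F y in nhds z. (B0 y, E0 y) = (B0 z, E0 z)" using z unfolding loc_const_def by blast
  ultimately show "\<forall>\<^sub>F y in nhds z. loc_const (%z. (B0 z, E0 z)) y & snd y : {0<..<T} & norm (B0 y) <= C & norm (E0 y) <= C"
   by eventually_elim (use z in auto)
 qed
 have aeW: "AE z in torus_time T. z : W"
 proof -
  have "AE z in torus_time T. z : \<Union>Qb \<inter> \<Union>Qe" unfolding AE_torus_time
   using negligible_imp_AE_lborel[OF Qb(2)] negligible_imp_AE_lborel[OF Qe(2)] by eventually_elim auto
  moreover have "AE z in torus_time T. snd z : {0<..<T}" unfolding AE_torus_time by (intro AE_I2) auto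
  ultimately show ?thesis using C
  proof eventually_elim
   case (elim z)
   have "loc_const B0 z" "loc_const E0 z" using lc Qb Qe elim(1) by blast+
   hence "loc_const (%z. (B0 z, E0 z)) z" by (rule loc_const_compose2)
   thus ?case using elim unfolding W_def C_def by auto
  qed
 qed
 define b where "b z = (if z : W then B0 z else 0)" for z
 define e where "e z = (if z : W then E0 z else 0)" for z
 have lcW: "loc_const B0 z" "loc_const E0 z" "loc_const b z" "loc_const e z" if z: "z : W" for z
 proof -
  have "loc_const (%z. (B0 z, E0 z)) z" using z unfolding W_def by blast
  from loc_const_compose[OF this, of fst] loc_const_compose[OF this, of snd]
  show B: "loc_const B0 z" and E: "loc_const E0 z" by simp_all
  have zW: "\<forall>\<^sub>F y in nhds z. y : W" using W z by (rule eventually_nhds_in_open)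
  have "\<forall>\<^sub>F y in nhds z. b y = B0 y" "\<forall>\<^sub>F y in nhds z. e y = E0 y" using zW by (eventually_elim, simp add: b_def e_def)+
  thus "loc_const b z" "loc_const e z" using loc_const_cong B E by blast+
 qed
 have meas: "(%z. if z : W then v z else 0) : bmeas" if "!!z. z : W ==> loc_const v z" for v :: "(real^3) * real => real^3"
 proof (rule borel_measurableI)
  fix S :: "(real^3) set" assume "open S"
  have "open (W \<inter> v -` S)"
  proof -
   have "open {z. z : W & v z : S}"
   proof (rule open_if_eventually_nhds)
    fix z assume z: "z : W & v z : S"
    have "\<forall>\<^sub>F y in nhds z. v y = v z" using that z unfolding loc_const_def by blast
    moreover have "\<forall>\<^sub>F y in nhds z. y : W" using W z eventually_nhds_in_open by blast
    ultimately show "\<forall>\<^sub>F y in nhds z. y : W & v y : S" by eventually_elim (use z in auto)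
   qed
   thus ?thesis by (simp add: Int_def vimage_def)
  qed
  moreover have "(%z. if z : W then v z else 0) -` S \<inter> space borel = W \<inter> v -` S \<union> (if 0 : S then - W else {})" by (auto split: if_splits)
  ultimately show "(%z. if z : W then v z else 0) -` S \<inter> space borel : sets borel" using W by auto
 qed
 have mb: "b : bmeas" and me: "e : bmeas" unfolding b_def[abs_def] e_def[abs_def] using meas lcW by blast+
 have C0: "0 <= C" unfolding C_def by simp
 define G where "G = {t : {0<..<T}. (AE x in torus. (x, t) : W) & zero_mean (%x. B0 (x, t))}"
 have AEG: "AE t in lborel. t : {0<..<T} --> t : G"
 proof -
  have "AE z in lborel. z : cbox 0 1 \<times> {0<..<T} --> z : W" using aeW unfolding AE_torus_time .
  hence "AE t in lborel. AE x in lborel. (x, t) : cbox 0 1 \<times> {0<..<T} --> (x, t) : W" by (rule AE_lborel_slices)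
  moreover have "AE t in lborel. t : {0<..<T} --> zero_mean (%x. B0 (x, t))" using zm unfolding AE_time .
  ultimately show ?thesis
  proof eventually_elim
   case (elim t)
   show ?case
   proof
    assume t: "t : {0<..<T}"
    have "AE x in torus. (x, t) : W" unfolding AE_torus using elim(1) by eventually_elim (use t in auto)
    thus "t : G" unfolding G_def using t elim(2) by blast
   qed
  qed
 qed
 have eqb: "AE x in torus. B0 (x, t) = b (x, t)" if "t : G" for t
 proof -
  have "AE x in torus. (x, t) : W" using that unfolding G_def by blast
  thus ?thesis by eventually_elim (simp add: b_def)
 qed
 have Bi: "integrable torus (%x. B0 (x, t))" "(LINT x|torus. B0 (x, t)) = 0" if "t : G" for t using that unfolding G_def zero_mean_def by auto
 have aeb: "AE z in torus_time T. B0 z = b z & E0 z = e z" using aeW by eventually_elim (simp add: b_def e_def)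
 have Lm: "B0 : borel_measurable (torus_time T)" "E0 : borel_measurable (torus_time T)" using L unfolding L_infinity_def by auto
 interpret flow T C b e G
 proof
  show "norm (b z) <= C" "norm (e z) <= C" for z unfolding b_def e_def W_def using C0 by auto
  show "G \<subseteq> {0<..<T}" unfolding G_def by blast
  show "AE x in torus. isCont (%s. b (x, s)) t & isCont (%s. e (x, s)) t" if t: "t : G" for t
  proof -
   have "AE x in torus. (x, t) : W" using t unfolding G_def by blast
   thus ?thesis
   proof eventually_elim
    case (elim x)
    have "isCont (%s. v (x, s)) t" if "loc_const v (x, t)" for v :: "(real^3) * real => real^3"
    proof -
     have "isCont v (x, t)" using that unfolding loc_const_def isCont_def by (intro tendsto_eventually) (simp add: eventually_nhds_conv_at)
     thus ?thesis using isCont_o2[of t "%s. (x, s)" v] by (simp add: isCont_Pair)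
    qed
    thus ?case using lcW(3,4)[OF elim] by blast
   qed
  qed
  show "(LINT x|torus. b (x, t)) = 0" if t: "t : G" for t
   using integral_cong_AE[OF borel_measurable_integrable[OF Bi(1)[OF t]] borel_measurable_torus[OF pair_swap_measurable(2)[OF mb]] eqb[OF t]] Bi(2)[OF t] by simp
  have eq: "(LINT z|torus_time T. B0 z \<bullet> f z) = (LINT z|torus_time T. b z \<bullet> f z)" "(LINT z|torus_time T. E0 z \<bullet> f z) = (LINT z|torus_time T. e z \<bullet> f z)"
   if f: "f : borel_measurable (torus_time T)" for f
  proof -
   have "AE z in torus_time T. B0 z \<bullet> f z = b z \<bullet> f z" "AE z in torus_time T. E0 z \<bullet> f z = e z \<bullet> f z"
    using aeb by (eventually_elim, simp)+
   thus "(LINT z|torus_time T. B0 z \<bullet> f z) = (LINT z|torus_time T. b z \<bullet> f z)" "(LINT z|torus_time T. E0 z \<bullet> f z) = (LINT z|torus_time T. e z \<bullet> f z)"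
    using f Lm borel_measurable_torus_time[OF mb] borel_measurable_torus_time[OF me] by (auto intro!: integral_cong_AE)
  qed
  show "faraday_maxwell T b e" unfolding faraday_maxwell_def
  proof (intro conjI allI impI)
   fix ph :: "(real^3) * real => real^3" assume ph: "torus_time_test T ph"
   hence C: "C_infinity ph" unfolding torus_time_test_def by blast
   have "- (LINT z|torus_time T. B0 z \<bullet> vector_derivative (%s. ph (fst z, s)) (at (snd z)))
    + (LINT z|torus_time T. E0 z \<bullet> curl (%y. ph (y, snd z)) (fst z)) = 0" using fm ph unfolding faraday_maxwell_def case_prod_unfold by simp
   thus "- (\<integral>(x, t). b (x, t) \<bullet> vector_derivative (%s. ph (x, s)) (at t) \<partial>torus_time T)
    + (\<integral>(x, t). e (x, t) \<bullet> curl (%y. ph (y, t)) x \<partial>torus_time T) = 0"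
    using eq test_continuous[OF C] by (simp add: case_prod_unfold borel_measurable_torus_time meas_cont)
  next
   fix ps :: "(real^3) * real => real" assume ps: "torus_time_test T ps"
   hence C: "C_infinity ps" unfolding torus_time_test_def by blast
   have "(LINT z|torus_time T. B0 z \<bullet> grad (%y. ps (y, snd z)) (fst z)) = 0" using fm ps unfolding faraday_maxwell_def case_prod_unfold by simp
   thus "- (\<integral>(x, t). b (x, t) \<bullet> grad (%y. ps (y, t)) x \<partial>torus_time T) = 0"
    using eq grad_test_continuous[OF C] by (simp add: case_prod_unfold borel_measurable_torus_time meas_cont)
  qed
 qed (use T mb me AEG in auto)
 have "G ~= {}"
 proof
  assume "G = {}"
  hence "AE t in lborel. t ~: {0<..<T}" using AEG by simp
  hence "{0<..<T} : null_sets lborel" by (subst AE_iff_null_sets) auto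
  thus False using T by (simp add: null_sets_def)
 qed
 then obtain s where s: "s : G" by blast
 have "helicity (%x. B0 (x, t)) = helicity (%x. b (x, t))" if t: "t : G" for t
  using potential(1)[OF t] helicity_cong[OF eqb[OF t] Bi(1)[OF t] slice_integrable(1)] by blast
 hence "ALL t:G. ALL s:G. s <= t --> helicity (%x. B0 (x, t)) - helicity (%x. B0 (x, s)) = (LBINT u:{s..t}. g u)" using helicity_diff by simp
 thus thesis using that[OF G AEG g_props(1) _ _ s] g_props(2,3) by blast
qed

section \<open>Decomposition into step functions\<close>

text \<open>A countable base of the line in a fixed order, so that the first suitable interval can
  be chosen in a measurable way.\<close>

definition ival :: "nat => real set" where
 "ival n = (let q = from_nat n :: rat \<times> rat in {of_rat (fst q)<..<of_rat (snd q)})"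

lemma ival_nhd:
 assumes "open S" "t : S" shows "EX n. t : ival n & ival n \<subseteq> S"
proof -
 obtain d where d: "0 < d" "ball t d \<subseteq> S" using assms openE by blast
 obtain p q where "t - d < of_rat p" "of_rat p < t" "t < of_rat q" "of_rat q < t + d" using of_rat_dense[of "t - d" t] of_rat_dense[of t "t + d"] d(1) by auto
 hence "t : ival (to_nat (p, q))" "ival (to_nat (p, q)) \<subseteq> ball t d" by (auto simp: ival_def dist_real_def)
 thus ?thesis using d(2) by blast
qed

lemma ival_eventually: "AE t in lborel. ALL n. (\<forall>\<^sub>F y in nhds t. y : ival n \<longleftrightarrow> t : ival n)"
proof -
 have "countable (\<Union>n. {t. t = of_rat (fst (from_nat n :: rat \<times> rat)) | t = of_rat (snd (from_nat n :: rat \<times> rat))} :: real set)"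
  by (intro countable_UN) (auto simp: Collect_disj_eq)
 from countable_imp_AE_lborel[OF this] show ?thesis
 proof eventually_elim
  case (elim t)
  show ?case
  proof
   fix n
   define a b where "a = (of_rat (fst (from_nat n :: rat \<times> rat)) :: real)" and "b = (of_rat (snd (from_nat n :: rat \<times> rat)) :: real)"
   have i: "ival n = {a<..<b}" unfolding ival_def a_def b_def by (simp add: Let_def)
   have "t ~= a" "t ~= b" using elim unfolding a_def b_def by auto
   then consider "t : {a<..<b}" | "t : - {a..b}" by fastforce
   thus "\<forall>\<^sub>F y in nhds t. y : ival n \<longleftrightarrow> t : ival n"
   proof cases
    case 1
    hence "\<forall>\<^sub>F y in nhds t. y : {a<..<b}" by (intro eventually_nhds_in_open) auto
    thus ?thesis unfolding i by eventually_elim (use 1 in auto)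
   next
    case 2
    hence "\<forall>\<^sub>F y in nhds t. y : - {a..b}" by (intro eventually_nhds_in_open) (auto simp: open_Compl)
    thus ?thesis unfolding i by eventually_elim (use 2 in auto)
   qed
  qed
 qed
qed

text \<open>\<open>i t\<close> is the first rational interval around \<open>t\<close> on which
  \<open>g\<close> oscillates by at most \<open>ep\<close>, and \<open>S\<close> takes the value of
  \<open>g\<close> at one fixed point of it. Away from rational endpoints, membership in finitely
  many intervals does not change nearby, hence neither do \<open>i\<close> and
  \<open>S\<close>.\<close>

lemma step_approximation:
 fixes g :: "real => real"
 assumes b: "!!t. abs (g t) <= M" and e: "0 < ep" shows "EX S. S : bmeas & (ALL t. isCont g t --> abs (g t - S t) <= ep) & (ALL t. abs (S t) <= M) \<and>
  (AE t in lborel. isCont g t --> loc_const S t)"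
proof -
 define P where "P n t \<longleftrightarrow> t : ival n & (ALL u:ival n. ALL v:ival n. abs (g u - g v) <= ep)" for n t
 define i where "i t = (LEAST n. P n t)" for t
 define S where "S t = g (SOME u. u : ival (i t))" for t
 have io: "ival n : sets borel" for n unfolding ival_def by (simp add: Let_def)
 have "i : measurable borel (count_space UNIV)" unfolding i_def by (rule measurable_Least) (use io in \<open>auto simp: P_def intro!: pred_intros_logic\<close>)
 hence mS: "S : bmeas" unfolding S_def[abs_def] by (rule measurable_compose[where g = "%n. g (SOME u. u : ival n)"]) simp
 have ex: "EX n. P n t" if "isCont g t" for t
 proof -
  have "\<forall>\<^sub>F y in nhds t. dist (g y) (g t) < ep / 2" by (rule tendstoD[OF isCont_tendsto_nhds[OF that]]) (use e in simp)
  then obtain d where d: "0 < d" "!!y. abs (y - t) < d ==> abs (g y - g t) < ep / 2" unfolding eventually_nhds_metric dist_real_def by blast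
  obtain n where n: "t : ival n" "ival n \<subseteq> ball t d" using ival_nhd[of "ball t d" t] d(1) by auto
  have "abs (g u - g v) <= ep" if "u : ival n" "v : ival n" for u v
  proof -
   have "abs (u - t) < d" "abs (v - t) < d" using n(2) that by (auto simp: dist_real_def abs_minus_commute)
   from d(2)[OF this(1)] d(2)[OF this(2)] show ?thesis by linarith
  qed
  thus ?thesis using n(1) unfolding P_def by blast
 qed
 have ap: "abs (g t - S t) <= ep" if t: "isCont g t" for t
 proof -
  have "P (i t) t" unfolding i_def using ex[OF t] by (rule LeastI_ex)
  hence P: "t : ival (i t)" "ALL u:ival (i t). ALL v:ival (i t). abs (g u - g v) <= ep" unfolding P_def by auto
  have "(SOME u. u : ival (i t)) : ival (i t)" using P(1) by (rule someI)
  thus ?thesis using P unfolding S_def by blast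
 qed
 have "AE t in lborel. isCont g t --> loc_const S t" using ival_eventually
 proof eventually_elim
  case (elim t)
  show ?case
  proof
   assume t: "isCont g t"
   have ev: "\<forall>\<^sub>F y in nhds t. ALL n:{..i t}. P n y \<longleftrightarrow> P n t"
   proof (rule eventually_ball_finite, simp, intro ballI)
    fix n show "\<forall>\<^sub>F y in nhds t. P n y \<longleftrightarrow> P n t" using elim[THEN spec, of n] unfolding P_def by eventually_elim auto
   qed
   have L: "P (i t) t" unfolding i_def using ex[OF t] by (rule LeastI_ex)
   show "loc_const S t" unfolding loc_const_def using ev
   proof eventually_elim
    case (elim y)
    have "i y = i t" unfolding i_def[of y]
    proof (rule Least_equality)
     show "P (i t) y" using elim L by simp
     show "i t <= n" if "P n y" for n
     proof (rule ccontr)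
      assume n: "~ i t <= n"
      hence "P n t" using elim that by simp
      thus False using n Least_le[of "%n. P n t" n] unfolding i_def by simp
     qed
    qed
    thus ?case unfolding S_def by simp
   qed
  qed
 qed
 moreover have "abs (S t) <= M" for t unfolding S_def by (rule b)
 ultimately show ?thesis using mS ap by blast
qed

text \<open>A locally constant rate has a locally affine primitive. For negative \<open>t\<close>
  the integral over \<open>{0..t}\<close> is zero, in accordance with the rate being zero
  there.\<close>

lemma ppl_integral:
 fixes w :: "real => real"
 assumes w: "w : bmeas" "!!u. abs (w u) <= M" and z: "!!t. t <= 0 ==> w t = 0" and lc: "AE t in lborel. 0 < t --> loc_const w t"
 shows "ppl (%t. c + integral {0..t} w) w" unfolding ppl_def
proof (intro conjI)
 show "EX L. L-lipschitz_on UNIV (%t. c + integral {0..t} w)" using bounded_integral(4)[OF w] by blast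
 show "w : bmeas" by fact
 have "AE t in lborel. t ~= (0::real)" by (rule AE_lborel_singleton)
 with lc show "AE t in lborel. lin_at (%t. c + integral {0..t} w) w t"
 proof eventually_elim
  case (elim t)
  show ?case
  proof (cases "t < 0")
   case True
   hence "\<forall>\<^sub>F y in nhds t. y : {..<0}" by (intro eventually_nhds_in_open) auto
   thus ?thesis unfolding lin_at_def by eventually_elim (use True z in simp)
  next
   case False
   with elim have t: "0 < t" "loc_const w t" by auto
   hence "\<forall>\<^sub>F y in nhds t. w y = w t & 0 < y"
    unfolding loc_const_def by (intro eventually_conj eventually_nhds_in_open[of "{0<..}", simplified]) auto
   then obtain d where d: "0 < d" "!!y. dist y t < d ==> w y = w t & 0 < y" unfolding eventually_nhds_metric by blast
   have "integral {0..y} w = integral {0..x} w + w t * (y - x)" if xy: "x <= y" "dist x t < d" "dist y t < d" for x y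
   proof -
    have "integral {0..x} w + integral {x..y} w = integral {0..y} w"
     using d(2)[OF xy(2)] by (intro Henstock_Kurzweil_Integration.integral_combine bounded_integral(2)[OF w] xy) auto
    moreover have "integral {x..y} w = integral {x..y} (%_. w t)"
     by (rule integral_cong) (use xy in \<open>auto intro!: d(2)[THEN conjunct1] simp: dist_real_def\<close>)
    ultimately show ?thesis using xy by (simp add: mult.commute)
   qed
   note step = this
   have "\<forall>\<^sub>F y in nhds t. dist y t < d" using d(1) unfolding eventually_nhds_metric by blast
   thus ?thesis unfolding lin_at_def
   proof eventually_elim
    case (elim y)
    have "integral {0..y} w = integral {0..t} w + w t * (y - t)" using step[of t y] step[of y t] elim d(1) by (cases "t <= y") (simp_all add: algebra_simps)
    thus ?case using d(2)[OF elim] by simp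
   qed
  qed
 qed
qed

text \<open>Loop \<open>k\<close> transmits its clock with the small factor
  \<open>2 * ((1 / 2) ^ k / 8)^2\<close>, so clock \<open>k\<close> has to run
  \<open>32 * 4 ^ k\<close> times as fast as the term it realises. All rates remain below a common
  bound because the approximations of \<open>g\<close> improve by the factor \<open>4\<close> at
  each step.\<close>

lemma step_decomposition:
 fixes g :: "real => real"
 assumes T: "0 < T" and M: "0 <= M" and g: "g : bmeas" "!!t. abs (g t) <= M" and c: "AE t in lborel. t : {0<..<T} --> isCont g t"
 shows "\<exists>R E (et :: nat => real => real) e. 0 < R & (ALL k. ppl (et k) (e k)) & (ALL k t. 0 <= et k t & et k t < R & abs (e k t) <= E) \<and>
  (ALL t:{0<..<T}. h + (LBINT u:{0..t}. g u) = 2 * (\<Sum>k. (if k = 0 then - 1 else 1) * (((1 / 2) ^ k / 8)^2 * et k t)))"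
proof -
 have "ALL k. EX S. S : bmeas & (ALL t. isCont g t --> abs (g t - S t) <= (1 / 4) ^ k) & (ALL t. abs (S t) <= M) \<and>
  (AE t in lborel. isCont g t --> loc_const S t)" by (intro allI step_approximation g(2)) auto
 from choice[OF this] obtain S where SS: "ALL k. S k : bmeas & (ALL t. isCont g t --> abs (g t - S k t) <= (1 / 4) ^ k) \<and>
  (ALL t. abs (S k t) <= M) & (AE t in lborel. isCont g t --> loc_const (S k) t)" by blast
 have S: "S k : bmeas" "isCont g t ==> abs (g t - S k t) <= (1 / 4) ^ k"
  "abs (S k t) <= M" "AE t in lborel. isCont g t --> loc_const (S k) t" for k t using SS by blast+
 define D where "D = (%k t. if k = 0 then S 0 t else S k t - S (k - 1) t)"
 \<comment> \<open>The difference of consecutive approximations is at most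
   \<open>(1 / 4) ^ Suc n + (1 / 4) ^ n = 5 * (1 / 4) ^ Suc n\<close>; the summand \<open>M\<close>
   covers the term \<open>k = 0\<close>.\<close>
 define m where "m = (%k::nat. (M + 5) * (1 / 4) ^ k)"
 have m0: "0 <= m k" for k unfolding m_def using M by simp
 \<comment> \<open>Clipping changes nothing where \<open>g\<close> is continuous, but gives the
   bound \<open>m k\<close> at all other times as well.\<close>
 define w where "w = (%k t. if t : {0<..<T} then max (- m k) (min (m k) (D k t)) else 0)"
 have Dm: "D k : bmeas" for k unfolding D_def using S(1) by (cases "k = 0") auto
 have wm: "w k : bmeas" for k unfolding w_def using Dm by measurable
 have wb: "abs (w k t) <= m k" for k t unfolding w_def using m0[of k] by auto
 have wD: "w k t = D k t" if t: "t : {0<..<T}" "isCont g t" for k t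
 proof -
  have "abs (D k t) <= m k"
  proof (cases k)
   case 0 thus ?thesis using S(3)[of 0 t] unfolding D_def m_def by simp
  next
   case (Suc n)
   have "D k t = S (Suc n) t - S n t" unfolding D_def Suc by simp
   hence "abs (D k t) <= (1 / 4) ^ Suc n + (1 / 4) ^ n" using S(2)[OF t(2), of "Suc n"] S(2)[OF t(2), of n] by linarith
   also have "... = 5 * (1 / 4) ^ Suc n" by simp
   also have "... <= m k" unfolding m_def Suc using M by (intro mult_right_mono) auto
   finally show ?thesis .
  qed
  thus ?thesis unfolding w_def using t(1) by auto
 qed
 have sumD: "(SUM k<Suc n. D k t) = S n t" for n t by (induction n) (simp_all add: D_def)
 have wl: "AE t in lborel. 0 < t --> loc_const (w k) t" for k
 proof -
  have "AE t in lborel. t ~= T" by (rule AE_lborel_singleton)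
  with c S(4)[of k] S(4)[of "k - 1"] show ?thesis
  proof eventually_elim
   case (elim t)
   show ?case
   proof
    assume t0: "0 < t"
    show "loc_const (w k) t"
    proof (cases "t < T")
     case True
     hence "loc_const (D k) t" using elim t0 unfolding D_def by (cases "k = 0") (auto intro: loc_const_compose2[where f = "(-)"])
     hence "loc_const (%t. max (- m k) (min (m k) (D k t))) t" by (rule loc_const_compose)
     moreover have "\<forall>\<^sub>F y in nhds t. y : {0<..<T}" using True t0 by (intro eventually_nhds_in_open) auto
     hence "\<forall>\<^sub>F y in nhds t. w k y = max (- m k) (min (m k) (D k y))" by eventually_elim (simp add: w_def)
     ultimately show ?thesis by (rule loc_const_cong)
    next
     case False
     hence "\<forall>\<^sub>F y in nhds t. y : {T<..}" using elim(4) by (intro eventually_nhds_in_open) auto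
     thus ?thesis unfolding loc_const_def by eventually_elim (use False in \<open>simp add: w_def\<close>)
    qed
   qed
  qed
 qed
 \<comment> \<open>This is \<open>E * T + 96 * abs h\<close>: the first summand dominates every
   integrated rate, the second makes \<open>A / 3 - 32 * h\<close> nonnegative.\<close>
 define A where "A = 32 * (4 * (M + 5)) * T + 96 * abs h"
 have A0: "0 <= A" unfolding A_def using M T by simp
 \<comment> \<open>Clock \<open>k\<close> realises the term \<open>w (k - 1)\<close>, shifted by
   \<open>A\<close> to stay nonnegative. The shifts add up to \<open>A / 96\<close>; clock
   \<open>0\<close>, constant and counted with a minus sign, contributes
   \<open>h - A / 96\<close>.\<close>
 define et where "et = (%k t. if k = 0 then A / 3 - 32 * h else A + integral {0..t} (%u. 32 * 4 ^ k * w (k - 1) u))"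
 define e where "e = (%k t. if k = 0 then 0 else 32 * 4 ^ k * w (k - 1) t)"
 define E where "E = 32 * (4 * (M + 5))"
 have em: "(%u. 32 * 4 ^ k * w (k - 1) u) : bmeas" for k using wm by simp
 have eb: "abs (32 * 4 ^ Suc n * w n t) <= E" for n t
 proof -
  have "abs (32 * 4 ^ Suc n * w n t) <= 32 * 4 ^ Suc n * m n" unfolding abs_mult using wb by (intro mult_mono) auto
  also have "... = E" unfolding m_def E_def by (simp add: power_one_over)
  finally show ?thesis .
 qed
 have eb': "abs (32 * 4 ^ k * w (k - 1) t) <= E" if "k ~= 0" for k t using eb[of "k - 1" t] that by simp
 have E0: "0 <= E" unfolding E_def using M by simp
 have ppl: "ppl (et k) (e k)" for k
 proof (cases "k = 0")
  case False
  have "ppl (%t. A + integral {0..t} (%u. 32 * 4 ^ k * w (k - 1) u)) (%u. 32 * 4 ^ k * w (k - 1) u)"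
  proof (rule ppl_integral[OF em eb'[OF False]])
   show "AE t in lborel. 0 < t --> loc_const (%u. 32 * 4 ^ k * w (k - 1) u) t" using wl[of "k - 1"] by eventually_elim (blast intro: loc_const_compose)
  qed (simp add: w_def)
  thus ?thesis using False by (simp add: et_def e_def)
 qed (simp add: et_def e_def ppl_const)
 have ib: "abs (integral {0..t} (%u. 32 * 4 ^ k * w (k - 1) u)) <= E * T" if k: "k ~= 0" for k t
 proof (cases "0 <= t")
  case True
  let ?f = "%u. 32 * 4 ^ k * w (k - 1) u"
  have "abs (integral {0..t} ?f) <= E * min t T"
  proof (cases "t <= T")
   case True
   thus ?thesis using bounded_integral(5)[OF em eb'[OF k], of 0 t] \<open>0 <= t\<close> by simp
  next
   case False
   have "integral {0..t} ?f = integral {0..T} ?f + integral {T..t} ?f"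
    using False T by (intro Henstock_Kurzweil_Integration.integral_combine[symmetric] bounded_integral(2)[OF em eb'[OF k]]) auto
   also have "integral {T..t} ?f = integral {T..t} (%_. 0)" by (rule integral_cong) (simp add: w_def)
   finally show ?thesis using bounded_integral(5)[OF em eb'[OF k], of 0 T] T False by simp
  qed
  also have "... <= E * T" using E0 by (intro mult_left_mono) auto
  finally show ?thesis .
 qed (use E0 T in simp)
 have AE: "A = E * T + 96 * abs h" unfolding A_def E_def by simp
 have etb: "0 <= et k t & et k t < A + A + 32 * abs h + 1" for k t
 proof -
  have h: "h <= abs h" "- h <= abs h" "0 <= E * T" using E0 T by auto
  show ?thesis
  proof (cases "k = 0")
   case True
   hence "et k t = A / 3 - 32 * h" by (simp add: et_def)
   thus ?thesis using h AE by linarith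
  next
   case False
   hence "abs (et k t - A) <= E * T" using ib[OF False, of t] by (simp add: et_def)
   thus ?thesis using h AE by linarith
  qed
 qed
 have main: "h + (LBINT u:{0..t}. g u) = 2 * (\<Sum>k. (if k = 0 then - 1 else 1) * (((1 / 2) ^ k / 8)^2 * et k t))" if t: "t : {0<..<T}" for t
 proof -
  have I: "w k integrable_on {0..t}" for k by (rule bounded_integral(2)[OF wm wb])
  have lim: "(%n. integral {0..t} (S n)) \<longlonglongrightarrow> integral {0..t} g"
  proof -
   have "(%n. LBINT u:{0..t}. S n u) \<longlonglongrightarrow> (LBINT u:{0..t}. g u)" unfolding lint_def
   proof (rule integral_dominated_convergence[where w = "%u. indicator {0..t} u * M"])
    show "integrable lborel (%u. indicator {0..t} u * M)" by (intro integrable_mult_left integrable_real_indicator) (auto simp: emeasure_lborel_Icc_eq)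
    have "AE u in lborel. u ~= (0::real)" by (rule AE_lborel_singleton)
    with c show "AE u in lborel. (%n. indicator {0..t} u *\<^sub>R S n u) \<longlonglongrightarrow> indicator {0..t} u *\<^sub>R g u"
    proof eventually_elim
     case (elim u)
     show ?case
     proof (cases "u : {0..t}")
      case True
      hence u: "isCont g u" using elim t by auto
      have "(%n. (1 / 4 :: real) ^ n) \<longlonglongrightarrow> 0" by (rule LIMSEQ_realpow_zero) auto
      hence "(%n. S n u - g u) \<longlonglongrightarrow> 0"
       by (rule Lim_null_comparison[rotated]) (use S(2)[OF u] in \<open>auto simp: abs_minus_commute\<close>)
      thus ?thesis using True by (simp add: LIM_zero_iff)
     qed simp
    qed
    show "AE u in lborel. norm (indicator {0..t} u *\<^sub>R S n u) <= indicator {0..t} u * M" for n using S(3) by (intro AE_I2) (simp add: indicator_def)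
   qed (use S(1) g(1) in auto)
   thus ?thesis unfolding bounded_integral(3)[OF S(1) S(3)] bounded_integral(3)[OF g] .
  qed
  have eq: "integral {0..t} (S n) = (SUM k<Suc n. integral {0..t} (w k))" for n
  proof -
   have "(LBINT u:{0..t}. S n u) = (LBINT u:{0..t}. (SUM k<Suc n. w k u))" unfolding lint_def
   proof (rule integral_cong_AE)
    have "AE u in lborel. u ~= (0::real)" by (rule AE_lborel_singleton)
    with c show "AE u in lborel. indicator {0..t} u *\<^sub>R S n u = indicator {0..t} u *\<^sub>R (SUM k<Suc n. w k u)"
    proof eventually_elim
     case (elim u)
     show ?case
     proof (cases "u : {0..t}")
      case True
      thus ?thesis using elim t wD[of u] unfolding sumD[symmetric] by auto
     qed simp
    qed
   qed (use S(1) wm in auto)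
   also have "... = (SUM k<Suc n. LBINT u:{0..t}. w k u)" using bounded_integral(1)[OF wm wb, of 0 t] unfolding lint_def set_integrable_def scaleR_sum_right
    by (intro bint_sum)
   finally show ?thesis unfolding bounded_integral(3)[OF S(1) S(3)] bounded_integral(3)[OF wm wb] .
  qed
  have "(%k. integral {0..t} (w k)) sums integral {0..t} g" unfolding sums_def by (rule LIMSEQ_imp_Suc) (rule lim[unfolded eq])
  moreover have "(%k. A / 128 * (1 / 4) ^ k) sums (A / 128 * (1 / (1 - 1 / 4)))" by (intro sums_mult geometric_sums) simp
  ultimately have "(%k. integral {0..t} (w k) + A / 128 * (1 / 4) ^ k) sums (integral {0..t} g + A / 128 * (1 / (1 - 1 / 4)))" by (rule sums_add)
  moreover have "integral {0..t} (w k) + A / 128 * (1 / 4) ^ k = 2 * (((1 / 2) ^ Suc k / 8)^2 * et (Suc k) t)" for k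
  proof -
   have "et (Suc k) t = A + 32 * 4 ^ Suc k * integral {0..t} (w k)" unfolding et_def by simp
   moreover have "((1 / 2) ^ Suc k / 8)^2 = 1 / (64 * 4 ^ Suc k :: real)" by (simp add: power2_eq_square power_one_over flip: power_mult_distrib)
   ultimately show ?thesis by (simp add: field_simps)
  qed
  ultimately have "(%k. 2 * (((1 / 2) ^ Suc k / 8)^2 * et (Suc k) t)) sums (integral {0..t} g + A / 96)" by simp
  hence "(%k. (if Suc k = 0 then - 1 else 1) * (((1 / 2) ^ Suc k / 8)^2 * et (Suc k) t)) sums ((integral {0..t} g + A / 96) / 2)"
   using sums_divide[of _ _ 2] by fastforce
  from sums_Suc[OF this] have "(%k. (if k = 0 then - 1 else 1) * (((1 / 2) ^ k / 8)^2 * et k t)) sums ((integral {0..t} g + A / 96) / 2 - et 0 t / 64)"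
   by (simp add: power2_eq_square)
  from sums_unique[OF this] show ?thesis unfolding bounded_integral(3)[OF g] by (simp add: et_def field_simps)
 qed
 have "0 < A + A + 32 * abs h + 1" using A0 by linarith
 moreover have "abs (e k t) <= E" for k t using eb'[of k t] E0 by (simp add: e_def)
 ultimately show ?thesis using ppl etb main by blast
qed

section \<open>Product rule for absolutely continuous functions\<close>

lemma set_fubini:
 fixes u v :: "real => real"
 assumes m[measurable]: "u : bmeas" "v : bmeas" and i: "sint {0..1} u" "sint {0..1} v"
 shows "(LBINT x:{0..1}. u x * (LBINT y:{0..x}. v y)) = (LBINT y:{0..1}. v y * (LBINT x:{y..1}. u x))"
proof -
 define U where "U x = indicator {0..1} x * u x" for x
 define V where "V y = indicator {0..1} y * v y" for y
 define K where "K x y = U x * V y * (if y <= x then 1 else 0)" for x y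
 have U: "integrable lborel U" and V: "integrable lborel V" using i unfolding U_def V_def set_integrable_def by simp_all
 have [measurable]: "U : bmeas" "V : bmeas" using U V by auto
 have UV: "integrable (lborel \<Otimes>\<^sub>M lborel) (%(x, y). U x * V y)"
 proof (rule lborel_pair.Fubini_integrable)
  show "(%(x, y). U x * V y) : borel_measurable (lborel \<Otimes>\<^sub>M lborel)" by measurable
  have "(%x. LINT y|lborel. norm (case (x, y) of (x, y) => U x * V y)) = (%x. abs (U x) * (LINT y|lborel. abs (V y)))" by (simp add: abs_mult)
  thus "integrable lborel (%x. LINT y|lborel. norm (case (x, y) of (x, y) => U x * V y))" using U by simp
  show "AE x in lborel. integrable lborel (%y. case (x, y) of (x, y) => U x * V y)" using V by simp
 qed
 have "integrable (lborel \<Otimes>\<^sub>M lborel) (%(x, y). K x y)" by (rule Bochner_Integration.integrable_bound[OF UV]) (auto simp: K_def case_prod_unfold)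
 from lborel_pair.Fubini_integral[OF this]
 have "(LINT y|lborel. LINT x|lborel. K x y) = (LINT x|lborel. LINT y|lborel. K x y)" .
 moreover have "(LINT y|lborel. K x y) = indicator {0..1} x *\<^sub>R (u x * (LBINT y:{0..x}. v y))" for x
 proof -
  have "K x y = U x * (indicator {0..x} y *\<^sub>R v y)" for y unfolding K_def U_def V_def by (auto simp: indicator_def)
  thus ?thesis by (simp add: lint_def U_def)
 qed
 moreover have "(LINT x|lborel. K x y) = indicator {0..1} y *\<^sub>R (v y * (LBINT x:{y..1}. u x))" for y
 proof -
  have "K x y = V y * (indicator {y..1} x *\<^sub>R u x)" for x unfolding K_def U_def V_def by (auto simp: indicator_def)
  thus ?thesis by (simp add: lint_def V_def)
 qed
 ultimately show ?thesis unfolding lint_def by simp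
qed

lemma set_split:
 fixes v :: "real => real"
 assumes i: "sint {0..1} v" and y: "y : {0..1}" shows "(LBINT x:{0..y}. v x) + (LBINT x:{y..1}. v x) = (LBINT x:{0..1}. v x)"
proof -
 have i2: "sint {0..y} v" "sint {y..1} v" using y by (auto intro: set_integrable_subset[OF i])
 have "(LBINT x:{0..1}. v x) = (LBINT x:{0..y} \<union> {y..1}. v x)" using y by (simp add: ivl_disj_un_two_touch)
 also have "... = (LBINT x:{0..y}. v x) + (LBINT x:{y..1}. v x)"
 proof (rule set_integral_Un_AE[OF _ _ _ i2])
  have "AE x in lborel. x ~= y" by (rule AE_lborel_singleton)
  thus "AE x in lborel. ~ (x : {0..y} & x : {y..1})" by eventually_elim auto
 qed auto
 finally show ?thesis by simp
qed

text \<open>The difference of \<open>f\<close> and the primitive \<open>D\<close> is orthogonal to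
  every derivative of a \<open>C1\<close> function. On a line in the first direction each
  \<open>cas k\<close> is such a derivative, even when it is constant there, because test functions
  need not be periodic. Fourier uniqueness on the torus then gives equality, with no additive
  constant left.\<close>

lemma bp_primitive:
 assumes bp: "bp 0 1 f d" and f: "f : bmeas" and d: "d : bmeas"
 shows "AE x in lborel. x : {0..1} --> f x = (LBINT y:{0..x}. d y)" and "(LBINT y:{0..1}. d y) = 0"
  and "(%x. LBINT y:{0..x}. d y) : bmeas" and "sint {0..1} (%x. LBINT y:{0..x}. d y)"
proof -
 note i = bpD(1,2)[OF bp]
 define D where "D x = (LBINT y:{0..x}. d y)" for x
 have C1c: "C1 (%_. 1) (%_. 0)" unfolding C1_def by simp
 show 0: "(LBINT y:{0..1}. d y) = 0" using bpD(3)[OF bp C1c] by simp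
 have mm: "(%(x, y). indicator {0..x} y *\<^sub>R d y) : borel_measurable (borel \<Otimes>\<^sub>M lborel)"
 proof -
  have "(%(x, y). (if 0 <= y & y <= x then 1 else 0) * d y) : borel_measurable (borel \<Otimes>\<^sub>M lborel)" using d by measurable
  also have "(%(x, y). (if 0 <= y & y <= x then 1 else 0) * d y) = (%(x, y). indicator {0..x} y *\<^sub>R d y)" by (auto simp: fun_eq_iff)
  finally show ?thesis .
 qed
 have mD: "D : bmeas" unfolding D_def[abs_def] lint_def using lborel.borel_measurable_lebesgue_integral[OF mm] by simp
 thus "(%x. LBINT y:{0..x}. d y) : bmeas" unfolding D_def .
 have Db: "abs (D x) <= (LBINT y:{0..1}. abs (d y))" if x: "x : {0..1}" for x
 proof -
  have "sint {0..x} d" using x by (intro set_integrable_subset[OF i(2)]) auto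
  hence "abs (D x) <= (LBINT y:{0..x}. abs (d y))" unfolding D_def using set_integral_norm_bound[of lborel "{0..x}" d] by simp
  also have "... <= (LBINT y:{0..1}. abs (d y))" unfolding lint_def
   using x set_integrable_abs[OF i(2)] set_integrable_abs[OF \<open>sint {0..x} d\<close>] unfolding set_integrable_def
   by (intro integral_mono) (auto simp: indicator_def)
  finally show ?thesis .
 qed
 have iD: "sint {0..1} D" unfolding set_integrable_def
  by (rule integrableI_bounded_set[where A = "{0..1}" and B = "LBINT y:{0..1}. abs (d y)"]) (use mD Db in \<open>auto intro!: AE_I2\<close>)
 thus "sint {0..1} (%x. LBINT y:{0..x}. d y)" unfolding D_def .
 have test: "(LBINT x:{0..1}. (f x - D x) * ph' x) = 0" if ph: "C1 ph ph'" for ph ph'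
 proof -
  have c: "contU ph'" and cp: "contU ph" using ph C1_continuous by (auto simp: C1_def)
  have ip: "sint {0..1} ph'" by (rule borel_integrable_atLeastAtMost') (rule continuous_on_subset[OF c], simp)
  have "(LBINT x:{0..1}. D x * ph' x) = (LBINT x:{0..1}. ph' x * (LBINT y:{0..x}. d y))" by (simp add: D_def mult.commute)
  also have "... = (LBINT y:{0..1}. d y * (LBINT x:{y..1}. ph' x))" by (rule set_fubini[OF meas_cont[OF c] d ip i(2)])
  also have "... = (LBINT y:{0..1}. d y * ph 1 - d y * ph y)"
  proof (intro set_lebesgue_integral_cong allI)
   fix y :: real
   have "(LBINT x:{y..1}. ph' x) = ph 1 - ph y" if "y <= 1" using ph that unfolding C1_def lint_def
    by (intro integral_FTC_Icc) (auto simp: real_vector_deriv intro: has_vector_derivative_at_within continuous_on_subset)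
   thus "y : {0..1} --> d y * (LBINT x:{y..1}. ph' x) = d y * ph 1 - d y * ph y" by (simp add: right_diff_distrib)
  qed simp
  also have "... = (LBINT y:{0..1}. d y) * ph 1 - (LBINT y:{0..1}. d y * ph y)"
   using set_integral_diff(2)[OF _ bpD(4)[OF bp ph], of "%y. d y * ph 1"] i(2) by simp
  also have "(LBINT y:{0..1}. d y * ph y) = - (LBINT y:{0..1}. f y * ph' y)" using bpD(3)[OF bp ph] set_integral_add(2)[OF bpD(4,5)[OF bp ph]] by simp
  finally show ?thesis using 0 set_integral_diff(2)[OF bpD(5)[OF bp ph] set_integrable_mult_cont[OF iD c]] by (simp add: left_diff_distrib)
 qed
 have "AE x in torus. f (x $ 1) - D (x $ 1) = 0"
 proof (rule fourier_unique)
  have fD: "(%s. f s - D s) : bmeas" using f mD by simp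
  show it: "integrable torus (%x. f (x $ 1) - D (x $ 1))" using integrable_torus_1[OF fD] set_integral_diff(1)[OF i(1) iD] by simp
  show "(LINT x|torus. cas k x * (f (x $ 1) - D (x $ 1))) = 0" if k: "k : lattice" for k
  proof (rule torus_integral_slices_zero[where i = 1])
   show "(%x. cas k x * (f (x $ 1) - D (x $ 1))) : bmeas" using measurable_1[OF fD] measurable_cas by (rule borel_measurable_times[rotated])
   fix p :: "real * real"
   show "(LBINT s:{0..1}. cas k (mk 1 (s, p)) * (f (mk 1 (s, p) $ 1) - D (mk 1 (s, p) $ 1))) = 0"
   proof -
    define q where "q = 2 * pi * k $ 1"
    have der: "((%s. cas m (mk 1 (s, p))) has_real_derivative (2 * pi * m $ 1) * cas (- m) (mk 1 (s, p))) (at s)" for m s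
     using C_infinity_partial(1)[OF C_infinity_cas[of 1 m "1::real"], of 1 p s] partial_cas[of 1 1 m "1::real"] by (simp add: real_vector_deriv)
    have cc: "contU (%s. cas k (mk 1 (s, p)))" by (rule continuous_on_compose2[OF continuous_cas[of UNIV] continuous_mk_line]) simp
    have "\<exists>ph. C1 ph (%s. cas k (mk 1 (s, p)))"
    proof (cases "k $ 1 = 0")
     case True
     define c where "c = cas k (mk 1 (0, p))"
     have e: "(%s. cas k (mk 1 (s, p))) = (%s. c)" unfolding cas_def c_def by (cases p) (simp add: inner_3 True mk_nth)
     have "C1 (%s. c * s) (%s. cas k (mk 1 (s, p)))" unfolding e C1_def by (auto intro!: derivative_eq_intros)
     thus ?thesis by blast
    next
     case False
     have "((%s. (- 1 / q) * cas (- k) (mk 1 (s, p))) has_real_derivative cas k (mk 1 (s, p))) (at s)" for s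
      using DERIV_cmult[OF der[of "- k" s], of "- 1 / q"] False unfolding q_def by simp
     thus ?thesis using cc unfolding C1_def by blast
    qed
    then obtain ph where "C1 ph (%s. cas k (mk 1 (s, p)))" ..
    from test[OF this] show ?thesis by (cases p) (simp add: mk_nth mult.commute)
   qed
  qed
 qed
 note fD = this
 define S where "S = {s : {0..1}. f s ~= D s}"
 have ae: "AE x in torus. x $ 1 ~: S" using fD by eventually_elim (simp add: S_def)
 have Wb: "S : sets borel" unfolding S_def using f mD by measurable
 have "(%x::real^3. x $ 1) : borel_measurable torus" by (intro borel_measurable_torus measurable_1) simp
 from measurable_sets[OF this Wb] have "{x : space torus. x $ 1 : S} : sets torus" by (simp add: vimage_def Int_def conj_commute)
 hence "emeasure torus {x : space torus. x $ 1 : S} = 0" using ae AE_iff_measurable[of "{x : space torus. x $ 1 : S}" torus "%x. x $ 1 ~: S"] by simp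
 moreover have "S \<inter> {0..1} = S" unfolding S_def by auto
 ultimately have "S : null_sets lborel" using emeasure_torus_1[OF Wb] Wb by (simp add: null_sets_def)
 from AE_not_in[OF this] show "AE x in lborel. x : {0..1} --> f x = (LBINT y:{0..x}. d y)" by eventually_elim (auto simp: S_def D_def)
qed

text \<open>The first factor is replaced by its primitive and the order of integration is exchanged
  over a triangle. Since \<open>e\<close> has total integral zero, its integral over
  \<open>{y..1}\<close> is minus the one over \<open>{0..y}\<close>, which is again the primitive of
  \<open>e\<close>.\<close>

lemma bp_product:
 assumes f: "bp 0 1 f d" "f : bmeas" "d : bmeas" and g: "bp 0 1 g e" "g : bmeas" "e : bmeas" shows "(LBINT x:{0..1}. f x * e x) = - (LBINT x:{0..1}. g x * d x)"
proof -
 have eq: "(LBINT x:{0..1}. f x * e x) = (LBINT x:{0..1}. e x * (LBINT y:{0..x}. d y))" if f: "bp 0 1 f d" "f : bmeas" "d : bmeas" and e: "e : bmeas" for f d e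
 proof (rule set_lebesgue_integral_cong_AE)
  show "AE x\<in>{0..1} in lborel. f x * e x = e x * (LBINT y:{0..x}. d y)" using bp_primitive(1)[OF f] by eventually_elim auto
 qed (use f e bp_primitive(3)[OF f] in \<open>auto simp: set_borel_measurable_def\<close>)
 have "(LBINT x:{0..1}. f x * e x) = (LBINT y:{0..1}. d y * (LBINT x:{y..1}. e x))"
  unfolding eq[OF f g(3)] by (rule set_fubini[OF g(3) f(3) bpD(2)[OF g(1)] bpD(2)[OF f(1)]])
 also have "... = (LBINT y:{0..1}. - (d y * (LBINT x:{0..y}. e x)))" using set_split[OF bpD(2)[OF g(1)]] bp_primitive(2)[OF g]
  by (intro set_lebesgue_integral_cong allI impI) (auto simp: add_eq_0_iff)
 also have "... = - (LBINT x:{0..1}. g x * d x)" unfolding eq[OF g f(3)] by (simp add: lint_def)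
 finally show ?thesis .
qed

section \<open>Fields depending on one space variable and time\<close>

lemma AE_first:
 assumes "AE s in lborel. P (s::real)" shows "AE x in lborel. P ((x::real^3) $ 1)"
proof -
 obtain N where N: "N : null_sets lborel" "{s. ~ P s} \<subseteq> N" using assms by (auto simp: eventually_ae_filter)
 have "AE z in (lborel :: (real * real \<times> real) measure). fst z ~: N" by (rule AE_lborel_fst[OF AE_not_in[OF N(1)]])
 hence "AE z in lborel. mk 1 z $ 1 ~: N" by eventually_elim (auto simp: mk_nth)
 moreover have "{x :: real^3. x $ 1 ~: N} : sets borel"
 proof -
  have "(%x::real^3. x $ 1) -` (- N) \<inter> space borel : sets borel" by (rule measurable_sets[OF measurable_1[of "%s. s"]]) (use N(1) in auto)
  thus ?thesis by (simp add: vimage_def)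
 qed
 ultimately have "AE x in distr lborel borel (mk 1). x $ 1 ~: N" by (subst AE_distr_iff) (use measurable_mk in auto)
 thus ?thesis unfolding lborel_mk by eventually_elim (use N(2) in auto)
qed

text \<open>The fractional part is a translation by one of countably many integers, and translations
  preserve null sets.\<close>

lemma AE_frac:
 assumes "AE s in lborel. P s" shows "AE s in lborel. P (frac s)"
proof -
 have "AE s in lborel. ALL n. P (s + of_int n)"
 proof (subst AE_all_countable, intro allI)
  fix n :: int
  have "AE s in distr lborel borel (%s. of_int n + s). P s" using assms unfolding lborel_distr_plus .
  hence "AE s in lborel. P (of_int n + s)" by (rule AE_distrD[rotated]) simp
  thus "AE s in lborel. P (s + of_int n)" by (simp add: add.commute)
 qed
 thus ?thesis
 proof eventually_elim
  case (elim s)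
  from elim[THEN spec, of "- \<lfloor>s\<rfloor>"] show ?case by (simp add: frac_def)
 qed
qed

lemma loc_const_frac:
 fixes g :: "real * real => 'b"
 assumes "AE z in lborel. loc_const g z" shows "AE z in lborel. loc_const (%z :: (real^3) * real. g (frac (fst z $ 1), snd z)) z"
proof (rule AE_lborel_pairI2)
 show "{z. loc_const (%z :: (real^3) * real. g (frac (fst z $ 1), snd z)) z} : sets borel" by (rule borel_open) (rule open_loc_const)
 have "AE t in lborel. AE s in lborel. loc_const g (s, t)" using assms by (rule AE_lborel_slices)
 thus "AE t in lborel. AE x in lborel. loc_const (%z :: (real^3) * real. g (frac (fst z $ 1), snd z)) (x, t)"
 proof eventually_elim
  case (elim t)
  have "AE s in lborel. loc_const g (frac s, t) & s ~: \<int>" using AE_frac[OF elim] countable_imp_AE_lborel[OF countable_Ints] by eventually_elim simp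
  from AE_first[OF this] show ?case
  proof eventually_elim
   case (elim x)
   have f: "isCont frac (fst (x, t) $ 1)" using elim by (simp add: continuous_frac)
   have "isCont (%z :: (real^3) * real. fst z $ 1) (x, t)" by (intro continuous_intros)
   from isCont_Pair[OF isCont_o2[OF this f] isCont_snd[OF continuous_ident]]
   have "isCont (%z :: (real^3) * real. (frac (fst z $ 1), snd z)) (x, t)" .
   note lim = isCont_tendsto_nhds[OF this]
   have "\<forall>\<^sub>F y in nhds (frac (fst (x, t) $ 1), snd (x, t)). g y = g (frac (x $ 1), t)" using elim by (simp add: loc_const_def)
   from eventually_compose_filterlim[OF this lim] show ?case unfolding loc_const_def by simp
  qed
 qed
qed

text \<open>The pieces are the level sets of \<open>v\<close> within the open set where it is
  locally constant. They are open and disjoint, so only countably many are nonempty, whatever the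
  type of the values.\<close>

lemma piecewise_constant_loc_const:
 fixes v :: "(real^3) * real => 'b"
 assumes per: "!!t. periodic (%x. v (x, t))" and lc: "AE z in lborel. loc_const v z" shows "piecewise_constant T v"
proof -
 define W where "W = {z. loc_const v z & snd z : {0<..<T}}"
 define Q where "Q c = {z : W. v z = c}" for c
 have op: "open (Q c)" for c unfolding Q_def W_def mem_Collect_eq
 proof (rule open_if_eventually_nhds)
  fix z assume z: "(loc_const v z & snd z : {0<..<T}) & v z = c"
  have "\<forall>\<^sub>F y in nhds z. loc_const v y" using open_loc_const[of v] z eventually_nhds by blast
  moreover have "\<forall>\<^sub>F y in nhds z. snd y : {0<..<T}" by (rule eventually_nhds_snd, rule eventually_nhds_in_open) (use z in auto)
  moreover have "\<forall>\<^sub>F y in nhds z. v y = v z" using z unfolding loc_const_def by blast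
  ultimately show "\<forall>\<^sub>F y in nhds z. (loc_const v y & snd y : {0<..<T}) & v y = c" by eventually_elim (use z in auto)
 qed
 have shift: "loc_const v (x + k, t)" if l: "loc_const v (x, t)" and k: "k : lattice" for x k t
 proof -
  have p: "v (y + (k, 0)) = v y" for y using per k unfolding periodic_def by (cases y) simp
  have lim: "((%y. y - (k, 0)) \<longlongrightarrow> (x + k, t) - (k, 0)) (nhds (x + k, t))" by (rule isCont_tendsto_nhds) (intro continuous_intros)
  have "\<forall>\<^sub>F y in nhds ((x + k, t) - (k, 0)). v y = v (x, t)" using l by (simp add: loc_const_def)
  from eventually_compose_filterlim[OF this lim] have "\<forall>\<^sub>F y in nhds (x + k, t). v (y - (k, 0)) = v (x, t)" .
  thus ?thesis unfolding loc_const_def by eventually_elim (use p[of "_ - (k, 0)"] p[of "(x, t)"] in simp)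
 qed
 have "torus_time_open T (Q c)" for c unfolding torus_time_open_def using op shift per unfolding Q_def W_def periodic_def by auto
 moreover have "countable (range Q - {{}})" by (rule countable_disjoint_open_subsets) (use op in \<open>auto simp: pairwise_def disjnt_def Q_def\<close>)
 moreover have "disjoint (range Q - {{}})" by (auto simp: pairwise_def disjnt_def Q_def)
 moreover have "negligible (UNIV \<times> {0<..<T} - \<Union>(range Q - {{}}))"
 proof (rule negligible_subset)
  show "negligible {z. ~ loc_const v z}" using lc open_loc_const[of v] by (subst negligible_iff_AE_lborel) (auto simp: Collect_neg_eq)
  show "UNIV \<times> {0<..<T} - \<Union>(range Q - {{}}) \<subseteq> {z. ~ loc_const v z}"
  proof (intro subsetI CollectI notI)
   fix z assume z: "z : UNIV \<times> {0<..<T} - \<Union>(range Q - {{}})" and "loc_const v z"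
   hence "z : Q (v z)" unfolding Q_def W_def by auto
   thus False using z by blast
  qed
 qed
 moreover have "ALL q:range Q - {{}}. v constant_on q" unfolding constant_on_def Q_def by auto
 ultimately show ?thesis unfolding piecewise_constant_def torus_time_field_def using per by blast
qed

lemma scale_bracket:
 fixes K bt :: real
 assumes "0 < K" "1 < bt" "K < s" obtains M where "K * bt ^ M < s" "s <= K * bt ^ Suc M"
proof -
 obtain n where n: "s / K < bt ^ n" using real_arch_pow[OF assms(2)] by blast
 define m where "m = (LEAST n. s <= K * bt ^ n)"
 have "s <= K * bt ^ n" using n assms(1) by (simp add: field_simps)
 hence m: "s <= K * bt ^ m" unfolding m_def by (rule LeastI)
 hence "m ~= 0" using assms by (metis linorder_not_le mult.right_neutral power_0)
 then obtain M where M: "m = Suc M" by (cases m) auto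
 have "~ s <= K * bt ^ M" using not_less_Least[of M "%n. s <= K * bt ^ n"] M unfolding m_def by simp
 thus thesis using that m M by force
qed

text \<open>Geometric heights suffice: an intermediate \<open>s\<close> loses at most the factor
  \<open>bt\<close>, and \<open>th powr (1 / p) * bt = 1\<close> balances the growth of the height
  against the decay of the measure.\<close>

lemma weak_Lp_norm_layers:
 fixes f :: "real^3 => real^3"
 assumes f: "f : borel_measurable torus" and m: "!!M. measure torus {x : space torus. K * bt ^ M < norm (f x)} <= th ^ M"
  and K: "0 < K" "1 < bt" and p: "0 < p" and th: "0 < th" "th powr (1 / p) * bt = 1" shows "weak_Lp_norm p f <= ennreal (K * bt)" unfolding weak_Lp_norm_def
proof (rule SUP_least, rule ennreal_leI)
 fix s :: real assume "s : {0<..}" hence s: "0 < s" by simp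
 let ?m = "measure torus {x : space torus. s < norm (f x)}"
 interpret finite_measure torus by (rule finite_measure_torus)
 show "s * ?m powr (1 / p) <= K * bt"
 proof (cases "s <= K")
  case True
  have "?m <= 1" using bounded_measure[of "{x : space torus. s < norm (f x)}"] measure_torus by simp
  hence "?m powr (1 / p) <= 1" using p powr_mono2[of "1 / p" ?m 1] by simp
  hence "s * ?m powr (1 / p) <= K * 1" using True s by (intro mult_mono) auto
  also have "... <= K * bt" using K by simp
  finally show ?thesis .
 next
  case False
  then obtain M where M: "K * bt ^ M < s" "s <= K * bt ^ Suc M" using scale_bracket[of K bt s] K by auto
  have "?m <= th ^ M"
  proof (rule order_trans[OF finite_measure_mono m[of M]])
   show "{x : space torus. K * bt ^ M < norm (f x)} : sets torus" using f by measurable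
  qed (use M(1) in auto)
  hence "?m powr (1 / p) <= (th ^ M) powr (1 / p)" using p by (intro powr_mono2) auto
  also have "... = (th powr (1 / p)) ^ M" using th(1) by (simp add: powr_powr powr_realpow[symmetric] mult.commute)
  finally have "s * ?m powr (1 / p) <= (K * bt ^ Suc M) * (th powr (1 / p)) ^ M" using M(2) s by (intro mult_mono) auto
  also have "... = K * bt * (th powr (1 / p) * bt) ^ M" by (simp add: power_mult_distrib)
  finally show ?thesis unfolding th(2) by simp
 qed
qed

text \<open>Summation over the same geometric layers: the \<open>r\<close>-th moment is dominated by
  a geometric series of ratio \<open>bt powr r * th\<close>.\<close>

lemma nn_integral_layers:
 fixes f :: "real^3 => real^3"
 assumes f: "f : borel_measurable torus" and m: "!!M. measure torus {x : space torus. K * bt ^ M < norm (f x)} <= th ^ M"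
  and K: "0 < K" "1 < bt" and r: "0 < r" and th: "0 < th" "bt powr r * th < 1"
 shows "(\<integral>\<^sup>+x. ennreal (norm (f x) powr r) \<partial>torus) <= ennreal (K powr r + K powr r * bt powr r / (1 - bt powr r * th))"
proof -
 interpret finite_measure torus by (rule finite_measure_torus)
 let ?S = "%M. {x : space torus. K * bt ^ M < norm (f x)}"
 let ?c = "%M. (K * bt ^ Suc M) powr r"
 have S: "?S M : sets torus" for M using f by measurable
 have c: "?c M = K powr r * bt powr r * (bt powr r) ^ M" for M
 proof -
  have "(bt ^ n) powr r = (bt powr r) ^ n" for n using K by (simp add: powr_powr powr_realpow[symmetric] mult.commute)
  thus ?thesis using K by (simp add: powr_mult)
 qed
 have pt: "ennreal (norm (f x) powr r) <= ennreal (K powr r) + (\<Sum>M. ennreal (?c M) * indicator (?S M) x)" if x: "x : space torus" for x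
 proof (cases "norm (f x) <= K")
  case True
  hence "ennreal (norm (f x) powr r) <= ennreal (K powr r)" using r by (intro ennreal_leI powr_mono2) auto
  also have "... <= ennreal (K powr r) + (\<Sum>M. ennreal (?c M) * indicator (?S M) x)" by simp
  finally show ?thesis .
 next
  case False
  then obtain M where M: "K * bt ^ M < norm (f x)" "norm (f x) <= K * bt ^ Suc M" using scale_bracket[of K bt "norm (f x)"] K by auto
  have "ennreal (norm (f x) powr r) <= ennreal (?c M) * indicator (?S M) x" using M x r by (simp del: power_Suc) (intro powr_mono2, auto)
  also have "... <= (\<Sum>M. ennreal (?c M) * indicator (?S M) x)"
  proof -
   define h where "h M = ennreal (?c M) * indicator (?S M) x" for M
   have "sum h {M} <= suminf h" by (rule sum_le_suminf) auto
   thus ?thesis by (simp add: h_def[abs_def] del: power_Suc sum_mult_indicator)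
  qed
  also have "... <= ennreal (K powr r) + ..." by (simp add: add_increasing)
  finally show ?thesis .
 qed
 have "(\<integral>\<^sup>+x. ennreal (norm (f x) powr r) \<partial>torus) <= (\<integral>\<^sup>+x. ennreal (K powr r) + (\<Sum>M. ennreal (?c M) * indicator (?S M) x) \<partial>torus)"
  by (rule nn_integral_mono) (rule pt)
 also have "... = (\<integral>\<^sup>+x. ennreal (K powr r) \<partial>torus) + (\<integral>\<^sup>+x. (\<Sum>M. ennreal (?c M) * indicator (?S M) x) \<partial>torus)"
  using S by (intro nn_integral_add) auto
 also have "(\<integral>\<^sup>+x. ennreal (K powr r) \<partial>torus) = ennreal (K powr r)" using measure_torus by (simp add: emeasure_eq_measure)
 also have "(\<integral>\<^sup>+x. (\<Sum>M. ennreal (?c M) * indicator (?S M) x) \<partial>torus) = (\<Sum>M. \<integral>\<^sup>+x. ennreal (?c M) * indicator (?S M) x \<partial>torus)"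
  using S by (intro nn_integral_suminf) auto
 also have "... = (\<Sum>M. ennreal (?c M) * emeasure torus (?S M))" using S by (intro suminf_cong nn_integral_cmult_indicator)
 also have "... <= (\<Sum>M. ennreal (K powr r * bt powr r * (bt powr r * th) ^ M))"
 proof (intro suminf_le summableI)
  fix M
  have "ennreal (?c M) * emeasure torus (?S M) <= ennreal (?c M) * ennreal (th ^ M)" unfolding emeasure_eq_measure by (intro mult_left_mono ennreal_leI m) auto
  thus "ennreal (?c M) * emeasure torus (?S M) <= ennreal (K powr r * bt powr r * (bt powr r * th) ^ M)"
   unfolding c using th(1) by (simp add: ennreal_mult[symmetric] power_mult_distrib mult_ac)
 qed
 also have "... = ennreal (\<Sum>M. K powr r * bt powr r * (bt powr r * th) ^ M)" using th by (intro suminf_ennreal2 summable_mult summable_geometric) auto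
 also have "(\<Sum>M. K powr r * bt powr r * (bt powr r * th) ^ M) = K powr r * bt powr r / (1 - bt powr r * th)"
  using th by (subst suminf_mult) (auto simp: suminf_geometric)
 also have "ennreal (K powr r) + ennreal (K powr r * bt powr r / (1 - bt powr r * th)) = ennreal (K powr r + K powr r * bt powr r / (1 - bt powr r * th))"
  using th by (intro ennreal_plus[symmetric]) auto
 finally show ?thesis by (simp add: add_left_mono)
qed

lemma integrable_torus_time_slices:
 fixes F :: "(real^3) * real => 'b::{banach, second_countable_topology}"
 assumes F: "F : bmeas" and b: "!!t. (\<integral>\<^sup>+x. ennreal (norm (F (x, t))) \<partial>torus) <= ennreal C" shows "integrable (torus_time T) F"
 unfolding torus_time_integral(2)[OF F]
proof (rule integrableI_bounded)
 have S: "cbox 0 1 \<times> {0<..<T} : sets (borel :: ((real^3) * real) measure)" by (intro borel_Times) auto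
 show m: "(%z. indicator (cbox 0 1 \<times> {0<..<T}) z *\<^sub>R F z) : borel_measurable lborel" using F S by measurable
 let ?g = "%x t. ennreal (norm (indicator (cbox 0 1 \<times> {0<..<T}) (x, t) *\<^sub>R F (x, t)))"
 have "case_prod ?g : borel_measurable (borel :: ((real^3) * real) measure)" unfolding case_prod_unfold prod.collapse using F S by measurable
 hence m2: "case_prod ?g : borel_measurable (lborel \<Otimes>\<^sub>M lborel)" unfolding lborel_prod by simp
 have "(\<integral>\<^sup>+z. ennreal (norm (indicator (cbox 0 1 \<times> {0<..<T}) z *\<^sub>R F z)) \<partial>lborel) = (\<integral>\<^sup>+z. case_prod ?g z \<partial>(lborel \<Otimes>\<^sub>M lborel))"
  unfolding lborel_prod by (simp add: case_prod_unfold)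
 also have "... = (\<integral>\<^sup>+t. (\<integral>\<^sup>+x. ?g x t \<partial>lborel) \<partial>lborel)" using lborel_pair.nn_integral_snd[OF m2] by (simp add: case_prod_unfold)
 also have "... <= (\<integral>\<^sup>+t. ennreal C * indicator {0<..<T} t \<partial>lborel)"
 proof (rule nn_integral_mono)
  fix t
  show "(\<integral>\<^sup>+x. ?g x t \<partial>lborel) <= ennreal C * indicator {0<..<T} t"
  proof (cases "t : {0<..<T}")
   case True
   have "(\<integral>\<^sup>+x. ?g x t \<partial>lborel) = (\<integral>\<^sup>+x. ennreal (norm (F (x, t))) * indicator (cbox 0 1) x \<partial>lborel)"
    using True by (intro nn_integral_cong) (auto simp: indicator_def)
   also have "... = (\<integral>\<^sup>+x. ennreal (norm (F (x, t))) \<partial>torus)"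
    using pair_swap_measurable(2)[OF F, of t] by (intro nn_integral_torus[symmetric]) simp
   finally show ?thesis using b[of t] True by simp
  qed (auto simp: indicator_def)
 qed
 also have "... = ennreal C * emeasure lborel {0<..<T}" by (rule nn_integral_cmult_indicator) simp
 also have "... < \<infinity>" by (cases "0 <= T") (auto simp: ennreal_mult_less_top)
 finally show "(\<integral>\<^sup>+z. ennreal (norm (indicator (cbox 0 1 \<times> {0<..<T}) z *\<^sub>R F z)) \<partial>lborel) < \<infinity>" .
qed

lemma torus_time_fubini_zero:
 fixes F :: "(real^3) * real => real"
 assumes F: "F : bmeas" and i: "integrable (torus_time T) F"
 shows "(!!t. t : {0<..<T} ==> (LINT x|torus. F (x, t)) = 0) ==> integral\<^sup>L (torus_time T) F = 0"
  and "(AE x in lborel. (LBINT t:{0<..<T}. F (x, t)) = 0) ==> integral\<^sup>L (torus_time T) F = 0"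
proof -
 show "integral\<^sup>L (torus_time T) F = 0" if "!!t. t : {0<..<T} ==> (LINT x|torus. F (x, t)) = 0"
 proof -
  have "integral\<^sup>L (torus_time T) F = (LBINT t:{0<..<T}. 0)" unfolding torus_time_fubini[OF F i] using that by (intro set_lebesgue_integral_cong) auto
  thus ?thesis by simp
 qed
 show "integral\<^sup>L (torus_time T) F = 0" if z: "AE x in lborel. (LBINT t:{0<..<T}. F (x, t)) = 0"
 proof -
  let ?g = "%x t. indicator (cbox 0 1 \<times> {0<..<T}) (x, t) *\<^sub>R F (x, t)"
  have ig: "integrable (lborel \<Otimes>\<^sub>M lborel) (case_prod ?g)"
   unfolding lborel_prod using i unfolding torus_time_integral(2)[OF F] by (simp add: case_prod_unfold)
  have "integral\<^sup>L (torus_time T) F = (\<integral>z. case_prod ?g z \<partial>(lborel \<Otimes>\<^sub>M lborel))"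
   unfolding lborel_prod torus_time_integral(1)[OF F] by (simp add: case_prod_unfold)
  also have "... = (LINT x|lborel. (LINT t|lborel. ?g x t))" by (rule lborel_pair.integral_fst[OF ig, symmetric])
  also have "... = 0"
  proof (rule integral_eq_zero_AE)
   show "AE x in lborel. (LINT t|lborel. ?g x t) = 0" using z
   proof eventually_elim
    case (elim x)
    have e: "?g x t = indicator (cbox 0 1) x * (indicator {0<..<T} t *\<^sub>R F (x, t))" for t by (auto simp: indicator_def)
    show ?case unfolding e integral_mult_right_zero using elim by (simp add: lint_def)
   qed
  qed
  finally show ?thesis .
 qed
qed

text \<open>Symmetry of mixed derivatives has to be derived for iterated Frechet derivatives. The
  test field is the time integral of \<open>U\<close> from a time before its support;
  differentiation under the integral sign and the fundamental theorem give both orders.\<close>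

lemma test_mixed_derivative:
 fixes ph :: "(real^3) * real => real^3"
 assumes ph: "torus_time_test T ph"
 defines "U == %z. fder ph z (0, 1)" shows "((%t. fder ph (x, t) (axis i 1, 0)) has_vector_derivative fder U (x, t) (axis i 1, 0)) (at t)"
proof -
 have C: "C_infinity ph" using ph unfolding torus_time_test_def by blast
 obtain a b where ab: "0 < a" "!!x t. t ~: {a..b} ==> ph (x, t) = 0" using ph unfolding torus_time_test_def by blast
 have CU: "C_infinity U" unfolding U_def by (rule test_slice(3)[OF C]) simp
 \<comment> \<open>A starting time before \<open>t\<close> and before the support, where the test
   field vanishes.\<close>
 define L where "L = min t 0 - 1"
 have L: "L < t" "L < a" unfolding L_def using ab(1) by auto
 define PU where "PU z = fder U z (axis i 1, 0)" for z
 have cPU: "contU PU" unfolding PU_def by (rule C_infinityD(2)[OF test_slice(3)[OF CU]]) simp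
 have cU: "contU U" by (rule C_infinityD(2)[OF CU])
 have int: "((%ta. U (x, ta)) has_integral ph (x, s)) {L..s}" if "L <= s" for x s
 proof -
  have "((%ta. U (x, ta)) has_integral (ph (x, s) - ph (x, L))) {L..s}"
   unfolding U_def by (rule fundamental_theorem_of_calculus[OF that]) (rule has_vector_derivative_at_within[OF test_slice(2)[OF C]])
  thus ?thesis using ab(2)[of L x] L by simp
 qed
 obtain p where p: "x = mk i (x $ i, p)"
 proof -
  have "x = mk i (x $ i, (if i = 1 then x $ 2 else x $ 1), (if i = 3 then x $ 2 else x $ 3))" using exhaust_3[of i] by (auto simp: vec_eq_iff forall_3 mk_nth)
  thus thesis by (rule that)
 qed
 have P: "fder ph (x, s) (axis i 1, 0) = integral {L..s} (%ta. PU (x, ta))" if s: "L <= s" for s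
 proof -
  have "((%y. integral (cbox L s) (%ta. U (mk i (y, p), ta))) has_vector_derivative integral (cbox L s) (%ta. PU (mk i (x $ i, p), ta))) (at (x $ i) within UNIV)"
  proof (rule leibniz_rule_vector_derivative)
   show "((%y. U (mk i (y, p), ta)) has_vector_derivative PU (mk i (y, p), ta)) (at y within UNIV)" for y ta unfolding PU_def by (rule test_slice(4)[OF CU])
   show "(%ta. U (mk i (y, p), ta)) integrable_on cbox L s" for y by (intro integrable_continuous continuous_on_compose2[OF cU] continuous_intros) auto
   show "continuous_on (UNIV \<times> cbox L s) (%(y, ta). PU (mk i (y, p), ta))"
    unfolding case_prod_unfold by (intro continuous_on_compose2[OF cPU] continuous_intros continuous_on_compose2[OF continuous_mk_line]) auto
  qed auto
  moreover have "integral (cbox L s) (%ta. U (mk i (y, p), ta)) = ph (mk i (y, p), s)" for y using integral_unique[OF int[OF s]] by simp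
  ultimately have "((%y. ph (mk i (y, p), s)) has_vector_derivative integral {L..s} (%ta. PU (x, ta))) (at (x $ i))" using p by simp
  moreover have "((%y. ph (mk i (y, p), s)) has_vector_derivative fder ph (x, s) (axis i 1, 0)) (at (x $ i))"
   using test_slice(4)[OF C, of i p s "x $ i"] p by simp
  ultimately show ?thesis by (rule vector_derivative_unique_at[rotated])
 qed
 have "((%s. integral {L..s} (%ta. PU (x, ta))) has_vector_derivative PU (x, t)) (at t within {L..t + 1})"
  by (rule integral_has_vector_derivative) (use L in \<open>auto intro!: continuous_on_compose2[OF cPU] continuous_intros\<close>)
 hence "((%s. integral {L..s} (%ta. PU (x, ta))) has_vector_derivative PU (x, t)) (at t)" using L at_within_Icc_at[of L t "t + 1"] by simp
 hence "((%s. fder ph (x, s) (axis i 1, 0)) has_vector_derivative PU (x, t)) (at t)"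
  by (rule has_vector_derivative_transform_within_open[where S = "{L<..}"]) (use L P in auto)
 thus ?thesis unfolding PU_def .
qed

section \<open>The electromagnetic field of a superposition of loops\<close>

lemma integrable_torus_time_mult:
 fixes f c :: "(real^3) * real => real"
 assumes f: "integrable (torus_time T) f" and c: "contU c" shows "integrable (torus_time T) (%z. f z * c z)"
proof -
 have "bounded (c ` (cbox 0 1 \<times> {0..T}))" using continuous_on_subset[OF c] by (intro compact_imp_bounded compact_continuous_image compact_Times) auto
 then obtain C where C: "ALL y:c ` (cbox 0 1 \<times> {0..T}). norm y <= C" unfolding bounded_iff by blast
 show ?thesis by (rule integrable_mult_bounded[OF f borel_measurable_torus_time[OF meas_cont[OF c]], of C])
   (use C in \<open>auto simp: torus_time_def\<close>)
qed

abbreviation "per W == %z :: (real^3) * real. W (frac (fst z $ 1)) (snd z) :: real"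

lemma compose_measurable:
 assumes "bmeas2 W" shows "per W : bmeas" "(%z :: (real^3) * real. W (fst z $ 1) (snd z)) : bmeas"
  "(%x. W x t) : bmeas" "(%t. W x t) : bmeas"
proof -
 have f: "(%z::(real^3) * real. fst z $ 1) : bmeas" by (intro meas_cont continuous_intros)
 hence fr: "(%z::(real^3) * real. frac (fst z $ 1)) : bmeas" unfolding frac_def by measurable
 have s: "(snd :: (real^3) * real => real) : bmeas" by (intro meas_cont continuous_intros)
 show "per W : bmeas" using measurable_compose[OF measurable_Pair[OF fr s] assms] by simp
 show "(%z :: (real^3) * real. W (fst z $ 1) (snd z)) : bmeas" using measurable_compose[OF measurable_Pair[OF f s] assms] by simp
 show "(%x. W x t) : bmeas" "(%t. W x t) : bmeas"
  using measurable_compose[OF _ assms, of "%x. (x, t)" borel] measurable_compose[OF _ assms, of "%t. (x, t)" borel] by simp_all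
qed

context loops
begin

definition B :: "(real^3) * real => real^3" where "B z = vector [0, - per Qx z, per Yx z]"
definition F :: "(real^3) * real => real^3" where "F z = vector [0, - per Yt z, - per Qt z]"

text \<open>\<open>frac\<close> alters only the face with coordinate \<open>1\<close>, which goes to
  \<open>0\<close>, and all six functions vanish at both values.\<close>

lemma frac_cube:
 fixes x :: "real^3"
 assumes "x : cbox 0 1" shows "Y (frac (x $ 1)) t = Y (x $ 1) t" "Q (frac (x $ 1)) t = Q (x $ 1) t" "Yx (frac (x $ 1)) t = Yx (x $ 1) t"
  "Qx (frac (x $ 1)) t = Qx (x $ 1) t" "Yt (frac (x $ 1)) t = Yt (x $ 1) t" "Qt (frac (x $ 1)) t = Qt (x $ 1) t"
proof -
 have n: "~ supp k 0" "~ supp k 1" for k using ll[of k] power_le_one[of "1 / 2 :: real" k] by (auto simp: supp_def ll_def)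
 have 0: "Y s t = 0 & Q s t = 0 & Yx s t = 0 & Qx s t = 0 & Yt s t = 0 & Qt s t = 0" if "s : {0, 1}" for s
  using that n single[of 0 s t] not_supp[of 0 s t] by auto
 have "frac (x $ 1) = x $ 1 | frac (x $ 1) = 0 & x $ 1 = 1" using assms[unfolded cbox01, THEN spec, of 1] by (cases "x $ 1 = 1") (auto simp: frac_eq)
 thus "Y (frac (x $ 1)) t = Y (x $ 1) t" "Q (frac (x $ 1)) t = Q (x $ 1) t" "Yx (frac (x $ 1)) t = Yx (x $ 1) t"
  "Qx (frac (x $ 1)) t = Qx (x $ 1) t" "Yt (frac (x $ 1)) t = Yt (x $ 1) t" "Qt (frac (x $ 1)) t = Qt (x $ 1) t" using 0[of 0] 0[of 1] by auto
qed

lemma B_cube: assumes "x : cbox 0 1" shows "B (x, t) = vector [0, - Qx (x $ 1) t, Yx (x $ 1) t]" "F (x, t) = vector [0, - Yt (x $ 1) t, - Qt (x $ 1) t]"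
 using frac_cube[OF assms] by (simp_all add: B_def F_def)

lemmas meas = measurables[THEN compose_measurable(1)] and meas_x = measurables[THEN compose_measurable(3)] and meas_1 = measurables[THEN compose_measurable(2)]

lemma B_measurable: "B : bmeas" "F : bmeas"
proof -
 have v: "(%z. vector [f z, g z, h z] :: real^3) : bmeas" if "f : bmeas" "g : bmeas" "h : bmeas" for f g h :: "(real^3) * real => real"
 proof (rule borel_vecI)
  fix i show "(%z. (vector [f z, g z, h z] :: real^3) $ i) : bmeas" using exhaust_3[of i] that by auto
 qed
 show "B : bmeas" "F : bmeas" unfolding B_def[abs_def] F_def[abs_def] by (intro v borel_measurable_uminus borel_measurable_const meas)+
qed

lemma B_slice: "(%x. B (x, t)) : borel_measurable torus" "(%x. F (x, t)) : borel_measurable torus"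
 by (intro borel_measurable_torus pair_swap_measurable(2) B_measurable)+

lemma B_periodic: "periodic (%x. B (x, t))" "periodic (%x. F (x, t))"
proof -
 have "frac ((x + k) $ 1) = frac (x $ 1)" if "k : lattice" for x k using that unfolding lattice_def by (auto simp: frac_def elim!: Ints_cases[of "k $ 1"])
 thus "periodic (%x. B (x, t))" "periodic (%x. F (x, t))" unfolding periodic_def B_def F_def by simp_all
qed

lemma B_piecewise_constant: "piecewise_constant T B" "piecewise_constant T F"
proof -
 note l = loc_const_frac[OF locally_constant]
 have "AE z in lborel. loc_const B z" "AE z in lborel. loc_const F z"
 proof -
  show "AE z in lborel. loc_const B z" using l
  proof eventually_elim
   case (elim z) from loc_const_compose[OF elim, of "%(a, b, c, d). vector [0, - c, a]"] show ?case by (simp add: B_def[abs_def])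
  qed
  show "AE z in lborel. loc_const F z" using l
  proof eventually_elim
   case (elim z) from loc_const_compose[OF elim, of "%(a, b, c, d). vector [0, - b, - d]"] show ?case by (simp add: F_def[abs_def])
  qed
 qed
 thus "piecewise_constant T B" "piecewise_constant T F" using B_periodic by (auto intro: piecewise_constant_loc_const)
qed

lemma B_orthogonal: "AE z in torus_time T. B z \<bullet> F z = 0"
proof -
 have "AE t in lborel. AE s in lborel. Qx s t * Yt s t = Yx s t * Qt s t" using AE_lborel_slices[OF det] by simp
 hence "AE t in lborel. AE x::real^3 in lborel. Qx (frac (x $ 1)) t * Yt (frac (x $ 1)) t = Yx (frac (x $ 1)) t * Qt (frac (x $ 1)) t"
 proof eventually_elim
  case (elim t) from AE_first[OF AE_frac[OF elim]] show ?case .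
 qed
 hence "AE t in lborel. AE x in lborel. B (x, t) \<bullet> F (x, t) = 0" by (simp add: B_def F_def inner_3)
 moreover have "{z. B z \<bullet> F z = 0} : sets borel" using B_measurable by measurable
 ultimately have "AE z in lborel. B z \<bullet> F z = 0" by (intro AE_lborel_pairI2)
 thus ?thesis unfolding AE_torus_time by eventually_elim simp
qed

text \<open>The factor \<open>2\<close> pays for the two nonzero components in the norm, the summand
  \<open>1\<close> makes the constant positive.\<close>

definition "KK = 2 * (abs (L.KB) + 1)"
definition "EE = 2 * (abs (3 * E) + 1)"

lemma layers:
 "measure torus {x : space torus. KK * L.al ^ M < norm (B (x, t))} <= th ^ M"
 "measure torus {x : space torus. EE * 2 ^ M < norm (F (x, t))} <= th ^ M"
proof -
 interpret finite_measure torus by (rule finite_measure_torus)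
 obtain W where W: "W : sets borel" "emeasure lborel W <= ennreal (th ^ M)"
  and b: "!!x. x ~: W ==> abs (Yx x t) <= L.KB * L.al ^ M & abs (Qx x t) <= L.KB * L.al ^ M & abs (Yt x t) <= 3 * E * 2 ^ M & abs (Qt x t) <= 3 * E * 2 ^ M"
  using weak_bounds[of M t] by blast
 have "(%x::real^3. x $ 1) : borel_measurable torus" by (intro borel_measurable_torus measurable_1) simp
 from measurable_sets[OF this W(1)] have S: "{x : space torus. x $ 1 : W} : sets torus" by (simp add: vimage_def Int_def conj_commute)
 have "emeasure torus {x : space torus. x $ 1 : W} <= ennreal (th ^ M)"
  unfolding emeasure_torus_1[OF W(1)] using W by (intro order_trans[OF emeasure_mono W(2)]) auto
 hence m: "measure torus {x : space torus. x $ 1 : W} <= th ^ M" using th(1) by (simp add: emeasure_eq_measure)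
 have n: "norm (vector [0, u, v] :: real^3) <= abs u + abs v" for u v using norm_le_l1_cart[of "vector [0, u, v] :: real^3"] by (simp add: sum_3)
 have a: "0 < L.al" using th by (simp add: L.al_def)
 show "measure torus {x : space torus. KK * L.al ^ M < norm (B (x, t))} <= th ^ M"
 proof (rule order_trans[OF finite_measure_mono[OF _ S] m], safe)
  fix x :: "real^3" assume x: "x : space torus" "KK * L.al ^ M < norm (B (x, t))"
  show "x $ 1 : W"
  proof (rule ccontr)
   assume "x $ 1 ~: W"
   hence "norm (B (x, t)) <= 2 * (L.KB * L.al ^ M)" using b[of "x $ 1"] n[of "- Qx (x $ 1) t" "Yx (x $ 1) t"] B_cube x by simp
   also have "... <= KK * L.al ^ M" unfolding KK_def using a by (simp add: mult_right_mono)
   finally show False using x(2) by simp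
  qed
 qed
 show "measure torus {x : space torus. EE * 2 ^ M < norm (F (x, t))} <= th ^ M"
 proof (rule order_trans[OF finite_measure_mono[OF _ S] m], safe)
  fix x :: "real^3" assume x: "x : space torus" "EE * 2 ^ M < norm (F (x, t))"
  show "x $ 1 : W"
  proof (rule ccontr)
   assume "x $ 1 ~: W"
   hence "norm (F (x, t)) <= 2 * (3 * E * 2 ^ M)" using b[of "x $ 1"] n[of "- Yt (x $ 1) t" "- Qt (x $ 1) t"] B_cube x by simp
   also have "... <= EE * 2 ^ M" unfolding EE_def by (simp add: mult_right_mono)
   finally show False using x(2) by simp
  qed
 qed
qed

text \<open>Both sides equal minus the integral of \<open>W\<close> against the mixed derivative of
  the test field: the left one by parts in \<open>x\<close> at fixed time, the right one by parts in
  \<open>t\<close> at almost every fixed point.\<close>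

lemma wave:
 fixes W Wx Wt :: "real => real => real" and ph :: "(real^3) * real => real^3" and j :: 3
 assumes m: "bmeas2 W" "bmeas2 Wx"
   "bmeas2 Wt"
  and b: "!!x t. abs (W x t) <= C" and i: "integrable (torus_time T) (%z. Wx (fst z $ 1) (snd z))" "integrable (torus_time T) (%z. Wt (fst z $ 1) (snd z))"
  and bp: "!!t. bp 0 1 (%x. W x t) (%x. Wx x t)" and pp: "AE x in lborel. ppl (W x) (Wt x)" and T: "0 < T" and ph: "torus_time_test T ph"
 shows "(LINT z|torus_time T. Wx (fst z $ 1) (snd z) * fder ph z (0, 1) $ j) =
  (LINT z|torus_time T. Wt (fst z $ 1) (snd z) * fder ph z (axis 1 1, 0) $ j)"
proof -
 have C: "C_infinity ph" using ph unfolding torus_time_test_def by blast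
 obtain a b where ab: "0 < a" "b < T" "!!x t. t ~: {a..b} ==> ph (x, t) = 0" using ph unfolding torus_time_test_def by blast
 define U where "U = (%z. fder ph z (0, 1))"
 define P where "P = (%z. fder ph z (axis 1 1, 0))"
 define PU where "PU = (%z. fder U z (axis 1 1, 0))"
 have CU: "C_infinity U" unfolding U_def by (rule test_slice(3)[OF C]) simp
 have c: "contU U" "contU P" "contU PU"
  using C_infinityD(2)[OF CU] C_infinityD(2)[OF test_slice(3)[OF C, of "(axis 1 1, 0)" 1]] C_infinityD(2)[OF test_slice(3)[OF CU, of "(axis 1 1, 0)" 1]]
  unfolding P_def PU_def by simp_all
 have cj: "contU (%z. U z $ j)" "contU (%z. P z $ j)" "contU (%z. PU z $ j)" by (intro continuous_on_component c)+
 have mj: "(%z. U z $ j) : bmeas" "(%z. P z $ j) : bmeas" "(%z. PU z $ j) : bmeas" using cj by (auto intro: meas_cont)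
 let ?w = "%W (z :: (real^3) * real). W (fst z $ 1) (snd z) :: real"
 note mw = m[THEN compose_measurable(2)]
 have iW: "integrable (torus_time T) (?w W)" by (rule integrable_torus_time_bounded[OF mw(1)]) (use \<open>!!x t. abs (W x t) <= C\<close> in simp)
 note ii = integrable_torus_time_mult[OF i(1) cj(1)] integrable_torus_time_mult[OF iW cj(3)] integrable_torus_time_mult[OF i(2) cj(2)]
 have cs: "continuous_on S (%x. G (x, t) $ j)" if "contU G" for G :: "(real^3) * real => real^3" and t S
  by (intro continuous_on_component continuous_on_compose2[OF that] continuous_intros) auto
 have 1: "(LINT z|torus_time T. ?w Wx z * U z $ j + ?w W z * PU z $ j) = 0"
 proof (rule torus_time_fubini_zero(1))
  show "integrable (torus_time T) (%z. ?w Wx z * U z $ j + ?w W z * PU z $ j)" by (intro Bochner_Integration.integrable_add ii)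
  show "(%z. ?w Wx z * U z $ j + ?w W z * PU z $ j) : bmeas" by (intro borel_measurable_add borel_measurable_times mw mj)
  show "(LINT x|torus. ?w Wx (x, t) * U (x, t) $ j + ?w W (x, t) * PU (x, t) $ j) = 0" for t
   using torus_weak_1[OF bp compose_measurable(3)[OF m(1)] compose_measurable(3)[OF m(2)] vector_derivative_component[OF test_slice(4)[OF CU]]
     cs[OF c(1)] cs[OF c(3)[unfolded PU_def]], of t] by (simp add: PU_def)
 qed
 have 2: "(LINT z|torus_time T. ?w Wt z * P z $ j + ?w W z * PU z $ j) = 0"
 proof (rule torus_time_fubini_zero(2))
  show "integrable (torus_time T) (%z. ?w Wt z * P z $ j + ?w W z * PU z $ j)" by (intro Bochner_Integration.integrable_add ii)
  show "(%z. ?w Wt z * P z $ j + ?w W z * PU z $ j) : bmeas" by (intro borel_measurable_add borel_measurable_times mw mj)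
  show "AE x in lborel. (LBINT t:{0<..<T}. ?w Wt (x, t) * P (x, t) $ j + ?w W (x, t) * PU (x, t) $ j) = 0" using AE_first[OF pp]
  proof eventually_elim
   case (elim x)
   have d: "((%t. P (x, t) $ j) has_real_derivative PU (x, t) $ j) (at t)" for t
    using vector_derivative_component[OF test_mixed_derivative[OF ph]] unfolding P_def PU_def U_def .
   have z: "P (x, t) $ j = 0" if t: "t = 0 | t = T" for t
   proof -
    have "(%y. ph (y, t)) = (%y. 0)" using ab t by (auto simp: fun_eq_iff)
    thus ?thesis using test_slice(1)[OF C, of 1 t x] unfolding P_def partial_def by (simp add: frechet_derivative_const)
   qed
   have ct: "contU (%t. PU (x, t) $ j)" by (intro continuous_on_component continuous_on_compose2[OF c(3)] continuous_intros) auto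
   have "(LBINT t:{0..T}. Wt (x $ 1) t * P (x, t) $ j + W (x $ 1) t * PU (x, t) $ j) = 0" using ppl_by_parts(2)[OF less_imp_le[OF T] elim d ct] z by simp
   moreover have "(LBINT t:{0<..<T}. Wt (x $ 1) t * P (x, t) $ j + W (x $ 1) t * PU (x, t) $ j) =
     (LBINT t:{0..T}. Wt (x $ 1) t * P (x, t) $ j + W (x $ 1) t * PU (x, t) $ j)" by (rule set_integral_discrete_difference[where X = "{0, T}"]) auto
   ultimately show ?case by simp
  qed
 qed
 show ?thesis using 1 2 ii unfolding U_def P_def by (simp add: ii)
qed

end

lemma torus_time_zero:
 fixes f g :: "(real^3) * real => real" and W :: "real => real => real"
 assumes m: "bmeas2 W" and i: "integrable (torus_time T) (%z. W (fst z $ 1) (snd z))"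
  and d: "!!s p t. ((%s. f (mk i (s, p), t)) has_real_derivative g (mk i (s, p), t)) (at s)" and g: "contU g"
  and p: "!!t. periodic (%x. f (x, t))" and i1: "i ~= 1" shows "(LINT z|torus_time T. W (fst z $ 1) (snd z) * g z) = 0"
proof (rule torus_time_fubini_zero(1)[OF _ integrable_torus_time_mult[OF i g]])
 show "(%z. W (fst z $ 1) (snd z) * g z) : bmeas" by (intro borel_measurable_times compose_measurable(2)[OF m] meas_cont g)
 have gs: "contU (%x. g (x, t))" for t by (intro continuous_on_compose2[OF g] continuous_intros) auto
 show "(LINT x|torus. W (fst (x, t) $ 1) (snd (x, t)) * g (x, t)) = 0" for t
 proof -
  have "(%x. W x t) : bmeas" using measurable_compose[OF _ m, of "%x. (x, t)" borel] by simp
  from torus_trans_zero[OF d gs p i1 this] show ?thesis by simp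
 qed
qed

lemma torus_mult_1:
 fixes h :: "real => real" and c :: "real^3 => real"
 assumes h: "h : bmeas" "sint {0..1} h" and c: "contU c" "periodic c" shows "integrable torus (%x. h (x $ 1) * c x)"
proof -
 obtain C where C: "!!x. norm (c x) <= C" using periodic_bounded[OF c] by blast
 show ?thesis by (rule integrable_mult_bounded[OF integrable_torus_1[OF h] borel_measurable_torus[OF meas_cont[OF c(1)]], of C])
   (use C in simp)
qed

context loops
begin

lemma fields_integrable:
 assumes r: "0 < r" "L.al powr r * th < 1"
 shows "(\<integral>\<^sup>+x. ennreal (norm (B (x, t)) powr r) \<partial>torus) <= ennreal (KK powr r + KK powr r * L.al powr r / (1 - L.al powr r * th))"
proof -
 have "1 < L.al" using th by (simp add: L.al_def)
 thus ?thesis using th r by (intro nn_integral_layers B_slice layers) (auto simp: KK_def)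
qed

lemma B_integrable: "integrable (torus_time T) B" "integrable (torus_time T) F"
proof -
 have a: "L.al * th < 1" "0 < L.al" using th by (simp_all add: L.al_def)
 have "(\<integral>\<^sup>+x. ennreal (norm (B (x, t))) \<partial>torus) <= ennreal (KK powr 1 + KK powr 1 * L.al powr 1 / (1 - L.al powr 1 * th))" for t
  using fields_integrable[of 1 t] a by simp
 thus "integrable (torus_time T) B" by (rule integrable_torus_time_slices[OF B_measurable(1)])
 have "(\<integral>\<^sup>+x. ennreal (norm (F (x, t))) \<partial>torus) <= ennreal (EE powr 1 + EE powr 1 * 2 powr 1 / (1 - 2 powr 1 * th))" for t
  using nn_integral_layers[OF B_slice(2) layers(2)[of _ t], of 1] th by (simp add: EE_def)
 thus "integrable (torus_time T) F" by (rule integrable_torus_time_slices[OF B_measurable(2)])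
qed

lemma component_integrable:
 "integrable (torus_time T) (%z. Yx (fst z $ 1) (snd z))" "integrable (torus_time T) (%z. Qx (fst z $ 1) (snd z))"
 "integrable (torus_time T) (%z. Yt (fst z $ 1) (snd z))" "integrable (torus_time T) (%z. Qt (fst z $ 1) (snd z))"
proof -
 have s: "B z = vector [0, - Qx (fst z $ 1) (snd z), Yx (fst z $ 1) (snd z)]" "F z = vector [0, - Yt (fst z $ 1) (snd z), - Qt (fst z $ 1) (snd z)]"
  if "z : space (torus_time T)" for z using that B_cube[of "fst z" "snd z"] by (auto simp: torus_time_def)
 note n = integrable_nth[OF B_integrable(1), of T] integrable_nth[OF B_integrable(2), of T]
 show "integrable (torus_time T) (%z. Yx (fst z $ 1) (snd z))"
  using n(1)[of 3] by (rule Bochner_Integration.integrable_cong[THEN iffD1, rotated 2]) (simp_all add: s)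
 show "integrable (torus_time T) (%z. Qx (fst z $ 1) (snd z))"
  using integrable_minus[OF n(1)[of 2]] by (rule Bochner_Integration.integrable_cong[THEN iffD1, rotated 2]) (simp_all add: s)
 show "integrable (torus_time T) (%z. Yt (fst z $ 1) (snd z))"
  using integrable_minus[OF n(2)[of 2]] by (rule Bochner_Integration.integrable_cong[THEN iffD1, rotated 2]) (simp_all add: s)
 show "integrable (torus_time T) (%z. Qt (fst z $ 1) (snd z))"
  using integrable_minus[OF n(2)[of 3]] by (rule Bochner_Integration.integrable_cong[THEN iffD1, rotated 2]) (simp_all add: s)
qed

text \<open>Derivatives of the test field in the second and third direction integrate to zero since
  the fields depend on the first coordinate only. The two remaining pairs of terms match by
  \<open>wave\<close>, once for \<open>Y\<close> and once for \<open>Q\<close>.\<close>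

lemma B_faraday:
 assumes T: "0 < T" shows "faraday_maxwell T B F" unfolding faraday_maxwell_def
proof (intro conjI allI impI)
 note ci = component_integrable[of T]
 let ?w = "%W (z :: (real^3) * real). W (fst z $ 1) (snd z) :: real"
 have sp: "z : space (torus_time T) ==> fst z : cbox 0 1" for z by (auto simp: torus_time_def)
 fix ph :: "(real^3) * real => real^3" assume ph: "torus_time_test T ph"
 hence C: "C_infinity ph" and per: "!!t. periodic (%x. ph (x, t))" unfolding torus_time_test_def by blast+
 define U where "U z = fder ph z (0, 1)" for z
 define P where "P i z = fder ph z (axis i 1, 0)" for i :: 3 and z
 have c: "contU (%z. U z $ j)" "contU (%z. P i z $ j)" for i j
  unfolding U_def P_def by (intro continuous_on_component C_infinityD(2)[OF test_slice(3)[OF C]]; simp)+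
 note ii = ci[THEN integrable_torus_time_mult, OF c(1)] ci[THEN integrable_torus_time_mult, OF c(2)]
 have z: "(LINT z|torus_time T. ?w W z * P i z $ j) = 0" if "bmeas2 W" "integrable (torus_time T) (?w W)" "i ~= 1" for W i j
  using torus_time_zero[OF that(1,2) vector_derivative_component[OF test_slice(4)[OF C]] _ periodic_component[OF per] that(3)] c(2)[unfolded P_def]
  unfolding P_def by blast
 have wY: "(LINT z|torus_time T. ?w Yx z * U z $ 3) = (LINT z|torus_time T. ?w Yt z * P 1 z $ 3)"
  unfolding U_def P_def using ppl_t by (intro wave[OF measurables(1-3) abs_bounds(1) ci(1,3) bps(1) _ T ph]) (auto elim: AE_mp)
 have wQ: "(LINT z|torus_time T. ?w Qx z * U z $ 2) = (LINT z|torus_time T. ?w Qt z * P 1 z $ 2)"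
  unfolding U_def P_def using ppl_t by (intro wave[OF measurables(4-6) abs_bounds(2) ci(2,4) bps(2) _ T ph]) (auto elim: AE_mp)
 have "(\<integral>(x, t). B (x, t) \<bullet> vector_derivative (%s. ph (x, s)) (at t) \<partial>torus_time T) = (LINT z|torus_time T. ?w Yx z * U z $ 3 - ?w Qx z * U z $ 2)"
  using sp B_cube(1) vector_derivative_at[OF test_slice(2)[OF C]] by (intro bint_cong) (auto simp: inner_3 U_def)
 also have "... = (LINT z|torus_time T. ?w Yt z * P 1 z $ 3) - (LINT z|torus_time T. ?w Qt z * P 1 z $ 2)"
  unfolding wY[symmetric] wQ[symmetric] by (intro bint_diff ii)
 finally have 1: "(\<integral>(x, t). B (x, t) \<bullet> vector_derivative (%s. ph (x, s)) (at t) \<partial>torus_time T) = ..." .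
 have "(\<integral>(x, t). F (x, t) \<bullet> curl (%y. ph (y, t)) x \<partial>torus_time T) =
   (LINT z|torus_time T. (?w Yt z * P 1 z $ 3 - ?w Yt z * P 3 z $ 1) + (?w Qt z * P 2 z $ 1 - ?w Qt z * P 1 z $ 2))" using sp B_cube(2)
  by (intro bint_cong) (auto simp: inner_3 curl_nth test_slice(1)[OF C] P_def algebra_simps)
 also have "... = ((LINT z|torus_time T. ?w Yt z * P 1 z $ 3) - (LINT z|torus_time T. ?w Yt z * P 3 z $ 1)) +
   ((LINT z|torus_time T. ?w Qt z * P 2 z $ 1) - (LINT z|torus_time T. ?w Qt z * P 1 z $ 2))"
  by (simp only: bint_add bint_diff ii Bochner_Integration.integrable_diff)
 finally show "- (\<integral>(x, t). B (x, t) \<bullet> vector_derivative (%s. ph (x, s)) (at t) \<partial>torus_time T) +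
   (\<integral>(x, t). F (x, t) \<bullet> curl (%y. ph (y, t)) x \<partial>torus_time T) = 0"
  unfolding 1 using z[OF measurables(3) ci(3), of 3 1] z[OF measurables(6) ci(4), of 2 1] by simp
next
 note ci = component_integrable[of T]
 let ?w = "%W (z :: (real^3) * real). W (fst z $ 1) (snd z) :: real"
 have sp: "z : space (torus_time T) ==> fst z : cbox 0 1" for z by (auto simp: torus_time_def)
 fix ps :: "(real^3) * real => real" assume ps: "torus_time_test T ps"
 hence C: "C_infinity ps" and per: "!!t. periodic (%x. ps (x, t))" unfolding torus_time_test_def by blast+
 define P where "P i z = fder ps z (axis i 1, 0)" for i :: 3 and z
 have c: "contU (P i)" for i unfolding P_def by (intro C_infinityD(2)[OF test_slice(3)[OF C]]) simp
 have z: "(LINT z|torus_time T. ?w W z * P i z) = 0" if "bmeas2 W" "integrable (torus_time T) (?w W)" "i ~= 1" for W i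
  using torus_time_zero[OF that(1,2) test_slice(4)[OF C, folded real_vector_deriv] _ per that(3)] c[unfolded P_def] unfolding P_def by blast
 have "(\<integral>(x, t). B (x, t) \<bullet> grad (%y. ps (y, t)) x \<partial>torus_time T) = (LINT z|torus_time T. ?w Yx z * P 3 z - ?w Qx z * P 2 z)"
  using sp B_cube(1) by (intro bint_cong) (auto simp: inner_3 grad_def test_slice(1)[OF C] P_def)
 also have "... = (LINT z|torus_time T. ?w Yx z * P 3 z) - (LINT z|torus_time T. ?w Qx z * P 2 z)" by (intro bint_diff integrable_torus_time_mult ci c)
 finally show "- (\<integral>(x, t). B (x, t) \<bullet> grad (%y. ps (y, t)) x \<partial>torus_time T) = 0"
  using z[OF measurables(2) ci(1), of 3] z[OF measurables(5) ci(2), of 2] by simp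
qed

lemma B_weak_Lp:
 assumes p: "0 < p" "th powr (1 / p) * L.al = 1" and p': "0 < p'" "th powr (1 / p') * 2 = 1" shows "Linfty_weak_Lp T p B" "Linfty_weak_Lp T p' F"
proof -
 have a: "1 < L.al" using th by (simp add: L.al_def)
 have "weak_Lp_norm p (%x. B (x, t)) <= ennreal (KK * L.al)" for t by (rule weak_Lp_norm_layers[OF B_slice(1) layers(1) _ a p(1) th(1) p(2)]) (simp add: KK_def)
 thus "Linfty_weak_Lp T p B" unfolding Linfty_weak_Lp_def
  using B_slice(1) borel_measurable_torus_time[OF B_measurable(1)] by (intro conjI exI[of _ "KK * L.al"] AE_I2) auto
 have "weak_Lp_norm p' (%x. F (x, t)) <= ennreal (EE * 2)" for t
  by (rule weak_Lp_norm_layers[OF B_slice(2) layers(2) _ _ p'(1) th(1) p'(2)]) (simp_all add: EE_def)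
 thus "Linfty_weak_Lp T p' F" unfolding Linfty_weak_Lp_def
  using B_slice(2) borel_measurable_torus_time[OF B_measurable(2)] by (intro conjI exI[of _ "EE * 2"] AE_I2) auto
qed

lemma B_slice_integrable: "integrable torus (%x. B (x, t))"
proof (rule integrableI_bounded[OF B_slice(1)])
 have "L.al powr 1 * th < 1" using th by (simp add: L.al_def)
 from fields_integrable[OF _ this, of t] show "(\<integral>\<^sup>+x. ennreal (norm (B (x, t))) \<partial>torus) < \<infinity>"
  by (simp add: le_less_trans ennreal_less_top)
qed

lemma B_div_free: "weak_div_free (%x. B (x, t))" unfolding weak_div_free_def
proof (intro allI impI)
 fix ps :: "real^3 => real" assume ps: "torus_test ps"
 hence C: "C_infinity ps" and per: "periodic ps" by (auto simp: torus_test_def)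
 note mx = meas_x[of t]
 note i = torus_mult_1[OF _ _ C_infinity_partial(3)[OF C] periodic_partial[OF ps]]
 have "(LINT x|torus. B (x, t) \<bullet> grad ps x) = (LINT x|torus. Yx (x $ 1) t * partial 3 ps x - Qx (x $ 1) t * partial 2 ps x)"
  using B_cube(1) by (intro bint_cong) (auto simp: inner_3 grad_def)
 also have "... = (LINT x|torus. Yx (x $ 1) t * partial 3 ps x) - (LINT x|torus. Qx (x $ 1) t * partial 2 ps x)"
  by (rule bint_diff[OF i[OF mx(2) bpD(2)[OF bps(1)]] i[OF mx(5) bpD(2)[OF bps(2)]]])
 also have "... = 0" using torus_trans_zero[OF smooth_scalar[OF C] C_infinity_partial(3)[OF C] per _ mx(2), of 3]
   torus_trans_zero[OF smooth_scalar[OF C] C_infinity_partial(3)[OF C] per _ mx(5), of 2] by simp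
 finally show "(LINT x|torus. B (x, t) \<bullet> grad ps x) = 0" .
qed

end

section \<open>Vector potential and helicity of the new field\<close>

context loops
begin

text \<open>The means are subtracted to satisfy the normalisation of the potential; they do not
  change the helicity because \<open>Yx\<close> and \<open>Qx\<close> have zero integral.\<close>

definition A :: "real => real^3 => real^3" where
 "A t x = vector [0, Y (frac (x $ 1)) t - (LINT y|torus. Y (y $ 1) t), Q (frac (x $ 1)) t - (LINT y|torus. Q (y $ 1) t)]"

lemma A_potential: "vector_potential (%x. B (x, t)) (A t)"
proof -
 define mY mQ where "mY = (LINT y|torus. Y (y $ 1) t)" and "mQ = (LINT y|torus. Q (y $ 1) t)"
 note mx = meas_x[of t] and s = bpD(1,2)[OF bps(1)[of t]] bpD(1,2)[OF bps(2)[of t]]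
 have A_cube: "A t x = vector [0, Y (x $ 1) t - mY, Q (x $ 1) t - mQ]" if "x : cbox 0 1" for x using frac_cube[OF that] by (simp add: A_def mY_def mQ_def)
 have iY: "integrable torus (%x. Y (x $ 1) t)" "integrable torus (%x. Q (x $ 1) t)"
  by (rule integrable_torus_1[OF mx(1) s(1)], rule integrable_torus_1[OF mx(4) s(3)])
 have one: "(LINT x|torus. c) = c" "integrable torus (%_. c)" for c :: real using measure_torus integrable_torus_continuous[of "%_. c"] by simp_all
 have per: "periodic (A t)"
 proof -
  have "frac ((x + k) $ 1) = frac (x $ 1)" if "k : lattice" for x k using that unfolding lattice_def by (auto simp: frac_def elim!: Ints_cases[of "k $ 1"])
  thus ?thesis unfolding periodic_def A_def by simp
 qed
 have An: "integrable torus (%x. A t x $ j) & (LINT x|torus. A t x $ j) = 0" for j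
 proof -
  have "(LINT x|torus. A t x $ j) = (LINT x|torus. (vector [0, Y (x $ 1) t - mY, Q (x $ 1) t - mQ] :: real^3) $ j)"
   "integrable torus (%x. A t x $ j) = integrable torus (%x. (vector [0, Y (x $ 1) t - mY, Q (x $ 1) t - mQ] :: real^3) $ j)"
   by (auto intro!: bint_cong Bochner_Integration.integrable_cong simp: A_cube)
  thus ?thesis using exhaust_3[of j] iY one[of mY] one[of mQ] by (auto simp: mY_def mQ_def)
 qed
 hence iA: "integrable torus (A t)" by (blast intro: integrable_vecI)
 have zm: "zero_mean (A t)" unfolding zero_mean_def using iA An by (simp add: vec_eq_iff integral_nth)
 have wc: "weak_curl_eq (A t) (%x. B (x, t))" unfolding weak_curl_eq_def
 proof (intro allI impI)
  fix ph :: "real^3 => real^3" assume ph: "torus_test ph"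
  hence C: "C_infinity ph" and p: "periodic ph" by (auto simp: torus_test_def)
  let ?P = "%i j x. partial i ph x $ j"
  note i = torus_mult_1[OF _ _ smooth_component(2)[OF C] periodic_component[OF periodic_partial[OF ph]]]
  note iY = i[OF mx(1) s(1)] and iQ = i[OF mx(4) s(3)]
  have ic: "integrable torus (curl ph)" by (rule integrable_torus_continuous[OF continuous_curl[OF C]])
  have "vcoef 0 (curl ph) = 0" using vcoef_curl[OF ph lattice_0] by (simp add: cross3_def vec_eq_iff forall_3)
  hence "(LINT x|torus. curl ph x) = 0" by (simp add: vcoef_def)
  hence c0: "(LINT x|torus. curl ph x $ j) = 0" for j using integral_nth[OF ic, of j] by simp
  have z: "(LINT x|torus. Y (x $ 1) t * ?P 3 1 x) = 0" "(LINT x|torus. Q (x $ 1) t * ?P 2 1 x) = 0"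
   using torus_trans_zero[OF smooth_component(1,2)[OF C] periodic_component[OF p] _ mx(1), of 3]
    torus_trans_zero[OF smooth_component(1,2)[OF C] periodic_component[OF p] _ mx(4), of 2] by simp_all
  note iw = torus_mult_1[OF mx(2) s(2) smooth_component(3)[OF C] periodic_component[OF p]]
   torus_mult_1[OF mx(5) s(4) smooth_component(3)[OF C] periodic_component[OF p]]
  have w: "(LINT x|torus. Y (x $ 1) t * ?P 1 3 x) = - (LINT x|torus. Yx (x $ 1) t * ph x $ 3)"
   "(LINT x|torus. Q (x $ 1) t * ?P 1 2 x) = - (LINT x|torus. Qx (x $ 1) t * ph x $ 2)"
   using torus_weak_1[OF bps(1) mx(1,2) smooth_component(1)[OF C] smooth_component(3,2)[OF C], of 3]
    torus_weak_1[OF bps(2) mx(4,5) smooth_component(1)[OF C] smooth_component(3,2)[OF C], of 2]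
    iw iY iQ by (simp_all add: bint_add)
  have "(LINT x|torus. A t x \<bullet> curl ph x) = (LINT x|torus. ((Y (x $ 1) t * ?P 3 1 x - Y (x $ 1) t * ?P 1 3 x) + (Q (x $ 1) t * ?P 1 2 x - Q (x $ 1) t * ?P 2 1 x)) -
    (mY * curl ph x $ 2 + mQ * curl ph x $ 3))" by (intro bint_cong) (simp_all add: A_cube inner_3 curl_nth algebra_simps)
  also have "... = (((LINT x|torus. Y (x $ 1) t * ?P 3 1 x) - (LINT x|torus. Y (x $ 1) t * ?P 1 3 x)) +
    ((LINT x|torus. Q (x $ 1) t * ?P 1 2 x) - (LINT x|torus. Q (x $ 1) t * ?P 2 1 x))) - (mY * (LINT x|torus. curl ph x $ 2) + mQ * (LINT x|torus. curl ph x $ 3))"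
   using iY iQ integrable_nth[OF ic] by simp
  also have "... = (LINT x|torus. Yx (x $ 1) t * ph x $ 3) - (LINT x|torus. Qx (x $ 1) t * ph x $ 2)" unfolding z w c0 by simp
  also have "... = (LINT x|torus. Yx (x $ 1) t * ph x $ 3 - Qx (x $ 1) t * ph x $ 2)" by (rule bint_diff[OF iw, symmetric])
  also have "... = (LINT x|torus. B (x, t) \<bullet> ph x)" using B_cube(1) by (intro bint_cong) (auto simp: inner_3)
  finally show "(LINT x|torus. A t x \<bullet> curl ph x) = (LINT x|torus. B (x, t) \<bullet> ph x)" .
 qed
 have wd: "weak_div_free (A t)" unfolding weak_div_free_def
 proof (intro allI impI)
  fix ps :: "real^3 => real" assume ps: "torus_test ps"
  hence C: "C_infinity ps" and p: "periodic ps" by (auto simp: torus_test_def)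
  have m: "(%x. Y x t - mY) : bmeas" "(%x. Q x t - mQ) : bmeas" using mx by auto
  have ci: "sint {0..1} (%_::real. c)" for c :: real by (rule borel_integrable_atLeastAtMost') simp
  note si = set_integral_diff(1)[OF s(1) ci[of mY]] set_integral_diff(1)[OF s(3) ci[of mQ]]
  note i = torus_mult_1[OF _ _ C_infinity_partial(3)[OF C] periodic_partial[OF ps]]
  have "(LINT x|torus. A t x \<bullet> grad ps x) = (LINT x|torus. (Y (x $ 1) t - mY) * partial 2 ps x + (Q (x $ 1) t - mQ) * partial 3 ps x)"
   by (intro bint_cong) (simp_all add: A_cube inner_3 grad_def)
  also have "... = (LINT x|torus. (Y (x $ 1) t - mY) * partial 2 ps x) + (LINT x|torus. (Q (x $ 1) t - mQ) * partial 3 ps x)"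
   by (rule bint_add[OF i[OF m(1) si(1)] i[OF m(2) si(2)]])
  also have "... = 0" using torus_trans_zero[OF smooth_scalar[OF C] C_infinity_partial(3)[OF C] p _ m(1), of 2]
    torus_trans_zero[OF smooth_scalar[OF C] C_infinity_partial(3)[OF C] p _ m(2), of 3] by simp
  finally show "(LINT x|torus. A t x \<bullet> grad ps x) = 0" .
 qed
 show ?thesis unfolding vector_potential_def using per zm wc wd by blast
qed

lemma B_zero_mean: "zero_mean (%x. B (x, t))"
proof -
 note s = bps(1)[of t] bps(2)[of t] and mx = meas_x[of t]
 have 0: "(LBINT x:{0..1}. Yx x t) = 0" "(LBINT x:{0..1}. Qx x t) = 0" using bp_primitive(2)[OF s(1) mx(1,2)] bp_primitive(2)[OF s(2) mx(4,5)] .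
 have "(LINT x|torus. B (x, t) $ j) = (LINT x|torus. (vector [0, - Qx (x $ 1) t, Yx (x $ 1) t] :: real^3) $ j)" for j using B_cube(1) by (intro bint_cong) auto
 hence "(LINT x|torus. B (x, t) $ j) = 0" for j
  using exhaust_3[of j] integral_torus_1[OF mx(2) bpD(2)[OF s(1)]] integral_torus_1[OF mx(5) bpD(2)[OF s(2)]] 0 by auto
 thus ?thesis unfolding zero_mean_def using B_slice_integrable[of t] by (simp add: vec_eq_iff integral_nth)
qed

text \<open>Integration by parts turns the part with \<open>Y\<close> and \<open>Qx\<close> into a
  second copy of the part with \<open>Q\<close> and \<open>Yx\<close>, whence the factor
  \<open>2\<close>.\<close>

lemma B_helicity: "helicity (%x. B (x, t)) = 2 * (\<Sum>k. sg k * ((ll k)^2 * et k t))"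
proof -
 define mY mQ where "mY = (LINT y|torus. Y (y $ 1) t)" and "mQ = (LINT y|torus. Q (y $ 1) t)"
 note s = bps(1)[of t] bps(2)[of t] and mx = meas_x[of t]
 let ?h = "%x. (Q x t * Yx x t - Y x t * Qx x t) + (mY * Qx x t - mQ * Yx x t)"
 have iYQ: "sint {0..1} (%x. Y x t * Qx x t)"
 proof -
  have "integrable lborel (%x. (indicator {0..1} x *\<^sub>R Qx x t) * Y x t)"
   by (rule integrable_mult_bounded[where C = 3]) (use bpD(2)[OF s(2)] mx abs_bounds in \<open>auto simp: set_integrable_def\<close>)
  thus ?thesis unfolding set_integrable_def by (simp add: mult_ac)
 qed
 note i1 = set_integral_diff[OF integral_QYx(1)[of t] iYQ]
 note i2 = set_integral_diff[OF set_integrable_mult_right[OF bpD(2)[OF s(2)], of mY] set_integrable_mult_right[OF bpD(2)[OF s(1)], of mQ]]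
 have "helicity (%x. B (x, t)) = (LINT x|torus. A t x \<bullet> B (x, t))" by (rule helicity_eq[OF A_potential B_slice_integrable])
 also have "... = (LINT x|torus. ?h (x $ 1))" using B_cube(1) frac_cube by (intro bint_cong) (auto simp: inner_3 A_def mY_def mQ_def algebra_simps)
 also have "... = (LBINT x:{0..1}. ?h x)" by (rule integral_torus_1) (use mx set_integral_add(1)[OF i1(1) i2(1)] in auto)
 also have "... = (LBINT x:{0..1}. Q x t * Yx x t) - (LBINT x:{0..1}. Y x t * Qx x t)" unfolding set_integral_add(2)[OF i1(1) i2(1)] i1(2) i2(2)
  using bp_primitive(2)[OF s(1) mx(1,2)] bp_primitive(2)[OF s(2) mx(4,5)] by simp
 also have "... = 2 * (LBINT x:{0..1}. Q x t * Yx x t)" using bp_product[OF s(1) mx(1,2) s(2) mx(4,5)] by simp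
 finally show ?thesis unfolding integral_QYx(2) .
qed

lemma B_helicity_field:
 assumes "L.al powr (3 / 2) * th < 1" shows "helicity_field (%x. B (x, t))"
proof -
 have "integrable torus (%x. norm (B (x, t)) powr (3 / 2))"
 proof (rule integrableI_bounded)
  show "(%x. norm (B (x, t)) powr (3 / 2)) : borel_measurable torus" using B_slice(1)[of t] by measurable
  show "(\<integral>\<^sup>+x. ennreal (norm (norm (B (x, t)) powr (3 / 2))) \<partial>torus) < \<infinity>"
   using fields_integrable[OF _ assms, of t] by (simp add: le_less_trans ennreal_less_top)
 qed
 thus ?thesis unfolding helicity_field_def using B_periodic(1) B_slice(1) B_div_free B_zero_mean by blast
qed

end

theorem theorem1:
  fixes T p p' :: real
    and B0 E0 :: "(real^3) \<times> real \<Rightarrow> real^3"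
  assumes "T > 0"
    and "L_infinity T B0" and "L_infinity T E0"
    and "piecewise_constant T B0" and "piecewise_constant T E0"
    and "faraday_maxwell T B0 E0"
    and "AE t in lebesgue_on {0<..<T}. zero_mean (\<lambda>x. B0 (x, t))"
    and "3 / 2 < p" and "1 / p + 1 / p' = 1"
  shows "\<exists>B E :: (real^3) \<times> real \<Rightarrow> real^3.
           piecewise_constant T B \<and> piecewise_constant T E \<and>
           integrable (torus_time T) B \<and> integrable (torus_time T) E \<and>
           faraday_maxwell T B E \<and>
           Linfty_weak_Lp T p B \<and> Linfty_weak_Lp T p' E \<and>
           (AE z in torus_time T. B z \<bullet> E z = 0) \<and>
           (AE t in lebesgue_on {0<..<T}.
              helicity_field (\<lambda>x. B (x, t)) \<and>
              helicity (\<lambda>x. B (x, t)) = helicity (\<lambda>x. B0 (x, t)))"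
proof -
 have "1 / p < 2 / 3" "0 < 1 / p" using assms(8) by (simp_all add: field_simps)
 hence q: "1 / 3 < 1 / p'" "1 / p' < 1" using assms(9) by linarith+
 hence "0 < 1 / p'" by linarith
 hence p'0: "0 < p'" by simp
 hence p': "1 < p'" "p' < 3" using q by (simp_all add: field_simps)
 have p0: "0 < p" using assms(8) by simp
 have pp: "p' / p = p' - 1" using assms(9) p0 p'0 by (simp add: field_simps)
 \<comment> \<open>The solution of \<open>2 * th powr (1 / p') = 1\<close>, the balance for
   \<open>E\<close>; the balance for \<open>B\<close> then follows from the duality of the
   exponents.\<close>
 define th :: real where "th = 2 powr (- p')"
 have half: "2 powr (- 1) = (1 / 2 :: real)" by (simp add: powr_minus)
 have th: "0 < th" "th < 1 / 2" using powr_less_mono[of "- p'" "- 1" 2] p' half unfolding th_def by simp_all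
 have al: "1 / (2 * th) = 2 powr (p' - 1)" unfolding th_def by (simp add: powr_diff powr_minus field_simps)
 obtain G g M s where G: "G \<subseteq> {0<..<T}" "AE t in lborel. t : {0<..<T} --> t : G" and g: "g : bmeas"
  "ALL t. abs (g t) <= M" "ALL t:G. isCont g t" and s: "s : G"
  and h: "ALL t:G. ALL s:G. s <= t --> helicity (%x. B0 (x, t)) - helicity (%x. B0 (x, s)) = (LBINT u:{s..t}. g u)" using given_helicity[OF assms(1-7)] by blast
 have gM: "abs (g t) <= M" for t using g(2) by blast
 have M0: "0 <= M" using gM[of 0] by linarith
 have gc: "AE t in lborel. t : {0<..<T} --> isCont g t" using G(2) by eventually_elim (use g(3) in blast)
 \<comment> \<open>The helicity extrapolated back to time \<open>0\<close>, so that one formula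
   serves good times before and after \<open>s\<close>.\<close>
 define c where "c = helicity (%x. B0 (x, s)) - (LBINT u:{0..s}. g u)"
 note bi = bounded_integral[OF g(1) gM]
 have split: "(LBINT u:{0..x}. g u) + (LBINT u:{x..y}. g u) = (LBINT u:{0..y}. g u)" if "0 <= x" "x <= y" for x y
  unfolding bi(3) using that by (intro Henstock_Kurzweil_Integration.integral_combine bi(2))
 have hc: "helicity (%x. B0 (x, t)) = c + (LBINT u:{0..t}. g u)" if t: "t : G" for t
 proof (cases "s <= t")
  case True
  have "0 <= s" using s G(1) by auto
  thus ?thesis using h t s True split[of s t] unfolding c_def by fastforce
 next
  case False
  have "0 <= t" using t G(1) by auto
  thus ?thesis using h t s False split[of t s] unfolding c_def by fastforce
 qed
 obtain R E and et e :: "nat => real => real" where R: "0 < R" and et: "ALL k. ppl (et k) (e k)" "ALL k t. 0 <= et k t & et k t < R & abs (e k t) <= E"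
  and dec: "ALL t:{0<..<T}. c + (LBINT u:{0..t}. g u) = 2 * (\<Sum>k. (if k = 0 then - 1 else 1) * (((1 / 2) ^ k / 8)^2 * et k t))"
  using step_decomposition[OF assms(1) M0 g(1) gM gc, of c] by (elim exE conjE) (rule that)
 interpret loops th R E et e by unfold_locales (use th R et in auto)
 have al': "L.al = 2 powr (p' - 1)" unfolding L.al_def by (rule al)
 have e1: "th powr (1 / p) * L.al = 1"
 proof -
  have "th powr (1 / p) = 2 powr (- (p' - 1))" unfolding th_def powr_powr using pp by simp
  thus ?thesis unfolding al' by (simp add: powr_add[symmetric])
 qed
 have e2: "th powr (1 / p') * 2 = 1" unfolding th_def powr_powr using p'0 half by simp
 \<comment> \<open>The exponent \<open>(p' - 1) * (3 / 2) - p'\<close> is negative exactly for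
   \<open>p' < 3\<close>; this makes the norm of \<open>B\<close> integrable to the power
   \<open>3 / 2\<close>.\<close>
 have e3: "L.al powr (3 / 2) * th < 1"
 proof -
  have "L.al powr (3 / 2) * th = 2 powr ((p' - 1) * (3 / 2) + - p')" unfolding al' unfolding th_def powr_powr powr_add ..
  also have "... < 2 powr 0" using p' by (intro powr_less_mono) (simp_all add: field_simps)
  finally show ?thesis by simp
 qed
 have "AE t in lebesgue_on {0<..<T}. helicity_field (%x. B (x, t)) & helicity (%x. B (x, t)) = helicity (%x. B0 (x, t))" unfolding AE_time using G(2)
 proof eventually_elim
  case (elim t)
  show ?case
  proof (intro impI conjI B_helicity_field e3)
   assume t: "t : {0<..<T}"
   thus "helicity (%x. B (x, t)) = helicity (%x. B0 (x, t))" using hc[of t] bspec[OF dec t] elim unfolding B_helicity sg_def ll_def by simp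
  qed
 qed
 with B_piecewise_constant B_integrable B_faraday[OF assms(1)] B_weak_Lp[OF p0 e1 p'0 e2] B_orthogonal
 show ?thesis by blast
qed

end
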